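(* Let $\boldsymbol f\in L^2(\Omega)^d$ and let $[\mathbf u^{f*},p^{f*}]\in\mathbb V$ be the solution of the adjoint source problem $\mathcal A([\mathbf v,q],[\mathbf u^{f*},p^{f*}])=(\mathbf v,\boldsymbol f)$ for all $[\mathbf v,q]\in\mathbb V$. Then, for any $\theta\in\{-1,0,1\}$, $$\mathcal A_h([\mathbf v_h,q_h],[\mathbf u^{f*},p^{f*}])-(1+\theta)\sum_{F\in\mathcal E_h}\int_F\mu\,\overline{\{\nabla\mathbf u^{f*}\}}:[\![\underline{\mathbf v_h}]\!]\,ds=(\mathbf v_h,\boldsymbol f)\qquad\forall\,[\mathbf v_h,q_h]\in\mathbb X(h)\times\mathbb W .$$
   Context: Let $d\in\{2,3\}$, let $\Omega\subset\mathbb R^d$ be a bounded polyhedral domain, $\mu>0$ a constant, and $\boldsymbol\beta\in W^{1,\infty}(\Omega)^d$ a given (real) divergence-free vector field (standard scaling: $\|\boldsymbol\beta\|_{\infty,\Omega}\sim1$ if $\mu\le\|\boldsymbol\beta\|_{\infty,\Omega}$, and $\mu\sim1$ otherwise). All functions are complex valued; $(\mathbf u,\mathbf v)=\int_\Omega\mathbf u\cdot\overline{\mathbf v}\,dx$ (similarly for scalars and tensors). $\mathbb X=H_0^1(\Omega)^d$, $\mathbb W=L_0^2(\Omega)$ (zero-mean $L^2$ functions), $\mathbb V=\mathbb X\times\mathbb W$, $$A(\mathbf u,\mathbf v)=\mu(\nabla\mathbf u,\nabla\mathbf v)+((\boldsymbol\beta\cdot\nabla)\mathbf u,\mathbf v),\quad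 B(\mathbf v,p)=-(p,\nabla\cdot\mathbf v),\quad \mathcal A([\mathbf w,r],[\mathbf v,q])=A(\mathbf w,\mathbf v)+B(\mathbf v,r)+\overline{B(\mathbf w,q)}.$$ Regularity assumption: there is $r\in(\frac12,1]$ such that for every $\boldsymbol f\in L^2(\Omega)^d$ the solution $[\mathbf T\boldsymbol f,\mathbf S\boldsymbol f]\in\mathbb V$ of $\mathcal A([\mathbf T\boldsymbol f,\mathbf S\boldsymbol f],[\mathbf v,q])=(\boldsymbol f,\mathbf v)$ for all $[\mathbf v,q]\in\mathbb V$, and the solution $[\mathbf T^*\boldsymbol f,\mathbf S^*\boldsymbol f]=[\mathbf u^{f*},p^{f*}]$ of the adjoint source problem, lie in $H^{1+r}(\Omega)^d\times H^r(\Omega)$, with $\|\mathbf T\boldsymbol f\|_{1+r}+\|\mathbf S\boldsymbol f\|_r\le C_\Omega\|\boldsymbol f\|_0$ and $\|\mathbf T^*\boldsymbol f\|_{1+r}+\|\mathbf S^*\boldsymbol f\|_r\le C_\Omega\|\boldsymbol f\|_0$, $C_\Omega$ independent of $\boldsymbol f$. Mesh. $\mathcal T_h=\{\tau\}$ belongs to a regular (shape-regular) family of simplicial partitions of $\Omega$, $h_\tau=\mathrm{diam}\,\tau$, $h=\max_\tau h_\tau$. $\mathcal E_h^i$, $\mathcal E_h^b$ are the sets of interior and boundary faces (edges if $d=2$), $\mathcal E_h=\mathcal E_h^i\cup\mathcal E_h^b$, and $h_F$ is the diameter of $F$. For $F\in\mathcal E_h^i$, $F=\tau^+\cap\tau^-$,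 $\mathbf n^+$ is the unit normal pointing from $\tau^+$ to $\tau^-$, $\mathbf n^-=-\mathbf n^+$. The mean is $\{\varphi\}=\frac12(\varphi^++\varphi^-)$. Jumps: for scalars $[\![\varphi]\!]=\varphi^+\mathbf n^++\varphi^-\mathbf n^-$; for vectors $[\![\boldsymbol\varphi]\!]=\boldsymbol\varphi^+\cdot\mathbf n^++\boldsymbol\varphi^-\cdot\mathbf n^-$; full jump $[\![\underline{\boldsymbol\varphi}]\!]=\boldsymbol\varphi^+\otimes\mathbf n^++\boldsymbol\varphi^-\otimes\mathbf n^-$ with $(\boldsymbol\varphi\otimes\mathbf n)_{ij}=\varphi_in_j$; for $d\times d$ tensors $[\![\boldsymbol\chi]\!]=\boldsymbol\chi^+\mathbf n^++\boldsymbol\chi^-\mathbf n^-$. On boundary faces jumps are defined by setting $^-$ values to zero and means by setting $^-$ values equal to $^+$ values. For $k\ge1$, $\mathbb X_h=\{\mathbf v_h\in L^2(\Omega)^d:\mathbf v_h|_\tau\in P_k(\tau)^d\ \forall\tau\}$ and $\mathbb X(h)=\mathbb X+\mathbb X_h$. With penalty parameter $\gamma>0$, $$\begin{aligned}A_h(\mathbf u,\mathbf v)=&\sum_{\tau}\int_\tau\mu\nabla\mathbf u:\overline{\nabla\mathbf v}\,dx+\sum_\tau\int_\tau(\boldsymbol\beta\cdot\nabla)\mathbf u\cdot\overline{\mathbf v}\,dx-\sum_{F\in\mathcal E_h}\int_F\mu\{\nabla\mathbf u\}:\overline{[\![\underline{\mathbf v}]\!]}ds+\theta\sum_{F\in\mathcal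 E_h}\int_F\mu\overline{\{\nabla\mathbf v\}}:[\![\underline{\mathbf u}]\!]ds\\&+\sum_{F\in\mathcal E_h}\int_F\frac{\gamma}{h_F}[\![\underline{\mathbf u}]\!]:\overline{[\![\underline{\mathbf v}]\!]}ds-\sum_{F\in\mathcal E_h^i}\int_F[\![\mathbf u\otimes\boldsymbol\beta]\!]\cdot\overline{\{\mathbf v\}}ds-\frac12\sum_{F\in\mathcal E_h^b}\int_F(\mathbf u\otimes\boldsymbol\beta)\mathbf n\cdot\overline{\mathbf v}ds,\\ B_h(\mathbf v,q)=&-\sum_\tau\int_\tau q\,\overline{\nabla\cdot\mathbf v}\,dx+\sum_{F\in\mathcal E_h}\int_F\{q\}\overline{[\![\mathbf v]\!]}ds,\\ \mathcal A_h([\mathbf w,r],[\mathbf v,q])=&A_h(\mathbf w,\mathbf v)+B_h(\mathbf v,r)+\overline{B_h(\mathbf w,q)}.\end{aligned}$$ Convention: a face term in which one factor is a jump that vanishes identically (such as $[\![\underline{\mathbf u^{f*}}]\!]=0$) is taken to be zero even if the other factor has no trace. *)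

theory Defs
  imports "HOL-Analysis.Analysis"
begin

section \<open>Function spaces\<close>

text \<open>
  Functions are total functions on \<open>real^'n\<close>; only their values on the set \<open>U\<close> under
  consideration matter, and they matter only up to null sets.  The codomain is any Euclidean
  space, so that the same definitions serve scalars (\<open>complex\<close>), vectors (\<open>complex^'n\<close>) and
  tensors (\<open>complex^'n^'n\<close>, with the Frobenius norm); all spaces are the usual componentwise ones.
\<close>

definition Lebesgue2 :: "'a measure \<Rightarrow> ('a \<Rightarrow> 'b::euclidean_space) set" where
  "Lebesgue2 M = {u. u \<in> borel_measurable M \<and> integrable M (\<lambda>x. (norm (u x))\<^sup>2)}"

definition L2_norm :: "'a measure \<Rightarrow> ('a \<Rightarrow> 'b::euclidean_space) \<Rightarrow> real" where
  "L2_norm M u = sqrt (LINT x|M. (norm (u x))\<^sup>2)"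

definition L2 :: "(real^'n) set \<Rightarrow> (real^'n \<Rightarrow> 'b::euclidean_space) set" where
  "L2 U = Lebesgue2 (lebesgue_on U)"

definition L2_zero_mean :: "(real^'n) set \<Rightarrow> (real^'n \<Rightarrow> complex) set" where
  "L2_zero_mean U = {q \<in> L2 U. (LINT x|lebesgue_on U. q x) = 0}"

definition partial :: "'n \<Rightarrow> (real^'n \<Rightarrow> 'b::euclidean_space) \<Rightarrow> real^'n \<Rightarrow> 'b" where
  "partial i f x = frechet_derivative f (at x) (axis i 1)"

primrec C_k :: "nat \<Rightarrow> (real^'n \<Rightarrow> 'b::euclidean_space) \<Rightarrow> bool" where
  "C_k 0 f \<longleftrightarrow> continuous_on UNIV f"
| "C_k (Suc k) f \<longleftrightarrow> (\<forall>x. f differentiable (at x)) \<and> (\<forall>i. C_k k (partial i f))"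

definition smooth :: "(real^'n \<Rightarrow> 'b::euclidean_space) \<Rightarrow> bool" where
  "smooth f \<longleftrightarrow> (\<forall>k. C_k k f)"

definition test_functions :: "(real^'n) set \<Rightarrow> (real^'n \<Rightarrow> 'b::euclidean_space) set" where
  "test_functions U = {\<phi>. smooth \<phi> \<and> (\<exists>K. compact K \<and> K \<subseteq> U \<and> (\<forall>x. x \<notin> K \<longrightarrow> \<phi> x = 0))}"

definition locally_integrable :: "(real^'n) set \<Rightarrow> (real^'n \<Rightarrow> 'b::euclidean_space) \<Rightarrow> bool" where
  "locally_integrable U u \<longleftrightarrow> (\<forall>K. compact K \<and> K \<subseteq> U \<longrightarrow> integrable (lebesgue_on K) u)"

definition is_weak_partial ::
  "(real^'n) set \<Rightarrow> 'n \<Rightarrow> (real^'n \<Rightarrow> 'b::euclidean_space) \<Rightarrow> (real^'n \<Rightarrow> 'b) \<Rightarrow> bool" where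
  "is_weak_partial U i u g \<longleftrightarrow>
     locally_integrable U u \<and> locally_integrable U g \<and>
     (\<forall>\<phi> \<in> test_functions U.
        (LINT x|lebesgue_on U. (partial i \<phi> x :: real) *\<^sub>R u x)
          = - (LINT x|lebesgue_on U. \<phi> x *\<^sub>R g x))"

text \<open>A representative of the weak derivative, which is unique almost everywhere on \<open>U\<close>.\<close>

definition weak_partial ::
  "(real^'n) set \<Rightarrow> 'n \<Rightarrow> (real^'n \<Rightarrow> 'b::euclidean_space) \<Rightarrow> real^'n \<Rightarrow> 'b" where
  "weak_partial U i u = (SOME g. is_weak_partial U i u g)"

definition H1 :: "(real^'n) set \<Rightarrow> (real^'n \<Rightarrow> 'b::euclidean_space) set" where
  "H1 U = {u \<in> L2 U. \<forall>i. \<exists>g \<in> L2 U. is_weak_partial U i u g}"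

definition H1_norm :: "(real^'n) set \<Rightarrow> (real^'n \<Rightarrow> 'b::euclidean_space) \<Rightarrow> real" where
  "H1_norm U u = sqrt ((L2_norm (lebesgue_on U) u)\<^sup>2
     + (\<Sum>i\<in>UNIV. (L2_norm (lebesgue_on U) (weak_partial U i u))\<^sup>2))"

definition H1_0 :: "(real^'n) set \<Rightarrow> (real^'n \<Rightarrow> 'b::euclidean_space) set" where
  "H1_0 U = {u \<in> H1 U. \<exists>\<phi> :: nat \<Rightarrow> real^'n \<Rightarrow> 'b.
     (\<forall>m. \<phi> m \<in> test_functions U) \<and>
     (\<lambda>m. H1_norm U (\<lambda>x. \<phi> m x - u x)) \<longlonglongrightarrow> 0}"

definition ess_bounded :: "(real^'n) set \<Rightarrow> (real^'n \<Rightarrow> 'b::euclidean_space) \<Rightarrow> bool" where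
  "ess_bounded U u \<longleftrightarrow> u \<in> borel_measurable (lebesgue_on U) \<and>
     (\<exists>C. AE x in lebesgue_on U. norm (u x) \<le> C)"

definition W1_infinity :: "(real^'n) set \<Rightarrow> (real^'n \<Rightarrow> 'b::euclidean_space) set" where
  "W1_infinity U = {u. ess_bounded U u \<and> (\<forall>i. \<exists>g. ess_bounded U g \<and> is_weak_partial U i u g)}"

text \<open>The square of the Gagliardo--Slobodeckij seminorm of order \<open>s\<close>, for \<open>0 < s < 1\<close>.\<close>

definition gagliardo :: "real \<Rightarrow> (real^'n) set \<Rightarrow> (real^'n \<Rightarrow> 'b::euclidean_space) \<Rightarrow> ennreal" where
  "gagliardo s U u = (\<integral>\<^sup>+ x. \<integral>\<^sup>+ y.
     ennreal ((norm (u x - u y))\<^sup>2 / norm (x - y) powr (real CARD('n) + 2 * s))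
     \<partial>lebesgue_on U \<partial>lebesgue_on U)"

text \<open>\<open>Hs s U\<close> is the Sobolev space of order \<open>s\<close>, for \<open>0 < s \<le> 1\<close>.\<close>

definition Hs :: "real \<Rightarrow> (real^'n) set \<Rightarrow> (real^'n \<Rightarrow> 'b::euclidean_space) set" where
  "Hs s U = (if s = 1 then H1 U else {u \<in> L2 U. gagliardo s U u < \<infinity>})"

definition Hs_norm :: "real \<Rightarrow> (real^'n) set \<Rightarrow> (real^'n \<Rightarrow> 'b::euclidean_space) \<Rightarrow> real" where
  "Hs_norm s U u = (if s = 1 then H1_norm U u
     else sqrt ((L2_norm (lebesgue_on U) u)\<^sup>2 + enn2real (gagliardo s U u)))"

text \<open>\<open>H1_plus r U\<close> is the Sobolev space of order \<open>1 + r\<close>, for \<open>0 < r \<le> 1\<close>.\<close>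

definition H1_plus :: "real \<Rightarrow> (real^'n) set \<Rightarrow> (real^'n \<Rightarrow> 'b::euclidean_space) set" where
  "H1_plus r U = {u \<in> H1 U. \<forall>i. weak_partial U i u \<in> Hs r U}"

definition H1_plus_norm :: "real \<Rightarrow> (real^'n) set \<Rightarrow> (real^'n \<Rightarrow> 'b::euclidean_space) \<Rightarrow> real" where
  "H1_plus_norm r U u = sqrt ((L2_norm (lebesgue_on U) u)\<^sup>2
     + (\<Sum>i\<in>UNIV. (Hs_norm r U (weak_partial U i u))\<^sup>2))"


section \<open>Vector and tensor calculus\<close>

text \<open>
  The products are bilinear; conjugations are always written explicitly.
\<close>

definition vdot :: "complex^'n \<Rightarrow> complex^'n \<Rightarrow> complex" where
  "vdot u v = (\<Sum>i\<in>UNIV. u $ i * v $ i)"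

definition tdot :: "complex^'n^'n \<Rightarrow> complex^'n^'n \<Rightarrow> complex" where
  "tdot S T = (\<Sum>i\<in>UNIV. \<Sum>j\<in>UNIV. S $ i $ j * T $ i $ j)"

definition vcnj :: "complex^'n \<Rightarrow> complex^'n" where
  "vcnj v = (\<chi> i. cnj (v $ i))"

definition tcnj :: "complex^'n^'n \<Rightarrow> complex^'n^'n" where
  "tcnj T = (\<chi> i j. cnj (T $ i $ j))"

definition cvec :: "real^'n \<Rightarrow> complex^'n" where
  "cvec v = (\<chi> i. of_real (v $ i))"

definition tensor :: "complex^'n \<Rightarrow> complex^'n \<Rightarrow> complex^'n^'n" where
  "tensor u w = (\<chi> i j. u $ i * w $ j)"

definition grad :: "(real^'n) set \<Rightarrow> (real^'n \<Rightarrow> complex^'n) \<Rightarrow> real^'n \<Rightarrow> complex^'n^'n" where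
  "grad U u x = (\<chi> i j. weak_partial U j u x $ i)"

definition divergence :: "(real^'n) set \<Rightarrow> (real^'n \<Rightarrow> ('a::euclidean_space)^'n) \<Rightarrow> real^'n \<Rightarrow> 'a" where
  "divergence U u x = (\<Sum>i\<in>UNIV. weak_partial U i u x $ i)"

definition convect ::
  "(real^'n) set \<Rightarrow> (real^'n \<Rightarrow> real^'n) \<Rightarrow> (real^'n \<Rightarrow> complex^'n) \<Rightarrow> real^'n \<Rightarrow> complex^'n" where
  "convect U \<beta> u x = (\<Sum>j\<in>UNIV. (\<beta> x $ j) *\<^sub>R weak_partial U j u x)"

definition divergence_free :: "(real^'n) set \<Rightarrow> (real^'n \<Rightarrow> real^'n) \<Rightarrow> bool" where
  "divergence_free U \<beta> \<longleftrightarrow> (AE x in lebesgue_on U. divergence U \<beta> x = 0)"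

definition L2_inner ::
  "(real^'n) set \<Rightarrow> (real^'n \<Rightarrow> complex^'n) \<Rightarrow> (real^'n \<Rightarrow> complex^'n) \<Rightarrow> complex" where
  "L2_inner U u v = (LINT x|lebesgue_on U. vdot (u x) (vcnj (v x)))"


section \<open>The continuous problem\<close>

text \<open>
  The last clause excludes slits, i.e. domains lying on both sides of part of their boundary.
\<close>

definition polyhedral_domain :: "(real^'n) set \<Rightarrow> bool" where
  "polyhedral_domain \<Omega> \<longleftrightarrow> open \<Omega> \<and> connected \<Omega> \<and> \<Omega> \<noteq> {} \<and> bounded \<Omega> \<and>
     (\<exists>\<P>. finite \<P> \<and> (\<forall>P\<in>\<P>. polytope P) \<and> closure \<Omega> = \<Union>\<P>) \<and>
     interior (closure \<Omega>) = \<Omega>"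

definition form_A :: "(real^'n) set \<Rightarrow> real \<Rightarrow> (real^'n \<Rightarrow> real^'n) \<Rightarrow>
    (real^'n \<Rightarrow> complex^'n) \<Rightarrow> (real^'n \<Rightarrow> complex^'n) \<Rightarrow> complex" where
  "form_A \<Omega> \<mu> \<beta> u v =
     of_real \<mu> * (LINT x|lebesgue_on \<Omega>. tdot (grad \<Omega> u x) (tcnj (grad \<Omega> v x)))
     + L2_inner \<Omega> (convect \<Omega> \<beta> u) v"

definition form_B :: "(real^'n) set \<Rightarrow> (real^'n \<Rightarrow> complex^'n) \<Rightarrow> (real^'n \<Rightarrow> complex) \<Rightarrow> complex" where
  "form_B \<Omega> v p = - (LINT x|lebesgue_on \<Omega>. p x * cnj (divergence \<Omega> v x))"

definition form_AB :: "(real^'n) set \<Rightarrow> real \<Rightarrow> (real^'n \<Rightarrow> real^'n) \<Rightarrow>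
    (real^'n \<Rightarrow> complex^'n) \<times> (real^'n \<Rightarrow> complex) \<Rightarrow>
    (real^'n \<Rightarrow> complex^'n) \<times> (real^'n \<Rightarrow> complex) \<Rightarrow> complex" where
  "form_AB \<Omega> \<mu> \<beta> = (\<lambda>(w, r) (v, q).
     form_A \<Omega> \<mu> \<beta> w v + form_B \<Omega> v r + cnj (form_B \<Omega> w q))"

definition source_solution :: "(real^'n) set \<Rightarrow> real \<Rightarrow> (real^'n \<Rightarrow> real^'n) \<Rightarrow>
    (real^'n \<Rightarrow> complex^'n) \<Rightarrow> (real^'n \<Rightarrow> complex^'n) \<Rightarrow> (real^'n \<Rightarrow> complex) \<Rightarrow> bool" where
  "source_solution \<Omega> \<mu> \<beta> f u p \<longleftrightarrow> u \<in> H1_0 \<Omega> \<and> p \<in> L2_zero_mean \<Omega> \<and>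
     (\<forall>v \<in> H1_0 \<Omega>. \<forall>q \<in> L2_zero_mean \<Omega>. form_AB \<Omega> \<mu> \<beta> (u, p) (v, q) = L2_inner \<Omega> f v)"

definition adjoint_solution :: "(real^'n) set \<Rightarrow> real \<Rightarrow> (real^'n \<Rightarrow> real^'n) \<Rightarrow>
    (real^'n \<Rightarrow> complex^'n) \<Rightarrow> (real^'n \<Rightarrow> complex^'n) \<Rightarrow> (real^'n \<Rightarrow> complex) \<Rightarrow> bool" where
  "adjoint_solution \<Omega> \<mu> \<beta> f u p \<longleftrightarrow> u \<in> H1_0 \<Omega> \<and> p \<in> L2_zero_mean \<Omega> \<and>
     (\<forall>v \<in> H1_0 \<Omega>. \<forall>q \<in> L2_zero_mean \<Omega>. form_AB \<Omega> \<mu> \<beta> (v, q) (u, p) = L2_inner \<Omega> v f)"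

definition regularity_assumption :: "(real^'n) set \<Rightarrow> real \<Rightarrow> (real^'n \<Rightarrow> real^'n) \<Rightarrow> bool" where
  "regularity_assumption \<Omega> \<mu> \<beta> \<longleftrightarrow> (\<exists>r C. 1/2 < r \<and> r \<le> 1 \<and>
     (\<forall>f \<in> L2 \<Omega>. \<forall>u p. source_solution \<Omega> \<mu> \<beta> f u p \<or> adjoint_solution \<Omega> \<mu> \<beta> f u p \<longrightarrow>
        u \<in> H1_plus r \<Omega> \<and> p \<in> Hs r \<Omega> \<and>
        H1_plus_norm r \<Omega> u + Hs_norm r \<Omega> p \<le> C * L2_norm (lebesgue_on \<Omega>) f))"


section \<open>Meshes\<close>

definition simplicial_partition :: "(real^'n) set \<Rightarrow> (real^'n) set set \<Rightarrow> bool" where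
  "simplicial_partition \<Omega> \<T> \<longleftrightarrow> triangulation \<T> \<and> (\<forall>\<tau>\<in>\<T>. int CARD('n) simplex \<tau>) \<and>
     \<Union>\<T> = closure \<Omega>"

definition inball_diameter :: "(real^'n) set \<Rightarrow> real" where
  "inball_diameter \<tau> = Sup {2 * r | r. 0 \<le> r \<and> (\<exists>x. cball x r \<subseteq> \<tau>)}"

definition regular_family :: "(real^'n) set \<Rightarrow> (real^'n) set set set \<Rightarrow> bool" where
  "regular_family \<Omega> \<M> \<longleftrightarrow> (\<forall>\<T>\<in>\<M>. simplicial_partition \<Omega> \<T>) \<and>
     (\<exists>\<sigma>. \<forall>\<T>\<in>\<M>. \<forall>\<tau>\<in>\<T>. diameter \<tau> \<le> \<sigma> * inball_diameter \<tau>)"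

definition interior_faces :: "(real^'n) set set \<Rightarrow> (real^'n) set set" where
  "interior_faces \<T> = {F. \<exists>\<tau>\<in>\<T>. \<exists>\<tau>'\<in>\<T>. \<tau> \<noteq> \<tau>' \<and> F = \<tau> \<inter> \<tau>' \<and> F facet_of \<tau> \<and> F facet_of \<tau>'}"

definition boundary_faces :: "(real^'n) set \<Rightarrow> (real^'n) set set \<Rightarrow> (real^'n) set set" where
  "boundary_faces \<Omega> \<T> = {F. (\<exists>\<tau>\<in>\<T>. F facet_of \<tau>) \<and> F \<subseteq> frontier \<Omega>}"

definition all_faces :: "(real^'n) set \<Rightarrow> (real^'n) set set \<Rightarrow> (real^'n) set set" where
  "all_faces \<Omega> \<T> = interior_faces \<T> \<union> boundary_faces \<Omega> \<T>"

text \<open>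
  An arbitrary labelling of the elements adjacent to a face; \<open>elem_minus\<close> is meaningful only for
  interior faces.  All bilinear face terms below are invariant under exchanging the two labels.
\<close>

definition elem_plus :: "(real^'n) set set \<Rightarrow> (real^'n) set \<Rightarrow> (real^'n) set" where
  "elem_plus \<T> F = (SOME \<tau>. \<tau> \<in> \<T> \<and> F facet_of \<tau>)"

definition elem_minus :: "(real^'n) set set \<Rightarrow> (real^'n) set \<Rightarrow> (real^'n) set" where
  "elem_minus \<T> F = (SOME \<tau>. \<tau> \<in> \<T> \<and> F facet_of \<tau> \<and> \<tau> \<noteq> elem_plus \<T> F)"

definition outer_normal :: "(real^'n) set \<Rightarrow> (real^'n) set \<Rightarrow> real^'n" where
  "outer_normal \<tau> F = (THE n. norm n = 1 \<and> (\<forall>x\<in>F. \<forall>y\<in>\<tau>. (y - x) \<bullet> n \<le> 0))"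

definition normal_plus :: "(real^'n) set set \<Rightarrow> (real^'n) set \<Rightarrow> real^'n" where
  "normal_plus \<T> F = outer_normal (elem_plus \<T> F) F"


section \<open>Surface measure and traces\<close>

text \<open>
  Surface measure on a flat face \<open>F\<close> of codimension one.  On a hyperplane with unit normal \<open>n\<close>
  through \<open>a\<close>, surface measure is the image of Lebesgue measure on the slab of height one over
  the hyperplane under the orthogonal projection: by Fubini, a subset of the hyperplane of
  surface area \<open>\<alpha>\<close> is the base of a cylinder of height one and volume \<open>\<alpha>\<close>.  The result does not
  depend on the choice of \<open>a\<close> and of the sign of \<open>n\<close>.
\<close>

definition hyperplane_measure :: "real^'n \<Rightarrow> real^'n \<Rightarrow> (real^'n) measure" where
  "hyperplane_measure n a = completion
     (distr (restrict_space lborel {x. 0 \<le> (x - a) \<bullet> n \<and> (x - a) \<bullet> n \<le> 1}) borel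
        (\<lambda>x. x - ((x - a) \<bullet> n) *\<^sub>R n))"

definition surface_measure :: "(real^'n) set \<Rightarrow> (real^'n) measure" where
  "surface_measure F =
     (let n = (SOME n. norm n = 1 \<and> (\<forall>x\<in>F. \<forall>y\<in>F. (x - y) \<bullet> n = 0));
          a = (SOME a. a \<in> F)
      in restrict_space (hyperplane_measure n a) F)"

text \<open>
  The trace operator on the spaces of order \<open>s\<close> in \<open>(1/2, 1]\<close> is the continuous extension of
  the restriction \<open>\<phi> \<mapsto> \<phi>|\<^sub>F\<close> of functions smooth up to the boundary of \<open>\<tau>\<close>.  The spaces decrease
  in \<open>s\<close>, and the traces for different \<open>s\<close> agree.
\<close>

definition is_trace :: "(real^'n) set \<Rightarrow> (real^'n) set \<Rightarrow>
    (real^'n \<Rightarrow> 'b::euclidean_space) \<Rightarrow> (real^'n \<Rightarrow> 'b) \<Rightarrow> bool" where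
  "is_trace \<tau> F u g \<longleftrightarrow> g \<in> Lebesgue2 (surface_measure F) \<and>
     (\<exists>s. 1/2 < s \<and> s \<le> 1 \<and> u \<in> Hs s (interior \<tau>) \<and>
       (\<exists>\<phi> :: nat \<Rightarrow> real^'n \<Rightarrow> 'b. (\<forall>m. smooth (\<phi> m)) \<and>
          (\<lambda>m. Hs_norm s (interior \<tau>) (\<lambda>x. \<phi> m x - u x)) \<longlonglongrightarrow> 0 \<and>
          (\<lambda>m. L2_norm (surface_measure F) (\<lambda>x. \<phi> m x - g x)) \<longlonglongrightarrow> 0))"

text \<open>
  If \<open>u\<close> has no trace then \<open>face_trace \<tau> F u\<close> is an unspecified function.  A face integral
  of a product one factor of which is a jump that vanishes almost everywhere on \<open>F\<close> is then still
  zero, whatever the other factor is; this is the convention for products of a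
  vanishing jump with a quantity that has no trace.
\<close>

definition face_trace :: "(real^'n) set \<Rightarrow> (real^'n) set \<Rightarrow>
    (real^'n \<Rightarrow> 'b::euclidean_space) \<Rightarrow> real^'n \<Rightarrow> 'b" where
  "face_trace \<tau> F u = (SOME g. is_trace \<tau> F u g)"

text \<open>
  In the following, \<open>\<phi>\<close> assigns to each element \<open>\<tau>\<close> a function on \<open>\<tau>\<close>.  For a function \<open>u\<close> on the
  whole domain this is \<open>\<lambda>\<tau>. u\<close>; for the elementwise gradient it is \<open>\<lambda>\<tau>. grad (interior \<tau>) u\<close>.
\<close>

definition mean :: "(real^'n) set set \<Rightarrow> (real^'n) set \<Rightarrow>
    ((real^'n) set \<Rightarrow> real^'n \<Rightarrow> 'b::euclidean_space) \<Rightarrow> real^'n \<Rightarrow> 'b" where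
  "mean \<T> F \<phi> x =
     (let \<phi>p = face_trace (elem_plus \<T> F) F (\<phi> (elem_plus \<T> F)) x;
          \<phi>m = (if F \<in> interior_faces \<T>
                then face_trace (elem_minus \<T> F) F (\<phi> (elem_minus \<T> F)) x else \<phi>p)
      in (1/2) *\<^sub>R (\<phi>p + \<phi>m))"

text \<open>The jump for an arbitrary product \<open>pr\<close> of values with the (complexified) normal.\<close>

definition jump_wrt :: "('b::euclidean_space \<Rightarrow> complex^'n \<Rightarrow> 'c::ab_group_add) \<Rightarrow>
    (real^'n) set set \<Rightarrow> (real^'n) set \<Rightarrow>
    ((real^'n) set \<Rightarrow> real^'n \<Rightarrow> 'b) \<Rightarrow> real^'n \<Rightarrow> 'c" where
  "jump_wrt pr \<T> F \<phi> x =
     (let \<phi>p = face_trace (elem_plus \<T> F) F (\<phi> (elem_plus \<T> F)) x;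
          \<phi>m = (if F \<in> interior_faces \<T>
                then face_trace (elem_minus \<T> F) F (\<phi> (elem_minus \<T> F)) x else 0);
          n = normal_plus \<T> F
      in pr \<phi>p (cvec n) + pr \<phi>m (cvec (- n)))"

abbreviation "jump_vec \<equiv> jump_wrt vdot"
abbreviation "jump_full \<equiv> jump_wrt tensor"
abbreviation "jump_tensor \<equiv> jump_wrt ((*v) :: complex^'n^'n \<Rightarrow> complex^'n \<Rightarrow> complex^'n)"


section \<open>Discontinuous Galerkin forms\<close>

definition is_polynomial :: "nat \<Rightarrow> (real^'n \<Rightarrow> 'b::euclidean_space) \<Rightarrow> bool" where
  "is_polynomial k p \<longleftrightarrow> (\<exists>c :: ('n \<Rightarrow> nat) \<Rightarrow> 'b. \<forall>x.
     p x = (\<Sum>\<alpha> | (\<Sum>i\<in>UNIV. \<alpha> i) \<le> k. (\<Prod>i\<in>UNIV. (x $ i) ^ \<alpha> i) *\<^sub>R c \<alpha>))"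

definition dg_space :: "(real^'n) set \<Rightarrow> (real^'n) set set \<Rightarrow> nat \<Rightarrow> (real^'n \<Rightarrow> complex^'n) set" where
  "dg_space \<Omega> \<T> k = {v \<in> L2 \<Omega>. \<forall>\<tau>\<in>\<T>. \<exists>p. is_polynomial k p \<and> (AE x in lebesgue_on \<tau>. v x = p x)}"

definition dg_sum_space :: "(real^'n) set \<Rightarrow> (real^'n) set set \<Rightarrow> nat \<Rightarrow> (real^'n \<Rightarrow> complex^'n) set" where
  "dg_sum_space \<Omega> \<T> k = {(\<lambda>x. v x + w x) | v w. v \<in> H1_0 \<Omega> \<and> w \<in> dg_space \<Omega> \<T> k}"

abbreviation face_integral :: "(real^'n) set \<Rightarrow> (real^'n \<Rightarrow> complex) \<Rightarrow> complex" where
  "face_integral F g \<equiv> (LINT x|surface_measure F. g x)"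

definition form_A_h :: "(real^'n) set \<Rightarrow> (real^'n) set set \<Rightarrow> real \<Rightarrow> (real^'n \<Rightarrow> real^'n) \<Rightarrow>
    real \<Rightarrow> real \<Rightarrow> (real^'n \<Rightarrow> complex^'n) \<Rightarrow> (real^'n \<Rightarrow> complex^'n) \<Rightarrow> complex" where
  "form_A_h \<Omega> \<T> \<mu> \<beta> \<gamma> \<theta> u v =
     (let
        Du = (\<lambda>\<tau>. grad (interior \<tau>) u);
        Dv = (\<lambda>\<tau>. grad (interior \<tau>) v);
        ub = (\<lambda>x. tensor (u x) (cvec (\<beta> x)))
      in
        (\<Sum>\<tau>\<in>\<T>. LINT x|lebesgue_on \<tau>. of_real \<mu> * tdot (Du \<tau> x) (tcnj (Dv \<tau> x)))
      + (\<Sum>\<tau>\<in>\<T>. LINT x|lebesgue_on \<tau>. vdot (convect (interior \<tau>) \<beta> u x) (vcnj (v x)))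
      - (\<Sum>F\<in>all_faces \<Omega> \<T>. face_integral F (\<lambda>x.
           of_real \<mu> * tdot (mean \<T> F Du x) (tcnj (jump_full \<T> F (\<lambda>\<tau>. v) x))))
      + of_real \<theta> * (\<Sum>F\<in>all_faces \<Omega> \<T>. face_integral F (\<lambda>x.
           of_real \<mu> * tdot (tcnj (mean \<T> F Dv x)) (jump_full \<T> F (\<lambda>\<tau>. u) x)))
      + (\<Sum>F\<in>all_faces \<Omega> \<T>. face_integral F (\<lambda>x.
           of_real (\<gamma> / diameter F) *
             tdot (jump_full \<T> F (\<lambda>\<tau>. u) x) (tcnj (jump_full \<T> F (\<lambda>\<tau>. v) x))))
      - (\<Sum>F\<in>interior_faces \<T>. face_integral F (\<lambda>x.
           vdot (jump_tensor \<T> F (\<lambda>\<tau>. ub) x) (vcnj (mean \<T> F (\<lambda>\<tau>. v) x))))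
      - 1/2 * (\<Sum>F\<in>boundary_faces \<Omega> \<T>. face_integral F (\<lambda>x.
           vdot (face_trace (elem_plus \<T> F) F ub x *v cvec (normal_plus \<T> F))
             (vcnj (face_trace (elem_plus \<T> F) F v x)))))"

definition form_B_h :: "(real^'n) set \<Rightarrow> (real^'n) set set \<Rightarrow>
    (real^'n \<Rightarrow> complex^'n) \<Rightarrow> (real^'n \<Rightarrow> complex) \<Rightarrow> complex" where
  "form_B_h \<Omega> \<T> v q =
     - (\<Sum>\<tau>\<in>\<T>. LINT x|lebesgue_on \<tau>. q x * cnj (divergence (interior \<tau>) v x))
     + (\<Sum>F\<in>all_faces \<Omega> \<T>. face_integral F (\<lambda>x.
          mean \<T> F (\<lambda>\<tau>. q) x * cnj (jump_vec \<T> F (\<lambda>\<tau>. v) x)))"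

definition form_AB_h :: "(real^'n) set \<Rightarrow> (real^'n) set set \<Rightarrow> real \<Rightarrow> (real^'n \<Rightarrow> real^'n) \<Rightarrow>
    real \<Rightarrow> real \<Rightarrow> (real^'n \<Rightarrow> complex^'n) \<times> (real^'n \<Rightarrow> complex) \<Rightarrow>
    (real^'n \<Rightarrow> complex^'n) \<times> (real^'n \<Rightarrow> complex) \<Rightarrow> complex" where
  "form_AB_h \<Omega> \<T> \<mu> \<beta> \<gamma> \<theta> = (\<lambda>(w, r) (v, q).
     form_A_h \<Omega> \<T> \<mu> \<beta> \<gamma> \<theta> w v + form_B_h \<Omega> \<T> v r + cnj (form_B_h \<Omega> \<T> w q))"

end

theory Submission
  imports Defs
begin

text \<open>
 The traces of a field are the limits, in \<open>L2\<close> of the face, of the restrictions of its mollifications.  They exist and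
 do not depend on the approximation by the trace inequality for \<open>Hs\<close> with \<open>s > 1/2\<close>, which follows by telescoping
 averages over cones with vertex on the face.  With the divergence theorem on a polytope this gives integration by parts on
 an element, between fields in \<open>Hs\<close> with a weak divergence and functions in \<open>H1\<close>.  By the adjoint equation the
 stress \<open>\<mu> \<nabla>u - p I\<close> has the weak divergence \<open>- (f + (\<beta> \<cdot> \<nabla>)u)\<close> on the whole domain, so that its normal component is
 continuous across interior faces, and so is \<open>u\<close>.  Hence integration by parts on each element, summed over the
 elements, yields the face terms of the discrete form.
\<close>

abbreviation (input) "leb \<equiv> lebesgue_on"
abbreviation (input) "surf \<equiv> surface_measure"

lemmas bochner_add = Bochner_Integration.integrable_add and bochner_bound = Bochner_Integration.integrable_bound
 and bochner_sum = Bochner_Integration.integrable_sum and bochner_int_cong = Bochner_Integration.integral_cong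
 and bochner_int_sum = Bochner_Integration.integral_sum

abbreviation (input) "L2_conv M U u \<equiv> (\<lambda>m. L2_norm M (\<lambda>x. U m x - u x)) \<longlonglongrightarrow> 0"

abbreviation (input) "nn2 M u \<equiv> (\<integral>\<^sup>+x. ennreal ((norm (u x))\<^sup>2) \<partial>M)"

lemma tendsto_zero_le:
 fixes a b :: "'a => real"
 assumes "\<And>m. 0 \<le> a m" "\<And>m. a m \<le> b m" "(b \<longlongrightarrow> 0) F" shows "(a \<longlongrightarrow> 0) F"
 by (rule tendsto_sandwich[OF _ _ tendsto_const assms(3)]) (use assms(1,2) in auto)

section \<open>Square integrable functions on a measure space\<close>

lemma Lebesgue2I:
 "u \<in> borel_measurable M ==> integrable M (\<lambda>x. (norm (u x))\<^sup>2) ==> u \<in> Lebesgue2 M" by (simp add: Lebesgue2_def)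

lemma Lebesgue2_measurable: "u \<in> Lebesgue2 M ==> u \<in> borel_measurable M" by (simp add: Lebesgue2_def)

lemma Lebesgue2_integrable: "u \<in> Lebesgue2 M ==> integrable M (\<lambda>x. (norm (u x))\<^sup>2)" by (simp add: Lebesgue2_def)

lemma L2_norm_nonneg [simp]: "0 \<le> L2_norm M u" by (simp add: L2_norm_def)

lemma L2_norm_power2: "(L2_norm M u)\<^sup>2 = (LINT x|M. (norm (u x))\<^sup>2)" by (simp add: L2_norm_def)

lemma nn_integral_norm2:
 assumes "u \<in> Lebesgue2 M" shows "nn2 M u = ennreal ((L2_norm M u)\<^sup>2)"
 using Lebesgue2_integrable[OF assms] by (simp add: L2_norm_power2 nn_integral_eq_integral)

lemma Lebesgue2I_nn:
 assumes "u \<in> borel_measurable M" "nn2 M u < \<infinity>" shows "u \<in> Lebesgue2 M"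
proof -
 show ?thesis using assms by (intro Lebesgue2I integrableI_nonneg) auto
qed

text \<open>The Bochner integral of a non-integrable function is 0, so a bound on
  \<open>L2_norm\<close> alone says nothing about membership. Estimates are therefore made with
  \<open>nn_integral\<close>, whose finiteness also yields \<open>Lebesgue2\<close>.\<close>

lemma L2_norm_le_nn:
 assumes "u \<in> borel_measurable M" "nn2 M u \<le> ennreal (c\<^sup>2)" "0 \<le> c" shows "L2_norm M u \<le> c"
proof -
 have "u \<in> Lebesgue2 M" by (rule Lebesgue2I_nn[OF assms(1)]) (use assms(2) in \<open>simp add: le_less_trans\<close>)
 then have "(L2_norm M u)\<^sup>2 \<le> c\<^sup>2" using assms(2) by (simp add: nn_integral_norm2)
 then show ?thesis using assms(3) by (rule power2_le_imp_le)
qed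

lemma Lebesgue2_dominated:
 assumes "u \<in> Lebesgue2 M" "v \<in> borel_measurable M" "AE x in M. norm (v x) \<le> C * norm (u x)" shows "v \<in> Lebesgue2 M"
proof (rule Lebesgue2I[OF assms(2)])
 have [measurable]: "v \<in> borel_measurable M" by fact
 show "integrable M (\<lambda>x. (norm (v x))\<^sup>2)"
 proof (rule bochner_bound)
  show "integrable M (\<lambda>x. C\<^sup>2 * (norm (u x))\<^sup>2)" using Lebesgue2_integrable[OF assms(1)] by simp
  show "AE x in M. norm ((norm (v x))\<^sup>2) \<le> norm (C\<^sup>2 * (norm (u x))\<^sup>2)" using assms(3)
  proof eventually_elim
   case (elim x)
   then have "(norm (v x))\<^sup>2 \<le> (C * norm (u x))\<^sup>2" by (rule power_mono) simp
   then show ?case by (simp add: power_mult_distrib)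
  qed
 qed simp
qed

lemma Lebesgue2_zero [simp]: "(\<lambda>x. 0) \<in> Lebesgue2 M" by (simp add: Lebesgue2_def)

lemma Lebesgue2_add [intro]:
 assumes "u \<in> Lebesgue2 M" "v \<in> Lebesgue2 M" shows "(\<lambda>x. u x + v x) \<in> Lebesgue2 M"
proof (rule Lebesgue2I)
 have [measurable]: "u \<in> borel_measurable M" "v \<in> borel_measurable M" using assms by (auto simp: Lebesgue2_def)
 show "(\<lambda>x. u x + v x) \<in> borel_measurable M" by measurable
 show "integrable M (\<lambda>x. (norm (u x + v x))\<^sup>2)"
 proof (rule bochner_bound)
  show "integrable M (\<lambda>x. 2 * (norm (u x))\<^sup>2 + 2 * (norm (v x))\<^sup>2)" using assms by (simp add: Lebesgue2_def)
  show "AE x in M. norm ((norm (u x + v x))\<^sup>2) \<le> norm (2 * (norm (u x))\<^sup>2 + 2 * (norm (v x))\<^sup>2)"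
  proof (rule AE_I2)
   fix x
   have "(norm (u x + v x))\<^sup>2 \<le> (norm (u x) + norm (v x))\<^sup>2" by (intro power_mono norm_triangle_ineq) simp
   also have "\<dots> \<le> 2 * (norm (u x))\<^sup>2 + 2 * (norm (v x))\<^sup>2"
    using sum_squares_bound[of "norm (u x)" "norm (v x)"] by (simp add: power2_sum)
   finally show "norm ((norm (u x + v x))\<^sup>2) \<le> norm (2 * (norm (u x))\<^sup>2 + 2 * (norm (v x))\<^sup>2)" by simp
  qed
 qed measurable
qed

lemma Lebesgue2_bounded_linear:
 assumes "bounded_linear h" "u \<in> Lebesgue2 M" shows "(\<lambda>x. h (u x)) \<in> Lebesgue2 M"
proof -
 obtain K where K: "\<And>x. norm (h x) \<le> norm x * K" using bounded_linear.bounded[OF assms(1)] by auto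
 have [measurable]: "h \<in> borel_measurable borel"
  using assms(1) by (simp add: borel_measurable_continuous_onI linear_continuous_on)
 note [measurable] = Lebesgue2_measurable[OF assms(2)]
 show ?thesis by (rule Lebesgue2_dominated[OF assms(2), of _ K]) (use K in \<open>auto simp: mult.commute\<close>)
qed

lemma Lebesgue2_scaleR [intro]: "u \<in> Lebesgue2 M ==> (\<lambda>x. c *\<^sub>R u x) \<in> Lebesgue2 M"
 using Lebesgue2_bounded_linear[OF bounded_linear_scaleR_right[of c]] by auto

lemma Lebesgue2_uminus [intro]: "u \<in> Lebesgue2 M ==> (\<lambda>x. - u x) \<in> Lebesgue2 M" using Lebesgue2_scaleR[of u M "-1"] by simp

lemma Lebesgue2_diff [intro]:
 "u \<in> Lebesgue2 M ==> v \<in> Lebesgue2 M ==> (\<lambda>x. u x - v x) \<in> Lebesgue2 M"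
 using Lebesgue2_add[of u M "\<lambda>x. - v x"] Lebesgue2_uminus[of v M] by simp

lemma Lebesgue2_sum:
 "(\<And>i. i \<in> I ==> u i \<in> Lebesgue2 M) ==> (\<lambda>x. \<Sum>i\<in>I. u i x) \<in> Lebesgue2 M" by (induction I rule: infinite_finite_induct) auto

lemma Lebesgue2_bounded:
 assumes "finite_measure M" "u \<in> borel_measurable M" "AE x in M. norm (u x) \<le> C" shows "u \<in> Lebesgue2 M"
proof -
 have "(\<lambda>x. 1::real) \<in> Lebesgue2 M" using finite_measure.integrable_const[OF assms(1), of "1::real"] by (simp add: Lebesgue2_def)
 from Lebesgue2_dominated[OF this assms(2), of C] show ?thesis using assms(3) by simp
qed

lemma Lebesgue2_cong_AE:
 assumes "u \<in> Lebesgue2 M" "v \<in> borel_measurable M" "AE x in M. u x = v x" shows "v \<in> Lebesgue2 M"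
 by (rule Lebesgue2_dominated[OF assms(1,2), of 1]) (use assms(3) in auto)

lemma L2_norm_cong_AE:
 assumes "u \<in> borel_measurable M" "v \<in> borel_measurable M" "AE x in M. u x = v x" shows "L2_norm M u = L2_norm M v"
proof -
 have [measurable]: "u \<in> borel_measurable M" "v \<in> borel_measurable M" using assms by auto
 show ?thesis unfolding L2_norm_def by (subst integral_cong_AE[of _ M "\<lambda>x. (norm (v x))\<^sup>2"]) (use assms(3) in auto)
qed

lemma L2_norm_AE_zero: "AE x in M. u x = 0 ==> u \<in> borel_measurable M ==> L2_norm M u = 0"
 using L2_norm_cong_AE[of u M "\<lambda>x. 0"] by (simp add: L2_norm_def)

lemma AE_zero_of_L2_norm:
 assumes "u \<in> Lebesgue2 M" "L2_norm M u = 0" shows "AE x in M. u x = 0"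
proof -
 show ?thesis using assms(2) integral_nonneg_eq_0_iff_AE[OF Lebesgue2_integrable[OF assms(1)]] by (simp add: L2_norm_def)
qed

lemma L2_norm_minus: "L2_norm M (\<lambda>x. - u x) = L2_norm M u" by (simp add: L2_norm_def)

lemma L2_norm_diff_commute: "L2_norm M (\<lambda>x. u x - v x) = L2_norm M (\<lambda>x. v x - u x)" by (simp add: L2_norm_def norm_minus_commute)

lemma L2_norm_scaleR: "L2_norm M (\<lambda>x. c *\<^sub>R u x) = \<bar>c\<bar> * L2_norm M u" by (simp add: L2_norm_def power_mult_distrib real_sqrt_mult)

lemma L2_norm_mono:
 assumes "u \<in> Lebesgue2 M" "v \<in> borel_measurable M" "AE x in M. norm (v x) \<le> C * norm (u x)" "0 \<le> C"
 shows "L2_norm M v \<le> C * L2_norm M u"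
proof (rule L2_norm_le_nn[OF assms(2)])
 note [measurable] = Lebesgue2_measurable[OF assms(1)]
 have "nn2 M v \<le> (\<integral>\<^sup>+x. ennreal (C\<^sup>2) * ennreal ((norm (u x))\<^sup>2) \<partial>M)"
 proof (rule nn_integral_mono_AE)
  show "AE x in M. ennreal ((norm (v x))\<^sup>2) \<le> ennreal (C\<^sup>2) * ennreal ((norm (u x))\<^sup>2)" using assms(3)
  proof eventually_elim
   case (elim x)
   then have "(norm (v x))\<^sup>2 \<le> (C * norm (u x))\<^sup>2" by (rule power_mono) simp
   then show ?case by (simp add: power_mult_distrib ennreal_mult[symmetric])
  qed
 qed
 also have "\<dots> = ennreal (C\<^sup>2) * ennreal ((L2_norm M u)\<^sup>2)" by (simp add: nn_integral_cmult nn_integral_norm2[OF assms(1)])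
 also have "\<dots> = ennreal ((C * L2_norm M u)\<^sup>2)" by (simp add: power_mult_distrib ennreal_mult)
 finally show "nn2 M v \<le> ennreal ((C * L2_norm M u)\<^sup>2)" .
qed (use assms(4) in simp)

lemma L2_Cauchy_Schwarz:
 assumes "u \<in> Lebesgue2 M" "v \<in> Lebesgue2 M" shows "integrable M (\<lambda>x. norm (u x) * norm (v x))"
  and "(LINT x|M. norm (u x) * norm (v x)) \<le> L2_norm M u * L2_norm M v"
proof -
 have [measurable]: "u \<in> borel_measurable M" "v \<in> borel_measurable M" using assms by (auto simp: Lebesgue2_def)
 have "(\<integral>\<^sup>+x. ennreal (norm (u x) * norm (v x)) \<partial>M)\<^sup>2 = (\<integral>\<^sup>+x. ennreal (norm (u x)) * ennreal (norm (v x)) \<partial>M)\<^sup>2"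
  by (simp add: ennreal_mult)
 also have "\<dots> \<le> (\<integral>\<^sup>+x. (ennreal (norm (u x)))\<^sup>2 \<partial>M) * (\<integral>\<^sup>+x. (ennreal (norm (v x)))\<^sup>2 \<partial>M)"
  by (rule Cauchy_Schwarz_nn_integral) auto
 also have "\<dots> = ennreal ((L2_norm M u * L2_norm M v)\<^sup>2)" using nn_integral_norm2[OF assms(1)] nn_integral_norm2[OF assms(2)]
  by (simp add: ennreal_power power_mult_distrib ennreal_mult)
 finally have *: "(\<integral>\<^sup>+x. ennreal (norm (u x) * norm (v x)) \<partial>M)\<^sup>2 \<le> (ennreal (L2_norm M u * L2_norm M v))\<^sup>2"
  by (simp add: ennreal_power)
 have **: "(\<integral>\<^sup>+x. ennreal (norm (u x) * norm (v x)) \<partial>M) \<le> ennreal (L2_norm M u * L2_norm M v)"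
 proof (cases "\<integral>\<^sup>+x. ennreal (norm (u x) * norm (v x)) \<partial>M")
  case (real r)
  then show ?thesis using * real by (simp add: ennreal_power)
 next
  case top
  then show ?thesis using * by (simp add: ennreal_power top_unique del:)
 qed
 show int: "integrable M (\<lambda>x. norm (u x) * norm (v x))" by (rule integrableI_nonneg) (use ** in \<open>auto simp: le_less_trans\<close>)
 show "(LINT x|M. norm (u x) * norm (v x)) \<le> L2_norm M u * L2_norm M v" using ** int by (simp add: nn_integral_eq_integral)
qed

lemma L2_norm_triangle:
 assumes "u \<in> Lebesgue2 M" "v \<in> Lebesgue2 M" shows "L2_norm M (\<lambda>x. u x + v x) \<le> L2_norm M u + L2_norm M v"
proof (rule power2_le_imp_le)
 have "(L2_norm M (\<lambda>x. u x + v x))\<^sup>2 = (LINT x|M. (norm (u x + v x))\<^sup>2)" by (simp add: L2_norm_power2)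
 also have "\<dots> \<le> (LINT x|M. (norm (u x))\<^sup>2 + 2 * (norm (u x) * norm (v x)) + (norm (v x))\<^sup>2)"
 proof (rule integral_mono)
  show "integrable M (\<lambda>x. (norm (u x + v x))\<^sup>2)" using Lebesgue2_add[OF assms] by (rule Lebesgue2_integrable)
  show "integrable M (\<lambda>x. (norm (u x))\<^sup>2 + 2 * (norm (u x) * norm (v x)) + (norm (v x))\<^sup>2)"
   using assms L2_Cauchy_Schwarz(1)[OF assms] by (intro bochner_add) (auto simp: Lebesgue2_def)
  fix x
  have "(norm (u x + v x))\<^sup>2 \<le> (norm (u x) + norm (v x))\<^sup>2" by (intro power_mono norm_triangle_ineq) simp
  then show "(norm (u x + v x))\<^sup>2 \<le> (norm (u x))\<^sup>2 + 2 * (norm (u x) * norm (v x)) + (norm (v x))\<^sup>2" by (simp add: power2_sum)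
 qed
 also have "\<dots> = (L2_norm M u)\<^sup>2 + 2 * (LINT x|M. norm (u x) * norm (v x)) + (L2_norm M v)\<^sup>2"
  using assms L2_Cauchy_Schwarz(1)[OF assms] by (simp add: L2_norm_power2 Lebesgue2_integrable)
 also have "\<dots> \<le> (L2_norm M u + L2_norm M v)\<^sup>2" using L2_Cauchy_Schwarz(2)[OF assms] by (simp add: power2_sum)
 finally show "(L2_norm M (\<lambda>x. u x + v x))\<^sup>2 \<le> (L2_norm M u + L2_norm M v)\<^sup>2" .
qed simp

lemma L2_norm_triangle_diff:
 assumes "u \<in> Lebesgue2 M" "v \<in> Lebesgue2 M" "w \<in> Lebesgue2 M"
 shows "L2_norm M (\<lambda>x. u x - w x) \<le> L2_norm M (\<lambda>x. u x - v x) + L2_norm M (\<lambda>x. v x - w x)"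
 using L2_norm_triangle[OF Lebesgue2_diff[OF assms(1,2)] Lebesgue2_diff[OF assms(2,3)]] by simp

lemma L2_norm_le_add_diff:
 assumes "u \<in> Lebesgue2 M" "v \<in> Lebesgue2 M" shows "L2_norm M u \<le> L2_norm M (\<lambda>x. u x - v x) + L2_norm M v"
 using L2_norm_triangle[OF Lebesgue2_diff[OF assms] assms(2)] by simp

lemma L2_pairing_integrable:
 fixes u :: "'a => 'b::euclidean_space" and v :: "'a => 'c::euclidean_space" and h :: "'b => 'c => 'd::euclidean_space"
 assumes "bounded_bilinear h" "u \<in> Lebesgue2 M" "v \<in> Lebesgue2 M" shows "integrable M (\<lambda>x. h (u x) (v x))"
proof -
 interpret h: bounded_bilinear h by fact
 obtain K where K: "0 \<le> K" "\<And>a b. norm (h a b) \<le> norm a * norm b * K" using h.nonneg_bounded by blast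
 have [measurable]: "u \<in> borel_measurable M" "v \<in> borel_measurable M" using assms by (auto simp: Lebesgue2_def)
 have meas: "(\<lambda>x. h (u x) (v x)) \<in> borel_measurable M"
  by (rule borel_measurable_continuous_Pair) (auto intro!: h.continuous_on continuous_intros)
 show ?thesis
 proof (rule bochner_bound[OF _ meas])
  show "integrable M (\<lambda>x. (norm (u x) * norm (v x)) * K)" using L2_Cauchy_Schwarz(1)[OF assms(2,3)] by simp
  show "AE x in M. norm (h (u x) (v x)) \<le> norm (norm (u x) * norm (v x) * K)" by (rule AE_I2) (use K in simp)
 qed
qed

lemma L2_pairing_bound:
 fixes h :: "'b::euclidean_space => 'c::euclidean_space => 'd::euclidean_space"
 assumes "bounded_bilinear h"
 obtains K where "0 \<le> K" "\<And>(M::'a measure) (u::'a => 'b) (v::'a => 'c). u \<in> Lebesgue2 M ==> v \<in> Lebesgue2 M ==>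
   norm (LINT x|M. h (u x) (v x)) \<le> K * (L2_norm M u * L2_norm M v)"
proof -
 interpret h: bounded_bilinear h by fact
 obtain K where K: "0 \<le> K" "\<And>a b. norm (h a b) \<le> norm a * norm b * K" using h.nonneg_bounded by blast
 show ?thesis
 proof (rule that[OF K(1)])
  fix M :: "'a measure" and u :: "'a => 'b" and v :: "'a => 'c" assume uv: "u \<in> Lebesgue2 M" "v \<in> Lebesgue2 M"
  have "norm (LINT x|M. h (u x) (v x)) \<le> (LINT x|M. norm (h (u x) (v x)))" by simp
  also have "\<dots> \<le> (LINT x|M. K * (norm (u x) * norm (v x)))" by (rule integral_mono)
    (use L2_pairing_integrable[OF assms uv] L2_Cauchy_Schwarz(1)[OF uv] K(2) in
     \<open>auto simp: mult.commute intro: integrable_norm\<close>)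
  also have "\<dots> \<le> K * (L2_norm M u * L2_norm M v)" using L2_Cauchy_Schwarz(2)[OF uv] K(1) by (simp add: mult_left_mono)
  finally show "norm (LINT x|M. h (u x) (v x)) \<le> K * (L2_norm M u * L2_norm M v)" .
 qed
qed

text \<open>Split the error as \<open>h (U - u) V + h u (V - v)\<close>. Being stated for any real
  bilinear \<open>h\<close>, it serves sesquilinear pairings, inner products and scalings
  alike.\<close>

lemma L2_pairing_tendsto:
 fixes u :: "'a => 'b::euclidean_space" and v :: "'a => 'c::euclidean_space" and h :: "'b => 'c => 'd::euclidean_space"
 assumes "bounded_bilinear h" "u \<in> Lebesgue2 M" "v \<in> Lebesgue2 M" and "\<And>m. U m \<in> Lebesgue2 M" "\<And>m. V m \<in> Lebesgue2 M"
  and "L2_conv M U u" "L2_conv M V v" shows "(\<lambda>m::nat. LINT x|M. h (U m x) (V m x)) \<longlonglongrightarrow> (LINT x|M. h (u x) (v x))"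
proof -
 interpret h: bounded_bilinear h by fact
 obtain K where K: "0 \<le> K" "\<And>(M::'a measure) (u::'a => 'b) (v::'a => 'c). u \<in> Lebesgue2 M ==> v \<in> Lebesgue2 M ==>
   norm (LINT x|M. h (u x) (v x)) \<le> K * (L2_norm M u * L2_norm M v)" by (rule L2_pairing_bound[OF assms(1)]) blast
 define a where "a m = L2_norm M (\<lambda>x. U m x - u x)" for m
 define b where "b m = L2_norm M (\<lambda>x. V m x - v x)" for m
 have *: "norm ((LINT x|M. h (U m x) (V m x)) - (LINT x|M. h (u x) (v x)))
   \<le> K * (a m * (b m + L2_norm M v)) + K * (L2_norm M u * b m)" for m
 proof -
  note i = L2_pairing_integrable[OF assms(1)]
  have "(LINT x|M. h (U m x) (V m x)) - (LINT x|M. h (u x) (v x))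
    = (LINT x|M. h (U m x - u x) (V m x)) + (LINT x|M. h (u x) (V m x - v x))"
   using i[OF assms(4,5)] i[OF assms(2,3)] i[OF assms(2) assms(5)] by (simp add: h.diff_left h.diff_right)
  also have "norm \<dots> \<le> K * (a m * L2_norm M (V m)) + K * (L2_norm M u * b m)" unfolding a_def b_def using assms
   by (intro order_trans[OF norm_triangle_ineq] add_mono K(2)) auto
  also have "\<dots> \<le> K * (a m * (b m + L2_norm M v)) + K * (L2_norm M u * b m)"
   using L2_norm_le_add_diff[OF assms(5) assms(3), of m] K(1) by (simp add: a_def b_def mult_left_mono)
  finally show ?thesis .
 qed
 have "(\<lambda>m. K * (a m * (b m + L2_norm M v)) + K * (L2_norm M u * b m)) \<longlonglongrightarrow> K * (0 * (0 + L2_norm M v)) + K * (L2_norm M u * 0)"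
  by (intro tendsto_intros) (use assms in \<open>auto simp: a_def b_def\<close>)
 then have "(\<lambda>m. (LINT x|M. h (U m x) (V m x)) - (LINT x|M. h (u x) (v x))) \<longlonglongrightarrow> 0"
  by (intro Lim_null_comparison[OF always_eventually[OF allI[OF *]]]) simp
 then show ?thesis by (rule LIM_zero_cancel)
qed

lemma L2_limit_unique:
 assumes "\<And>m. U m \<in> Lebesgue2 M" "\<And>m. V m \<in> Lebesgue2 M" "u \<in> Lebesgue2 M" "v \<in> Lebesgue2 M"
  and "(\<lambda>m::nat. L2_norm M (\<lambda>x. U m x - u x)) \<longlonglongrightarrow> 0" "L2_conv M V v" and "(\<lambda>m. L2_norm M (\<lambda>x. U m x - V m x)) \<longlonglongrightarrow> 0"
 shows "AE x in M. u x = v x"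
proof -
 have "L2_norm M (\<lambda>x. u x - v x) \<le> L2_norm M (\<lambda>x. U m x - u x) + L2_norm M (\<lambda>x. U m x - V m x)
    + L2_norm M (\<lambda>x. V m x - v x)" for m using L2_norm_triangle_diff[OF assms(3) assms(1)[of m] assms(4)]
   L2_norm_triangle_diff[OF assms(1)[of m] assms(2)[of m] assms(4)] by (simp add: L2_norm_diff_commute[of M u])
 moreover have "(\<lambda>m. L2_norm M (\<lambda>x. U m x - u x) + L2_norm M (\<lambda>x. U m x - V m x) + L2_norm M (\<lambda>x. V m x - v x)) \<longlonglongrightarrow> 0 + 0 + 0"
  by (intro tendsto_intros assms)
 ultimately have "L2_norm M (\<lambda>x. u x - v x) \<le> 0 + 0 + 0" by (intro LIMSEQ_le_const) auto
 then have "L2_norm M (\<lambda>x. u x - v x) = 0" using L2_norm_nonneg[of M "\<lambda>x. u x - v x"] by linarith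
 from AE_zero_of_L2_norm[OF Lebesgue2_diff[OF assms(3,4)] this] show ?thesis by simp
qed

lemma L2_norm_bounded_linear_tendsto:
 assumes "bounded_linear h" "\<And>m. U m \<in> Lebesgue2 M" "u \<in> Lebesgue2 M" and "L2_conv M U u"
 shows "L2_conv M (\<lambda>m x. h (U m x)) (\<lambda>x. h (u x))"
proof -
 interpret h: bounded_linear h by fact
 obtain K where K: "0 \<le> K" "\<And>x. norm (h x) \<le> norm x * K" using h.nonneg_bounded by blast
 have "L2_norm M (\<lambda>x. h (U m x) - h (u x)) \<le> K * L2_norm M (\<lambda>x. U m x - u x)" for m
 proof (rule L2_norm_mono[OF Lebesgue2_diff[OF assms(2,3)] _ _ K(1)])
  show "(\<lambda>x. h (U m x) - h (u x)) \<in> borel_measurable M"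
   using Lebesgue2_diff[OF Lebesgue2_bounded_linear[OF assms(1,2)] Lebesgue2_bounded_linear[OF assms(1,3)]]
   by (rule Lebesgue2_measurable)
  show "AE x in M. norm (h (U m x) - h (u x)) \<le> K * norm (U m x - u x)" using K(2) by (simp add: h.diff[symmetric] mult.commute)
 qed
 moreover have "(\<lambda>m. K * L2_norm M (\<lambda>x. U m x - u x)) \<longlonglongrightarrow> 0" using tendsto_mult[OF tendsto_const assms(4), of K] by simp
 ultimately show ?thesis by (intro tendsto_zero_le[OF L2_norm_nonneg])
qed

text \<open>Riesz-Fischer: along a fast subsequence the increments are summable in L1, because the
  measure is finite, so the subsequence converges almost everywhere; Fatou's lemma upgrades this to
  L2 convergence of the whole sequence.\<close>

lemma L2_complete:
 assumes "finite_measure M" "\<And>m. U m \<in> Lebesgue2 M" and Cauchy: "\<And>e. e > 0 ==> \<exists>N. \<forall>m\<ge>N. \<forall>k\<ge>N. L2_norm M (\<lambda>x. U m x - U k x) < e"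
 obtains g where "g \<in> Lebesgue2 M" "L2_conv M U g"
proof -
 have meas [measurable]: "U m \<in> borel_measurable M" for m using assms(2) by (rule Lebesgue2_measurable)
 have "\<forall>j. \<exists>N. \<forall>m\<ge>N. \<forall>k\<ge>N. L2_norm M (\<lambda>x. U m x - U k x) < (1/2)^j" by (intro allI Cauchy) simp
 from choice[OF this] obtain N where
  N: "\<And>j m k. m \<ge> N j ==> k \<ge> N j ==> L2_norm M (\<lambda>x. U m x - U k x) < (1/2)^j" by blast
 \<comment> \<open>\<open>r j\<close> is at least \<open>N j\<close> and strictly increasing;
   summing the \<open>N i\<close> achieves both without a recursive choice of indices.\<close>
 define r where "r j = (\<Sum>i\<le>j. N i) + j" for j
 have rN: "N j \<le> r j" for j unfolding r_def by (simp add: member_le_sum trans_le_add1)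
 have r_less: "r j < r (Suc j)" for j unfolding r_def by simp
 have r_mono: "r j \<le> r k" if "j \<le> k" for j k using that r_less by (metis less_imp_le lift_Suc_mono_le)
 define D where "D j x = norm (U (r (Suc j)) x - U (r j) x)" for j x
 have [measurable]: "D j \<in> borel_measurable M" for j unfolding D_def by measurable
 interpret finite_measure M by fact
 have one: "(\<lambda>x. 1::real) \<in> Lebesgue2 M" using integrable_const[of "1::real"] by (simp add: Lebesgue2_def)
 define c where "c = L2_norm M (\<lambda>x. 1::real)"
 have D_le: "(\<integral>\<^sup>+x. ennreal (D j x) \<partial>M) \<le> ennreal ((1/2)^j * c)" for j
 proof -
  have "(LINT x|M. D j x) \<le> L2_norm M (\<lambda>x. U (r (Suc j)) x - U (r j) x) * c"
   using L2_Cauchy_Schwarz(2)[OF Lebesgue2_diff[OF assms(2) assms(2)] one] by (simp add: D_def c_def)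
  also have "\<dots> \<le> (1/2)^j * c"
  proof (rule mult_right_mono)
   show "L2_norm M (\<lambda>x. U (r (Suc j)) x - U (r j) x) \<le> (1/2)^j" using rN[of j] r_less[of j] N[of j "r (Suc j)" "r j"] rN[of j] by simp
  qed (simp add: c_def)
  finally have "(LINT x|M. D j x) \<le> (1/2)^j * c" .
  moreover have "integrable M (D j)" using L2_Cauchy_Schwarz(1)[OF Lebesgue2_diff[OF assms(2) assms(2)] one]
   by (simp add: D_def[abs_def])
  ultimately show ?thesis by (subst nn_integral_eq_integral) (auto simp: D_def[abs_def] intro!: ennreal_leI)
 qed
 have "(\<integral>\<^sup>+x. (\<Sum>j. ennreal (D j x)) \<partial>M) = (\<Sum>j. \<integral>\<^sup>+x. ennreal (D j x) \<partial>M)" by (rule nn_integral_suminf) simp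
 also have "\<dots> \<le> (\<Sum>j. ennreal ((1/2)^j * c))" by (intro suminf_le D_le) auto
 also have "\<dots> < \<infinity>"
 proof -
  have "summable (\<lambda>j. (1/2::real)^j * c)" by (intro summable_mult2 summable_geometric) simp
  then have "(\<Sum>j. ennreal ((1/2)^j * c)) = ennreal (\<Sum>j. (1/2)^j * c)" by (intro suminf_ennreal2) (auto simp: c_def)
  then show ?thesis by simp
 qed
 finally have "AE x in M. (\<Sum>j. ennreal (D j x)) \<noteq> \<infinity>" by (intro nn_integral_noteq_infinite) auto
 then have conv: "AE x in M. convergent (\<lambda>j. U (r j) x)"
 proof eventually_elim
  case (elim x)
  then have "summable (\<lambda>j. D j x)" by (intro summable_suminf_not_top) (auto simp: D_def)
  then have "summable (\<lambda>j. U (r (Suc j)) x - U (r j) x)" unfolding D_def by (rule summable_norm_cancel)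
  then have "convergent (\<lambda>n. U (r n) x - U (r 0) x)"
   by (simp add: summable_iff_convergent sum_lessThan_telescope[of "\<lambda>j. U (r j) x"])
  from convergent_add[OF this convergent_const[of "U (r 0) x"]] show ?case by simp
 qed
 define g where "g x = lim (\<lambda>j. U (r j) x)" for x
 have [measurable]: "g \<in> borel_measurable M" unfolding g_def by (rule borel_measurable_lim_metric) measurable
 have lim: "AE x in M. (\<lambda>j. U (r j) x) \<longlonglongrightarrow> g x" using conv by eventually_elim (simp add: g_def convergent_LIMSEQ_iff)
 have Fatou: "nn2 M (\<lambda>x. U m x - g x) \<le> ennreal (((1/2)^i)\<^sup>2)" if "m \<ge> N i" for m i
 proof -
  have "nn2 M (\<lambda>x. U m x - g x) = (\<integral>\<^sup>+x. liminf (\<lambda>j. ennreal ((norm (U m x - U (r j) x))\<^sup>2)) \<partial>M)"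
  proof (rule nn_integral_cong_AE)
   show "AE x in M. ennreal ((norm (U m x - g x))\<^sup>2) = liminf (\<lambda>j. ennreal ((norm (U m x - U (r j) x))\<^sup>2))" using lim
   proof eventually_elim
    case (elim x)
    then have "(\<lambda>j. ennreal ((norm (U m x - U (r j) x))\<^sup>2)) \<longlonglongrightarrow> ennreal ((norm (U m x - g x))\<^sup>2)" by (intro tendsto_intros) auto
    then show ?case by (intro lim_imp_Liminf[symmetric]) simp_all
   qed
  qed
  also have "\<dots> \<le> liminf (\<lambda>j. \<integral>\<^sup>+x. ennreal ((norm (U m x - U (r j) x))\<^sup>2) \<partial>M)" by (rule nn_integral_liminf) measurable
  also have "\<dots> \<le> liminf (\<lambda>j. ennreal (((1/2)^i)\<^sup>2))"
  proof (rule Liminf_mono)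
   have "\<forall>\<^sub>F j in sequentially. j \<ge> i" by (rule eventually_ge_at_top)
   then show "\<forall>\<^sub>F j in sequentially. nn2 M (\<lambda>x. U m x - U (r j) x) \<le> ennreal (((1/2)^i)\<^sup>2)"
   proof eventually_elim
    case (elim j)
    then show ?case using rN[of i] r_mono[of i j] N[OF that, of "r j"] assms(2) by (subst nn_integral_norm2) (auto intro!: ennreal_leI power_mono)
   qed
  qed
  also have "\<dots> = ennreal (((1/2)^i)\<^sup>2)" by (simp add: Liminf_const)
  finally show ?thesis .
 qed
 have le: "L2_norm M (\<lambda>x. U m x - g x) \<le> (1/2)^i" if "m \<ge> N i" for m i by (rule L2_norm_le_nn[OF _ Fatou[OF that]]) auto
 have "(\<lambda>x. U (N 0) x - g x) \<in> Lebesgue2 M" by (rule Lebesgue2I_nn) (use Fatou[of 0 "N 0"] in \<open>auto simp: le_less_trans\<close>)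
 from Lebesgue2_diff[OF assms(2)[of "N 0"] this] have g: "g \<in> Lebesgue2 M" by simp
 have "L2_conv M U g"
 proof (rule LIMSEQ_I)
  fix e :: real assume "e > 0"
  then obtain i where "(1/2::real)^i < e" using real_arch_pow_inv[of e "1/2"] by auto
  then show "\<exists>no. \<forall>m\<ge>no. norm (L2_norm M (\<lambda>x. U m x - g x) - 0) < e"
   using le[of i] by (intro exI[of _ "N i"]) (auto intro: le_less_trans)
 qed
 with g show ?thesis by (rule that)
qed

section \<open>Calculus of smooth functions\<close>

lemma partial_eq: "(f has_derivative f') (at x) ==> partial i f x = f' (axis i 1)"
 unfolding partial_def using frechet_derivative_at by metis

text \<open>\<open>C_k (Suc k)\<close> asks for differentiability and does not mention continuity,
  so the base case is the continuity of differentiable functions.\<close>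

lemma C_k_SucD: "C_k (Suc k) f ==> C_k k f"
proof (induction k arbitrary: f)
 case 0
 then show ?case by (auto simp: differentiable_imp_continuous_within continuous_on_eq_continuous_within)
next
 case (Suc k)
 then show ?case by simp
qed

lemma has_derivative_partials:
 assumes "f differentiable (at x)" shows "(f has_derivative (\<lambda>h. \<Sum>i\<in>UNIV. h $ i *\<^sub>R partial i f x)) (at x)"
proof -
 let ?D = "frechet_derivative f (at x)"
 have D: "(f has_derivative ?D) (at x)" using assms by (simp add: frechet_derivative_works)
 then interpret bounded_linear ?D by (rule has_derivative_bounded_linear)
 have "?D h = (\<Sum>i\<in>UNIV. h $ i *\<^sub>R partial i f x)" for h
 proof -
  have "?D h = ?D (\<Sum>i\<in>UNIV. h $ i *\<^sub>R axis i 1)" using basis_expansion[of h] by (simp add: scalar_mult_eq_scaleR)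
  then show ?thesis by (simp add: sum scaleR partial_def)
 qed
 then have "?D = (\<lambda>h. \<Sum>i\<in>UNIV. h $ i *\<^sub>R partial i f x)" by auto
 then show ?thesis using D by (simp only:)
qed

lemma partial_const [simp]: "partial i (\<lambda>x. c) = (\<lambda>x. 0)" by (rule ext) (simp add: partial_eq[OF has_derivative_const])

lemma C_k_const [simp]: "C_k k (\<lambda>x. c)" by (induction k arbitrary: c) auto

lemma C_k_add: "C_k k f ==> C_k k g ==> C_k k (\<lambda>x. f x + g x)"
proof (induction k arbitrary: f g)
 case 0 then show ?case by (simp add: continuous_on_add)
next
 case (Suc k)
 have d: "((\<lambda>x. f x + g x) has_derivative (\<lambda>v. frechet_derivative f (at x) v + frechet_derivative g (at x) v)) (at x)" for x
  by (rule has_derivative_add) (use Suc.prems in \<open>auto simp: frechet_derivative_works\<close>)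
 have "partial i (\<lambda>x. f x + g x) = (\<lambda>x. partial i f x + partial i g x)" for i
  by (rule ext) (simp add: partial_eq[OF d] partial_def)
 then show ?case using Suc by auto
qed

lemma C_k_sum: "(\<And>i. i \<in> I ==> C_k k (f i)) ==> C_k k (\<lambda>x. \<Sum>i\<in>I. f i x)"
 by (induction I rule: infinite_finite_induct) (auto intro: C_k_add)

text \<open>One induction covers every bilinear product in use. In the product rule one factor stays
  undifferentiated, which is why \<open>C_k_SucD\<close> is needed to lower its order.\<close>

lemma C_k_bilinear:
 assumes h: "bounded_bilinear h" shows "C_k k f ==> C_k k g ==> C_k k (\<lambda>x. h (f x) (g x))"
proof (induction k arbitrary: f g)
 case 0 then show ?case by (simp add: bounded_bilinear.continuous_on[OF h])
next
 case (Suc k)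
 have d: "((\<lambda>x. h (f x) (g x)) has_derivative
   (\<lambda>v. h (f x) (frechet_derivative g (at x) v) + h (frechet_derivative f (at x) v) (g x))) (at x)" for x
  by (rule bounded_bilinear.FDERIV[OF h]) (use Suc.prems in \<open>auto simp: frechet_derivative_works\<close>)
 have "partial i (\<lambda>x. h (f x) (g x)) = (\<lambda>x. h (f x) (partial i g x) + h (partial i f x) (g x))" for i
  by (rule ext) (simp add: partial_eq[OF d] partial_def)
 moreover have "C_k k f" "C_k k g" using Suc.prems by (metis C_k_SucD)+
 ultimately show ?case using Suc differentiableI[OF d] by (auto intro!: C_k_add)
qed

lemma C_k_linear:
 assumes h: "bounded_linear h" shows "C_k k f ==> C_k k (\<lambda>x. h (f x))"
proof (induction k arbitrary: f)
 case 0 then show ?case by (simp add: bounded_linear.continuous_on[OF h])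
next
 case (Suc k)
 have d: "((\<lambda>x. h (f x)) has_derivative (\<lambda>v. h (frechet_derivative f (at x) v))) (at x)" for x
  by (rule bounded_linear.has_derivative[OF h]) (use Suc.prems in \<open>auto simp: frechet_derivative_works\<close>)
 have "partial i (\<lambda>x. h (f x)) = (\<lambda>x. h (partial i f x))" for i by (rule ext) (simp add: partial_eq[OF d] partial_def)
 then show ?case using Suc differentiableI[OF d] by auto
qed

lemma C_k_affine: "C_k k f ==> C_k k (\<lambda>x. f (c *\<^sub>R x + b))"
proof (induction k arbitrary: f)
 case 0
 have "continuous_on UNIV (\<lambda>x. c *\<^sub>R x + b)" by (intro continuous_intros)
 from continuous_on_compose2[OF 0[unfolded C_k.simps] this] show ?case by simp
next
 case (Suc k)
 have d: "((\<lambda>x. f (c *\<^sub>R x + b)) has_derivative (\<lambda>v. frechet_derivative f (at (c *\<^sub>R x + b)) (c *\<^sub>R v))) (at x)" for x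
  by (rule has_derivative_compose[of "\<lambda>x. c *\<^sub>R x + b"])
   (use Suc.prems in \<open>auto simp: frechet_derivative_works intro!: derivative_eq_intros\<close>)
 have "partial i (\<lambda>x. f (c *\<^sub>R x + b)) = (\<lambda>x. c *\<^sub>R partial i f (c *\<^sub>R x + b))" for i
 proof (rule ext)
  fix x
  have "linear (frechet_derivative f (at (c *\<^sub>R x + b)))" using Suc.prems by (intro linear_frechet_derivative) auto
  then show "partial i (\<lambda>x. f (c *\<^sub>R x + b)) x = c *\<^sub>R partial i f (c *\<^sub>R x + b)"
   by (simp add: partial_eq[OF d] partial_def linear_cmul)
 qed
 then show ?case using Suc differentiableI[OF d] by (auto intro!: C_k_linear[OF bounded_linear_scaleR_right])
qed

lemma smooth_const [simp]: "smooth (\<lambda>x. c)" by (simp add: smooth_def)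

lemma smooth_add: "smooth f ==> smooth g ==> smooth (\<lambda>x. f x + g x)" by (simp add: smooth_def C_k_add)

lemma smooth_sum: "(\<And>i. i \<in> I ==> smooth (f i)) ==> smooth (\<lambda>x. \<Sum>i\<in>I. f i x)" by (simp add: smooth_def C_k_sum)

lemma smooth_bilinear: "bounded_bilinear h ==> smooth f ==> smooth g ==> smooth (\<lambda>x. h (f x) (g x))"
 for h :: "'b::euclidean_space => 'c::euclidean_space => 'd::euclidean_space" by (simp add: smooth_def C_k_bilinear)

lemma smooth_linear: "bounded_linear h ==> smooth f ==> smooth (\<lambda>x. h (f x))" by (simp add: smooth_def C_k_linear)

lemma smooth_diff:
 assumes "smooth f" "smooth g" shows "smooth (\<lambda>x. f x - g x)"
 using smooth_add[OF assms(1) smooth_linear[OF bounded_linear_minus[OF bounded_linear_ident] assms(2)]] by simp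

lemma smooth_scaleR: "smooth f ==> smooth g ==> smooth (\<lambda>x. f x *\<^sub>R g x)"
 for g :: "_ => 'b::euclidean_space" by (rule smooth_bilinear[OF bounded_bilinear_scaleR])

lemma smooth_mult: "smooth f ==> smooth g ==> smooth (\<lambda>x. f x * g x :: 'b::{euclidean_space,real_normed_algebra})"
 by (rule smooth_bilinear[OF bounded_bilinear_mult])

lemma smooth_affine: "smooth f ==> smooth (\<lambda>x. f (c *\<^sub>R x + b))" by (simp add: smooth_def C_k_affine)

lemma smooth_partial: "smooth f ==> smooth (partial i f)" unfolding smooth_def by (metis C_k.simps(2))

lemma smooth_differentiable: "smooth f ==> f differentiable (at x)" unfolding smooth_def by (metis C_k.simps(2))

lemma smooth_continuous: "smooth f ==> continuous_on S f"
 unfolding smooth_def by (metis C_k.simps(1) continuous_on_subset subset_UNIV)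

lemma smooth_has_derivative:
 "smooth f ==> (f has_derivative (\<lambda>h. \<Sum>i\<in>UNIV. h $ i *\<^sub>R partial i f x)) (at x)"
 by (intro has_derivative_partials smooth_differentiable)

lemma smooth_bounded_linear:
 assumes "bounded_linear h" shows "smooth h"
proof -
 have "C_k k h" for k
 proof (cases k)
  case 0
  then show ?thesis using linear_continuous_on[OF assms, of UNIV] by simp
 next
  case (Suc k')
  note d = bounded_linear_imp_has_derivative[OF assms]
  have "partial i h = (\<lambda>x. h (axis i 1))" for i by (rule ext) (rule partial_eq[OF d])
  then show ?thesis using Suc differentiableI[OF d] by auto
 qed
 then show ?thesis by (simp add: smooth_def)
qed

lemma smooth_component: "smooth (\<lambda>x::real^'n. x $ i)" by (rule smooth_bounded_linear[OF bounded_linear_vec_nth])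

lemma smooth_borel: "smooth f ==> f \<in> borel_measurable borel" by (intro borel_measurable_continuous_onI smooth_continuous)

lemma partial_add: "smooth f ==> smooth g ==> partial i (\<lambda>x. f x + g x) x = partial i f x + partial i g x"
 by (simp add: partial_eq[OF has_derivative_add[OF smooth_has_derivative smooth_has_derivative]] axis_def if_distrib[of "\<lambda>c. c *\<^sub>R _"] cong: if_cong)

lemma partial_bilinear:
 assumes "bounded_bilinear h" "smooth f" "smooth g"
 shows "partial i (\<lambda>x. h (f x) (g x)) x = h (f x) (partial i g x) + h (partial i f x) (g x)"
 using partial_eq[OF bounded_bilinear.FDERIV[OF assms(1) smooth_has_derivative[OF assms(2)] smooth_has_derivative[OF assms(3)]]]
 by (simp add: axis_def if_distrib[of "\<lambda>c. c *\<^sub>R _"] cong: if_cong)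

lemma partial_linear:
 assumes "bounded_linear h" "smooth f" shows "partial i (\<lambda>x. h (f x)) x = h (partial i f x)"
 using partial_eq[OF bounded_linear.has_derivative[OF assms(1) smooth_has_derivative[OF assms(2)]]]
 by (simp add: axis_def if_distrib[of "\<lambda>c. c *\<^sub>R _"] cong: if_cong)

text \<open>A one-variable function is handled together with the list of its derivatives: the chain
  rule turns \<open>g j\<close> into a product with \<open>g (Suc j)\<close>, so the induction on
  the order has to run over all members of the family at once.\<close>

lemma smooth_compose_family:
 assumes g: "\<And>k t. (g k has_real_derivative g (Suc k) t) (at t)" and q: "smooth q" shows "smooth (\<lambda>x. g j (q x))"
proof -
 have "C_k k (\<lambda>x. g j (q x))" for k j
 proof (induction k arbitrary: j)
  case 0
  have "continuous_on UNIV (g j)" using DERIV_isCont[OF g[of j]] by (simp add: continuous_at_imp_continuous_on)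
  then have "continuous_on UNIV (\<lambda>x. g j (q x))" by (rule continuous_on_compose2) (use smooth_continuous[OF q] in auto)
  then show ?case by simp
 next
  case (Suc k)
  have d: "((\<lambda>x. g j (q x)) has_derivative (\<lambda>v. g (Suc j) (q x) * (\<Sum>i\<in>UNIV. v $ i *\<^sub>R partial i q x))) (at x)" for x
   using has_derivative_compose[OF smooth_has_derivative[OF q, of x] g[of j "q x", unfolded has_field_derivative_def]] by simp
  have "partial i (\<lambda>x. g j (q x)) = (\<lambda>x. g (Suc j) (q x) * partial i q x)" for i
   by (rule ext) (simp add: partial_eq[OF d] axis_def if_distrib[of "\<lambda>c. c * _"] cong: if_cong)
  then show ?case using Suc differentiableI[OF d] smooth_partial[OF q]
   by (auto simp: smooth_def intro!: C_k_bilinear[OF bounded_bilinear_mult])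
 qed
 then show ?thesis by (simp add: smooth_def)
qed

section \<open>Bump functions\<close>

text \<open>The functions p(1/t) exp(-1/t), continued by 0, contain exp(-1/t) and are closed under
  differentiation, each derivative being of the same form with another polynomial. This is the
  family to which \<open>smooth_compose_family\<close> is applied.\<close>

definition exp_inv_poly :: "real poly => real => real" where
 "exp_inv_poly p t = (if t \<le> 0 then 0 else poly p (1/t) * exp (-(1/t)))"

lemma poly_times_exp_minus_tendsto_0: "((\<lambda>s::real. poly p s * exp (-s)) \<longlongrightarrow> 0) at_top"
proof -
 have "((\<lambda>s. \<Sum>i\<le>degree p. coeff p i * (s ^ i / exp s)) \<longlongrightarrow> (\<Sum>i\<le>degree p. coeff p i * 0)) at_top"
  by (intro tendsto_intros tendsto_power_div_exp_0)
 then show ?thesis by (simp add: poly_altdef sum_distrib_right exp_minus divide_inverse mult.assoc)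
qed

lemma exp_inv_poly_deriv:
 "(exp_inv_poly p has_real_derivative exp_inv_poly ([:0,0,1:] * (p - pderiv p)) t) (at t)"
proof -
 consider "t < 0" | "t > 0" | "t = 0" by linarith
 then show ?thesis
 proof cases
  case 1
  have "(exp_inv_poly p has_real_derivative 0) (at t)" by (rule has_field_derivative_transform_within_open[of _ _ _ "{..<0}"]) (use 1 in \<open>auto simp: exp_inv_poly_def\<close>)
  then show ?thesis using 1 by (simp add: exp_inv_poly_def)
 next
  case 2
  have "((\<lambda>t. poly p (1/t) * exp (-(1/t))) has_real_derivative exp_inv_poly ([:0,0,1:] * (p - pderiv p)) t) (at t)"
   using 2 by (auto intro!: derivative_eq_intros DERIV_chain2[OF poly_DERIV] simp: exp_inv_poly_def field_simps)
  then show ?thesis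
   by (rule has_field_derivative_transform_within_open[of _ _ _ "{0<..}"]) (use 2 in \<open>auto simp: exp_inv_poly_def\<close>)
 next
  case 3
  \<comment> \<open>With s = 1/h the difference quotient at 0 is s p(s) exp(-s), whence the factor
    \<open>[:0,1:]\<close>; the exponential beats every polynomial.\<close>
  have r: "((\<lambda>h. exp_inv_poly p h / h) \<longlongrightarrow> 0) (at_right 0)"
  proof -
   have "((\<lambda>h. poly ([:0,1:] * p) (inverse h) * exp (-(inverse h))) \<longlongrightarrow> 0) (at_right 0)" using poly_times_exp_minus_tendsto_0 by (rule filterlim_compose) (rule filterlim_inverse_at_top_right)
   moreover have "eventually (\<lambda>h. poly ([:0,1:] * p) (inverse h) * exp (-(inverse h)) = exp_inv_poly p h / h) (at_right (0::real))"
    by (auto simp: eventually_at_filter exp_inv_poly_def field_simps)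
   ultimately show ?thesis by (rule Lim_transform_eventually)
  qed
  have l: "((\<lambda>h. exp_inv_poly p h / h) \<longlongrightarrow> 0) (at_left 0)"
   by (rule Lim_transform_eventually[OF tendsto_const]) (auto simp: eventually_at_filter exp_inv_poly_def)
  show ?thesis using filterlim_split_at[OF l r] 3 by (simp add: has_field_derivative_iff exp_inv_poly_def)
 qed
qed

primrec exp_inv_pow :: "nat => real poly" where
 "exp_inv_pow 0 = 1"
| "exp_inv_pow (Suc k) = [:0,0,1:] * (exp_inv_pow k - pderiv (exp_inv_pow k))"

text \<open>Besides being flat at 0 it rises to the limit 1 at infinity. Hence
  \<open>flat_exp (k * t)\<close> smoothly approximates the indicator of the positive half-line, and
  its derivative in t is a probability density there that concentrates at 0. This drives the
  divergence theorem.\<close>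

definition flat_exp :: "real => real" where
 "flat_exp t = (if t \<le> 0 then 0 else exp (-(1/t)))"

definition flat_exp_deriv :: "real => real" where
 "flat_exp_deriv t = (if t \<le> 0 then 0 else exp (-(1/t)) / t\<^sup>2)"

lemma flat_exp_eq: "flat_exp = exp_inv_poly (exp_inv_pow 0)" by (rule ext) (simp add: flat_exp_def exp_inv_poly_def)

lemma flat_exp_deriv_eq: "flat_exp_deriv = exp_inv_poly (exp_inv_pow (Suc 0))"
 by (rule ext) (simp add: flat_exp_deriv_def exp_inv_poly_def power2_eq_square)

lemma flat_exp_DERIV: "(flat_exp has_real_derivative flat_exp_deriv t) (at t)"
 unfolding flat_exp_eq flat_exp_deriv_eq exp_inv_pow.simps(2) by (rule exp_inv_poly_deriv)

lemma flat_exp_nonneg [simp]: "0 \<le> flat_exp t" by (simp add: flat_exp_def)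

lemma flat_exp_deriv_nonneg [simp]: "0 \<le> flat_exp_deriv t" by (simp add: flat_exp_deriv_def)

lemma flat_exp_le_1: "flat_exp t \<le> 1" by (simp add: flat_exp_def)

lemma flat_exp_pos_iff [simp]: "0 < flat_exp t \<longleftrightarrow> 0 < t" by (simp add: flat_exp_def)

lemma flat_exp_eq_0 [simp]: "t \<le> 0 ==> flat_exp t = 0" by (simp add: flat_exp_def)

lemma flat_exp_at_top: "(flat_exp \<longlongrightarrow> 1) at_top"
proof -
 have "((\<lambda>t::real. exp (-(1/t))) \<longlongrightarrow> exp (- 0)) at_top"
  by (intro tendsto_intros) (simp add: inverse_eq_divide[symmetric] tendsto_inverse_0_at_top filterlim_ident)
 moreover have "eventually (\<lambda>t. exp (-(1/t)) = flat_exp t) at_top"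
  using eventually_gt_at_top[of 0] by eventually_elim (simp add: flat_exp_def)
 ultimately show ?thesis by (simp add: Lim_transform_eventually)
qed

lemma smooth_flat_exp: "smooth q ==> smooth (\<lambda>x. flat_exp (q x))" unfolding flat_exp_eq
 by (rule smooth_compose_family[of "\<lambda>k. exp_inv_poly (exp_inv_pow k)"]) (simp_all only: exp_inv_pow.simps(2) exp_inv_poly_deriv)

lemma partial_flat_exp:
 assumes "smooth q" shows "partial i (\<lambda>x. flat_exp (q x)) x = flat_exp_deriv (q x) * partial i q x"
proof -
 have d: "((\<lambda>x. flat_exp (q x)) has_derivative (\<lambda>v. flat_exp_deriv (q x) * (\<Sum>i\<in>UNIV. v $ i *\<^sub>R partial i q x))) (at x)"
  using has_derivative_compose[OF smooth_has_derivative[OF assms, of x]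
    flat_exp_DERIV[of "q x", unfolded has_field_derivative_def]] by simp
 show ?thesis by (simp add: partial_eq[OF d] axis_def if_distrib[of "\<lambda>c. c * _"] cong: if_cong)
qed

text \<open>The squared distance is spelled out in coordinates so that smoothness follows from the
  rules for sums, products and components.\<close>

definition bump :: "real^'n => real => real^'n => real" where
 "bump a r x = flat_exp (r\<^sup>2 - (\<Sum>i\<in>UNIV. (x $ i - a $ i) * (x $ i - a $ i)))"

lemma bump_eq: "bump a r x = flat_exp (r\<^sup>2 - (dist a x)\<^sup>2)"
 by (simp add: bump_def dist_norm norm_minus_commute[of a] power2_norm_eq_inner inner_vec_def)

lemma smooth_bump: "smooth (bump a r)" unfolding bump_def[abs_def]
 by (intro smooth_flat_exp smooth_diff smooth_sum smooth_mult smooth_component smooth_const)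

lemma bump_nonneg [simp]: "0 \<le> bump a r x" by (simp add: bump_def)

lemma bump_pos_iff: "0 < r ==> 0 < bump a r x \<longleftrightarrow> dist a x < r"
 by (auto simp: bump_eq intro: power_strict_mono dest: power2_less_imp_less)

lemma bump_eq_0: "0 < r ==> r \<le> dist a x ==> bump a r x = 0" by (simp add: bump_eq power_mono)

section \<open>Test functions\<close>

lemma test_smooth: "Y \<in> test_functions U ==> smooth Y" by (simp add: test_functions_def)

lemma test_functionsI:
 "smooth Y ==> compact K ==> K \<subseteq> U ==> (\<And>x. x \<notin> K ==> Y x = 0) ==> Y \<in> test_functions U" by (auto simp: test_functions_def)

lemma test_functions_mono: "U \<subseteq> V ==> Y \<in> test_functions U ==> Y \<in> test_functions V" by (auto simp: test_functions_def)

lemma test_outside: "Y \<in> test_functions U ==> x \<notin> U ==> Y x = 0" by (auto simp: test_functions_def)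

lemma test_functions_zero [simp]: "(\<lambda>x. 0) \<in> test_functions U" by (auto simp: test_functions_def intro!: exI[of _ "{}"])

lemma test_functions_bump: "0 < r ==> cball a r \<subseteq> U ==> bump a r \<in> test_functions U"
 by (rule test_functionsI[OF smooth_bump compact_cball]) (auto intro: bump_eq_0)

lemma partial_outside:
 assumes "open V" "x \<in> V" "\<And>y. y \<in> V ==> Y y = 0" shows "partial i Y x = 0"
proof -
 have "((\<lambda>x. 0) has_derivative (\<lambda>h. 0)) (at x)" by simp
 then have "(Y has_derivative (\<lambda>h. 0)) (at x)"
  by (rule has_derivative_transform_within_open[OF _ assms(1,2)]) (use assms(3) in simp)
 from partial_eq[OF this] show ?thesis .
qed

lemma test_functions_partial:
 assumes "Y \<in> test_functions U" shows "partial i Y \<in> test_functions U"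
proof -
 obtain K where K: "compact K" "K \<subseteq> U" "\<And>x. x \<notin> K ==> Y x = 0" "smooth Y" using assms by (auto simp: test_functions_def)
 show ?thesis
 proof (rule test_functionsI[OF smooth_partial[OF K(4)] K(1,2)])
  fix x assume "x \<notin> K"
  then show "partial i Y x = 0" by (intro partial_outside[of "- K"]) (use K in \<open>auto simp: compact_imp_closed\<close>)
 qed
qed

lemma test_functions_bilinear:
 assumes h: "bounded_bilinear h" and "Y \<in> test_functions U" "smooth W" shows "(\<lambda>x. h (Y x) (W x)) \<in> test_functions U"
proof -
 obtain K where K: "compact K" "K \<subseteq> U" "\<And>x. x \<notin> K ==> Y x = 0" "smooth Y" using assms by (auto simp: test_functions_def)
 show ?thesis by (rule test_functionsI[OF smooth_bilinear[OF h K(4) assms(3)] K(1,2)])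
   (simp add: K bounded_bilinear.zero_left[OF h])
qed

lemma test_functions_linear:
 assumes h: "bounded_linear h" and "Y \<in> test_functions U" shows "(\<lambda>x. h (Y x)) \<in> test_functions U"
proof -
 obtain K where K: "compact K" "K \<subseteq> U" "\<And>x. x \<notin> K ==> Y x = 0" "smooth Y" using assms by (auto simp: test_functions_def)
 show ?thesis by (rule test_functionsI[OF smooth_linear[OF h K(4)] K(1,2)])
   (simp add: K linear_0[OF bounded_linear.linear[OF h]])
qed

lemma test_bounded:
 assumes "Y \<in> test_functions U"
 obtains B where "0 \<le> B" "\<And>x. norm (Y x) \<le> B"
proof -
 obtain K where K: "compact K" "K \<subseteq> U" "\<And>x. x \<notin> K ==> Y x = 0" "smooth Y" using assms by (auto simp: test_functions_def)
 have "compact (Y ` K)" using K by (intro compact_continuous_image smooth_continuous)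
 then obtain B where B: "\<And>y. y \<in> Y ` K ==> norm y \<le> B" by (meson bounded_iff compact_imp_bounded)
 show ?thesis
 proof (rule that[of "\<bar>B\<bar>"])
  fix x show "norm (Y x) \<le> \<bar>B\<bar>" using B[of "Y x"] K(3)[of x] by (cases "x \<in> K") auto
 qed simp
qed

lemma test_borel: "Y \<in> test_functions U ==> Y \<in> borel_measurable borel" by (intro smooth_borel test_smooth)

lemma integrable_bounded_support:
 fixes g :: "'a::euclidean_space => 'b::euclidean_space"
 assumes "g \<in> borel_measurable lborel" "bounded K" "\<And>x. x \<notin> K ==> g x = 0" "\<And>x. norm (g x) \<le> B" shows "integrable lborel g"
proof -
 obtain r where r: "K \<subseteq> cball 0 r" using bounded_subset_ballD[OF assms(2), of 0] ball_subset_cball by (metis order_trans)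
 show ?thesis
 proof (rule bochner_bound[OF _ assms(1)])
  show "integrable lborel (\<lambda>x. B * indicator (cball 0 r) x)" by (intro integrable_mult_right integrable_real_indicator)
    (use emeasure_bounded_finite[OF bounded_cball] in auto)
  show "AE x in lborel. norm (g x) \<le> norm (B * indicator (cball 0 r) x)"
  proof (rule AE_I2)
   fix x show "norm (g x) \<le> norm (B * indicator (cball 0 r) x)"
    using assms(3)[of x] assms(4)[of x] r order_trans[OF norm_ge_zero assms(4)[of x]] by (cases "x \<in> K") auto
  qed
 qed
qed

lemma test_integrable: "Y \<in> test_functions U ==> integrable lborel Y"
proof -
 assume a: "Y \<in> test_functions U"
 obtain K where K: "compact K" "K \<subseteq> U" "\<And>x. x \<notin> K ==> Y x = 0" "smooth Y" using a by (auto simp: test_functions_def)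
 obtain B where B: "\<And>x. norm (Y x) \<le> B" using test_bounded[OF a] by blast
 show ?thesis by (rule integrable_bounded_support[OF _ compact_imp_bounded[OF K(1)] K(3) B])
   (use test_borel[OF a] in auto)
qed

lemma sum_component_bound:
 assumes "(\<Sum>i\<in>UNIV. norm (c i)) \<le> B" shows "norm (\<Sum>i\<in>UNIV. h $ i *\<^sub>R c i) \<le> B * norm h"
proof -
 have "norm (\<Sum>i\<in>UNIV. h $ i *\<^sub>R c i) \<le> (\<Sum>i\<in>UNIV. \<bar>h $ i\<bar> * norm (c i))" by (rule order_trans[OF norm_sum]) simp
 also have "\<dots> \<le> (\<Sum>i\<in>UNIV. norm h * norm (c i))" by (intro sum_mono mult_right_mono component_le_norm_cart) simp
 also have "\<dots> \<le> B * norm h" using mult_left_mono[OF assms norm_ge_zero[of h]] by (simp add: sum_distrib_left mult.commute)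
 finally show ?thesis .
qed

lemma lipschitz_of_partial_bound:
 fixes f :: "real^'n => 'b::euclidean_space"
 assumes "smooth f" "convex S" "\<And>x i. x \<in> S ==> norm (partial i f x) \<le> B" and "x \<in> S" "y \<in> S"
 shows "norm (f x - f y) \<le> (real CARD('n) * B) * norm (x - y)"
proof (rule differentiable_bound[OF assms(2) _ _ assms(4,5)])
 fix x assume x: "x \<in> S"
 show "(f has_derivative (\<lambda>h. \<Sum>i\<in>UNIV. h $ i *\<^sub>R partial i f x)) (at x within S)"
  by (rule has_derivative_at_withinI[OF smooth_has_derivative[OF assms(1)]])
 have "(\<Sum>i\<in>UNIV. norm (partial i f x)) \<le> (\<Sum>i\<in>(UNIV::'n set). B)" by (intro sum_mono assms x)
 then have *: "(\<Sum>i\<in>UNIV. norm (partial i f x)) \<le> real CARD('n) * B" by simp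
 show "onorm (\<lambda>h. \<Sum>i\<in>UNIV. h $ i *\<^sub>R partial i f x) \<le> real CARD('n) * B" by (rule onorm_le) (rule sum_component_bound[OF *])
qed

lemma test_lipschitz:
 fixes Y :: "real^'n => 'b::euclidean_space"
 assumes "Y \<in> test_functions U"
 obtains L where "0 \<le> L" "\<And>x y. norm (Y x - Y y) \<le> L * norm (x - y)"
proof -
 have "\<exists>B. 0 \<le> B \<and> (\<forall>x. norm (partial i Y x) \<le> B)" for i using test_bounded[OF test_functions_partial[OF assms]] by metis
 then obtain B where B: "\<And>i. 0 \<le> B i" "\<And>i x. norm (partial i Y x) \<le> B i" by metis
 have "norm (partial i Y x) \<le> sum B UNIV" for i x using B member_le_sum[of i UNIV B] by (meson UNIV_I finite order_trans)
 then have "norm (Y x - Y y) \<le> (real CARD('n) * sum B UNIV) * norm (x - y)" for x y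
  by (intro lipschitz_of_partial_bound[OF test_smooth[OF assms] convex_UNIV]) auto
 then show ?thesis using B(1) by (intro that[of "real CARD('n) * sum B UNIV"]) (auto simp: sum_nonneg)
qed

text \<open>The remainder constant is uniform in the base point; this permits differentiation under
  an integral against a merely integrable density in
  \<open>smooth_param_integral_derivative\<close>.\<close>

lemma test_taylor:
 assumes "Y \<in> test_functions U"
 obtains C where "0 \<le> C"
  "\<And>p h. norm (Y (p + h) - Y p - (\<Sum>i\<in>UNIV. h $ i *\<^sub>R partial i Y p)) \<le> C * (norm h)\<^sup>2"
proof -
 have "\<exists>L. 0 \<le> L \<and> (\<forall>x y. norm (partial i Y x - partial i Y y) \<le> L * norm (x - y))" for i
  using test_lipschitz[OF test_functions_partial[OF assms]] by metis
 then obtain L where L: "\<And>i. 0 \<le> L i"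
   "\<And>i x y. norm (partial i Y x - partial i Y y) \<le> L i * norm (x - y)" by metis
 show ?thesis
 proof (rule that[of "sum L UNIV"])
  fix p h
  \<comment> \<open>\<open>g\<close> is \<open>Y\<close> minus its linear part at \<open>p\<close>.
    Its derivative is a difference of partial derivatives, of size at most a constant times
    \<open>norm h\<close> on the ball of that radius, so the mean value inequality yields the
    square.\<close>
  define g where "g q = Y q - (\<Sum>i\<in>UNIV. q $ i *\<^sub>R partial i Y p)" for q
  have d: "(g has_derivative (\<lambda>v. \<Sum>i\<in>UNIV. v $ i *\<^sub>R (partial i Y q - partial i Y p))) (at q within S)" for q S
  proof -
   have "(g has_derivative (\<lambda>v. (\<Sum>i\<in>UNIV. v $ i *\<^sub>R partial i Y q) - (\<Sum>i\<in>UNIV. v $ i *\<^sub>R partial i Y p))) (at q within S)"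
    unfolding g_def
    by (intro has_derivative_diff has_derivative_at_withinI[OF smooth_has_derivative[OF test_smooth[OF assms]]]
     has_derivative_sum has_derivative_scaleR_left bounded_linear_imp_has_derivative bounded_linear_vec_nth)
   then show ?thesis by (simp add: sum_subtractf algebra_simps)
  qed
  have "norm (g (p + h) - g p) \<le> (sum L UNIV * norm h) * norm ((p + h) - p)"
  proof (rule differentiable_bound[OF convex_cball[of p "norm h"] d])
   fix q assume q: "q \<in> cball p (norm h)"
   have "(\<Sum>i\<in>UNIV. norm (partial i Y q - partial i Y p)) \<le> (\<Sum>i\<in>UNIV. L i * norm h)"
   proof (rule sum_mono)
    fix i
    have "norm (partial i Y q - partial i Y p) \<le> L i * norm (q - p)" by (rule L)
    also have "\<dots> \<le> L i * norm h" using q by (intro mult_left_mono L) (simp add: dist_norm norm_minus_commute)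
    finally show "norm (partial i Y q - partial i Y p) \<le> L i * norm h" .
   qed
   then have *: "(\<Sum>i\<in>UNIV. norm (partial i Y q - partial i Y p)) \<le> sum L UNIV * norm h" by (simp add: sum_distrib_right)
   show "onorm (\<lambda>v. \<Sum>i\<in>UNIV. v $ i *\<^sub>R (partial i Y q - partial i Y p)) \<le> sum L UNIV * norm h"
    by (rule onorm_le) (rule sum_component_bound[OF *])
  qed (auto simp: dist_norm)
  moreover have "g (p + h) - g p = Y (p + h) - Y p - (\<Sum>i\<in>UNIV. h $ i *\<^sub>R partial i Y p)"
   by (simp add: g_def algebra_simps sum.distrib)
  ultimately show "norm (Y (p + h) - Y p - (\<Sum>i\<in>UNIV. h $ i *\<^sub>R partial i Y p)) \<le> sum L UNIV * (norm h)\<^sup>2"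
   by (simp add: power2_eq_square)
 qed (simp add: L sum_nonneg)
qed

section \<open>Affine substitutions and the integral of a derivative\<close>

lemma nn_integral_lborel_affine:
 fixes f :: "'a::euclidean_space => ennreal"
 assumes [measurable]: "f \<in> borel_measurable borel" and c: "c \<noteq> 0"
 shows "(\<integral>\<^sup>+x. f x \<partial>lborel) = ennreal (\<bar>c\<bar> ^ DIM('a)) * (\<integral>\<^sup>+x. f (t + c *\<^sub>R x) \<partial>lborel)"
proof -
 have "(\<integral>\<^sup>+x. f x \<partial>lborel) = (\<integral>\<^sup>+x. f x \<partial>density (distr lborel borel (\<lambda>x. t + c *\<^sub>R x)) (\<lambda>_. \<bar>c\<bar>^DIM('a)))"
  by (subst lborel_affine[OF c, of t]) simp
 also have "\<dots> = (\<integral>\<^sup>+x. ennreal (\<bar>c\<bar> ^ DIM('a)) * f (t + c *\<^sub>R x) \<partial>lborel)" by (simp add: nn_integral_density nn_integral_distr)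
 finally show ?thesis by (simp add: nn_integral_cmult)
qed

lemma integral_lborel_affine:
 fixes f :: "'a::euclidean_space => 'b::euclidean_space"
 assumes [measurable]: "f \<in> borel_measurable borel" and c: "c \<noteq> 0"
 shows "(LINT x|lborel. f x) = (\<bar>c\<bar> ^ DIM('a)) *\<^sub>R (LINT x|lborel. f (t + c *\<^sub>R x))"
proof -
 have "(LINT x|lborel. f x) = (LINT x|density (distr lborel borel (\<lambda>x. t + c *\<^sub>R x)) (\<lambda>_. \<bar>c\<bar>^DIM('a)). f x)"
  by (subst lborel_affine[OF c, of t]) simp
 also have "\<dots> = (LINT x|lborel. (\<bar>c\<bar> ^ DIM('a)) *\<^sub>R f (t + c *\<^sub>R x))" by (simp add: integral_density integral_distr)
 finally show ?thesis by simp
qed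

lemma integrable_lborel_affine:
 fixes f :: "'a::euclidean_space => 'b::euclidean_space"
 assumes f: "integrable lborel f" and c: "c \<noteq> 0" shows "integrable lborel (\<lambda>x. f (t + c *\<^sub>R x))"
proof (rule integrableI_bounded)
 have [measurable]: "f \<in> borel_measurable borel" using borel_measurable_integrable[OF f] by simp
 show "(\<lambda>x. f (t + c *\<^sub>R x)) \<in> borel_measurable lborel" by simp
 have "(\<integral>\<^sup>+x. ennreal (norm (f x)) \<partial>lborel) < \<infinity>" using f by (simp add: integrable_iff_bounded)
 then have "ennreal (\<bar>c\<bar> ^ DIM('a)) * (\<integral>\<^sup>+x. ennreal (norm (f (t + c *\<^sub>R x))) \<partial>lborel) < \<infinity>"
  by (subst (asm) nn_integral_lborel_affine[OF _ c, of _ t]) auto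
 then show "(\<integral>\<^sup>+x. ennreal (norm (f (t + c *\<^sub>R x))) \<partial>lborel) < \<infinity>" using c by (auto simp: ennreal_mult_less_top)
qed

lemma sum_axis_scaleR:
 fixes X :: "'n::finite => 'b::real_vector" shows "(\<Sum>j\<in>UNIV. axis i (1::real) $ j *\<^sub>R X j) = X i"
proof -
 have "(\<Sum>j\<in>UNIV. axis i (1::real) $ j *\<^sub>R X j) = (\<Sum>j\<in>UNIV. if j = i then X j else 0)" by (rule sum.cong) (auto simp: axis_def)
 then show ?thesis by simp
qed

lemma smooth_increment:
 fixes f :: "real^'n => 'b::euclidean_space"
 assumes f: "smooth f"
 shows "(LINT t|lborel. indicator {0..1} t *\<^sub>R (\<Sum>i\<in>UNIV. h $ i *\<^sub>R partial i f (x + t *\<^sub>R h))) = f (x + h) - f x"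
proof -
 let ?F = "\<lambda>t. \<Sum>i\<in>UNIV. h $ i *\<^sub>R partial i f (x + t *\<^sub>R h)"
 have "continuous_on {0..1} ?F"
  by (intro continuous_intros continuous_on_compose2[OF smooth_continuous[OF smooth_partial[OF f], of UNIV]]) auto
 moreover have "((\<lambda>t. f (x + t *\<^sub>R h)) has_vector_derivative ?F t) (at t within {0..1})" for t :: real
 proof -
  have "((\<lambda>t. f (x + t *\<^sub>R h)) has_derivative (\<lambda>d. \<Sum>i\<in>UNIV. (d *\<^sub>R h) $ i *\<^sub>R partial i f (x + t *\<^sub>R h))) (at t)"
   by (rule has_derivative_compose[OF _ smooth_has_derivative[OF f]]) (auto intro!: derivative_eq_intros)
  then show ?thesis by (simp add: has_vector_derivative_def has_derivative_at_withinI scaleR_right.sum)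
 qed
 ultimately show ?thesis using integral_FTC_Icc[of 0 1 "\<lambda>t. f (x + t *\<^sub>R h)" ?F] by simp
qed

text \<open>Integrate the increment of \<open>Y\<close> over a unit step in direction i: by
  translation invariance the result is 0, and by Fubini it is the average over t in the unit
  interval of integrals of translates of \<open>partial i Y\<close>, which are all equal.\<close>

lemma integral_partial_test:
 fixes Y :: "real^'n => 'b::euclidean_space"
 assumes Y: "Y \<in> test_functions U" shows "(LINT x|lborel. partial i Y x) = 0"
proof -
 let ?e = "axis i 1 :: real^'n"
 define F where "F t x = indicator {0..1} t *\<^sub>R partial i Y (x + t *\<^sub>R ?e)" for t :: real and x
 note P = test_integrable[OF test_functions_partial[OF Y, of i]]
 note [measurable] = test_borel[OF test_functions_partial[OF Y]]
 have shift: "integrable lborel g ==> integrable lborel (\<lambda>x. g (x + v)) \<and> (LINT x|lborel. g (x + v)) = (LINT x|lborel. g x)"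
  for g :: "real^'n => 'c::euclidean_space" and v
  using integrable_lborel_affine[of g 1 v] integral_lborel_affine[of g 1 v] by (simp add: add.commute)
 have "integrable (lborel \<Otimes>\<^sub>M lborel) (case_prod F)"
 proof (rule lborel_pair.Fubini_integrable)
  show "case_prod F \<in> borel_measurable (lborel \<Otimes>\<^sub>M lborel)" unfolding F_def[abs_def] by measurable
  show "integrable lborel (\<lambda>t. LINT x|lborel. norm (case_prod F (t, x)))" using shift[OF integrable_norm[OF P]] by (simp add: F_def)
  show "AE t in lborel. integrable lborel (\<lambda>x. case_prod F (t, x))" using shift[OF P] by (simp add: F_def)
 qed
 then have "(LINT x|lborel. LINT t|lborel. F t x) = (LINT t|lborel. LINT x|lborel. F t x)" by (rule lborel_pair.Fubini_integral)
 also have "\<dots> = (LINT x|lborel. partial i Y x)" using shift[OF P] by (simp add: F_def)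
 also have "(\<lambda>x. LINT t|lborel. F t x) = (\<lambda>x. Y (x + ?e) - Y x)"
  using smooth_increment[OF test_smooth[OF Y], of ?e] by (simp add: F_def sum_axis_scaleR)
 finally show ?thesis using shift[OF test_integrable[OF Y], of ?e] test_integrable[OF Y] by simp
qed

section \<open>Weak derivatives\<close>

lemma compact_lebesgue: "compact K ==> K \<in> sets lebesgue" for K :: "'a::euclidean_space set"
 by (auto intro: lmeasurable_compact fmeasurableD)

lemma LINT_lebesgue_on:
 fixes g :: "'a::euclidean_space => 'b::euclidean_space"
 assumes "U \<in> sets lebesgue" "\<And>x. x \<notin> U ==> g x = 0" shows "(LINT x|leb U. g x) = (LINT x|lebesgue. g x)"
proof -
 have "(LINT x|leb U. g x) = (LINT x|lebesgue. indicator U x *\<^sub>R g x)" using assms by (intro integral_restrict_space) auto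
 also have "(\<lambda>x. indicator U x *\<^sub>R g x) = g" using assms(2) by (auto simp: indicator_def)
 finally show ?thesis .
qed

lemma LINT_lebesgue_on_borel:
 fixes g :: "'a::euclidean_space => 'b::euclidean_space"
 assumes "U \<in> sets lebesgue" "\<And>x. x \<notin> U ==> g x = 0" "g \<in> borel_measurable borel"
 shows "(LINT x|leb U. g x) = (LINT x|lborel. g x)"
 using LINT_lebesgue_on[OF assms(1,2)] integral_completion[of g lborel] assms(3) by simp

lemma integrable_lebesgue_on:
 fixes g :: "'a::euclidean_space => 'b::euclidean_space"
 assumes "U \<in> sets lebesgue" shows "integrable (leb U) g \<longleftrightarrow> integrable lebesgue (\<lambda>x. indicator U x *\<^sub>R g x)"
 using assms by (intro integrable_restrict_space) auto

text \<open>Fubini and substitutions are applied to Borel functions under \<open>lborel\<close>,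
  while the function spaces rest on Lebesgue measurability. Representatives of this kind bridge the
  two; vector values go by coordinates.\<close>

lemma borel_representative:
 fixes u :: "'a => 'b::euclidean_space"
 assumes "u \<in> borel_measurable (completion M)"
 obtains u' where "u' \<in> borel_measurable M" "AE x in completion M. u x = u' x"
proof -
 have "\<exists>g'\<in>borel_measurable M. AE x in M. u x \<bullet> b = g' x" for b
  by (intro completion_ex_borel_measurable_real borel_measurable_inner assms borel_measurable_const)
 then obtain g where g: "\<And>b. g b \<in> borel_measurable M" "\<And>b. AE x in M. u x \<bullet> b = g b x" by metis
 note [measurable] = g
 show ?thesis
 proof (rule that[of "\<lambda>x. \<Sum>b\<in>Basis. g b x *\<^sub>R b"])
  show "(\<lambda>x. \<Sum>b\<in>Basis. g b x *\<^sub>R b) \<in> borel_measurable M" by simp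
  have "AE x in M. \<forall>b\<in>Basis. u x \<bullet> b = g b x" using g by (intro AE_finite_allI) auto
  then have "AE x in M. u x = (\<Sum>b\<in>Basis. g b x *\<^sub>R b)"
  proof eventually_elim
   case (elim x)
   then have "(\<Sum>b\<in>Basis. g b x *\<^sub>R b) = (\<Sum>b\<in>Basis. (u x \<bullet> b) *\<^sub>R b)" by simp
   then show ?case by (simp add: euclidean_representation)
  qed
  then show "AE x in completion M. u x = (\<Sum>b\<in>Basis. g b x *\<^sub>R b)" by (rule AE_completion)
 qed
qed

lemma flat_exp_box_tendsto:
 fixes a b x :: "real^'n" shows "(\<lambda>m. \<Prod>i\<in>UNIV. flat_exp (real m * (x $ i - a $ i)) * flat_exp (real m * (b $ i - x $ i)))
   \<longlonglongrightarrow> indicator (box a b) x"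
proof -
 have one: "(\<lambda>m. flat_exp (real m * t)) \<longlonglongrightarrow> 1" if "0 < t" for t using filterlim_compose[OF flat_exp_at_top
    filterlim_tendsto_pos_mult_at_top[OF tendsto_const that filterlim_real_sequentially]] by (simp add: mult.commute)
 have zero: "flat_exp (real m * t) = 0" if "t \<le> 0" for t m using that by (intro flat_exp_eq_0) (simp add: mult_nonneg_nonpos)
 show ?thesis
 proof (cases "x \<in> box a b")
  case True
  then have "(\<lambda>m. \<Prod>i\<in>UNIV. flat_exp (real m * (x $ i - a $ i)) * flat_exp (real m * (b $ i - x $ i)))
    \<longlonglongrightarrow> (\<Prod>i\<in>(UNIV::'n set). 1 * 1)" by (intro tendsto_intros one) (auto simp: mem_box_cart)
  then show ?thesis using True by simp
 next
  case False
  then obtain i where i: "x $ i - a $ i \<le> 0 \<or> b $ i - x $ i \<le> 0" by (auto simp: mem_box_cart not_less)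
  have z: "flat_exp (real m * (x $ i - a $ i)) * flat_exp (real m * (b $ i - x $ i)) = 0" for m
   using i zero by (metis mult_eq_0_iff)
  have "(\<Prod>i\<in>UNIV. flat_exp (real m * (x $ i - a $ i)) * flat_exp (real m * (b $ i - x $ i))) = 0" for m
   by (rule prod_zero[OF finite]) (use z in blast)
  moreover have "indicator (box a b) x = (0::real)" using False by simp
  ultimately show ?thesis by (simp only: tendsto_const)
 qed
qed

lemma smooth_prod: "(\<And>i. i \<in> I ==> smooth (f i)) ==> smooth (\<lambda>x. \<Prod>i\<in>I. f i x :: real)"
 by (induction I rule: infinite_finite_induct) (auto intro: smooth_mult)

text \<open>Open boxes form an intersection-stable generator of the Borel sets, so that vanishing
  integrals propagate from boxes to all Borel sets.\<close>

lemma AE_zero_of_integral_boxes: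
 fixes k :: "'a::euclidean_space => 'b::euclidean_space"
 assumes k: "integrable lborel k" and 0: "\<And>a b. (LINT x|lborel. indicator (box a b) x *\<^sub>R k x) = 0"
  and supp: "\<And>x. x \<notin> box c d ==> k x = 0" shows "AE x in lborel. k x = 0"
proof (rule sigma_finite_measure.density_zero[OF sigma_finite_lborel k])
 fix A :: "'a set" assume "A \<in> sets lborel"
 then have A: "A \<in> sigma_sets UNIV (range (\<lambda>(a, b). box a b :: 'a set))" by (simp add: borel_eq_box)
 have Int: "Int_stable (range (\<lambda>(a, b). box a b :: 'a set))" by (auto simp: Int_stable_def box_Int_box)
 have P: "range (\<lambda>(a, b). box a b :: 'a set) \<subseteq> Pow UNIV" by simp
 show "set_lebesgue_integral lborel A k = 0" using A
 proof (induction rule: sigma_sets_induct_disjoint[OF Int P, consumes 1, case_names basic empty compl union])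
  case (basic A)
  then show ?case using 0 by (auto simp: set_lebesgue_integral_def)
 next
  case empty
  then show ?case by (simp add: set_lebesgue_integral_def)
 next
  case (compl A)
  have A: "A \<in> sets lborel" using compl(1) by (simp add: borel_eq_box)
  \<comment> \<open>Complements need the integral over the whole space, which the support condition
    turns into an integral over a single box.\<close>
  have "(\<lambda>x. indicator (box c d) x *\<^sub>R k x) = k" using supp by (auto simp: indicator_def)
  then have "(LINT x|lborel. k x) = 0" using 0[of c d] by simp
  moreover have "indicator (UNIV - A) x *\<^sub>R k x = k x - indicator A x *\<^sub>R k x" for x by (auto simp: indicator_def)
  ultimately show ?case using compl(2) k integrable_mult_indicator[OF A k] by (simp add: set_lebesgue_integral_def)
 next
  case (union A)
  have A: "A i \<in> sets lborel" for i using union(2) by (auto simp: borel_eq_box)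
  have "set_integrable lborel (\<Union>i. A i) k" unfolding set_integrable_def using A by (intro integrable_mult_indicator k) auto
  then have "(LINT x:(\<Union>i. A i)|lborel. k x) = (\<Sum>i. (LINT x:(A i)|lborel. k x))"
   using A union(1) by (intro lebesgue_integral_countable_add) (auto simp: disjoint_family_on_def)
  then show ?case using union(3) by simp
 qed
qed

text \<open>Products of \<open>flat_exp\<close> over the sides of a box are smooth, bounded by 1,
  vanish outside the box and tend to its indicator; dominated convergence thus turns smooth tests
  into tests with boxes.\<close>

lemma AE_zero_of_smooth:
 fixes k :: "real^'n => 'b::euclidean_space"
 assumes k: "integrable lborel k" "\<And>x. x \<notin> box a b ==> k x = 0"
  and 0: "\<And>Y. smooth Y ==> (\<And>x. x \<notin> box a b ==> Y x = 0) ==> (LINT x|lborel. (Y x :: real) *\<^sub>R k x) = 0"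
 shows "AE x in lborel. k x = 0"
proof (rule AE_zero_of_integral_boxes[OF k(1) _ k(2)])
 fix c d :: "real^'n"
 \<comment> \<open>Only weights vanishing outside \<open>box a b\<close> are admissible, so the
   given box is first cut down to its intersection with that one.\<close>
 obtain a' b' where ab: "box c d \<inter> box a b = box a' b'" using box_Int_box[of c d a b] by blast
 define w where "w m x = (\<Prod>i\<in>UNIV. flat_exp (real m * (x $ i - a' $ i)) * flat_exp (real m * (b' $ i - x $ i)))" for m x
 have "smooth (w m)" for m unfolding w_def[abs_def]
  by (intro smooth_prod smooth_mult smooth_flat_exp smooth_diff smooth_const smooth_component)
 note s = this smooth_borel[OF this, measurable]
 have out: "w m x = 0" if x: "x \<notin> box a' b'" for m x
 proof -
  obtain i where "x $ i - a' $ i \<le> 0 \<or> b' $ i - x $ i \<le> 0" using x by (auto simp: mem_box_cart not_less)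
  then show ?thesis unfolding w_def by (intro prod_zero[OF finite] bexI[of _ i]) (auto intro!: simp: mult_nonneg_nonpos)
 qed
 have bound: "0 \<le> w m x" "w m x \<le> 1" for m x unfolding w_def by (auto intro!: prod_nonneg prod_le_1 mult_le_one flat_exp_le_1)
 have "(\<lambda>m. LINT x|lborel. w m x *\<^sub>R k x) \<longlonglongrightarrow> (LINT x|lborel. indicator (box a' b') x *\<^sub>R k x)"
 proof (rule integral_dominated_convergence[OF _ _ integrable_norm[OF k(1)]])
  show "AE x in lborel. (\<lambda>m. w m x *\<^sub>R k x) \<longlonglongrightarrow> indicator (box a' b') x *\<^sub>R k x"
   unfolding w_def by (intro AE_I2 tendsto_scaleR tendsto_const flat_exp_box_tendsto)
  show "AE x in lborel. norm (w m x *\<^sub>R k x) \<le> norm (k x)" for m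
   using bound[of m] by (intro AE_I2) (simp add: mult_left_le_one_le)
 qed (use k(1) in measurable)
 moreover have "(LINT x|lborel. w m x *\<^sub>R k x) = 0" for m using ab out by (intro 0 s) blast
 moreover have "(\<lambda>x. indicator (box c d) x *\<^sub>R k x) = (\<lambda>x. indicator (box a' b') x *\<^sub>R k x)"
  unfolding ab[symmetric] using k(2) by (auto simp: indicator_def)
 ultimately show "(LINT x|lborel. indicator (box c d) x *\<^sub>R k x) = 0" by (simp only: LIMSEQ_const_iff)
qed

text \<open>\<open>h\<close> is integrable only on compact subsets, so the argument runs on closed
  boxes inside \<open>U\<close>, countably many of which cover \<open>U\<close>. On each of them
  \<open>h\<close> is replaced by a Borel function supported in the open box; the discarded boundary
  is a null set.\<close>

lemma fundamental_lemma:
 fixes h :: "real^'n => 'b::euclidean_space"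
 assumes U: "open U" and h: "locally_integrable U h"
  and 0: "\<And>Y. Y \<in> test_functions U ==> (LINT x|leb U. (Y x :: real) *\<^sub>R h x) = 0" shows "AE x in leb U. h x = 0"
proof -
 have box: "AE x in lebesgue. x \<in> cbox a b \<longrightarrow> h x = 0" if ab: "cbox a b \<subseteq> U" for a b
 proof -
  have "set_integrable lebesgue (cbox a b) h"
   using h ab unfolding locally_integrable_def set_integrable_def by (subst integrable_lebesgue_on[symmetric]) auto
  then have int: "integrable lebesgue (\<lambda>x. indicator (box a b) x *\<^sub>R h x)"
   unfolding set_integrable_def[symmetric] by (rule set_integrable_subset) (auto simp: box_subset_cbox)
  obtain k where k: "k \<in> borel_measurable lborel" "AE x in lebesgue. indicator (box a b) x *\<^sub>R h x = k x"
   using borel_representative[OF borel_measurable_integrable[OF int]] by blast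
  define k' where "k' x = indicator (box a b) x *\<^sub>R k x" for x
  have [measurable]: "k \<in> borel_measurable borel" using k(1) by simp
  have k'm [measurable]: "k' \<in> borel_measurable borel" unfolding k'_def by measurable
  have leb: "f \<in> borel_measurable borel ==> f \<in> borel_measurable lebesgue" for f :: "real^'n => 'c::euclidean_space"
   by (intro measurable_completion) simp
  have ae: "AE x in lebesgue. k' x = indicator (box a b) x *\<^sub>R h x" using k(2) by (auto simp: k'_def indicator_def)
  have "integrable lebesgue k'" by (rule integrable_cong_AE_imp[OF int leb[OF k'm]]) (use ae in \<open>auto simp: eq_commute\<close>)
  then have int': "integrable lborel k'" by (simp add: integrable_completion)
  have "AE x in lborel. k' x = 0"
  proof (rule AE_zero_of_smooth[OF int'])
   fix Y :: "real^'n => real" assume Y: "smooth Y" "\<And>x. x \<notin> box a b ==> Y x = 0"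
   have t: "Y \<in> test_functions U" using Y(2) box_subset_cbox by (intro test_functionsI[OF Y(1) compact_cbox ab]) blast
   note [measurable] = smooth_borel[OF Y(1)]
   have "(LINT x|lborel. Y x *\<^sub>R k' x) = (LINT x|lebesgue. Y x *\<^sub>R k' x)" by (rule integral_completion[symmetric]) measurable
   also have "\<dots> = (LINT x|lebesgue. Y x *\<^sub>R (indicator (box a b) x *\<^sub>R h x))"
    using ae by (intro integral_cong_AE borel_measurable_scaleR borel_measurable_integrable[OF int] leb) auto
   also have "(\<lambda>x. Y x *\<^sub>R (indicator (box a b) x *\<^sub>R h x)) = (\<lambda>x. Y x *\<^sub>R h x)"
    using Y(2) by (intro ext) (auto simp: indicator_def)
   also have "(LINT x|lebesgue. Y x *\<^sub>R h x) = (LINT x|leb U. Y x *\<^sub>R h x)"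
    using U test_outside[OF t] by (intro LINT_lebesgue_on[symmetric]) auto
   finally show "(LINT x|lborel. Y x *\<^sub>R k' x) = 0" using 0[OF t] by simp
  qed (simp add: k'_def)
  then have "AE x in lebesgue. k' x = 0" by (rule AE_completion)
  moreover have "AE x in lebesgue. x \<notin> cbox a b - box a b" using negligible_frontier_interval[of a b]
   by (intro AE_not_in) (simp add: negligible_iff_null_sets)
  ultimately show ?thesis using ae by (auto simp: split:)
 qed
 obtain B where D: "countable B" "B \<subseteq> Pow U" "\<And>X. X \<in> B ==> \<exists>a b. X = cbox a b" "\<Union>B = U"
  using open_countable_Union_open_cbox[OF U] by metis
 have "AE x in lebesgue. \<forall>X\<in>B. x \<in> X \<longrightarrow> h x = 0" using D(2,3) box by (intro AE_ball_countable'[OF _ D(1)]) (metis PowD subsetD)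
 then have "AE x in lebesgue. x \<in> U \<longrightarrow> h x = 0" by eventually_elim (use D(4) in auto)
 then show ?thesis using U by (subst AE_restrict_space_iff) auto
qed

lemma test_mult_integrable:
 assumes U: "open U" and g: "locally_integrable U g" and Y: "Y \<in> test_functions U" shows "integrable (leb U) (\<lambda>x. Y x *\<^sub>R g x)"
proof -
 obtain K where K: "compact K" "K \<subseteq> U" "\<And>x. x \<notin> K ==> Y x = 0" "smooth Y" using Y by (auto simp: test_functions_def)
 obtain B where B: "\<And>x. norm (Y x) \<le> B" using test_bounded[OF Y] by blast
 have i: "integrable lebesgue (\<lambda>x. indicator K x *\<^sub>R g x)"
  using g K by (subst integrable_lebesgue_on[symmetric]) (auto simp: locally_integrable_def compact_lebesgue)
 note [measurable] = borel_measurable_integrable[OF i]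
 have [measurable]: "Y \<in> borel_measurable lebesgue" using test_borel[OF Y] by (intro measurable_completion) simp
 have "integrable lebesgue (\<lambda>x. Y x *\<^sub>R (indicator K x *\<^sub>R g x))"
 proof (rule bochner_bound)
  show "integrable lebesgue (\<lambda>x. B * norm (indicator K x *\<^sub>R g x))" using i by (intro integrable_mult_right integrable_norm)
  show "AE x in lebesgue. norm (Y x *\<^sub>R (indicator K x *\<^sub>R g x)) \<le> norm (B * norm (indicator K x *\<^sub>R g x))"
  proof (rule AE_I2)
   fix x
   have "norm (Y x *\<^sub>R (indicator K x *\<^sub>R g x)) \<le> B * norm (indicator K x *\<^sub>R g x)"
    unfolding norm_scaleR[of "Y x"] using B[of x] by (intro mult_right_mono) auto
   then show "norm (Y x *\<^sub>R (indicator K x *\<^sub>R g x)) \<le> norm (B * norm (indicator K x *\<^sub>R g x))" by simp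
  qed
 qed measurable
 also have "(\<lambda>x. Y x *\<^sub>R (indicator K x *\<^sub>R g x)) = (\<lambda>x. indicator U x *\<^sub>R (Y x *\<^sub>R g x))"
  using K by (auto simp: indicator_def fun_eq_iff)
 finally show ?thesis using U by (subst integrable_lebesgue_on) auto
qed

lemma locally_integrable_add:
 "locally_integrable U f ==> locally_integrable U g ==> locally_integrable U (\<lambda>x. f x + g x)"
 by (auto simp: locally_integrable_def)

lemma locally_integrable_diff:
 "locally_integrable U f ==> locally_integrable U g ==> locally_integrable U (\<lambda>x. f x - g x)"
 by (auto simp: locally_integrable_def)

lemma locally_integrable_linear:
 "bounded_linear h ==> locally_integrable U f ==> locally_integrable U (\<lambda>x. h (f x))"
 by (auto simp: locally_integrable_def intro: integrable_bounded_linear)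

lemma locally_integrable_subset:
 "V \<subseteq> U ==> locally_integrable U f ==> locally_integrable V f" by (auto simp: locally_integrable_def)

lemma locally_integrable_zero [simp]: "locally_integrable U (\<lambda>x. 0)" by (auto simp: locally_integrable_def)

lemma lebesgue_on_subset_measurable:
 "u \<in> borel_measurable (leb U) ==> V \<subseteq> U ==> u \<in> borel_measurable (leb V)" using measurable_restrict_mono by blast

lemma AE_lebesgue_on_subset:
 assumes "AE x in leb U. P x" "V \<subseteq> U" "U \<in> sets lebesgue" "V \<in> sets lebesgue" shows "AE x in leb V. P x"
 using assms by (subst AE_restrict_space_iff, simp, subst (asm) AE_restrict_space_iff, simp) auto

lemma locally_integrable_cong_AE:
 assumes "locally_integrable U f" "g \<in> borel_measurable (leb U)" "U \<in> sets lebesgue"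
  "AE x in leb U. f x = g x" shows "locally_integrable U g" unfolding locally_integrable_def
proof (intro allI impI, elim conjE)
 fix K assume K: "compact K" "K \<subseteq> U"
 have "AE x in leb K. f x = g x"
  by (rule AE_lebesgue_on_subset[OF assms(4) K(2) assms(3)]) (use K in \<open>auto intro: lmeasurable_compact fmeasurableD\<close>)
 then show "integrable (leb K) g" using assms(1) K lebesgue_on_subset_measurable[OF assms(2) K(2)]
  by (intro integrable_cong_AE_imp[of "leb K" f g]) (auto simp: locally_integrable_def)
qed

lemma finite_measure_lebesgue_on_bounded:
 "U \<in> sets lebesgue ==> bounded U ==> finite_measure (leb U)"
 using bounded_set_imp_lmeasurable by (intro finite_measure_lebesgue_on) auto

lemma integrable_of_Lebesgue2:
 assumes "finite_measure M" "u \<in> Lebesgue2 M" shows "integrable M u"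
proof -
 have "(\<lambda>x. 1::real) \<in> Lebesgue2 M" using finite_measure.integrable_const[OF assms(1), of "1::real"] by (simp add: Lebesgue2_def)
 from L2_pairing_integrable[OF bounded_bilinear_scaleR this assms(2)] show ?thesis by simp
qed

lemma L2_restrict:
 assumes "u \<in> L2 U" "V \<subseteq> U" "U \<in> sets lebesgue" "V \<in> sets lebesgue" shows "u \<in> L2 V" unfolding L2_def
proof (rule Lebesgue2I)
 show "u \<in> borel_measurable (leb V)"
  using assms by (auto simp: L2_def Lebesgue2_def intro: lebesgue_on_subset_measurable[of u U])
 have "integrable lebesgue (\<lambda>x. indicator U x *\<^sub>R (norm (u x))\<^sup>2)"
  using assms by (subst integrable_lebesgue_on[symmetric]) (auto simp: L2_def Lebesgue2_def)
 from integrable_mult_indicator[OF _ this, of V]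
 have "integrable lebesgue (\<lambda>x. indicator V x *\<^sub>R indicator U x *\<^sub>R (norm (u x))\<^sup>2)" using assms by simp
 also have "(\<lambda>x. indicator V x *\<^sub>R indicator U x *\<^sub>R (norm (u x))\<^sup>2) = (\<lambda>x. indicator V x *\<^sub>R (norm (u x))\<^sup>2)"
  using assms(2) by (auto simp: indicator_def fun_eq_iff)
 finally show "integrable (leb V) (\<lambda>x. (norm (u x))\<^sup>2)" using assms by (subst integrable_lebesgue_on) auto
qed

lemma locally_integrable_L2:
 assumes "u \<in> L2 U" "U \<in> sets lebesgue" shows "locally_integrable U u" unfolding locally_integrable_def
proof (intro allI impI, elim conjE)
 fix K assume K: "compact K" "K \<subseteq> U"
 then have "K \<in> sets lebesgue" by (auto intro: lmeasurable_compact fmeasurableD)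
 then show "integrable (leb K) u"
  using L2_restrict[OF assms(1) K(2) assms(2)] finite_measure_lebesgue_on_bounded[OF _ compact_imp_bounded[OF K(1)]]
  by (intro integrable_of_Lebesgue2) (auto simp: L2_def)
qed

text \<open>A weak partial derivative is the weak divergence of a family with one nonzero member.\<close>

definition weak_div ::
 "(real^'n) set => ('n => real^'n => 'b::euclidean_space) => (real^'n => 'b) => bool" where
 "weak_div U u D \<longleftrightarrow> (\<forall>j. locally_integrable U (u j)) \<and> locally_integrable U D \<and>
   (\<forall>Y\<in>test_functions U. (\<Sum>j\<in>UNIV. LINT x|leb U. (partial j Y x :: real) *\<^sub>R u j x) = - (LINT x|leb U. Y x *\<^sub>R D x))"

lemma weak_div_of_partial:
 assumes "is_weak_partial U i u g" shows "weak_div U (\<lambda>j. if j = i then u else (\<lambda>x. 0)) g"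
proof -
 have "(\<Sum>j\<in>UNIV. LINT x|leb U. (partial j Y x :: real) *\<^sub>R (if j = i then u else (\<lambda>x. 0)) x)
   = (\<Sum>j\<in>UNIV. if j = i then LINT x|leb U. (partial i Y x :: real) *\<^sub>R u x else 0)" for Y by (intro sum.cong) auto
 then show ?thesis using assms by (auto simp: weak_div_def is_weak_partial_def)
qed

lemma weak_div_of_partials:
 fixes U :: "(real^'n) set" and u g :: "'n => real^'n => 'b::euclidean_space"
 assumes "\<And>j. is_weak_partial U j (u j) (g j)" "open U" shows "weak_div U u (\<lambda>x. \<Sum>j\<in>UNIV. g j x)"
proof -
 have "locally_integrable U (\<lambda>x. \<Sum>j\<in>J. g j x)" for J :: "'n set" using assms by (induction J rule: infinite_finite_induct)
   (auto simp: is_weak_partial_def intro: locally_integrable_add)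
 moreover have "(\<Sum>j\<in>UNIV. LINT x|leb U. (partial j Y x :: real) *\<^sub>R u j x)
    = - (LINT x|leb U. Y x *\<^sub>R (\<Sum>j\<in>UNIV. g j x))" if "Y \<in> test_functions U" for Y
 proof -
  have "(LINT x|leb U. Y x *\<^sub>R (\<Sum>j\<in>UNIV. g j x)) = (\<Sum>j\<in>UNIV. LINT x|leb U. Y x *\<^sub>R g j x)" unfolding scaleR_sum_right
   by (rule bochner_int_sum)
    (use assms that in \<open>auto simp: is_weak_partial_def intro!: test_mult_integrable\<close>)
  then show ?thesis using assms that by (simp add: is_weak_partial_def sum_negf)
 qed
 ultimately show ?thesis using assms by (auto simp: weak_div_def is_weak_partial_def)
qed

lemma weak_div_unique:
 assumes U: "open U" and "weak_div U u D" "weak_div U u D'" shows "AE x in leb U. D x = D' x"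
proof -
 have l: "locally_integrable U D" "locally_integrable U D'" using assms by (auto simp: weak_div_def)
 have "AE x in leb U. D x - D' x = 0"
 proof (rule fundamental_lemma[OF U locally_integrable_diff[OF l]])
  fix Y :: "real^'a => real" assume t: "Y \<in> test_functions U"
  show "(LINT x|leb U. Y x *\<^sub>R (D x - D' x)) = 0"
   using assms(2,3) t test_mult_integrable[OF U l(1) t] test_mult_integrable[OF U l(2) t]
   by (simp add: weak_div_def scaleR_diff_right)
 qed
 then show ?thesis by simp
qed

lemma is_weak_partial_unique:
 "open U ==> is_weak_partial U i u g ==> is_weak_partial U i u g' ==> AE x in leb U. g x = g' x"
 by (rule weak_div_unique[OF _ weak_div_of_partial weak_div_of_partial])

lemma is_weak_partial_weak_partial:
 "is_weak_partial U i u g ==> is_weak_partial U i u (weak_partial U i u)"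
 unfolding weak_partial_def by (rule someI[of "is_weak_partial U i u"])

lemma weak_partial_AE:
 "open U ==> is_weak_partial U i u g ==> AE x in leb U. weak_partial U i u x = g x"
 by (rule is_weak_partial_unique[OF _ is_weak_partial_weak_partial])

lemma LINT_test_subset:
 fixes g :: "real^'n => 'b::euclidean_space" and Y :: "real^'n => real"
 assumes "open U" "open V" "V \<subseteq> U" "Y \<in> test_functions V" shows "(LINT x|leb V. Y x *\<^sub>R g x) = (LINT x|leb U. Y x *\<^sub>R g x)"
proof -
 define k where "k x = Y x *\<^sub>R g x" for x
 have z: "k x = 0" if "x \<notin> V" for x using test_outside[OF assms(4) that] by (simp add: k_def)
 have "(LINT x|leb V. k x) = (LINT x|lebesgue. k x)" by (rule LINT_lebesgue_on) (use assms(2) z in auto)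
 moreover have "(LINT x|leb U. k x) = (LINT x|lebesgue. k x)" by (rule LINT_lebesgue_on) (use assms(1,3) z in auto)
 ultimately show ?thesis by (simp add: k_def)
qed

lemma weak_div_subset:
 assumes "open U" "open V" "V \<subseteq> U" "weak_div U u D" shows "weak_div V u D" using assms test_functions_mono[OF assms(3)]
 by (auto simp: weak_div_def LINT_test_subset[OF assms(1-3)] LINT_test_subset[OF assms(1-3) test_functions_partial]
   intro: locally_integrable_subset[OF assms(3)])

lemma is_weak_partial_subset:
 assumes "open U" "open V" "V \<subseteq> U" "is_weak_partial U i u g" shows "is_weak_partial V i u g"
 using assms test_functions_mono[OF assms(3)]
 by (auto simp: is_weak_partial_def LINT_test_subset[OF assms(1-3)] LINT_test_subset[OF assms(1-3) test_functions_partial]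
   intro: locally_integrable_subset[OF assms(3)])

lemma is_weak_partial_add:
 assumes U: "open U" and u: "is_weak_partial U i u g" and v: "is_weak_partial U i v h"
 shows "is_weak_partial U i (\<lambda>x. u x + v x) (\<lambda>x. g x + h x)"
proof -
 show ?thesis using u v by (auto simp: is_weak_partial_def scaleR_add_right locally_integrable_add
   test_mult_integrable[OF U _ test_functions_partial] test_mult_integrable[OF U])
qed

lemma is_weak_partial_linear:
 assumes U: "open U" and h: "bounded_linear h" and u: "is_weak_partial U i u g"
 shows "is_weak_partial U i (\<lambda>x. h (u x)) (\<lambda>x. h (g x))"
proof -
 interpret h: bounded_linear h by fact
 have *: "(LINT x|leb U. Y x *\<^sub>R h (f x)) = h (LINT x|leb U. Y x *\<^sub>R f x)"
  if "Y \<in> test_functions U" "locally_integrable U f" for Y f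
  using integral_bounded_linear[OF h test_mult_integrable[OF U that(2,1)]] by (simp add: h.scaleR)
 show ?thesis using u by (auto simp: is_weak_partial_def * test_functions_partial h.neg locally_integrable_linear[OF h])
qed

lemma is_weak_partial_diff:
 assumes U: "open U" and u: "is_weak_partial U i u g" and v: "is_weak_partial U i v h"
 shows "is_weak_partial U i (\<lambda>x. u x - v x) (\<lambda>x. g x - h x)"
 using is_weak_partial_add[OF U u is_weak_partial_linear[OF U bounded_linear_minus[OF bounded_linear_ident] v]] by simp

lemma is_weak_partial_zero: "is_weak_partial U i (\<lambda>x. 0) (\<lambda>x. 0)" by (auto simp: is_weak_partial_def)

lemma LINT_test_cong_AE:
 assumes "open U" "locally_integrable U u" "locally_integrable U u'" "AE x in leb U. u x = u' x"
  "Y \<in> test_functions U" shows "(LINT x|leb U. Y x *\<^sub>R u x) = (LINT x|leb U. Y x *\<^sub>R u' x)"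
proof (rule integral_cong_AE)
 show "(\<lambda>x. Y x *\<^sub>R u x) \<in> borel_measurable (leb U)"
  by (rule borel_measurable_integrable[OF test_mult_integrable[OF assms(1,2,5)]])
 show "(\<lambda>x. Y x *\<^sub>R u' x) \<in> borel_measurable (leb U)"
  by (rule borel_measurable_integrable[OF test_mult_integrable[OF assms(1,3,5)]])
 show "AE x in leb U. Y x *\<^sub>R u x = Y x *\<^sub>R u' x" using assms(4) by eventually_elim simp
qed

lemma is_weak_partial_cong_AE:
 assumes U: "open U" and "is_weak_partial U i u g" and u': "u' \<in> borel_measurable (leb U)" "AE x in leb U. u x = u' x"
  and g': "g' \<in> borel_measurable (leb U)" "AE x in leb U. g x = g' x" shows "is_weak_partial U i u' g'"
proof -
 have l: "locally_integrable U u" "locally_integrable U g" using assms by (auto simp: is_weak_partial_def)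
 have l': "locally_integrable U u'" "locally_integrable U g'"
  using locally_integrable_cong_AE[OF l(1) u'(1) _ u'(2)] locally_integrable_cong_AE[OF l(2) g'(1) _ g'(2)] U by auto
 show ?thesis using assms(2) l'
  by (auto simp: is_weak_partial_def LINT_test_cong_AE[OF U l(1) l'(1) u'(2) test_functions_partial, symmetric]
   LINT_test_cong_AE[OF U l(2) l'(2) g'(2), symmetric])
qed

lemma integrable_lebesgue_on_compact:
 fixes f :: "'a::euclidean_space => 'b::euclidean_space"
 assumes "continuous_on UNIV f" "compact K" shows "integrable (leb K) f"
proof -
 note [measurable] = borel_measurable_continuous_onI[OF assms(1)]
 have "compact (f ` K)" using assms by (intro compact_continuous_image continuous_on_subset[OF assms(1)]) auto
 then obtain B where B: "\<And>y. y \<in> f ` K ==> norm y \<le> B" by (meson bounded_iff compact_imp_bounded)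
 have K: "K \<in> sets borel" using assms(2) by (simp add: compact_imp_closed)
 have m: "(\<lambda>x. indicator K x *\<^sub>R f x) \<in> borel_measurable borel" using K by measurable
 have "integrable lborel (\<lambda>x. indicator K x *\<^sub>R f x)"
  by (rule integrable_bounded_support[OF _ compact_imp_bounded[OF assms(2)], of _ "\<bar>B\<bar>"])
   (use m B in \<open>force simp: indicator_def\<close>)+
 then have "integrable lebesgue (\<lambda>x. indicator K x *\<^sub>R f x)" by (subst integrable_completion) auto
 then show ?thesis using K by (subst integrable_lebesgue_on) auto
qed

lemma smooth_locally_integrable: "smooth f ==> locally_integrable U f"
 by (auto simp: locally_integrable_def intro: integrable_lebesgue_on_compact smooth_continuous)

lemma smooth_is_weak_partial:
 assumes "smooth f" "open U" shows "is_weak_partial U i f (partial i f)"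
proof -
 have "(LINT x|leb U. (partial i Y x :: real) *\<^sub>R f x) = - (LINT x|leb U. Y x *\<^sub>R partial i f x)"
  if Y: "Y \<in> test_functions U" for Y
 proof -
  note t = test_functions_bilinear[OF bounded_bilinear_scaleR Y assms(1)]
  note t1 = test_functions_bilinear[OF bounded_bilinear_scaleR test_functions_partial[OF Y] assms(1)]
  note t2 = test_functions_bilinear[OF bounded_bilinear_scaleR Y smooth_partial[OF assms(1)]]
  have "0 = (LINT x|lborel. Y x *\<^sub>R partial i f x + partial i Y x *\<^sub>R f x)" using integral_partial_test[OF t, of i]
   by (simp add: partial_bilinear[OF bounded_bilinear_scaleR test_smooth[OF Y] assms(1)])
  also have "\<dots> = (LINT x|lborel. Y x *\<^sub>R partial i f x) + (LINT x|lborel. partial i Y x *\<^sub>R f x)"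
   by (rule Bochner_Integration.integral_add[OF test_integrable[OF t2] test_integrable[OF t1]])
  finally show ?thesis using LINT_lebesgue_on_borel[OF _ test_outside[OF t1] test_borel[OF t1]]
    LINT_lebesgue_on_borel[OF _ test_outside[OF t2] test_borel[OF t2]] assms(2) by (simp add: eq_neg_iff_add_eq_0 add.commute)
 qed
 then show ?thesis using assms by (auto simp: is_weak_partial_def smooth_locally_integrable smooth_partial)
qed

lemma H1_L2: "u \<in> H1 U ==> u \<in> L2 U" by (simp add: H1_def)

lemma H1_weak_partial:
 assumes "u \<in> H1 U" shows "is_weak_partial U i u (weak_partial U i u)"
 using assms by (auto simp: H1_def intro: is_weak_partial_weak_partial)

lemma locally_integrable_measurable:
 assumes U: "open U" and "locally_integrable U g" shows "g \<in> borel_measurable (leb U)"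
proof -
 obtain \<D> where D: "countable \<D>" "\<D> \<subseteq> Pow U" "\<And>X. X \<in> \<D> ==> \<exists>a b. X = cbox a b" "\<Union>\<D> = U"
  using open_countable_Union_open_cbox[OF U] by metis
 show ?thesis
 proof (rule measurable_piecewise_restrict[of \<D>])
  show "countable \<D>" by fact
  show "space (leb U) \<subseteq> \<Union>\<D>" using D by simp
  fix X assume X: "X \<in> \<D>"
  then obtain a b where X': "X = cbox a b" using D by blast
  have "X \<subseteq> U" using X D by auto
  then show "X \<inter> space (leb U) \<in> sets (leb U)" using X' U by (auto simp: sets_restrict_space_iff)
  have "g \<in> borel_measurable (leb X)"
   using assms(2) X' \<open>X \<subseteq> U\<close> by (auto simp: locally_integrable_def intro: borel_measurable_integrable)
  then show "g \<in> measurable (restrict_space (leb U) X) borel"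
   using \<open>X \<subseteq> U\<close> U by (simp add: restrict_restrict_space X' Int_absorb1)
 qed
qed

lemma H1_weak_partial_L2:
 assumes "open U" "u \<in> H1 U" shows "weak_partial U i u \<in> L2 U"
proof -
 obtain g where g: "g \<in> L2 U" "is_weak_partial U i u g" using assms by (auto simp: H1_def)
 have "weak_partial U i u \<in> borel_measurable (leb U)" using H1_weak_partial[OF assms(2)] assms(1)
  by (intro locally_integrable_measurable) (auto simp: is_weak_partial_def)
 then show ?thesis using g weak_partial_AE[OF assms(1) g(2)] unfolding L2_def
  by (intro Lebesgue2_cong_AE[OF g(1)[unfolded L2_def]]) auto
qed

lemma H1I: "u \<in> L2 U ==> (\<And>i. g i \<in> L2 U) ==> (\<And>i. is_weak_partial U i u (g i)) ==> u \<in> H1 U" by (auto simp: H1_def)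

text \<open>\<open>weak_partial\<close> picks a representative by choice, separately for each set,
  so derivatives taken on the domain and on an element agree only almost everywhere. This is the
  source of the many a.e. substitutions below.\<close>

lemma weak_partial_subset_AE:
 assumes "open U" "open V" "V \<subseteq> U" "is_weak_partial U i u g" shows "AE x in leb V. weak_partial V i u x = g x"
 using weak_partial_AE[OF assms(2) is_weak_partial_subset[OF assms]] .

lemma H1_subset:
 assumes "open U" "open V" "V \<subseteq> U" "u \<in> H1 U" shows "u \<in> H1 V"
proof (rule H1I)
 show "u \<in> L2 V" by (rule L2_restrict[OF H1_L2[OF assms(4)] assms(3)]) (use assms in auto)
 show "weak_partial U i u \<in> L2 V" for i by (rule L2_restrict[OF H1_weak_partial_L2[OF assms(1,4)] assms(3)]) (use assms in auto)
 show "is_weak_partial V i u (weak_partial U i u)" for i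
  by (rule is_weak_partial_subset[OF assms(1-3) H1_weak_partial[OF assms(4)]])
qed

lemma H1_add: "open U ==> u \<in> H1 U ==> v \<in> H1 U ==> (\<lambda>x. u x + v x) \<in> H1 U"
 by (rule H1I[where g = "\<lambda>i x. weak_partial U i u x + weak_partial U i v x"])
  (use H1_L2[of u U] H1_weak_partial_L2[of U u] H1_weak_partial[of u U] H1_L2[of v U] H1_weak_partial_L2[of U v] H1_weak_partial[of v U] in
   \<open>auto simp: L2_def intro!: is_weak_partial_add\<close>)

lemma H1_diff: "open U ==> u \<in> H1 U ==> v \<in> H1 U ==> (\<lambda>x. u x - v x) \<in> H1 U"
 by (rule H1I[where g = "\<lambda>i x. weak_partial U i u x - weak_partial U i v x"])
  (use H1_L2[of u U] H1_weak_partial_L2[of U u] H1_weak_partial[of u U] H1_L2[of v U] H1_weak_partial_L2[of U v] H1_weak_partial[of v U] in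
   \<open>auto simp: L2_def intro!: is_weak_partial_diff\<close>)

lemma H1_linear:
 assumes U: "open U" and h: "bounded_linear h" and u: "u \<in> H1 U" shows "(\<lambda>x. h (u x)) \<in> H1 U"
proof (rule H1I)
 show "(\<lambda>x. h (u x)) \<in> L2 U" unfolding L2_def by (rule Lebesgue2_bounded_linear[OF h H1_L2[OF u, unfolded L2_def]])
 show "(\<lambda>x. h (weak_partial U i u x)) \<in> L2 U" for i
  unfolding L2_def by (rule Lebesgue2_bounded_linear[OF h H1_weak_partial_L2[OF U u, unfolded L2_def]])
 show "is_weak_partial U i (\<lambda>x. h (u x)) (\<lambda>x. h (weak_partial U i u x))" for i
  by (rule is_weak_partial_linear[OF U h H1_weak_partial[OF u]])
qed

lemma bounded_smooth_L2:
 assumes "continuous_on UNIV f" "bounded U" "U \<in> sets lebesgue" shows "f \<in> L2 U"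
proof -
 have "compact (f ` closure U)" using assms by (intro compact_continuous_image continuous_on_subset[OF assms(1)]) auto
 then obtain B where B: "\<And>y. y \<in> f ` closure U ==> norm y \<le> B" by (meson bounded_iff compact_imp_bounded)
 show ?thesis unfolding L2_def
 proof (rule Lebesgue2_bounded[OF finite_measure_lebesgue_on_bounded[OF assms(3,2)]])
  have "f \<in> borel_measurable lebesgue" using borel_measurable_continuous_onI[OF assms(1)] by (intro measurable_completion) simp
  then show "f \<in> borel_measurable (leb U)" by (rule measurable_restrict_space1)
  show "AE x in leb U. norm (f x) \<le> B" using B closure_subset[of U] by (intro AE_I2) auto
 qed
qed

lemma smooth_H1:
 assumes "smooth f" "bounded U" "open U" shows "f \<in> H1 U" by (rule H1I[where g = "\<lambda>i. partial i f"])
  (use assms in \<open>auto intro!: bounded_smooth_L2 smooth_continuous smooth_partial smooth_is_weak_partial\<close>)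

lemma H1_norm_ge:
 "L2_norm (leb U) u \<le> H1_norm U u" "L2_norm (leb U) (weak_partial U i u) \<le> H1_norm U u"
proof -
 show "L2_norm (leb U) u \<le> H1_norm U u" unfolding H1_norm_def by (rule real_le_rsqrt) (simp add: sum_nonneg)
 have "(L2_norm (leb U) (weak_partial U i u))\<^sup>2 \<le> (\<Sum>i\<in>UNIV. (L2_norm (leb U) (weak_partial U i u))\<^sup>2)"
  by (rule member_le_sum) auto
 then show "L2_norm (leb U) (weak_partial U i u) \<le> H1_norm U u"
  unfolding H1_norm_def by (intro real_le_rsqrt) (simp add: add_increasing)
qed

lemma H1_norm_tendsto_0:
 assumes "((\<lambda>m. L2_norm (leb U) (u m)) \<longlongrightarrow> 0) F"
  "\<And>i. ((\<lambda>m. L2_norm (leb U) (weak_partial U i (u m))) \<longlongrightarrow> 0) F" shows "((\<lambda>m. H1_norm U (u m)) \<longlongrightarrow> 0) F"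
proof -
 have "((\<lambda>m. H1_norm U (u m)) \<longlongrightarrow> sqrt (0\<^sup>2 + (\<Sum>i\<in>(UNIV::'b set). 0\<^sup>2))) F" unfolding H1_norm_def by (intro tendsto_intros assms)
 then show ?thesis by simp
qed

lemma test_functions_H1_0:
 assumes "Y \<in> test_functions U" "open U" "bounded U" shows "Y \<in> H1_0 U"
proof -
 \<comment> \<open>The constant sequence serves as approximation. Even so, the representative chosen
   as derivative of the zero function vanishes only almost everywhere.\<close>
 have "AE x in leb U. weak_partial U i (\<lambda>x. Y x - Y x) x = 0" for i
  using weak_partial_AE[OF assms(2) is_weak_partial_zero, where 'b='b] by simp
 then have "L2_norm (leb U) (weak_partial U i (\<lambda>x. Y x - Y x)) = 0" for i
 proof (rule L2_norm_AE_zero)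
  show "weak_partial U i (\<lambda>x. Y x - Y x) \<in> borel_measurable (leb U)"
   using is_weak_partial_weak_partial[OF is_weak_partial_zero, where 'b='b] assms(2)
   by (intro locally_integrable_measurable) (auto simp: is_weak_partial_def)
 qed
 then show ?thesis using assms smooth_H1[OF test_smooth[OF assms(1)]] by (auto simp: H1_norm_def L2_norm_def H1_0_def)
qed

text \<open>With the Taylor remainder of \<open>Q\<close> under the integral the error is at most
  \<open>c\<close> times the squared increment, where \<open>c\<close> contains the L1 norm of
  \<open>u\<close>. The argument \<open>a *\<^sub>R x + b *\<^sub>R y\<close> admits kernels that
  are dilated as well as translated.\<close>

lemma smooth_param_integral_derivative:
 fixes Q :: "real^'n => real" and u :: "real^'n => 'b::euclidean_space"
 assumes Q: "Q \<in> test_functions U" and u: "integrable lborel u"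
 shows "((\<lambda>x. LINT y|lborel. Q (a *\<^sub>R x + b *\<^sub>R y) *\<^sub>R u y) has_derivative
   (\<lambda>h. \<Sum>i\<in>UNIV. h $ i *\<^sub>R (a *\<^sub>R (LINT y|lborel. partial i Q (a *\<^sub>R x + b *\<^sub>R y) *\<^sub>R u y)))) (at x)"
proof -
 have [measurable]: "u \<in> borel_measurable borel" using borel_measurable_integrable[OF u] by simp
 have int: "integrable lborel (\<lambda>y. Z (a *\<^sub>R x + b *\<^sub>R y) *\<^sub>R u y)"
  if Z: "Z \<in> test_functions U" for Z :: "real^'n => real" and x
 proof -
  note [measurable] = test_borel[OF Z]
  obtain B where B: "\<And>x. norm (Z x) \<le> B" using test_bounded[OF Z] by blast
  show ?thesis
  proof (rule bochner_bound)
   show "integrable lborel (\<lambda>y. B *\<^sub>R norm (u y))" using u by simp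
   show "AE y in lborel. norm (Z (a *\<^sub>R x + b *\<^sub>R y) *\<^sub>R u y) \<le> norm (B *\<^sub>R norm (u y))"
   proof (rule AE_I2)
    fix y
    show "norm (Z (a *\<^sub>R x + b *\<^sub>R y) *\<^sub>R u y) \<le> norm (B *\<^sub>R norm (u y))" using B[of "a *\<^sub>R x + b *\<^sub>R y"] by (simp add: mult_right_mono)
   qed
  qed measurable
 qed
 obtain C where C: "0 \<le> C"
  "\<And>p h. norm (Q (p + h) - Q p - (\<Sum>i\<in>UNIV. h $ i *\<^sub>R partial i Q p)) \<le> C * (norm h)\<^sup>2" using test_taylor[OF Q] by blast
 define I where "I x = (LINT y|lborel. Q (a *\<^sub>R x + b *\<^sub>R y) *\<^sub>R u y)" for x
 define D where "D h = (\<Sum>i\<in>UNIV. h $ i *\<^sub>R (a *\<^sub>R (LINT y|lborel. partial i Q (a *\<^sub>R x + b *\<^sub>R y) *\<^sub>R u y)))" for h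
 have D: "bounded_linear D" unfolding D_def by (intro bounded_linear_sum bounded_linear_scaleR_const bounded_linear_vec_nth)
 define c where "c = C * a\<^sup>2 * (LINT y|lborel. norm (u y))"
 have bound: "norm (I (x + h) - I x - D h) \<le> c * (norm h)\<^sup>2" for h
 proof -
  let ?p = "\<lambda>y. a *\<^sub>R x + b *\<^sub>R y"
  let ?r = "\<lambda>y. Q (?p y + a *\<^sub>R h) - Q (?p y) - (\<Sum>i\<in>UNIV. (a *\<^sub>R h) $ i *\<^sub>R partial i Q (?p y))"
  have Ih: "I (x + h) = (LINT y|lborel. Q (?p y + a *\<^sub>R h) *\<^sub>R u y)" unfolding I_def by (simp add: algebra_simps)
  have Dh: "D h = (LINT y|lborel. (\<Sum>i\<in>UNIV. (a *\<^sub>R h) $ i *\<^sub>R (partial i Q (?p y) *\<^sub>R u y)))"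
  proof -
   have "(LINT y|lborel. (\<Sum>i\<in>UNIV. (a *\<^sub>R h) $ i *\<^sub>R (partial i Q (?p y) *\<^sub>R u y)))
     = (\<Sum>i\<in>UNIV. LINT y|lborel. (a *\<^sub>R h) $ i *\<^sub>R (partial i Q (?p y) *\<^sub>R u y))" by (rule bochner_int_sum)
     (intro integrable_scaleR_right int[OF test_functions_partial[OF Q]])
   also have "\<dots> = (\<Sum>i\<in>UNIV. (a *\<^sub>R h) $ i *\<^sub>R (LINT y|lborel. partial i Q (?p y) *\<^sub>R u y))"
    by (simp only: integral_scaleR_right)
   finally show ?thesis by (simp add: D_def mult.commute)
  qed
  have i1: "integrable lborel (\<lambda>y. Q (?p y + a *\<^sub>R h) *\<^sub>R u y)" using int[OF Q, of "x + h"] by (simp add: algebra_simps)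
  have i2: "integrable lborel (\<lambda>y. \<Sum>i\<in>UNIV. (a *\<^sub>R h) $ i *\<^sub>R (partial i Q (?p y) *\<^sub>R u y))"
   by (intro bochner_sum integrable_scaleR_right int[OF test_functions_partial[OF Q]])
  have eq: "I (x + h) - I x - D h = (LINT y|lborel. ?r y *\<^sub>R u y)" unfolding Ih Dh unfolding I_def using i1 int[OF Q, of x] i2
   by (simp add: scaleR_diff_left scaleR_sum_left)
  have "norm (LINT y|lborel. ?r y *\<^sub>R u y) \<le> (LINT y|lborel. C * (norm (a *\<^sub>R h))\<^sup>2 * norm (u y))"
  proof (rule order_trans[OF integral_norm_bound integral_mono])
   have "integrable lborel (\<lambda>y. Q (?p y + a *\<^sub>R h) *\<^sub>R u y - Q (?p y) *\<^sub>R u y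
     - (\<Sum>i\<in>UNIV. (a *\<^sub>R h) $ i *\<^sub>R (partial i Q (?p y) *\<^sub>R u y)))"
    by (intro Bochner_Integration.integrable_diff i1 i2 int[OF Q])
   then have "integrable lborel (\<lambda>y. ?r y *\<^sub>R u y)" by (simp add: scaleR_diff_left scaleR_sum_left)
   then show "integrable lborel (\<lambda>y. norm (?r y *\<^sub>R u y))" by (rule integrable_norm)
   show "integrable lborel (\<lambda>y. C * (norm (a *\<^sub>R h))\<^sup>2 * norm (u y))" using u by simp
   show "norm (?r y *\<^sub>R u y) \<le> C * (norm (a *\<^sub>R h))\<^sup>2 * norm (u y)" for y
    unfolding norm_scaleR using C(2)[of "?p y" "a *\<^sub>R h"] by (intro mult_right_mono) auto
  qed
  also have "\<dots> = c * (norm h)\<^sup>2" by (simp add: c_def power_mult_distrib)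
  finally show ?thesis unfolding eq .
 qed
 have "((\<lambda>h. norm (I (x + h) - I x - D h) / norm h) \<longlongrightarrow> 0) (at 0)"
 proof (rule tendsto_zero_le)
  show "norm (I (x + h) - I x - D h) / norm h \<le> c * norm h" for h
   using bound[of h] by (cases "h = 0") (auto simp: field_simps power2_eq_square)
  have "((\<lambda>h::real^'n. h) \<longlongrightarrow> 0) (at 0)" by (rule tendsto_ident_at)
  from tendsto_mult[OF tendsto_const tendsto_norm_zero[OF this], of c]
  show "((\<lambda>h. c * norm (h::real^'n)) \<longlongrightarrow> 0) (at 0)" by (simp only: mult_zero_right)
 qed simp
 then have "(I has_derivative D) (at x)" using D by (simp add: has_derivative_at)
 then show ?thesis unfolding I_def[abs_def] D_def[abs_def] .
qed

lemma smooth_param_integral: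
 fixes Q :: "real^'n => real" and u :: "real^'n => 'b::euclidean_space"
 assumes Q: "Q \<in> test_functions U" and u: "integrable lborel u" shows "smooth (\<lambda>x. LINT y|lborel. Q (a *\<^sub>R x + b *\<^sub>R y) *\<^sub>R u y)"
  and "partial i (\<lambda>x. LINT y|lborel. Q (a *\<^sub>R x + b *\<^sub>R y) *\<^sub>R u y) x
   = a *\<^sub>R (LINT y|lborel. partial i Q (a *\<^sub>R x + b *\<^sub>R y) *\<^sub>R u y)"
proof -
 have p: "partial i (\<lambda>x. LINT y|lborel. Z (a *\<^sub>R x + b *\<^sub>R y) *\<^sub>R u y)
   = (\<lambda>x. a *\<^sub>R (LINT y|lborel. partial i Z (a *\<^sub>R x + b *\<^sub>R y) *\<^sub>R u y))"
  if "Z \<in> test_functions U" for Z :: "real^'n => real" and i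
  by (rule ext) (simp only: partial_eq[OF smooth_param_integral_derivative[OF that u]] sum_axis_scaleR)
 have "C_k k (\<lambda>x. LINT y|lborel. Z (a *\<^sub>R x + b *\<^sub>R y) *\<^sub>R u y)" if "Z \<in> test_functions U" for k and Z :: "real^'n => real"
  using that
 proof (induction k arbitrary: Z)
  case 0
  show ?case using has_derivative_continuous[OF smooth_param_integral_derivative[OF 0 u, of a b]]
   by (simp add: continuous_on_eq_continuous_within)
 next
  case (Suc k)
  show ?case using differentiableI[OF smooth_param_integral_derivative[OF Suc.prems u]] Suc.IH[OF test_functions_partial[OF Suc.prems]] by (simp add: p[OF Suc.prems] C_k_linear[OF bounded_linear_scaleR_right])
 qed
 then show "smooth (\<lambda>x. LINT y|lborel. Q (a *\<^sub>R x + b *\<^sub>R y) *\<^sub>R u y)" using Q by (simp add: smooth_def)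
 show "partial i (\<lambda>x. LINT y|lborel. Q (a *\<^sub>R x + b *\<^sub>R y) *\<^sub>R u y) x
   = a *\<^sub>R (LINT y|lborel. partial i Q (a *\<^sub>R x + b *\<^sub>R y) *\<^sub>R u y)" by (simp add: p[OF Q])
qed

section \<open>Mollification on convex sets\<close>

lemma L2_dominated_convergence:
 assumes w: "w \<in> Lebesgue2 M" and [measurable]: "\<And>m. f m \<in> borel_measurable M" "g \<in> borel_measurable M"
  and lim: "AE x in M. (\<lambda>m. f m x) \<longlonglongrightarrow> g x" and dom: "\<And>m. AE x in M. norm (f m x) \<le> norm (w x)" shows "L2_conv M f g"
proof -
 have "AE x in M. \<forall>m. norm (f m x) \<le> norm (w x)" using dom by (simp add: AE_all_countable)
 then have g: "AE x in M. norm (g x) \<le> norm (w x)" using lim by eventually_elim (auto intro: LIMSEQ_le_const2[OF tendsto_norm])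
 have "(\<lambda>m. LINT x|M. (norm (f m x - g x))\<^sup>2) \<longlonglongrightarrow> (LINT x|M. 0)"
 proof (rule integral_dominated_convergence[where w = "\<lambda>x. 4 * (norm (w x))\<^sup>2"])
  show "integrable M (\<lambda>x. 4 * (norm (w x))\<^sup>2)" using Lebesgue2_integrable[OF w] by simp
  show "AE x in M. (\<lambda>m. (norm (f m x - g x))\<^sup>2) \<longlonglongrightarrow> 0" using lim
  proof eventually_elim
   case (elim x)
   then have "(\<lambda>m. (norm (f m x - g x))\<^sup>2) \<longlonglongrightarrow> (norm (g x - g x))\<^sup>2" by (intro tendsto_intros)
   then show ?case by simp
  qed
  show "AE x in M. norm ((norm (f m x - g x))\<^sup>2) \<le> 4 * (norm (w x))\<^sup>2" for m using dom[of m] g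
  proof eventually_elim
   case (elim x)
   then have "norm (f m x - g x) \<le> 2 * norm (w x)" using norm_triangle_ineq4[of "f m x" "g x"] by linarith
   then have "(norm (f m x - g x))\<^sup>2 \<le> (2 * norm (w x))\<^sup>2" by (rule power_mono) simp
   then show ?case by simp
  qed
 qed measurable
 then have "(\<lambda>m. sqrt (LINT x|M. (norm (f m x - g x))\<^sup>2)) \<longlonglongrightarrow> sqrt 0" by (intro tendsto_real_sqrt) simp
 then show ?thesis by (simp add: L2_norm_def)
qed

lemma indicator_cball_Lebesgue2:
 "(\<lambda>x::'a::euclidean_space. indicator (cball 0 r) x * N :: real) \<in> Lebesgue2 lborel"
proof (rule Lebesgue2I)
 have "integrable lborel (\<lambda>x::'a. indicator (cball 0 r) x * N\<^sup>2)"
  using emeasure_bounded_finite[OF bounded_cball] by (intro integrable_mult_left integrable_real_indicator) auto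
 also have "(\<lambda>x::'a. indicator (cball 0 r) x * N\<^sup>2) = (\<lambda>x. (norm (indicator (cball 0 r) x * N))\<^sup>2)" by (auto simp: indicator_def)
 finally show "integrable lborel (\<lambda>x::'a. (norm (indicator (cball 0 r) x * N))\<^sup>2)" .
 show "(\<lambda>x::'a. indicator (cball 0 r) x * N) \<in> borel_measurable lborel"
  by (rule borel_measurable_times[OF borel_measurable_indicator]) auto
qed

text \<open>The continuous functions supplied by \<open>measurable_on\<close> converge only
  pointwise off a null set and may be unbounded. Projecting their values onto the ball of radius
  \<open>N\<close> and cutting off between the radii \<open>N\<close> and \<open>N + 1\<close>
  yields a dominating function and leaves the limit unchanged.\<close>

lemma L2_dense_bounded:
 fixes f :: "'a::euclidean_space => 'b::euclidean_space"
 assumes [measurable]: "f \<in> borel_measurable borel" and N: "0 \<le> N" "\<And>x. norm (f x) \<le> N" "\<And>x. norm x > N ==> f x = 0"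
 obtains g :: "nat => 'a => 'b" where "\<And>m. continuous_on UNIV (g m)" "\<And>m x. norm (g m x) \<le> N"
  "\<And>m x. norm x > N + 1 ==> g m x = 0" "L2_conv lborel g f"
proof -
 have "f measurable_on UNIV" by (rule lebesgue_measurable_imp_measurable_on) (auto intro: measurable_completion)
 then obtain Z k where Z: "negligible Z" and k: "\<And>m. continuous_on UNIV (k m)"
  "\<And>x. x \<notin> Z ==> (\<lambda>m. k m x) \<longlonglongrightarrow> f x" by (auto simp: measurable_on_def)
 define P where "P = closest_point (cball (0::'b) N)"
 have ne: "cball (0::'b) N \<noteq> {}" using N by auto
 have P: "continuous_on UNIV P" "\<And>y. norm (P y) \<le> N" "\<And>y. norm y \<le> N ==> P y = y" unfolding P_def
  using continuous_on_closest_point[OF convex_cball closed_cball ne]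
   closest_point_in_set[OF closed_cball ne] closest_point_self[of _ "cball (0::'b) N"] by auto
 define cut where "cut x = max 0 (min 1 (N + 1 - norm (x::'a)))" for x
 define g where "g m x = cut x *\<^sub>R P (k m x)" for m x
 have cont: "continuous_on UNIV (g m)" for m unfolding g_def cut_def
  by (intro continuous_intros continuous_on_compose2[OF P(1) k(1)]) auto
 have bd: "norm (g m x) \<le> N" for m x
  unfolding g_def using P(2)[of "k m x"] by (auto simp: cut_def intro!: order_trans[OF mult_left_le_one_le])
 have out: "g m x = 0" if "norm x > N + 1" for m x using that by (simp add: g_def cut_def)
 show ?thesis
 proof (rule that[OF cont bd out])
  show "L2_conv lborel g f"
  proof (rule L2_dominated_convergence[where w = "\<lambda>x. indicator (cball 0 (N + 1)) x * N"])
   show "(\<lambda>x::'a. indicator (cball 0 (N + 1)) x * N) \<in> Lebesgue2 lborel" by (rule indicator_cball_Lebesgue2)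
   show "g m \<in> borel_measurable lborel" for m using borel_measurable_continuous_onI[OF cont] by simp
   show "f \<in> borel_measurable lborel" by simp
   show "AE x in lborel. norm (g m x) \<le> norm (indicator (cball 0 (N + 1)) x * N)" for m
   proof (rule AE_I2)
    fix x show "norm (g m x) \<le> norm (indicator (cball 0 (N + 1)) x * N)"
     using bd[of m x] out[of x m] N(1) by (cases "norm x \<le> N + 1") auto
   qed
   have "AE x in lebesgue. x \<notin> Z" using Z by (intro AE_not_in) (simp add: negligible_iff_null_sets)
   then have "AE x in lborel. x \<notin> Z" by (simp add: AE_completion_iff)
   then show "AE x in lborel. (\<lambda>m. g m x) \<longlonglongrightarrow> f x"
   proof eventually_elim
    case (elim x)
    have "isCont P (f x)" using P(1) by (simp add: continuous_on_eq_continuous_at)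
    then have "(\<lambda>m. P (k m x)) \<longlonglongrightarrow> P (f x)" using k(2)[OF elim] by (rule isCont_tendsto_compose)
    then have "(\<lambda>m. P (k m x)) \<longlonglongrightarrow> f x" using P(3)[OF N(2)] by simp
    then have "(\<lambda>m. g m x) \<longlonglongrightarrow> cut x *\<^sub>R f x" unfolding g_def by (intro tendsto_intros)
    moreover have "cut x *\<^sub>R f x = f x" using N(3)[of x] by (cases "norm x \<le> N") (auto simp: cut_def)
    ultimately show ?case by simp
   qed
  qed
 qed
qed

text \<open>Truncation in value and in space by the same \<open>N\<close> reduces the claim to
  \<open>L2_dense_bounded\<close>; each of the two approximations spends
  \<open>E / 2\<close>.\<close>

lemma L2_dense_continuous:
 assumes f: "f \<in> Lebesgue2 lborel" and "0 < E"
 obtains g N where "continuous_on UNIV g" "0 \<le> N" "\<And>x. norm (g x) \<le> N" "\<And>x. norm x > N ==> g x = 0"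
  "g \<in> Lebesgue2 lborel" "L2_norm lborel (\<lambda>x. g x - f x) < E"
proof -
 have [measurable]: "f \<in> borel_measurable borel" using f by (simp add: Lebesgue2_def)
 define t where "t N x = (if norm (f x) \<le> real N \<and> norm x \<le> real N then f x else 0)" for N x
 have [measurable]: "t N \<in> borel_measurable borel" for N unfolding t_def by measurable
 have "L2_conv lborel t f"
 proof (rule L2_dominated_convergence[OF f])
  show "AE x in lborel. (\<lambda>N. t N x) \<longlonglongrightarrow> f x"
  proof (rule AE_I2)
   fix x
   obtain N0 where "real N0 \<ge> max (norm (f x)) (norm x)" using real_arch_simple by blast
   then have "\<forall>N\<ge>N0. t N x = f x" by (auto simp: t_def)
   then show "(\<lambda>N. t N x) \<longlonglongrightarrow> f x" by (intro tendsto_eventually) (auto simp: eventually_sequentially)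
  qed
 qed (auto simp: t_def)
 then have "\<forall>\<^sub>F N in sequentially. L2_norm lborel (\<lambda>x. t N x - f x) < E / 2" using \<open>0 < E\<close> by (intro order_tendstoD(2)) auto
 then obtain N where N: "L2_norm lborel (\<lambda>x. t N x - f x) < E / 2" by (auto simp: eventually_sequentially)
 have t_L2: "t N \<in> Lebesgue2 lborel" by (rule Lebesgue2_dominated[OF f, of _ 1]) (auto simp: t_def)
 obtain g where g: "\<And>m. continuous_on UNIV (g m)" "\<And>m x. norm (g m x) \<le> real N"
  "\<And>m x. norm x > real N + 1 ==> g m x = 0" "L2_conv lborel g (t N)"
  by (rule L2_dense_bounded[of "t N" "real N"]) (simp, simp, simp add: t_def, simp add: t_def, blast)
 have "\<forall>\<^sub>F m in sequentially. L2_norm lborel (\<lambda>x. g m x - t N x) < E / 2" using g(4) \<open>0 < E\<close> by (intro order_tendstoD(2)) auto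
 then obtain m where m: "L2_norm lborel (\<lambda>x. g m x - t N x) < E / 2" by (auto simp: eventually_sequentially)
 note [measurable] = borel_measurable_continuous_onI[OF g(1)]
 have g_L2: "g m \<in> Lebesgue2 lborel"
 proof (rule Lebesgue2I)
  show "integrable lborel (\<lambda>x. (norm (g m x))\<^sup>2)"
   by (rule integrable_bounded_support[OF _ bounded_cball[of 0 "real N + 1"], of _ "(real N)\<^sup>2"])
    (use g(2,3) in \<open>auto intro: power_mono\<close>)
 qed simp
 show ?thesis
 proof (rule that[OF g(1), of "real N + 1" m])
  show "norm (g m x) \<le> real N + 1" for x using g(2)[of m x] by linarith
  show "L2_norm lborel (\<lambda>x. g m x - f x) < E" using L2_norm_triangle_diff[OF g_L2 t_L2 f] N m by linarith
 qed (use g g_L2 in auto)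
qed

text \<open>The Jacobian \<open>c ^ DIM('a)\<close> is bounded below by
  \<open>(1/2) ^ DIM('a)\<close>, which makes the estimate uniform over all mollification
  steps.\<close>

lemma L2_norm_affine:
 fixes f :: "'a::euclidean_space => 'b::euclidean_space"
 assumes f: "f \<in> Lebesgue2 lborel" and c: "1/2 \<le> c" shows "(\<lambda>x. f (t + c *\<^sub>R x)) \<in> Lebesgue2 lborel"
  and "L2_norm lborel (\<lambda>x. f (t + c *\<^sub>R x)) \<le> sqrt (2 ^ DIM('a)) * L2_norm lborel f"
proof -
 have [measurable]: "f \<in> borel_measurable borel" using f by (simp add: Lebesgue2_def)
 have m: "(\<lambda>x. f (t + c *\<^sub>R x)) \<in> borel_measurable lborel" by simp
 have eq: "nn2 lborel f = ennreal (c ^ DIM('a)) * nn2 lborel (\<lambda>x. f (t + c *\<^sub>R x))"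
  using c by (subst nn_integral_lborel_affine[of _ c t]) auto
 have "nn2 lborel (\<lambda>x. f (t + c *\<^sub>R x))
   \<le> ennreal (2 ^ DIM('a)) * ennreal (c ^ DIM('a)) * nn2 lborel (\<lambda>x. f (t + c *\<^sub>R x))" using c one_le_power[of "2 * c" "DIM('a)"] c mult_right_mono[of 1 _ "\<integral>\<^sup>+x. ennreal ((norm (f (t + c *\<^sub>R x)))\<^sup>2) \<partial>lborel"] by (simp add: ennreal_mult[symmetric])
 also have "\<dots> = ennreal (2 ^ DIM('a)) * nn2 lborel f" by (simp add: eq mult.assoc)
 also have "\<dots> = ennreal ((sqrt (2 ^ DIM('a)) * L2_norm lborel f)\<^sup>2)"
  by (simp add: nn_integral_norm2[OF f] power_mult_distrib ennreal_mult)
 finally have *: "nn2 lborel (\<lambda>x. f (t + c *\<^sub>R x)) \<le> ennreal ((sqrt (2 ^ DIM('a)) * L2_norm lborel f)\<^sup>2)" .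
 show "(\<lambda>x. f (t + c *\<^sub>R x)) \<in> Lebesgue2 lborel" by (rule Lebesgue2I_nn[OF m]) (use * in \<open>auto simp: le_less_trans\<close>)
 show "L2_norm lborel (\<lambda>x. f (t + c *\<^sub>R x)) \<le> sqrt (2 ^ DIM('a)) * L2_norm lborel f" by (rule L2_norm_le_nn[OF m *]) simp
qed

text \<open>The shift by 2 keeps the value at most 1/2, so that the contraction factor
  \<open>1 - moll_eps m\<close> is at least 1/2 from the first term on, as
  \<open>L2_norm_affine\<close> requires.\<close>

definition moll_eps :: "nat => real" where "moll_eps m = 1 / (real m + 2)"

lemma moll_eps: "0 < moll_eps m" "moll_eps m \<le> 1/2" "moll_eps \<longlonglongrightarrow> 0"
proof -
 show "0 < moll_eps m" "moll_eps m \<le> 1/2" by (auto simp: moll_eps_def)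
 show "moll_eps \<longlonglongrightarrow> 0" using LIMSEQ_Suc[OF LIMSEQ_inverse_real_of_nat] by (simp add: inverse_eq_divide moll_eps_def[abs_def] add.commute)
qed

lemma L2_dilation_bound:
 fixes K :: "'a::euclidean_space => 'b::euclidean_space"
 assumes K: "K \<in> Lebesgue2 lborel" and c: "0 \<le> c" "c \<le> 1" and e: "e \<le> 1/2"
 shows "(\<lambda>q. c *\<^sub>R K ((1 - e) *\<^sub>R q + e *\<^sub>R p) - K q) \<in> Lebesgue2 lborel"
  and "L2_norm lborel (\<lambda>q. c *\<^sub>R K ((1 - e) *\<^sub>R q + e *\<^sub>R p) - K q) \<le> (sqrt (2 ^ DIM('a)) + 1) * L2_norm lborel K"
proof -
 have eq: "(\<lambda>q. c *\<^sub>R K ((1 - e) *\<^sub>R q + e *\<^sub>R p)) = (\<lambda>q. c *\<^sub>R K (e *\<^sub>R p + (1 - e) *\<^sub>R q))" by (simp add: add.commute)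
 have T: "(\<lambda>q. c *\<^sub>R K ((1 - e) *\<^sub>R q + e *\<^sub>R p)) \<in> Lebesgue2 lborel"
  unfolding eq using e by (intro Lebesgue2_scaleR L2_norm_affine(1)[OF K]) simp
 show "(\<lambda>q. c *\<^sub>R K ((1 - e) *\<^sub>R q + e *\<^sub>R p) - K q) \<in> Lebesgue2 lborel" by (rule Lebesgue2_diff[OF T K])
 have "L2_norm lborel (\<lambda>q. c *\<^sub>R K ((1 - e) *\<^sub>R q + e *\<^sub>R p)) \<le> 1 * (sqrt (2 ^ DIM('a)) * L2_norm lborel K)"
  unfolding eq L2_norm_scaleR using c e by (intro mult_mono L2_norm_affine(2)[OF K]) auto
 moreover have "L2_norm lborel (\<lambda>q. c *\<^sub>R K ((1 - e) *\<^sub>R q + e *\<^sub>R p) - K q)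
   \<le> L2_norm lborel (\<lambda>q. c *\<^sub>R K ((1 - e) *\<^sub>R q + e *\<^sub>R p)) + L2_norm lborel K"
  using L2_norm_triangle[OF T Lebesgue2_uminus[OF K]] by (simp add: L2_norm_minus)
 ultimately show "L2_norm lborel (\<lambda>q. c *\<^sub>R K ((1 - e) *\<^sub>R q + e *\<^sub>R p) - K q) \<le> (sqrt (2 ^ DIM('a)) + 1) * L2_norm lborel K"
  by (simp add: algebra_simps)
qed

text \<open>A density argument: for continuous \<open>g\<close> of bounded support it is dominated
  convergence, and the remainder \<open>K - g\<close> is controlled uniformly in \<open>m\<close> by
  \<open>L2_dilation_bound\<close>. The scalars \<open>c m\<close> are there for singular kernels,
  which a dilation multiplies by a power.\<close>

lemma L2_dilation_tendsto:
 fixes K :: "'a::euclidean_space => 'b::euclidean_space"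
 assumes K: "K \<in> Lebesgue2 lborel" and c: "\<And>m. 0 \<le> c m" "\<And>m. c m \<le> 1" "c \<longlonglongrightarrow> 1"
 shows "L2_conv lborel (\<lambda>m q. c m *\<^sub>R K ((1 - moll_eps m) *\<^sub>R q + moll_eps m *\<^sub>R p)) K"
proof (rule LIMSEQ_I)
 fix E :: real assume "0 < E"
 \<comment> \<open>Chosen so that the uniform bound on the dilated remainder contributes at most
   \<open>E / 2\<close>.\<close>
 define C where "C = E / (2 * (sqrt (2 ^ DIM('a)) + 1))"
 have s: "0 < sqrt (2 ^ DIM('a)) + 1" by (simp add: add_nonneg_pos)
 then have "0 < C" using \<open>0 < E\<close> by (simp add: C_def)
 then obtain g N where g: "continuous_on UNIV g" "0 \<le> N" "\<And>x. norm (g x) \<le> N" "\<And>x. norm x > N ==> g x = 0"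
  "g \<in> Lebesgue2 lborel" "L2_norm lborel (\<lambda>x. g x - K x) < C" using L2_dense_continuous[OF K] by blast
 note [measurable] = borel_measurable_continuous_onI[OF g(1)]
 let ?T = "\<lambda>m q. (1 - moll_eps m) *\<^sub>R q + moll_eps m *\<^sub>R p"
 have gT: "L2_conv lborel (\<lambda>m q. c m *\<^sub>R g (?T m q)) g"
 \<comment> \<open>Beyond the radius \<open>2 * N + norm p\<close> the moved point has norm above
   \<open>N\<close>, where \<open>g\<close> vanishes: the factor of \<open>q\<close> is at least 1/2
   and that of \<open>p\<close> at most 1/2.\<close>
 proof (rule L2_dominated_convergence[where w = "\<lambda>x. indicator (cball 0 (2 * N + norm p)) x * N"])
  show "(\<lambda>x::'a. indicator (cball 0 (2 * N + norm p)) x * N) \<in> Lebesgue2 lborel" by (rule indicator_cball_Lebesgue2)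
  show "(\<lambda>q. c m *\<^sub>R g (?T m q)) \<in> borel_measurable lborel" for m by measurable
  show "g \<in> borel_measurable lborel" by simp
  show "AE q in lborel. (\<lambda>m. c m *\<^sub>R g (?T m q)) \<longlonglongrightarrow> g q"
  proof (rule AE_I2)
   fix q
   have "(\<lambda>m. ?T m q) \<longlonglongrightarrow> (1 - 0) *\<^sub>R q + 0 *\<^sub>R p" by (intro tendsto_intros moll_eps(3))
   then have "(\<lambda>m. g (?T m q)) \<longlonglongrightarrow> g ((1 - 0) *\<^sub>R q + 0 *\<^sub>R p)"
    using g(1) by (intro isCont_tendsto_compose[of _ g]) (auto simp: continuous_on_eq_continuous_at)
   then have "(\<lambda>m. c m *\<^sub>R g (?T m q)) \<longlonglongrightarrow> 1 *\<^sub>R g ((1 - 0) *\<^sub>R q + 0 *\<^sub>R p)" by (intro tendsto_intros c)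
   then show "(\<lambda>m. c m *\<^sub>R g (?T m q)) \<longlonglongrightarrow> g q" by simp
  qed
  show "AE q in lborel. norm (c m *\<^sub>R g (?T m q)) \<le> norm (indicator (cball 0 (2 * N + norm p)) q * N)" for m
  proof (rule AE_I2)
   fix q
   show "norm (c m *\<^sub>R g (?T m q)) \<le> norm (indicator (cball 0 (2 * N + norm p)) q * N)"
   proof (cases "norm q \<le> 2 * N + norm p")
    case True
    have "norm (c m *\<^sub>R g (?T m q)) \<le> 1 * N" unfolding norm_scaleR using c g(2,3) by (intro mult_mono) auto
    then show ?thesis using True g(2) by simp
   next
    case False
    have "(1/2) * norm q \<le> (1 - moll_eps m) * norm q" using moll_eps(2)[of m] by (intro mult_right_mono) auto
    moreover have "moll_eps m * norm p \<le> (1/2) * norm p" using moll_eps(2)[of m] by (intro mult_right_mono) auto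
    moreover have "norm ((1 - moll_eps m) *\<^sub>R q) - norm (moll_eps m *\<^sub>R p) \<le> norm (?T m q)" by (rule norm_diff_ineq)
    moreover have "norm ((1 - moll_eps m) *\<^sub>R q) = (1 - moll_eps m) * norm q"
     "norm (moll_eps m *\<^sub>R p) = moll_eps m * norm p" using moll_eps(1,2)[of m] by auto
    ultimately have "N < norm (?T m q)" using False by linarith
    then show ?thesis using g(4) by simp
   qed
  qed
 qed
 then have "\<forall>\<^sub>F m in sequentially. L2_norm lborel (\<lambda>q. c m *\<^sub>R g (?T m q) - g q) < E / 2"
  using \<open>0 < E\<close> by (intro order_tendstoD(2)) auto
 then obtain M where M: "\<And>m. m \<ge> M ==> L2_norm lborel (\<lambda>q. c m *\<^sub>R g (?T m q) - g q) < E / 2"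
  by (auto simp: eventually_sequentially)
 show "\<exists>no. \<forall>m\<ge>no. norm (L2_norm lborel (\<lambda>q. c m *\<^sub>R K (?T m q) - K q) - 0) < E"
 proof (intro exI[of _ M] allI impI)
  fix m assume "m \<ge> M"
  define d where "d q = K q - g q" for q
  have d: "d \<in> Lebesgue2 lborel" unfolding d_def by (rule Lebesgue2_diff[OF K g(5)])
  have nd: "L2_norm lborel d < C" unfolding d_def using g(6) by (subst L2_norm_diff_commute)
  have "L2_norm lborel (\<lambda>q. c m *\<^sub>R K (?T m q) - K q)
    \<le> L2_norm lborel (\<lambda>q. c m *\<^sub>R d (?T m q) - d q) + L2_norm lborel (\<lambda>q. c m *\<^sub>R g (?T m q) - g q)" using L2_norm_triangle[OF L2_dilation_bound(1)[OF d c(1)[of m] c(2)[of m] moll_eps(2)[of m], of p] L2_dilation_bound(1)[OF g(5) c(1)[of m] c(2)[of m] moll_eps(2)[of m], of p]] by (simp add: d_def algebra_simps)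
  also have "\<dots> < (sqrt (2 ^ DIM('a)) + 1) * C + E / 2"
  proof (rule add_le_less_mono)
   show "L2_norm lborel (\<lambda>q. c m *\<^sub>R d (?T m q) - d q) \<le> (sqrt (2 ^ DIM('a)) + 1) * C"
    using L2_dilation_bound(2)[OF d c(1)[of m] c(2)[of m] moll_eps(2)[of m], of p] mult_left_mono[OF less_imp_le[OF nd] less_imp_le[OF s]]
    by linarith
  qed (rule M[OF \<open>m \<ge> M\<close>])
  also have "(sqrt (2 ^ DIM('a)) + 1) * C = E / 2"
  proof -
   have "x * (E / (2 * x)) = E / 2" if "0 < x" for x :: real using that by simp
   from this[OF s] show ?thesis by (simp only: C_def)
  qed
  finally show "norm (L2_norm lborel (\<lambda>q. c m *\<^sub>R K (?T m q) - K q) - 0) < E" by simp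
 qed
qed

text \<open>The centre of dilation is left general: \<open>p z = z\<close> serves the L2 norm of a
  function, \<open>p z = (z, z)\<close> that of a kernel on pairs of points. The uniform dilation
  bound dominates the integrand in z.\<close>

lemma averaged_dilation_tendsto:
 fixes K :: "'a::euclidean_space => 'b::euclidean_space" and p :: "'c::euclidean_space => 'a"
 assumes K: "K \<in> Lebesgue2 lborel" and c: "\<And>m. 0 \<le> c m" "\<And>m. c m \<le> 1" "c \<longlonglongrightarrow> 1"
  and Q: "integrable lborel Q" and [measurable]: "p \<in> borel_measurable borel"
 shows "(\<lambda>m. \<integral>\<^sup>+z. ennreal (Q z) * nn2 lborel (\<lambda>q. c m *\<^sub>R K ((1 - moll_eps m) *\<^sub>R q + moll_eps m *\<^sub>R p z) - K q) \<partial>lborel) \<longlonglongrightarrow> 0"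
proof -
 have [measurable]: "K \<in> borel_measurable borel" using K by (simp add: Lebesgue2_def)
 have [measurable]: "Q \<in> borel_measurable borel" using borel_measurable_integrable[OF Q] by simp
 define B where "B = ((sqrt (2 ^ DIM('a)) + 1) * L2_norm lborel K)\<^sup>2"
 let ?N = "\<lambda>m z. nn2 lborel (\<lambda>q. c m *\<^sub>R K ((1 - moll_eps m) *\<^sub>R q + moll_eps m *\<^sub>R p z) - K q)"
 note N = nn_integral_norm2[OF L2_dilation_bound(1)[OF K c(1,2) moll_eps(2)]]
 have "(\<lambda>m. \<integral>\<^sup>+z. ennreal (Q z) * ?N m z \<partial>lborel) \<longlonglongrightarrow> (\<integral>\<^sup>+z. 0 \<partial>(lborel :: 'c measure))"
 proof (rule nn_integral_dominated_convergence[where w = "\<lambda>z. ennreal (Q z) * ennreal B"])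
  show "(\<lambda>z. ennreal (Q z) * ?N m z) \<in> borel_measurable lborel" for m by simp
  show "AE z in lborel. ennreal (Q z) * ?N m z \<le> ennreal (Q z) * ennreal B" for m unfolding N B_def
   by (intro AE_I2 mult_left_mono ennreal_leI power_mono L2_dilation_bound(2)[OF K c(1,2) moll_eps(2)]) auto
  have "(\<integral>\<^sup>+z. ennreal (Q z) \<partial>lborel) \<le> (\<integral>\<^sup>+z. ennreal (norm (Q z)) \<partial>lborel)" by (intro nn_integral_mono) simp
  also have "\<dots> < \<infinity>" using Q by (simp add: integrable_iff_bounded)
  finally show "(\<integral>\<^sup>+z. ennreal (Q z) * ennreal B \<partial>lborel) < \<infinity>" by (simp add: nn_integral_multc ennreal_mult_less_top)
  show "AE z in lborel. (\<lambda>m. ennreal (Q z) * ?N m z) \<longlonglongrightarrow> 0"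
  proof (rule AE_I2)
   fix z
   have "(\<lambda>m. ennreal ((L2_norm lborel (\<lambda>q. c m *\<^sub>R K ((1 - moll_eps m) *\<^sub>R q + moll_eps m *\<^sub>R p z) - K q))\<^sup>2)) \<longlonglongrightarrow> ennreal (0\<^sup>2)"
    by (intro tendsto_intros L2_dilation_tendsto[OF K c])
   then have "(\<lambda>m. ?N m z) \<longlonglongrightarrow> 0" by (simp add: N)
   then have "(\<lambda>m. ennreal (Q z) * ?N m z) \<longlonglongrightarrow> ennreal (Q z) * 0" by (intro ennreal_tendsto_cmult) auto
   then show "(\<lambda>m. ennreal (Q z) * ?N m z) \<longlonglongrightarrow> 0" by simp
  qed
 qed measurable
 then show ?thesis by simp
qed

text \<open>Cauchy-Schwarz with \<open>Q\<close>, a probability density, split into two square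
  roots. Without integrability the left side is 0 by the convention for the Bochner
  integral.\<close>

lemma Jensen_square:
 assumes [measurable]: "F \<in> borel_measurable M" "Q \<in> borel_measurable M" and Q: "\<And>z. 0 \<le> Q z" "(\<integral>\<^sup>+z. ennreal (Q z) \<partial>M) = 1"
 shows "ennreal ((norm (LINT z|M. Q z *\<^sub>R F z))\<^sup>2) \<le> (\<integral>\<^sup>+z. ennreal (Q z) * ennreal ((norm (F z))\<^sup>2) \<partial>M)"
proof (cases "integrable M (\<lambda>z. Q z *\<^sub>R F z)")
 case True
 have "ennreal (norm (LINT z|M. Q z *\<^sub>R F z)) \<le> (\<integral>\<^sup>+z. norm (Q z *\<^sub>R F z) \<partial>M)" using True by (rule integral_norm_bound_ennreal)
 also have "\<dots> = (\<integral>\<^sup>+z. ennreal (sqrt (Q z)) * ennreal (sqrt (Q z) * norm (F z)) \<partial>M)"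
  using Q(1) by (intro nn_integral_cong) (simp add: ennreal_mult[symmetric])
 finally have "(ennreal (norm (LINT z|M. Q z *\<^sub>R F z)))\<^sup>2
   \<le> (\<integral>\<^sup>+z. ennreal (sqrt (Q z)) * ennreal (sqrt (Q z) * norm (F z)) \<partial>M)\<^sup>2" by (rule power_mono) simp
 also have "\<dots> \<le> (\<integral>\<^sup>+z. (ennreal (sqrt (Q z)))\<^sup>2 \<partial>M) * (\<integral>\<^sup>+z. (ennreal (sqrt (Q z) * norm (F z)))\<^sup>2 \<partial>M)"
  by (rule Cauchy_Schwarz_nn_integral) measurable
 also have "\<dots> = (\<integral>\<^sup>+z. ennreal (Q z) * ennreal ((norm (F z))\<^sup>2) \<partial>M)"
  using Q by (simp add: ennreal_power power_mult_distrib ennreal_mult)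
 finally show ?thesis by (simp add: ennreal_power)
next
 case False
 then show ?thesis by (simp add: not_integrable_integral_eq)
qed

lemma partial_affine:
 assumes "smooth f" shows "partial i (\<lambda>x. f (c *\<^sub>R x + b)) x = c *\<^sub>R partial i f (c *\<^sub>R x + b)"
proof -
 have d: "((\<lambda>x. f (c *\<^sub>R x + b)) has_derivative (\<lambda>v. frechet_derivative f (at (c *\<^sub>R x + b)) (c *\<^sub>R v))) (at x)"
  by (rule has_derivative_compose[of "\<lambda>x. c *\<^sub>R x + b"])
   (use smooth_differentiable[OF assms] in \<open>auto simp: frechet_derivative_works intro!: derivative_eq_intros\<close>)
 have "linear (frechet_derivative f (at (c *\<^sub>R x + b)))"
  using smooth_differentiable[OF assms] by (intro linear_frechet_derivative)
 then show ?thesis by (simp only: partial_eq[OF d] linear_cmul) (simp only: partial_def)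
qed

lemma tendsto_0_of_ennreal_square:
 assumes "\<And>m. 0 \<le> a m" "\<And>m. ennreal ((a m)\<^sup>2) \<le> b m" "b \<longlonglongrightarrow> 0" shows "a \<longlonglongrightarrow> 0"
proof -
 have "(\<lambda>m. ennreal ((a m)\<^sup>2)) \<longlonglongrightarrow> ennreal 0" by (rule tendsto_sandwich[OF _ _ tendsto_const[of "ennreal 0"]]) (use assms in auto)
 then have "(\<lambda>m. (a m)\<^sup>2) \<longlonglongrightarrow> 0" by (subst (asm) tendsto_ennreal_iff) auto
 then show ?thesis by simp
qed

lemma nn_integral_lebesgue_on_borel:
 assumes [measurable]: "f \<in> borel_measurable borel" "U \<in> sets borel"
 shows "(\<integral>\<^sup>+x. f x \<partial>leb U) = (\<integral>\<^sup>+x. f x * indicator U x \<partial>lborel)"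
proof -
 have "(\<integral>\<^sup>+x. f x \<partial>leb U) = (\<integral>\<^sup>+x. f x * indicator U x \<partial>lebesgue)" by (intro nn_integral_restrict_space) auto
 also have "\<dots> = (\<integral>\<^sup>+x. f x * indicator U x \<partial>lborel)" by (rule nn_integral_completion) measurable
 finally show ?thesis .
qed

text \<open>Vanishing outside \<open>U\<close> lets integrals over \<open>U\<close> be written over
  the whole space, where affine substitutions are available.\<close>

lemma L2_borel_representative:
 assumes u: "u \<in> L2 U" and U: "U \<in> sets borel"
 obtains w where "w \<in> Lebesgue2 lborel" "AE x in leb U. u x = w x" "\<forall>x. x \<notin> U \<longrightarrow> w x = 0"
proof -
 have U': "U \<in> sets lebesgue" using U by simp
 have "(\<lambda>x. indicator U x *\<^sub>R u x) \<in> borel_measurable lebesgue"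
  using u U' by (subst borel_measurable_restrict_space_iff[symmetric]) (auto simp: L2_def Lebesgue2_def)
 then obtain w0 where w0: "w0 \<in> borel_measurable lborel" "AE x in lebesgue. indicator U x *\<^sub>R u x = w0 x"
  by (rule borel_representative)
 define w where "w x = indicator U x *\<^sub>R w0 x" for x
 have [measurable]: "w0 \<in> borel_measurable borel" using w0(1) by simp
 have [measurable]: "w \<in> borel_measurable borel" unfolding w_def using U by measurable
 have ae: "AE x in leb U. u x = w x" using w0(2) U' by (subst AE_restrict_space_iff) (auto simp: w_def elim!:)
 have "nn2 lborel w = (\<integral>\<^sup>+x. ennreal ((norm (w x))\<^sup>2) * indicator U x \<partial>lborel)"
  by (intro nn_integral_cong) (simp add: w_def indicator_def)
 also have "\<dots> = nn2 (leb U) w" by (rule nn_integral_lebesgue_on_borel[symmetric]) (use U in auto)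
 also have "\<dots> = nn2 (leb U) u" by (rule nn_integral_cong_AE) (use ae in \<open>eventually_elim, simp\<close>)
 also have "\<dots> < \<infinity>" using nn_integral_norm2[OF u[unfolded L2_def]] by simp
 finally have "w \<in> Lebesgue2 lborel" by (intro Lebesgue2I_nn) auto
 then show ?thesis using ae by (rule that) (simp add: w_def)
qed

text \<open>Substituting y = (1 - e) x + e z, with e = \<open>moll_eps m\<close>, gives the average
  of \<open>u\<close> at (1 - e) x + e z with weight \<open>Q z\<close>. On a convex set these
  points stay inside, even for x on the boundary, so \<open>u\<close> needs no extension. In the
  form chosen here x enters only through the smooth kernel, which makes the result smooth on the
  whole space.\<close>

definition moll :: "(real^'n) set => (real^'n => real) => nat => (real^'n => 'b::euclidean_space) => real^'n => 'b" where
 "moll U Q m u x = (1 / moll_eps m ^ CARD('n)) *\<^sub>R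
   (LINT y|leb U. Q ((- (1 - moll_eps m) / moll_eps m) *\<^sub>R x + (1 / moll_eps m) *\<^sub>R y) *\<^sub>R u y)"

locale mollifier =
 fixes U :: "(real^'n) set" and Q :: "real^'n => real"
 assumes U: "open U" "convex U" "bounded U" and Q: "Q \<in> test_functions U" "\<And>z. 0 \<le> Q z" "(LINT z|lborel. Q z) = 1"
begin

lemma U_borel [measurable]: "U \<in> sets borel" using U(1) by simp

lemma Q_borel [measurable]: "Q \<in> borel_measurable borel" by (rule test_borel[OF Q(1)])

lemma Q_nn: "(\<integral>\<^sup>+z. ennreal (Q z) \<partial>lborel) = 1" using nn_integral_eq_integral[OF test_integrable[OF Q(1)]] Q(2,3) by simp

lemma LINT_representative:
 fixes u :: "real^'n => 'b::euclidean_space"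
 assumes w: "w \<in> borel_measurable borel" "AE x in leb U. u x = w x" "\<And>x. x \<notin> U ==> w x = 0" and u: "u \<in> borel_measurable (leb U)"
  and Z: "Z \<in> borel_measurable borel" shows "(LINT y|leb U. Z y *\<^sub>R u y) = (LINT y|lborel. Z y *\<^sub>R w y)"
proof -
 have [measurable]: "w \<in> borel_measurable borel" "Z \<in> borel_measurable borel" by fact+
 have sl: "Z \<in> borel_measurable (leb U)" "w \<in> borel_measurable (leb U)"
  by (rule measurable_restrict_space1, rule measurable_completion, simp)+
 have "(LINT y|leb U. Z y *\<^sub>R u y) = (LINT y|leb U. Z y *\<^sub>R w y)"
  by (rule integral_cong_AE) (use w(2) u sl in \<open>auto intro: borel_measurable_scaleR\<close>)
 also have "\<dots> = (LINT y|lborel. Z y *\<^sub>R w y)" by (rule LINT_lebesgue_on_borel) (use U(1) w(3) in auto)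
 finally show ?thesis .
qed

lemma integrable_of_L2_rep:
 assumes w: "w \<in> Lebesgue2 lborel" "\<And>x. x \<notin> U ==> w x = 0" shows "integrable lborel w"
proof -
 have "(\<lambda>x. indicator U x :: real) \<in> Lebesgue2 lborel"
 proof (rule Lebesgue2I)
  have "integrable lborel (indicator U :: real^'n => real)"
   using emeasure_bounded_finite[OF U(3)] by (intro integrable_real_indicator) auto
  also have "indicator U = (\<lambda>x. (norm (indicator U x :: real))\<^sup>2)" by (auto simp: indicator_def)
  finally show "integrable lborel (\<lambda>x. (norm (indicator U x :: real))\<^sup>2)" .
 qed measurable
 from L2_pairing_integrable[OF bounded_bilinear_scaleR this w(1)]
 have "integrable lborel (\<lambda>x. indicator U x *\<^sub>R w x)" .
 also have "(\<lambda>x. indicator U x *\<^sub>R w x) = w" using w(2) by (auto simp: indicator_def)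
 finally show ?thesis .
qed

text \<open>As a function of y the kernel lives on the compact set (1 - e) x + e K, which convexity
  keeps inside \<open>U\<close>. Weak derivatives of \<open>u\<close> may therefore be tested with
  it.\<close>

lemma moll_kernel_test:
 assumes "x \<in> U" shows "(\<lambda>y. Q ((- (1 - moll_eps m) / moll_eps m) *\<^sub>R x + (1 / moll_eps m) *\<^sub>R y)) \<in> test_functions U"
proof -
 obtain K where K: "compact K" "K \<subseteq> U" "\<And>x. x \<notin> K ==> Q x = 0" "smooth Q" using Q(1) by (auto simp: test_functions_def)
 let ?e = "moll_eps m"
 let ?K = "(\<lambda>z. (1 - ?e) *\<^sub>R x + ?e *\<^sub>R z) ` K"
 have e: "0 < ?e" "?e \<le> 1/2" by (rule moll_eps)+
 show ?thesis
 proof (rule test_functionsI)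
  show "smooth (\<lambda>y. Q ((- (1 - ?e) / ?e) *\<^sub>R x + (1 / ?e) *\<^sub>R y))"
   using smooth_affine[OF K(4), of "1 / ?e" "(- (1 - ?e) / ?e) *\<^sub>R x"] by (simp add: add.commute)
  show "compact ?K" by (intro compact_continuous_image K(1) continuous_intros)
  show "?K \<subseteq> U" using K(2) assms e by (auto intro!: convexD[OF U(2)])
  fix y assume y: "y \<notin> ?K"
  let ?z = "(- (1 - ?e) / ?e) *\<^sub>R x + (1 / ?e) *\<^sub>R y"
  have "(1 - ?e) *\<^sub>R x + ?e *\<^sub>R ?z = y" using e by (simp add: scaleR_add_right scaleR_diff_left)
  then have "?z \<notin> K" using y by (metis image_eqI)
  then show "Q ?z = 0" by (rule K(3))
 qed
qed

context
 fixes u w :: "real^'n => 'b::euclidean_space"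
 assumes u: "u \<in> L2 U" and w: "w \<in> Lebesgue2 lborel" "AE x in leb U. u x = w x" "\<And>x. x \<notin> U ==> w x = 0"
begin

lemma w_borel [measurable]: "w \<in> borel_measurable borel" using w(1) by (simp add: Lebesgue2_def)

lemma u_meas: "u \<in> borel_measurable (leb U)" using u by (simp add: L2_def Lebesgue2_def)

lemma w_integrable: "integrable lborel w" by (rule integrable_of_L2_rep[OF w(1)]) (rule w(3))

lemma LINT_rep: "Z \<in> borel_measurable borel ==> (LINT y|leb U. Z y *\<^sub>R u y) = (LINT y|lborel. Z y *\<^sub>R w y)"
 by (rule LINT_representative[OF w_borel w(2) _ u_meas]) (rule w(3))

lemma moll_eq_lborel:
 "moll U Q m u x = (1 / moll_eps m ^ CARD('n)) *\<^sub>R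
   (LINT y|lborel. Q ((- (1 - moll_eps m) / moll_eps m) *\<^sub>R x + (1 / moll_eps m) *\<^sub>R y) *\<^sub>R w y)"
 unfolding moll_def by (subst LINT_rep) measurable

lemma moll_smooth': "smooth (moll U Q m u)" unfolding moll_eq_lborel[abs_def]
 by (intro smooth_linear[OF bounded_linear_scaleR_right] smooth_param_integral(1)[OF Q(1) w_integrable])

lemma moll_partial':
 "partial j (moll U Q m u) x = (1 / moll_eps m ^ CARD('n)) *\<^sub>R ((- (1 - moll_eps m) / moll_eps m) *\<^sub>R
   (LINT y|leb U. partial j Q ((- (1 - moll_eps m) / moll_eps m) *\<^sub>R x + (1 / moll_eps m) *\<^sub>R y) *\<^sub>R u y))"
proof -
 note [measurable] = test_borel[OF test_functions_partial[OF Q(1)]]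
 note sp = smooth_param_integral[OF Q(1) w_integrable]
 have "partial j (moll U Q m u) x = (1 / moll_eps m ^ CARD('n)) *\<^sub>R ((- (1 - moll_eps m) / moll_eps m) *\<^sub>R
   (LINT y|lborel. partial j Q ((- (1 - moll_eps m) / moll_eps m) *\<^sub>R x + (1 / moll_eps m) *\<^sub>R y) *\<^sub>R w y))"
  unfolding moll_eq_lborel[abs_def] by (subst partial_linear[OF bounded_linear_scaleR_right sp(1)]) (simp only: sp(2))
 also have "(LINT y|lborel. partial j Q ((- (1 - moll_eps m) / moll_eps m) *\<^sub>R x + (1 / moll_eps m) *\<^sub>R y) *\<^sub>R w y)
   = (LINT y|leb U. partial j Q ((- (1 - moll_eps m) / moll_eps m) *\<^sub>R x + (1 / moll_eps m) *\<^sub>R y) *\<^sub>R u y)"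
  by (subst LINT_rep) measurable
 finally show ?thesis .
qed

lemma avg_integrable: "integrable lborel (\<lambda>z. Q z *\<^sub>R w ((1 - moll_eps m) *\<^sub>R x + moll_eps m *\<^sub>R z))"
proof -
 obtain B where B: "\<And>x. norm (Q x) \<le> B" using test_bounded[OF Q(1)] by blast
 have i: "integrable lborel (\<lambda>z. w ((1 - moll_eps m) *\<^sub>R x + moll_eps m *\<^sub>R z))"
  using integrable_lborel_affine[OF w_integrable] moll_eps(1)[of m] by simp
 show ?thesis
 proof (rule bochner_bound)
  show "integrable lborel (\<lambda>z. B * norm (w ((1 - moll_eps m) *\<^sub>R x + moll_eps m *\<^sub>R z)))" using i by simp
  show "AE z in lborel. norm (Q z *\<^sub>R w ((1 - moll_eps m) *\<^sub>R x + moll_eps m *\<^sub>R z))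
   \<le> norm (B * norm (w ((1 - moll_eps m) *\<^sub>R x + moll_eps m *\<^sub>R z)))"
  proof (rule AE_I2)
   fix z
   have "norm (Q z *\<^sub>R w ((1 - moll_eps m) *\<^sub>R x + moll_eps m *\<^sub>R z)) \<le> B * norm (w ((1 - moll_eps m) *\<^sub>R x + moll_eps m *\<^sub>R z))"
    unfolding norm_scaleR using B[of z] by (intro mult_right_mono) auto
   then show "norm (Q z *\<^sub>R w ((1 - moll_eps m) *\<^sub>R x + moll_eps m *\<^sub>R z))
     \<le> norm (B * norm (w ((1 - moll_eps m) *\<^sub>R x + moll_eps m *\<^sub>R z)))" by simp
  qed
 qed measurable
qed

lemma moll_eq_avg:
 "moll U Q m u x = (LINT z|lborel. Q z *\<^sub>R w ((1 - moll_eps m) *\<^sub>R x + moll_eps m *\<^sub>R z))"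
proof -
 let ?e = "moll_eps m"
 let ?F = "\<lambda>y. Q ((- (1 - ?e) / ?e) *\<^sub>R x + (1 / ?e) *\<^sub>R y) *\<^sub>R w y"
 have e: "0 < ?e" by (rule moll_eps)
 have "(LINT y|lborel. ?F y) = (\<bar>?e\<bar> ^ DIM(real^'n)) *\<^sub>R (LINT z|lborel. ?F ((1 - ?e) *\<^sub>R x + ?e *\<^sub>R z))"
  by (rule integral_lborel_affine) (use e in auto)
 moreover have "?F ((1 - ?e) *\<^sub>R x + ?e *\<^sub>R z) = Q z *\<^sub>R w ((1 - ?e) *\<^sub>R x + ?e *\<^sub>R z)" for z
 proof -
  have "(- (1 - ?e) / ?e) *\<^sub>R x + (1 / ?e) *\<^sub>R ((1 - ?e) *\<^sub>R x + ?e *\<^sub>R z) = z"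
   using e by (simp add: scaleR_add_right scaleR_add_left[symmetric] add_divide_distrib[symmetric])
  then show ?thesis by simp
 qed
 ultimately have "(LINT y|lborel. ?F y) = (\<bar>?e\<bar> ^ DIM(real^'n)) *\<^sub>R (LINT z|lborel. Q z *\<^sub>R w ((1 - ?e) *\<^sub>R x + ?e *\<^sub>R z))"
  by (simp only:)
 then show ?thesis unfolding moll_eq_lborel using e by (simp only:) simp
qed

lemma moll_diff_eq:
 "moll U Q m u x - w x = (LINT z|lborel. Q z *\<^sub>R (w ((1 - moll_eps m) *\<^sub>R x + moll_eps m *\<^sub>R z) - w x))"
proof -
 show ?thesis using Q(3) avg_integrable[of m x] test_integrable[OF Q(1)] by (simp add: scaleR_diff_right moll_eq_avg)
qed

text \<open>Jensen's inequality moves the square inside the average over z. After Fubini there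
  remains an average of dilation errors of the whole function, and each of these tends to 0.\<close>

lemma moll_L2_tendsto': "L2_conv (leb U) (\<lambda>m. moll U Q m u) u"
proof (rule tendsto_0_of_ennreal_square)
 let ?b = "\<lambda>m. \<integral>\<^sup>+z. ennreal (Q z) * nn2 lborel (\<lambda>q. 1 *\<^sub>R w ((1 - moll_eps m) *\<^sub>R q + moll_eps m *\<^sub>R z) - w q) \<partial>lborel"
 show "?b \<longlonglongrightarrow> 0" by (rule averaged_dilation_tendsto[OF w(1), of "\<lambda>_. 1" Q "\<lambda>z. z"]) (auto simp: test_integrable[OF Q(1)])
 fix m
 note mu = smooth_borel[OF moll_smooth']
 have mL2: "moll U Q m u \<in> L2 U" by (rule bounded_smooth_L2[OF smooth_continuous[OF moll_smooth'] U(3)]) (use U in auto)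
 have "ennreal ((L2_norm (leb U) (\<lambda>x. moll U Q m u x - u x))\<^sup>2) = nn2 (leb U) (\<lambda>x. moll U Q m u x - u x)"
  using u mL2 by (intro nn_integral_norm2[symmetric]) (auto simp: L2_def)
 also have "\<dots> = nn2 (leb U) (\<lambda>x. moll U Q m u x - w x)" by (rule nn_integral_cong_AE) (use w(2) in \<open>eventually_elim, simp\<close>)
 also have "\<dots> = (\<integral>\<^sup>+x. ennreal ((norm (moll U Q m u x - w x))\<^sup>2) * indicator U x \<partial>lborel)"
  by (rule nn_integral_lebesgue_on_borel) (use mu in measurable)
 also have "\<dots> \<le> (\<integral>\<^sup>+x. (\<integral>\<^sup>+z. ennreal (Q z) * ennreal ((norm (w ((1 - moll_eps m) *\<^sub>R x + moll_eps m *\<^sub>R z) - w x))\<^sup>2) \<partial>lborel) \<partial>lborel)"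
 proof (rule nn_integral_mono)
  fix x
  have "ennreal ((norm (moll U Q m u x - w x))\<^sup>2) * indicator U x \<le> ennreal ((norm (moll U Q m u x - w x))\<^sup>2)"
   by (auto simp: indicator_def)
  also have "\<dots> \<le> (\<integral>\<^sup>+z. ennreal (Q z) * ennreal ((norm (w ((1 - moll_eps m) *\<^sub>R x + moll_eps m *\<^sub>R z) - w x))\<^sup>2) \<partial>lborel)"
   unfolding moll_diff_eq by (rule Jensen_square) (use Q(2) Q_nn in auto)
  finally show "ennreal ((norm (moll U Q m u x - w x))\<^sup>2) * indicator U x
    \<le> (\<integral>\<^sup>+z. ennreal (Q z) * ennreal ((norm (w ((1 - moll_eps m) *\<^sub>R x + moll_eps m *\<^sub>R z) - w x))\<^sup>2) \<partial>lborel)" .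
 qed
 also have "\<dots> = (\<integral>\<^sup>+z. (\<integral>\<^sup>+x. ennreal (Q z) * ennreal ((norm (w ((1 - moll_eps m) *\<^sub>R x + moll_eps m *\<^sub>R z) - w x))\<^sup>2) \<partial>lborel) \<partial>lborel)"
  by (rule lborel_pair.Fubini'[symmetric]) measurable
 also have "\<dots> = ?b m" by (simp add: nn_integral_cmult)
 finally show "ennreal ((L2_norm (leb U) (\<lambda>x. moll U Q m u x - u x))\<^sup>2) \<le> ?b m" .
qed simp

end

lemma moll_smooth:
 assumes u: "u \<in> L2 U" shows "smooth (moll U Q m u)"
proof -
 obtain w where w: "w \<in> Lebesgue2 lborel" "AE x in leb U. u x = w x" "\<forall>x. x \<notin> U \<longrightarrow> w x = 0"
  by (rule L2_borel_representative[OF u U_borel])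
 show ?thesis by (rule moll_smooth'[OF u w(1,2)]) (use w(3) in blast)
qed

lemma moll_L2_tendsto:
 assumes u: "u \<in> L2 U" shows "L2_conv (leb U) (\<lambda>m. moll U Q m u) u"
proof -
 obtain w where w: "w \<in> Lebesgue2 lborel" "AE x in leb U. u x = w x" "\<forall>x. x \<notin> U \<longrightarrow> w x = 0"
  by (rule L2_borel_representative[OF u U_borel])
 show ?thesis by (rule moll_L2_tendsto'[OF u w(1,2)]) (use w(3) in blast)
qed

lemma moll_L2: "u \<in> L2 U ==> moll U Q m u \<in> L2 U"
 by (rule bounded_smooth_L2[OF smooth_continuous[OF moll_smooth] U(3)]) (use U in auto)

lemma moll_linear:
 assumes u: "u \<in> L2 U" and h: "bounded_linear h" and x: "x \<in> U" shows "moll U Q m (\<lambda>x. h (u x)) x = h (moll U Q m u x)"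
proof -
 interpret h: bounded_linear h by fact
 have "U \<in> sets lebesgue" by auto
 from integral_bounded_linear[OF h test_mult_integrable[OF U(1) locally_integrable_L2[OF u this] moll_kernel_test[OF x, of m]]]
 show ?thesis unfolding moll_def by (simp only: h.scaleR)
qed

text \<open>Differentiating the kernel in x gives -(1 - e) times its derivative in y, and the latter
  is moved onto \<open>u\<close> by the weak divergence. Only the sum over j can be treated, since a
  single \<open>u j\<close> need have no weak derivatives.\<close>

lemma moll_div:
 fixes u :: "'n => real^'n => 'b::euclidean_space"
 assumes div: "weak_div U u D" and u: "\<And>j. u j \<in> L2 U" and x: "x \<in> U"
 shows "(\<Sum>j\<in>UNIV. partial j (moll U Q m (u j)) x) = (1 - moll_eps m) *\<^sub>R moll U Q m D x"
proof -
 let ?e = "moll_eps m"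
 let ?k = "\<lambda>y. (- (1 - ?e) / ?e) *\<^sub>R x + (1 / ?e) *\<^sub>R y"
 have e: "0 < ?e" by (rule moll_eps)
 define W where "W y = Q (?k y)" for y
 have W: "W \<in> test_functions U" unfolding W_def[abs_def] by (rule moll_kernel_test[OF x])
 have d: "partial j Q (?k y) = ?e * partial j W y" for j y
  using partial_affine[OF test_smooth[OF Q(1)], of j "1 / ?e" "(- (1 - ?e) / ?e) *\<^sub>R x" y] e
  by (simp add: W_def[abs_def] add.commute)
 have p: "partial j (moll U Q m (u j)) x = (1 / ?e ^ CARD('n)) *\<^sub>R ((- (1 - ?e) / ?e) *\<^sub>R
   (LINT y|leb U. partial j Q (?k y) *\<^sub>R u j y))" for j
 proof -
  obtain w where w: "w \<in> Lebesgue2 lborel" "AE x in leb U. u j x = w x" "\<forall>x. x \<notin> U \<longrightarrow> w x = 0"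
   by (rule L2_borel_representative[OF u[of j] U_borel])
  show ?thesis by (rule moll_partial'[OF u[of j] w(1,2)]) (use w(3) in blast)
 qed
 have "(\<Sum>j\<in>UNIV. LINT y|leb U. partial j Q (?k y) *\<^sub>R u j y) = ?e *\<^sub>R (\<Sum>j\<in>UNIV. LINT y|leb U. partial j W y *\<^sub>R u j y)"
  unfolding d by (simp add: scaleR_sum_right flip: scaleR_scaleR)
 also have "\<dots> = - (?e *\<^sub>R (LINT y|leb U. W y *\<^sub>R D y))" using div W by (simp add: weak_div_def)
 finally have s: "(\<Sum>j\<in>UNIV. LINT y|leb U. partial j Q (?k y) *\<^sub>R u j y) = - (?e *\<^sub>R (LINT y|leb U. W y *\<^sub>R D y))" .
 have "(\<Sum>j\<in>UNIV. partial j (moll U Q m (u j)) x) = (1 / ?e ^ CARD('n)) *\<^sub>R ((- (1 - ?e) / ?e) *\<^sub>R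
   (\<Sum>j\<in>UNIV. LINT y|leb U. partial j Q (?k y) *\<^sub>R u j y))" unfolding p by (simp only: scaleR_sum_right)
 also have "\<dots> = (1 - ?e) *\<^sub>R moll U Q m D x"
 proof -
  have 1: "1 / ?e ^ CARD('n) * (- (1 - ?e) / ?e * - ?e) = (1 - ?e) * (1 / ?e ^ CARD('n))" using e by simp
  have 2: "- (?e *\<^sub>R I) = (- ?e) *\<^sub>R I" for I :: 'b by simp
  show ?thesis unfolding s moll_def W_def by (simp only: 2 scaleR_scaleR 1)
 qed
 finally show ?thesis .
qed

lemma moll_partial:
 fixes u :: "real^'n => 'b::euclidean_space"
 assumes g: "is_weak_partial U i u g" and u: "u \<in> L2 U" and x: "x \<in> U"
 shows "partial i (moll U Q m u) x = (1 - moll_eps m) *\<^sub>R moll U Q m g x"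
proof -
 have z: "moll U Q m (\<lambda>x. 0::'b) = (\<lambda>x. 0)" by (rule ext) (simp add: moll_def)
 have "(\<Sum>j\<in>UNIV. partial j (moll U Q m (if j = i then u else (\<lambda>x. 0))) x) = (1 - moll_eps m) *\<^sub>R moll U Q m g x"
  by (rule moll_div[OF weak_div_of_partial[OF g] _ x]) (use u in \<open>auto simp: L2_def\<close>)
 moreover have "(\<Sum>j\<in>UNIV. partial j (moll U Q m (if j = i then u else (\<lambda>x. 0))) x)
   = (\<Sum>j\<in>UNIV. if j = i then partial j (moll U Q m u) x else 0)" by (rule sum.cong) (auto simp: z)
 ultimately show ?thesis by simp
qed

text \<open>The factor is the one produced by \<open>moll_div\<close>; it costs at most
  \<open>moll_eps m\<close> times the norm of \<open>u\<close>.\<close>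

lemma scaled_moll_L2_tendsto:
 assumes u: "u \<in> L2 U" shows "L2_conv (leb U) (\<lambda>m x. (1 - moll_eps m) *\<^sub>R moll U Q m u x) u"
proof (rule tendsto_zero_le[OF L2_norm_nonneg])
 let ?N = "L2_norm (leb U)"
 show "?N (\<lambda>x. (1 - moll_eps m) *\<^sub>R moll U Q m u x - u x) \<le> ?N (\<lambda>x. moll U Q m u x - u x) + moll_eps m * ?N u" for m
 proof -
  have L: "u \<in> Lebesgue2 (leb U)" "moll U Q m u \<in> Lebesgue2 (leb U)" using u moll_L2[OF u, of m] by (auto simp: L2_def)
  have "(\<lambda>x. (1 - moll_eps m) *\<^sub>R moll U Q m u x - u x)
    = (\<lambda>x. (1 - moll_eps m) *\<^sub>R (moll U Q m u x - u x) + (- moll_eps m) *\<^sub>R u x)" by (simp add: algebra_simps)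
  then have "?N (\<lambda>x. (1 - moll_eps m) *\<^sub>R moll U Q m u x - u x)
   \<le> ?N (\<lambda>x. (1 - moll_eps m) *\<^sub>R (moll U Q m u x - u x)) + ?N (\<lambda>x. (- moll_eps m) *\<^sub>R u x)"
   using L2_norm_triangle[OF Lebesgue2_scaleR[OF Lebesgue2_diff[OF L(2,1)], of "1 - moll_eps m"]
     Lebesgue2_scaleR[OF L(1), of "- moll_eps m"]] by (simp only:)
  also have "\<dots> \<le> 1 * ?N (\<lambda>x. moll U Q m u x - u x) + moll_eps m * ?N u"
   unfolding L2_norm_scaleR using moll_eps(1,2)[of m] by (intro add_mono mult_right_mono) auto
  finally show ?thesis by simp
 qed
 have "(\<lambda>m. ?N (\<lambda>x. moll U Q m u x - u x) + moll_eps m * ?N u) \<longlonglongrightarrow> 0 + 0 * ?N u"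
  by (intro tendsto_intros moll_L2_tendsto[OF u] moll_eps(3))
 then show "(\<lambda>m. ?N (\<lambda>x. moll U Q m u x - u x) + moll_eps m * ?N u) \<longlonglongrightarrow> 0" by simp
qed

lemma moll_H1_tendsto:
 assumes u: "u \<in> H1 U" shows "(\<lambda>m. H1_norm U (\<lambda>x. moll U Q m u x - u x)) \<longlonglongrightarrow> 0"
proof (rule H1_norm_tendsto_0)
 have uL: "u \<in> L2 U" by (rule H1_L2[OF u])
 show "L2_conv (leb U) (\<lambda>m. moll U Q m u) u" by (rule moll_L2_tendsto[OF uL])
 fix i
 let ?g = "weak_partial U i u"
 have g: "is_weak_partial U i u ?g" "?g \<in> L2 U" using H1_weak_partial[OF u] H1_weak_partial_L2[OF U(1) u] by auto
 have "L2_norm (leb U) (weak_partial U i (\<lambda>x. moll U Q m u x - u x))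
   = L2_norm (leb U) (\<lambda>x. (1 - moll_eps m) *\<^sub>R moll U Q m ?g x - ?g x)" for m
 proof (rule L2_norm_cong_AE)
  have mH: "moll U Q m u \<in> H1 U" by (rule smooth_H1[OF moll_smooth[OF uL] U(3,1)])
  show "weak_partial U i (\<lambda>x. moll U Q m u x - u x) \<in> borel_measurable (leb U)"
   by (rule Lebesgue2_measurable[OF H1_weak_partial_L2[OF U(1) H1_diff[OF U(1) mH u], unfolded L2_def]])
  show "(\<lambda>x. (1 - moll_eps m) *\<^sub>R moll U Q m ?g x - ?g x) \<in> borel_measurable (leb U)"
   by (rule Lebesgue2_measurable[OF Lebesgue2_diff[OF Lebesgue2_scaleR[OF moll_L2[OF g(2), unfolded L2_def]] g(2)[unfolded L2_def]]])
  have "AE x in leb U. weak_partial U i (\<lambda>x. moll U Q m u x - u x) x = partial i (moll U Q m u) x - ?g x"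
   by (rule weak_partial_AE[OF U(1) is_weak_partial_diff[OF U(1) smooth_is_weak_partial[OF moll_smooth[OF uL] U(1)] g(1)]])
  moreover have "AE x in leb U. partial i (moll U Q m u) x = (1 - moll_eps m) *\<^sub>R moll U Q m ?g x"
   using moll_partial[OF g(1) uL] by (intro AE_I2) (auto simp: space_restrict_space)
  ultimately show "AE x in leb U. weak_partial U i (\<lambda>x. moll U Q m u x - u x) x = (1 - moll_eps m) *\<^sub>R moll U Q m ?g x - ?g x"
   by auto
 qed
 then show "(\<lambda>m. L2_norm (leb U) (weak_partial U i (\<lambda>x. moll U Q m u x - u x))) \<longlonglongrightarrow> 0"
  using scaled_moll_L2_tendsto[OF g(2)] by simp
qed

end

lemma mollifier_exists:
 assumes "open U" "convex U" "bounded U" "U \<noteq> {}"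
 obtains Q where "mollifier U Q"
proof -
 obtain a where "a \<in> U" using assms(4) by blast
 then obtain r where r: "0 < r" "cball a r \<subseteq> U" using assms(1) open_contains_cball by blast
 define c where "c = (LINT z|lborel. bump a r z)"
 have test: "bump a r \<in> test_functions U" by (rule test_functions_bump[OF r])
 have "c \<noteq> 0"
 proof
  assume "c = 0"
  then have "AE z in lborel. bump a r z = 0" using integral_nonneg_eq_0_iff_AE[OF test_integrable[OF test]] by (simp add: c_def)
  then have "AE z in lborel. z \<notin> ball a r" by eventually_elim (use bump_pos_iff[OF r(1), of a] in \<open>force simp: less_le\<close>)
  then have "ball a r \<in> null_sets lborel" by (simp add: AE_iff_null_sets)
  then show False using r(1) open_not_negligible[of "ball a r"] by (simp add: negligible_iff_null_sets null_sets_completionI)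
 qed
 moreover have "0 \<le> c" unfolding c_def by simp
 ultimately have c: "0 < c" by simp
 have "mollifier U (\<lambda>z. bump a r z *\<^sub>R (1 / c))"
 proof
  show "(\<lambda>z. bump a r z *\<^sub>R (1 / c)) \<in> test_functions U" by (rule test_functions_bilinear[OF bounded_bilinear_scaleR test]) simp
  show "(LINT z|lborel. bump a r z *\<^sub>R (1 / c)) = 1" using c by (simp add: c_def[symmetric])
 qed (use assms c in auto)
 then show ?thesis by (rule that)
qed

section \<open>Fractional Sobolev spaces\<close>

lemma gagliardo_cong_AE:
 assumes "AE x in leb U. u x = v x" shows "gagliardo s U u = gagliardo s U v" unfolding gagliardo_def
proof (rule nn_integral_cong_AE)
 show "AE x in leb U. (\<integral>\<^sup>+ y. ennreal ((norm (u x - u y))\<^sup>2 / norm (x - y) powr (real CARD('a) + 2 * s)) \<partial>leb U)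
  = (\<integral>\<^sup>+ y. ennreal ((norm (v x - v y))\<^sup>2 / norm (x - y) powr (real CARD('a) + 2 * s)) \<partial>leb U)" using assms
 proof eventually_elim
  case (elim x)
  note x = this
  show ?case
  proof (rule nn_integral_cong_AE)
   show "AE y in leb U. ennreal ((norm (u x - u y))\<^sup>2 / norm (x - y) powr (real CARD('a) + 2 * s))
    = ennreal ((norm (v x - v y))\<^sup>2 / norm (x - y) powr (real CARD('a) + 2 * s))" using assms by eventually_elim (simp add: x)
  qed
 qed
qed

text \<open>It carries half the exponent of the Gagliardo integrand, so that the seminorm is an L2
  norm over pairs of points. The kernel is linear in \<open>w\<close>, which reduces the triangle
  inequality, linear maps and mollification to facts about L2.\<close>

definition gag_kernel :: "real => (real^'n) set => (real^'n => 'b::euclidean_space) => (real^'n) \<times> (real^'n) => 'b" where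
 "gag_kernel s U w q = (indicator U (fst q) * indicator U (snd q) *
   norm (fst q - snd q) powr (- ((real CARD('n) + 2 * s) / 2))) *\<^sub>R (w (fst q) - w (snd q))"

lemma gag_kernel_borel [measurable]:
 assumes [measurable]: "w \<in> borel_measurable borel" "U \<in> sets borel" shows "gag_kernel s U w \<in> borel_measurable borel"
proof -
 have "gag_kernel s U w \<in> borel_measurable (borel \<Otimes>\<^sub>M borel)" unfolding gag_kernel_def[abs_def] by measurable
 then show ?thesis by (simp add: borel_prod)
qed

lemma gag_kernel_norm2:
 "(norm (gag_kernel s U w (x, y)))\<^sup>2 = ((norm (w x - w y))\<^sup>2 / norm (x - y) powr (real CARD('n) + 2 * s)) * indicator U y * indicator U x"
 for x :: "real^'n"
proof -
 have "(norm (x - y) powr (- ((real CARD('n) + 2 * s) / 2)))\<^sup>2 = norm (x - y) powr (- (real CARD('n) + 2 * s))"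
  by (cases "x = y") (auto simp: power2_eq_square powr_add[symmetric])
 moreover have "norm (x - y) powr (- (real CARD('n) + 2 * s)) = inverse (norm (x - y) powr (real CARD('n) + 2 * s))"
  by (rule powr_minus)
 ultimately show ?thesis by (cases "x \<in> U"; cases "y \<in> U") (simp_all only: gag_kernel_def norm_scaleR power_mult_distrib
   fst_conv snd_conv indicator_simps abs_one abs_zero mult_1_left power2_abs divide_inverse mult.commute zero_power2 not_False_eq_True)
qed

lemma gagliardo_kernel:
 fixes w :: "real^'n => 'b::euclidean_space"
 assumes [measurable]: "w \<in> borel_measurable borel" "U \<in> sets borel" shows "gagliardo s U w = nn2 lborel (gag_kernel s U w)"
proof -
 let ?f = "\<lambda>x y. ennreal ((norm (w x - w y))\<^sup>2 / norm (x - y) powr (real CARD('n) + 2 * s))"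
 have "gagliardo s U w = (\<integral>\<^sup>+x. (\<integral>\<^sup>+y. ?f x y * indicator U y \<partial>lborel) \<partial>leb U)"
  unfolding gagliardo_def by (intro nn_integral_cong nn_integral_lebesgue_on_borel) measurable
 also have "\<dots> = (\<integral>\<^sup>+x. (\<integral>\<^sup>+y. ?f x y * indicator U y \<partial>lborel) * indicator U x \<partial>lborel)"
  by (rule nn_integral_lebesgue_on_borel) measurable
 also have "\<dots> = (\<integral>\<^sup>+x. nn2 lborel (\<lambda>y. gag_kernel s U w (x, y)) \<partial>lborel)"
  by (intro nn_integral_cong, subst nn_integral_multc[symmetric])
   (auto intro!: nn_integral_cong simp: gag_kernel_norm2 indicator_def)
 also have "\<dots> = nn2 (lborel \<Otimes>\<^sub>M lborel) (gag_kernel s U w)" by (subst lborel.nn_integral_fst[symmetric]) (auto simp: lborel_prod)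
 finally show ?thesis by (simp add: lborel_prod)
qed

lemma gag_kernel_Lebesgue2:
 assumes "w \<in> borel_measurable borel" "U \<in> sets borel" "gagliardo s U w < \<infinity>" shows "gag_kernel s U w \<in> Lebesgue2 lborel"
 by (rule Lebesgue2I_nn) (use assms gagliardo_kernel[of w U s] in auto)

lemma gagliardo_eq_norm:
 assumes "w \<in> borel_measurable borel" "U \<in> sets borel" "gagliardo s U w < \<infinity>"
 shows "enn2real (gagliardo s U w) = (L2_norm lborel (gag_kernel s U w))\<^sup>2"
 using nn_integral_norm2[OF gag_kernel_Lebesgue2[OF assms]] gagliardo_kernel[OF assms(1,2), of s] by simp

lemma gag_kernel_diff: "gag_kernel s U (\<lambda>x. u x - v x) q = gag_kernel s U u q - gag_kernel s U v q"
 by (simp add: gag_kernel_def algebra_simps)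

lemma measurable_borel_representative:
 fixes u :: "real^'n => 'b::euclidean_space"
 assumes u: "u \<in> borel_measurable (leb U)" and U: "U \<in> sets borel"
 obtains w where "w \<in> borel_measurable borel" "AE x in leb U. u x = w x"
proof -
 have U': "U \<in> sets lebesgue" using U by simp
 have "(\<lambda>x. indicator U x *\<^sub>R u x) \<in> borel_measurable lebesgue"
  using u U' by (subst borel_measurable_restrict_space_iff[symmetric]) auto
 then obtain w0 where w0: "w0 \<in> borel_measurable lborel" "AE x in lebesgue. indicator U x *\<^sub>R u x = w0 x"
  by (rule borel_representative)
 have "AE x in leb U. u x = w0 x" using w0(2) U' by (subst AE_restrict_space_iff) (auto elim!:)
 then show ?thesis using w0(1) by (intro that) auto
qed

lemma gagliardo_diff_norm:
 assumes u: "u \<in> borel_measurable (leb U)" "gagliardo s U u < \<infinity>"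
  and v: "v \<in> borel_measurable (leb U)" "gagliardo s U v < \<infinity>" and U: "U \<in> sets borel" shows "gagliardo s U (\<lambda>x. u x - v x) < \<infinity>"
  and "sqrt (enn2real (gagliardo s U (\<lambda>x. u x - v x))) \<le> sqrt (enn2real (gagliardo s U u)) + sqrt (enn2real (gagliardo s U v))"
proof -
 obtain u' where u': "u' \<in> borel_measurable borel" "AE x in leb U. u x = u' x"
  using measurable_borel_representative[OF u(1) U] by blast
 obtain v' where v': "v' \<in> borel_measurable borel" "AE x in leb U. v x = v' x"
  using measurable_borel_representative[OF v(1) U] by blast
 have ae: "AE x in leb U. u x - v x = u' x - v' x" using u'(2) v'(2) by eventually_elim simp
 note eq = gagliardo_cong_AE[OF u'(2), of s] gagliardo_cong_AE[OF v'(2), of s] gagliardo_cong_AE[OF ae, of s]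
 have m: "(\<lambda>x. u' x - v' x) \<in> borel_measurable borel" using u'(1) v'(1) by measurable
 have fin: "gagliardo s U u' < \<infinity>" "gagliardo s U v' < \<infinity>" using u(2) v(2) eq by auto
 have K: "gag_kernel s U u' \<in> Lebesgue2 lborel" "gag_kernel s U v' \<in> Lebesgue2 lborel"
  by (rule gag_kernel_Lebesgue2[OF u'(1) U fin(1)], rule gag_kernel_Lebesgue2[OF v'(1) U fin(2)])
 have kd: "gag_kernel s U (\<lambda>x. u' x - v' x) = (\<lambda>q. gag_kernel s U u' q - gag_kernel s U v' q)"
  by (rule ext) (rule gag_kernel_diff)
 have fin3: "gagliardo s U (\<lambda>x. u' x - v' x) < \<infinity>"
  unfolding gagliardo_kernel[OF m U] kd nn_integral_norm2[OF Lebesgue2_diff[OF K]] by simp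
 then show "gagliardo s U (\<lambda>x. u x - v x) < \<infinity>" using eq by simp
 show "sqrt (enn2real (gagliardo s U (\<lambda>x. u x - v x))) \<le> sqrt (enn2real (gagliardo s U u)) + sqrt (enn2real (gagliardo s U v))" using L2_norm_triangle[OF K(1) Lebesgue2_uminus[OF K(2)]] unfolding eq gagliardo_eq_norm[OF u'(1) U fin(1)] gagliardo_eq_norm[OF v'(1) U fin(2)] gagliardo_eq_norm[OF m U fin3] kd by (simp add: L2_norm_minus)
qed

text \<open>Dyadic shells: for a norm between \<open>r (Suc k)\<close> and \<open>r k\<close> the
  integrand is at most \<open>r (Suc k) powr (- A)\<close>, and the ball of radius
  \<open>r k\<close> has volume proportional to \<open>r k ^ DIM('a)\<close>. The series is
  geometric with ratio \<open>q\<close>, below 1 because \<open>A\<close> is below the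
  dimension.\<close>

lemma nn_integral_norm_powr_finite:
 assumes "A < real DIM('a::euclidean_space)" "0 \<le> A" "0 < D"
 shows "(\<integral>\<^sup>+h. ennreal (norm (h::'a) powr (- A)) * indicator (cball 0 D) h \<partial>lborel) < \<infinity>"
proof -
 define r where "r k = D / 2 ^ k" for k
 have r: "0 < r k" for k using assms(3) by (simp add: r_def)
 define c where "c = unit_ball_vol (real DIM('a))"
 have c: "0 \<le> c" by (simp add: c_def)
 let ?g = "\<lambda>k h. ennreal (r (Suc k) powr (- A)) * indicator (cball 0 (r k)) (h::'a)"
 have pt: "ennreal (norm h powr (- A)) * indicator (cball 0 D) h \<le> (\<Sum>k. ?g k h)" for h :: 'a
 proof (cases "h \<noteq> 0 \<and> norm h \<le> D")
  case True
  then have "0 < norm h / D" using assms(3) by simp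
  then obtain j where "(1/2) ^ j < norm h / D" using real_arch_pow_inv[of "norm h / D" "1/2"] by auto
  then have j: "r j < norm h" using assms(3) by (simp add: r_def field_simps)
  \<comment> \<open>The first radius below \<open>norm h\<close>. Its index is not 0, since
    \<open>r 0 = D\<close>, so a previous radius exists and its ball still contains
    \<open>h\<close>.\<close>
  define k where "k = (LEAST j. r j < norm h)"
  have k: "r k < norm h" unfolding k_def by (rule LeastI[of "\<lambda>j. r j < norm h", OF j])
  have "k \<noteq> 0" using k True by (auto simp: r_def intro: ccontr)
  then obtain k' where k': "k = Suc k'" by (cases k) auto
  have "\<not> r k' < norm h" using not_less_Least[of k' "\<lambda>j. r j < norm h"] k' by (simp add: k_def[symmetric])
  then have h: "h \<in> cball 0 (r k')" by simp
  have "norm h powr (- A) \<le> r (Suc k') powr (- A)" using k k' r[of "Suc k'"] assms(2) by (intro powr_mono2') auto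
  then have "ennreal (norm h powr (- A)) * indicator (cball 0 D) h \<le> ?g k' h" using h by (auto simp: indicator_def)
  also have "\<dots> \<le> (\<Sum>k. ?g k h)"
  proof -
   define G where "G k = ?g k h" for k
   have "G k' \<le> suminf G" using sum_le_suminf[of G "{k'}"] by simp
   then show ?thesis by (simp only: G_def[abs_def])
  qed
  finally show ?thesis .
 next
  case False
  then have "ennreal (norm h powr (- A)) * indicator (cball 0 D) h = 0" by (cases "h = 0") auto
  then show ?thesis by (simp only: zero_le)
 qed
 define q where "q = 2 powr (A - real DIM('a))"
 have q: "0 \<le> q" "q < 1" using assms(1) by (auto simp: q_def powr_less_one)
 have g: "(\<integral>\<^sup>+h. ?g k h \<partial>lborel) = ennreal ((2 powr A * D powr (- A) * D ^ DIM('a) * c) * q ^ k)" for k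
 proof -
  have "(\<integral>\<^sup>+h. ?g k h \<partial>lborel) = ennreal (r (Suc k) powr (- A)) * ennreal (c * r k ^ DIM('a))"
   using r[of k] by (subst nn_integral_cmult_indicator) (auto simp: emeasure_cball c_def)
  also have "\<dots> = ennreal (r (Suc k) powr (- A) * (c * r k ^ DIM('a)))" by (simp add: ennreal_mult')
  also have "r (Suc k) powr (- A) * (c * r k ^ DIM('a)) = (2 powr A * D powr (- A) * D ^ DIM('a) * c) * q ^ k"
  proof -
   have "r (Suc k) powr (- A) = D powr (- A) * (2 ^ Suc k) powr A" by (simp add: r_def powr_divide powr_minus_divide del:)
   also have "(2 ^ Suc k :: real) powr A = 2 powr (A + real k * A)"
    by (simp add: powr_realpow[symmetric] powr_powr algebra_simps del: power_Suc)
   finally have 1: "r (Suc k) powr (- A) = D powr (- A) * (2 powr A * 2 powr (real k * A))" by (simp add: powr_add)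
   have 2: "r k ^ DIM('a) = D ^ DIM('a) * 2 powr (- (real k * real DIM('a)))"
    by (simp add: r_def power_divide powr_minus_divide powr_realpow[symmetric] powr_powr power_mult[symmetric])
   have 3: "q ^ k = 2 powr (real k * A) * 2 powr (- (real k * real DIM('a)))"
    by (simp add: q_def powr_realpow[symmetric] powr_powr powr_add[symmetric] algebra_simps)
   show ?thesis unfolding 1 2 3 by simp
  qed
  finally show ?thesis .
 qed
 have "(\<integral>\<^sup>+h. ennreal (norm (h::'a) powr (- A)) * indicator (cball 0 D) h \<partial>lborel) \<le> (\<integral>\<^sup>+h. (\<Sum>k. ?g k h) \<partial>lborel)"
  by (rule nn_integral_mono) (rule pt)
 also have "\<dots> = (\<Sum>k. \<integral>\<^sup>+h. ?g k h \<partial>lborel)"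
  by (intro nn_integral_suminf borel_measurable_times_ennreal borel_measurable_const borel_measurable_indicator) auto
 also have "\<dots> = ennreal (\<Sum>k. (2 powr A * D powr (- A) * D ^ DIM('a) * c) * q ^ k)" unfolding g using q c assms(3)
  by (intro suminf_ennreal2 summable_mult mult_nonneg_nonneg) auto
 also have "\<dots> < \<infinity>" by simp
 finally show ?thesis .
qed

lemma smooth_increment_square:
 fixes f :: "real^'n => 'b::euclidean_space"
 assumes f: "smooth f" shows "ennreal ((norm (f (x + h) - f x))\<^sup>2) \<le> (\<integral>\<^sup>+t. ennreal (indicator {0..1} t) *
  ennreal (real CARD('n) * (norm h)\<^sup>2 * (\<Sum>i\<in>UNIV. (norm (partial i f (x + t *\<^sub>R h)))\<^sup>2)) \<partial>lborel)"
proof -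
 let ?F = "\<lambda>t. \<Sum>i\<in>UNIV. h $ i *\<^sub>R partial i f (x + t *\<^sub>R h)"
 have c: "continuous_on UNIV ?F"
  by (intro continuous_intros continuous_on_compose2[OF smooth_continuous[OF smooth_partial[OF f], of UNIV]]) auto
 have "ennreal ((norm (f (x + h) - f x))\<^sup>2) \<le> (\<integral>\<^sup>+t. ennreal (indicator {0..1} t) * ennreal ((norm (?F t))\<^sup>2) \<partial>lborel)"
  using smooth_increment[OF f, of h x] Jensen_square[of ?F lborel "indicator {0..1}"] borel_measurable_continuous_onI[OF c] by (simp add: ennreal_indicator)
 also have "\<dots> \<le> (\<integral>\<^sup>+t. ennreal (indicator {0..1} t) *
  ennreal (real CARD('n) * (norm h)\<^sup>2 * (\<Sum>i\<in>UNIV. (norm (partial i f (x + t *\<^sub>R h)))\<^sup>2)) \<partial>lborel)"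
 proof (intro nn_integral_mono mult_left_mono ennreal_leI)
  fix t
  have "(norm (?F t))\<^sup>2 \<le> ((\<Sum>i\<in>UNIV. norm (partial i f (x + t *\<^sub>R h))) * norm h)\<^sup>2"
   by (intro power_mono sum_component_bound) simp_all
  also have "\<dots> \<le> real CARD('n) * (norm h)\<^sup>2 * (\<Sum>i\<in>UNIV. (norm (partial i f (x + t *\<^sub>R h)))\<^sup>2)"
   using mult_right_mono[OF sum_squared_le_sum_of_squares[of "\<lambda>i. norm (partial i f (x + t *\<^sub>R h))" UNIV], of "(norm h)\<^sup>2"]
   by (simp add: power_mult_distrib mult_ac)
  finally show "(norm (?F t))\<^sup>2 \<le> real CARD('n) * (norm h)\<^sup>2 * (\<Sum>i\<in>UNIV. (norm (partial i f (x + t *\<^sub>R h)))\<^sup>2)" .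
 qed simp
 finally show ?thesis .
qed

text \<open>The increment over \<open>h\<close> is an integral of the gradient along a segment,
  which stays in the convex set. This gains two powers of \<open>norm h\<close>, and after Fubini
  the integral of the gradient separates from that of the weight \<open>w\<close>.\<close>

lemma gagliardo_le_gradient:
 assumes U: "open U" "convex U" "bounded U" and s: "1/2 < s" "s < 1"
 obtains C where "0 \<le> C" "\<And>f :: real^'n => 'b::euclidean_space. smooth f ==>
  gagliardo s U f \<le> ennreal (C * (\<Sum>i\<in>UNIV. (L2_norm (leb U) (partial i f))\<^sup>2))"
proof -
 have [measurable]: "U \<in> sets borel" using U(1) by simp
 obtain D where D: "0 < D" "\<And>x. x \<in> U ==> norm x \<le> D" using bounded_pos U(3) by metis
 \<comment> \<open>The Gagliardo exponent less the two powers gained from the increment.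
   \<open>s < 1\<close> puts it below the dimension, and \<open>s > 1/2\<close> makes it nonnegative
   in every dimension.\<close>
 define A where "A = real CARD('n) + 2 * s - 2"
 have A: "A < real DIM(real^'n)" "0 \<le> A" using zero_less_card_finite[where 'a='n] s unfolding A_def DIM_cart DIM_real by linarith+
 \<comment> \<open>Two points of \<open>U\<close> have norm at most \<open>D\<close>, so their
   difference has norm at most \<open>2 * D\<close>.\<close>
 define w where "w h = ennreal (norm h powr (- A)) * indicator (cball 0 (2 * D)) h" for h :: "real^'n"
 have "cball (0::real^'n) (2 * D) \<in> sets borel" by simp
 then have w [measurable]: "w \<in> borel_measurable borel" unfolding w_def[abs_def] by measurable
 have I: "(\<integral>\<^sup>+h. w h \<partial>lborel) < \<infinity>" unfolding w_def by (rule nn_integral_norm_powr_finite[OF A]) (use D in simp)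
 define C where "C = real CARD('n) * enn2real (\<integral>\<^sup>+h. w h \<partial>lborel)"
 have "gagliardo s U f \<le> ennreal (C * (\<Sum>i\<in>UNIV. (L2_norm (leb U) (partial i f))\<^sup>2))"
  if f: "smooth f" for f :: "real^'n => 'b"
 proof -
  define g where "g x = real CARD('n) * (\<Sum>i\<in>UNIV. (norm (partial i f x))\<^sup>2)" for x
  have [measurable]: "f \<in> borel_measurable borel" "partial i f \<in> borel_measurable borel" for i
   by (intro smooth_borel smooth_partial f)+
  have [measurable]: "g \<in> borel_measurable borel" unfolding g_def[abs_def] by measurable
  define G where "G x = ennreal (g x) * indicator U x" for x
  have [measurable]: "G \<in> borel_measurable borel" unfolding G_def[abs_def] by measurable
  let ?k = "\<lambda>x h. ennreal ((norm (gag_kernel s U f (x, x + h)))\<^sup>2)"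
  have pt: "?k x h \<le> w h * (\<integral>\<^sup>+t. indicator {0..1} t * G (x + t *\<^sub>R h) \<partial>lborel)" for x h
  proof (cases "h \<noteq> 0 \<and> x \<in> U \<and> x + h \<in> U")
   case h: True
   then have wh: "w h = ennreal (norm h powr (- A))" using D(2)[of x] D(2)[of "x + h"] norm_triangle_ineq4[of "x + h" x] by (simp add: w_def)
   have "(norm (gag_kernel s U f (x, x + h)))\<^sup>2 = norm h powr (- A) * ((norm (f (x + h) - f x))\<^sup>2 / (norm h)\<^sup>2)"
    unfolding gag_kernel_norm2 using h by (simp add: A_def norm_minus_commute powr_diff powr_add powr_minus field_simps)
   then have "?k x h = w h * (ennreal (1 / (norm h)\<^sup>2) * ennreal ((norm (f (x + h) - f x))\<^sup>2))"
    by (simp add: wh ennreal_mult[symmetric])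
   also have "\<dots> \<le> w h * (ennreal (1 / (norm h)\<^sup>2) * (\<integral>\<^sup>+t. ennreal (indicator {0..1} t) * ennreal ((norm h)\<^sup>2 * g (x + t *\<^sub>R h)) \<partial>lborel))"
    using smooth_increment_square[OF f, of x h] by (intro mult_left_mono) (simp_all add: g_def mult_ac)
   also have "\<dots> = w h * (\<integral>\<^sup>+t. indicator {0..1} t * ennreal (g (x + t *\<^sub>R h)) \<partial>lborel)"
    by (subst nn_integral_cmult[symmetric], measurable)
     (use h in \<open>auto intro!: nn_integral_cong arg_cong[of _ _ "(*) (w h)"] simp: indicator_def ennreal_mult'[symmetric]\<close>)
   also have "\<dots> \<le> w h * (\<integral>\<^sup>+t. indicator {0..1} t * G (x + t *\<^sub>R h) \<partial>lborel)"
   proof (rule mult_left_mono[OF nn_integral_mono])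
    fix t :: real
    show "indicator {0..1} t * ennreal (g (x + t *\<^sub>R h)) \<le> indicator {0..1} t * G (x + t *\<^sub>R h)" using convexD_alt[OF U(2), of x "x + h" t] h that by (simp add: algebra_simps G_def indicator_def)
   qed simp
   finally show ?thesis .
  qed (auto simp: gag_kernel_def)
  have "gagliardo s U f = (\<integral>\<^sup>+x. nn2 lborel (\<lambda>y. gag_kernel s U f (x, y)) \<partial>lborel)"
   unfolding gagliardo_kernel[OF \<open>f \<in> borel_measurable borel\<close> \<open>U \<in> sets borel\<close>]
   by (subst lborel.nn_integral_fst) (auto simp: lborel_prod)
  also have "\<dots> = (\<integral>\<^sup>+x. (\<integral>\<^sup>+h. ?k x h \<partial>lborel) \<partial>lborel)"
  proof (rule nn_integral_cong)
   fix x
   have [measurable]: "gag_kernel s U f \<in> borel_measurable (borel \<Otimes>\<^sub>M borel)" by (simp add: borel_prod)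
   show "nn2 lborel (\<lambda>y. gag_kernel s U f (x, y)) = (\<integral>\<^sup>+h. ?k x h \<partial>lborel)"
    by (subst nn_integral_lborel_affine[of _ 1 x]) simp_all
  qed
  also have "\<dots> \<le> (\<integral>\<^sup>+x. (\<integral>\<^sup>+h. w h * (\<integral>\<^sup>+t. indicator {0..1} t * G (x + t *\<^sub>R h) \<partial>lborel) \<partial>lborel) \<partial>lborel)"
   by (intro nn_integral_mono pt)
  also have "\<dots> = (\<integral>\<^sup>+h. (\<integral>\<^sup>+x. w h * (\<integral>\<^sup>+t. indicator {0..1} t * G (x + t *\<^sub>R h) \<partial>lborel) \<partial>lborel) \<partial>lborel)"
   by (rule lborel_pair.Fubini') measurable
  also have "\<dots> = (\<integral>\<^sup>+h. w h * (\<integral>\<^sup>+t. (\<integral>\<^sup>+x. indicator {0..1} t * G (x + t *\<^sub>R h) \<partial>lborel) \<partial>lborel) \<partial>lborel)"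
   by (intro nn_integral_cong, subst nn_integral_cmult, measurable, subst lborel_pair.Fubini', measurable)
  also have "\<dots> = (\<integral>\<^sup>+h. w h \<partial>lborel) * (\<integral>\<^sup>+x. G x \<partial>lborel)"
  proof -
   have "(\<integral>\<^sup>+x. G (x + t *\<^sub>R h) \<partial>lborel) = (\<integral>\<^sup>+x. G x \<partial>lborel)" for t h
    by (subst (2) nn_integral_lborel_affine[of _ 1 "t *\<^sub>R h"]) (simp_all add: add.commute)
   then show ?thesis by (simp add: nn_integral_cmult nn_integral_multc)
  qed
  also have "(\<integral>\<^sup>+x. G x \<partial>lborel) = (\<integral>\<^sup>+x. ennreal (g x) \<partial>leb U)"
   unfolding G_def by (rule nn_integral_lebesgue_on_borel[symmetric]) measurable
  also have "\<dots> = ennreal (real CARD('n) * (\<Sum>i\<in>UNIV. (L2_norm (leb U) (partial i f))\<^sup>2))"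
  proof -
   have "integrable (leb U) (\<lambda>x. (norm (partial i f x))\<^sup>2)" for i
    using bounded_smooth_L2[OF smooth_continuous[OF smooth_partial[OF f]] U(3)] U(1) by (auto simp: L2_def intro!: Lebesgue2_integrable)
   then show ?thesis unfolding g_def by (subst nn_integral_eq_integral)
     (auto simp: L2_norm_power2 sum_nonneg bochner_int_sum)
  qed
  also have "(\<integral>\<^sup>+h. w h \<partial>lborel) = ennreal (enn2real (\<integral>\<^sup>+h. w h \<partial>lborel))" using I by simp
  finally show ?thesis by (simp add: C_def ennreal_mult[symmetric] sum_nonneg mult_ac)
 qed
 then show ?thesis by (intro that[of C]) (simp_all add: C_def)
qed

lemma smooth_gagliardo_finite:
 assumes f: "smooth f" and U: "open U" "convex U" "bounded U" and s: "1/2 < s" "s < 1" shows "gagliardo s U f < \<infinity>"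
proof -
 obtain C where "gagliardo s U f \<le> ennreal (C * (\<Sum>i\<in>UNIV. (L2_norm (leb U) (partial i f))\<^sup>2))"
  by (rule gagliardo_le_gradient[OF U s]) (use f in blast)
 then show ?thesis using le_less_trans by fastforce
qed

text \<open>On pairs of points the mollification contracts both coordinates towards the diagonal
  point \<open>(z, z)\<close>. By homogeneity of the singular weight the kernel of the smoothing is
  an average of contracted kernels times \<open>c m\<close>, so convergence follows from that of
  dilations in L2 of the product space.\<close>

lemma (in mollifier) moll_gagliardo_tendsto:
 fixes u :: "real^'n => 'b::euclidean_space"
 assumes u: "u \<in> L2 U" "gagliardo s U u < \<infinity>" and s: "0 \<le> s"
 shows "(\<lambda>m. sqrt (enn2real (gagliardo s U (\<lambda>x. moll U Q m u x - u x)))) \<longlonglongrightarrow> 0"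
proof -
 obtain w where w: "w \<in> Lebesgue2 lborel" "AE x in leb U. u x = w x" "\<forall>x. x \<notin> U \<longrightarrow> w x = 0"
  by (rule L2_borel_representative[OF u(1) U_borel])
 have wz: "\<And>x. x \<notin> U ==> w x = 0" using w(3) by blast
 have [measurable]: "w \<in> borel_measurable borel" using w(1) by (simp add: Lebesgue2_def)
 define a where "a = (real CARD('n) + 2 * s) / 2"
 have a: "0 \<le> a" using s by (simp add: a_def)
 define K where "K = gag_kernel s U w"
 have finw: "gagliardo s U w < \<infinity>" using u(2) gagliardo_cong_AE[OF w(2), of s] by simp
 have K: "K \<in> Lebesgue2 lborel" unfolding K_def by (rule gag_kernel_Lebesgue2) (use finw in auto)
 have [measurable]: "K \<in> borel_measurable borel" using K by (simp add: Lebesgue2_def)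
 define c where "c m = (1 - moll_eps m) powr a" for m
 have c: "0 \<le> c m" "c m \<le> 1" for m using moll_eps(1,2)[of m] a by (auto simp: c_def powr_le1)
 have "c \<longlonglongrightarrow> (1 - 0) powr a" unfolding c_def by (intro tendsto_intros moll_eps(3)) simp
 then have c1: "c \<longlonglongrightarrow> 1" by simp
 let ?b = "\<lambda>m. \<integral>\<^sup>+z. ennreal (Q z) * nn2 lborel (\<lambda>q. c m *\<^sub>R K ((1 - moll_eps m) *\<^sub>R q + moll_eps m *\<^sub>R (z, z)) - K q) \<partial>lborel"
 have b: "?b \<longlonglongrightarrow> 0" by (rule averaged_dilation_tendsto[OF K c c1 test_integrable[OF Q(1)]]) (simp add: borel_prod[symmetric])
 show ?thesis
 proof (rule tendsto_0_of_ennreal_square[OF _ _ b])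
  fix m
  let ?e = "moll_eps m"
  have e: "0 < ?e" "?e \<le> 1/2" by (rule moll_eps)+
  let ?M = "moll U Q m u"
  have [measurable]: "?M \<in> borel_measurable borel" by (rule smooth_borel[OF moll_smooth[OF u(1)]])
  have ae: "AE x in leb U. ?M x - u x = ?M x - w x" using w(2) by simp
  have kernel: "gag_kernel s U (\<lambda>x. ?M x - w x) q = (LINT z|lborel. Q z *\<^sub>R (c m *\<^sub>R K ((1 - ?e) *\<^sub>R q + ?e *\<^sub>R (z, z)) - K q))"
   if q: "fst q \<in> U" "snd q \<in> U" for q
  proof -
   obtain x y where xy: "q = (x, y)" "x \<in> U" "y \<in> U" using q by (cases q) auto
   let ?p = "norm (x - y) powr (- a)"
   have pt: "Q z *\<^sub>R (c m *\<^sub>R K ((1 - ?e) *\<^sub>R q + ?e *\<^sub>R (z, z)) - K q)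
     = ?p *\<^sub>R (Q z *\<^sub>R (w ((1 - ?e) *\<^sub>R x + ?e *\<^sub>R z) - w x) - Q z *\<^sub>R (w ((1 - ?e) *\<^sub>R y + ?e *\<^sub>R z) - w y))" for z
   proof (cases "Q z = 0")
    case False
    then have z: "z \<in> U" using test_outside[OF Q(1)] by blast
    have in_U: "(1 - ?e) *\<^sub>R x + ?e *\<^sub>R z \<in> U" "(1 - ?e) *\<^sub>R y + ?e *\<^sub>R z \<in> U" using xy z e by (auto intro!: convexD[OF U(2)])
    have "(1 - ?e) *\<^sub>R x + ?e *\<^sub>R z - ((1 - ?e) *\<^sub>R y + ?e *\<^sub>R z) = (1 - ?e) *\<^sub>R (x - y)" by (simp add: algebra_simps)
    then have "c m * norm ((1 - ?e) *\<^sub>R x + ?e *\<^sub>R z - ((1 - ?e) *\<^sub>R y + ?e *\<^sub>R z)) powr (- a) = ?p"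
     using e by (simp add: c_def powr_mult powr_minus)
    then have "c m *\<^sub>R K ((1 - ?e) *\<^sub>R q + ?e *\<^sub>R (z, z)) = ?p *\<^sub>R (w ((1 - ?e) *\<^sub>R x + ?e *\<^sub>R z) - w ((1 - ?e) *\<^sub>R y + ?e *\<^sub>R z))"
     using in_U by (simp add: K_def gag_kernel_def xy a_def[symmetric])
    moreover have "K q = ?p *\<^sub>R (w x - w y)" using xy by (simp add: K_def gag_kernel_def a_def[symmetric])
    ultimately show ?thesis by (simp only:) (simp add: algebra_simps)
   qed simp
   have i: "integrable lborel (\<lambda>z. Q z *\<^sub>R (w ((1 - ?e) *\<^sub>R x + ?e *\<^sub>R z) - w x))" for x
    using avg_integrable[OF u(1) w(1,2) wz, of m x] test_integrable[OF Q(1)] by (simp add: scaleR_diff_right)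
   have "(LINT z|lborel. Q z *\<^sub>R (c m *\<^sub>R K ((1 - ?e) *\<^sub>R q + ?e *\<^sub>R (z, z)) - K q)) = ?p *\<^sub>R ((?M x - w x) - (?M y - w y))"
    unfolding pt using i[of x] i[of y] by (simp add: moll_diff_eq[OF u(1) w(1,2) wz])
   then show ?thesis using xy by (simp add: gag_kernel_def a_def[symmetric])
  qed
  have "gagliardo s U (\<lambda>x. ?M x - u x) = gagliardo s U (\<lambda>x. ?M x - w x)" by (rule gagliardo_cong_AE[OF ae])
  also have "\<dots> = nn2 lborel (gag_kernel s U (\<lambda>x. ?M x - w x))" by (rule gagliardo_kernel) measurable
  also have "\<dots> \<le> (\<integral>\<^sup>+q. (\<integral>\<^sup>+z. ennreal (Q z) * ennreal ((norm (c m *\<^sub>R K ((1 - ?e) *\<^sub>R q + ?e *\<^sub>R (z, z)) - K q))\<^sup>2) \<partial>lborel) \<partial>lborel)"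
  proof (rule nn_integral_mono)
   fix q :: "(real^'n) \<times> (real^'n)"
   show "ennreal ((norm (gag_kernel s U (\<lambda>x. ?M x - w x) q))\<^sup>2)
    \<le> (\<integral>\<^sup>+z. ennreal (Q z) * ennreal ((norm (c m *\<^sub>R K ((1 - ?e) *\<^sub>R q + ?e *\<^sub>R (z, z)) - K q))\<^sup>2) \<partial>lborel)"
   proof (cases "fst q \<in> U \<and> snd q \<in> U")
    case True
    show ?thesis unfolding kernel[OF conjunct1[OF True] conjunct2[OF True]] by (rule Jensen_square) (use Q(2) Q_nn in auto)
   qed (auto simp: gag_kernel_def)
  qed
  also have "\<dots> = (\<integral>\<^sup>+z. (\<integral>\<^sup>+q. ennreal (Q z) * ennreal ((norm (c m *\<^sub>R K ((1 - ?e) *\<^sub>R q + ?e *\<^sub>R (z, z)) - K q))\<^sup>2) \<partial>lborel) \<partial>lborel)"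
   by (rule lborel_pair.Fubini'[symmetric]) measurable
  also have "\<dots> = ?b m" by (simp add: nn_integral_cmult)
  finally have le: "gagliardo s U (\<lambda>x. ?M x - u x) \<le> ?b m" .
  have "ennreal (enn2real (gagliardo s U (\<lambda>x. ?M x - u x))) \<le> gagliardo s U (\<lambda>x. ?M x - u x)"
   by (cases "gagliardo s U (\<lambda>x. ?M x - u x)") auto
  then show "ennreal ((sqrt (enn2real (gagliardo s U (\<lambda>x. ?M x - u x))))\<^sup>2) \<le> ?b m" using le by simp
 qed simp
qed

lemma Hs_L2: "u \<in> Hs s U ==> u \<in> L2 U" by (auto simp: Hs_def H1_L2 split: if_splits)

lemma (in mollifier) moll_Hs_tendsto:
 assumes u: "u \<in> Hs s U" and s: "1/2 < s" shows "(\<lambda>m. Hs_norm s U (\<lambda>x. moll U Q m u x - u x)) \<longlonglongrightarrow> 0"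
proof (cases "s = 1")
 case True
 then show ?thesis using u moll_H1_tendsto by (simp add: Hs_def Hs_norm_def)
next
 case False
 then have u': "u \<in> L2 U" "gagliardo s U u < \<infinity>" using u by (auto simp: Hs_def)
 have "(\<lambda>m. sqrt ((L2_norm (leb U) (\<lambda>x. moll U Q m u x - u x))\<^sup>2
   + (sqrt (enn2real (gagliardo s U (\<lambda>x. moll U Q m u x - u x))))\<^sup>2)) \<longlonglongrightarrow> sqrt (0\<^sup>2 + 0\<^sup>2)"
  by (intro tendsto_intros moll_L2_tendsto[OF u'(1)] moll_gagliardo_tendsto[OF u']) (use s in simp)
 then show ?thesis using False by (simp add: Hs_norm_def)
qed

lemma smooth_Hs:
 assumes "smooth f" "open U" "convex U" "bounded U" "1/2 < s" "s \<le> 1" shows "f \<in> Hs s U"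
 using assms smooth_H1[OF assms(1,4,2)] smooth_gagliardo_finite[OF assms(1-5)] by (auto simp: Hs_def H1_L2)

lemma Hs_norm_ge_L2: "L2_norm (leb U) u \<le> Hs_norm s U u" by (auto simp: Hs_norm_def H1_norm_ge intro: real_le_rsqrt)

lemma Hs_norm_ge_gagliardo: "s \<noteq> 1 ==> sqrt (enn2real (gagliardo s U u)) \<le> Hs_norm s U u" by (auto simp: Hs_norm_def)

lemma Hs_norm_le_H1_norm:
 assumes U: "open U" "convex U" "bounded U" and s: "1/2 < s" "s < 1"
 obtains C where "0 \<le> C" "\<And>f :: real^'n => 'b::euclidean_space. smooth f ==> Hs_norm s U f \<le> C * H1_norm U f"
proof -
 obtain C where C: "0 \<le> C" "\<And>f :: real^'n => 'b. smooth f ==>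
  gagliardo s U f \<le> ennreal (C * (\<Sum>i\<in>UNIV. (L2_norm (leb U) (partial i f))\<^sup>2))"
  by (rule gagliardo_le_gradient[OF U s, where 'b='b]) (rule that)
 have "Hs_norm s U f \<le> sqrt (1 + C) * H1_norm U f" if f: "smooth f" for f :: "real^'n => 'b"
 proof -
  have "L2_norm (leb U) (weak_partial U i f) = L2_norm (leb U) (partial i f)" for i
   using H1_weak_partial_L2[OF U(1) smooth_H1[OF f U(3,1)], of i] U(1)
    bounded_smooth_L2[OF smooth_continuous[OF smooth_partial[OF f]] U(3), of i]
   by (intro L2_norm_cong_AE weak_partial_AE[OF U(1) smooth_is_weak_partial[OF f U(1)]]) (auto simp: L2_def Lebesgue2_measurable)
  then have "enn2real (gagliardo s U f) \<le> C * (\<Sum>i\<in>UNIV. (L2_norm (leb U) (weak_partial U i f))\<^sup>2)"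
   using C(2)[OF f] C(1) by (intro enn2real_leI mult_nonneg_nonneg sum_nonneg) simp_all
  moreover have "0 \<le> C * (L2_norm (leb U) f)\<^sup>2" "0 \<le> (\<Sum>i\<in>UNIV. (L2_norm (leb U) (weak_partial U i f))\<^sup>2)"
   using C(1) by (simp_all add: sum_nonneg)
  ultimately have "(L2_norm (leb U) f)\<^sup>2 + enn2real (gagliardo s U f)
   \<le> (1 + C) * ((L2_norm (leb U) f)\<^sup>2 + (\<Sum>i\<in>UNIV. (L2_norm (leb U) (weak_partial U i f))\<^sup>2))"
   by (simp add: distrib_left distrib_right)
  then show ?thesis using s by (simp add: Hs_norm_def H1_norm_def real_sqrt_mult[symmetric])
 qed
 then show ?thesis using C(1) by (intro that[of "sqrt (1 + C)"]) simp_all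
qed

text \<open>The triangle inequality is needed only in the limit. It suffices to bound the L2 part
  and the derivative or Gagliardo part separately, each by the sum of the two full norms.\<close>

lemma Hs_norm_diff_tendsto:
 fixes a b :: "nat => real^'n => 'b::euclidean_space"
 assumes U: "open U" and a: "\<And>m. a m \<in> Hs s U" and b: "\<And>m. b m \<in> Hs s U"
  and a0: "(\<lambda>m. Hs_norm s U (a m)) \<longlonglongrightarrow> 0" and b0: "(\<lambda>m. Hs_norm s U (b m)) \<longlonglongrightarrow> 0" shows "(\<lambda>m. Hs_norm s U (\<lambda>x. a m x - b m x)) \<longlonglongrightarrow> 0"
proof -
 have diff: "L2_norm M (\<lambda>x. u x - v x) \<le> L2_norm M u + L2_norm M v"
  if "u \<in> Lebesgue2 M" "v \<in> Lebesgue2 M" for M and u v :: "real^'n => 'b"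
  using L2_norm_triangle[OF that(1) Lebesgue2_uminus[OF that(2)]] by (simp add: L2_norm_minus)
 have ab: "(\<lambda>m. Hs_norm s U (a m) + Hs_norm s U (b m)) \<longlonglongrightarrow> 0" using tendsto_add[OF a0 b0] by simp
 have L: "a m \<in> Lebesgue2 (leb U)" "b m \<in> Lebesgue2 (leb U)" for m using Hs_L2[OF a] Hs_L2[OF b] by (auto simp: L2_def)
 have L0: "(\<lambda>m. L2_norm (leb U) (\<lambda>x. a m x - b m x)) \<longlonglongrightarrow> 0"
 proof (rule tendsto_zero_le[OF L2_norm_nonneg _ ab])
  show "L2_norm (leb U) (\<lambda>x. a m x - b m x) \<le> Hs_norm s U (a m) + Hs_norm s U (b m)" for m
   using diff[OF L] Hs_norm_ge_L2[of U "a m" s] Hs_norm_ge_L2[of U "b m" s] by (meson add_mono order_trans)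
 qed
 show ?thesis
 proof (cases "s = 1")
  case True
  have H: "a m \<in> H1 U" "b m \<in> H1 U" for m using a b True by (auto simp: Hs_def)
  have "(\<lambda>m. H1_norm U (\<lambda>x. a m x - b m x)) \<longlonglongrightarrow> 0"
  proof (rule H1_norm_tendsto_0[OF L0])
   fix i
   show "(\<lambda>m. L2_norm (leb U) (weak_partial U i (\<lambda>x. a m x - b m x))) \<longlonglongrightarrow> 0"
   proof (rule tendsto_zero_le[OF L2_norm_nonneg _ ab])
    fix m
    have g: "weak_partial U i (a m) \<in> Lebesgue2 (leb U)" "weak_partial U i (b m) \<in> Lebesgue2 (leb U)"
     using H1_weak_partial_L2[OF U H(1)] H1_weak_partial_L2[OF U H(2)] by (auto simp: L2_def)
    have "L2_norm (leb U) (weak_partial U i (\<lambda>x. a m x - b m x))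
      = L2_norm (leb U) (\<lambda>x. weak_partial U i (a m) x - weak_partial U i (b m) x)"
    proof (rule L2_norm_cong_AE)
     show "weak_partial U i (\<lambda>x. a m x - b m x) \<in> borel_measurable (leb U)"
      by (rule Lebesgue2_measurable[OF H1_weak_partial_L2[OF U H1_diff[OF U H], unfolded L2_def]])
     show "(\<lambda>x. weak_partial U i (a m) x - weak_partial U i (b m) x) \<in> borel_measurable (leb U)"
      by (rule Lebesgue2_measurable[OF Lebesgue2_diff[OF g]])
     show "AE x in leb U. weak_partial U i (\<lambda>x. a m x - b m x) x = weak_partial U i (a m) x - weak_partial U i (b m) x"
      by (rule weak_partial_AE[OF U is_weak_partial_diff[OF U H1_weak_partial[OF H(1)] H1_weak_partial[OF H(2)]]])
    qed
    also have "\<dots> \<le> H1_norm U (a m) + H1_norm U (b m)"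
     using diff[OF g] H1_norm_ge(2)[of U i "a m"] H1_norm_ge(2)[of U i "b m"] by linarith
    finally show "L2_norm (leb U) (weak_partial U i (\<lambda>x. a m x - b m x)) \<le> Hs_norm s U (a m) + Hs_norm s U (b m)"
     using True by (simp add: Hs_norm_def)
   qed
  qed
  then show ?thesis using True by (simp add: Hs_norm_def)
 next
  case False
  have g: "gagliardo s U (a m) < \<infinity>" "gagliardo s U (b m) < \<infinity>" for m using a b False by (auto simp: Hs_def)
  have "(\<lambda>m. sqrt (enn2real (gagliardo s U (\<lambda>x. a m x - b m x)))) \<longlonglongrightarrow> 0"
  proof (rule tendsto_zero_le[OF _ _ ab])
   show "sqrt (enn2real (gagliardo s U (\<lambda>x. a m x - b m x))) \<le> Hs_norm s U (a m) + Hs_norm s U (b m)" for m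
    using gagliardo_diff_norm(2)[OF Lebesgue2_measurable[OF L(1)] g(1) Lebesgue2_measurable[OF L(2)] g(2), of m m] U
     Hs_norm_ge_gagliardo[OF False, of U "a m"] Hs_norm_ge_gagliardo[OF False, of U "b m"] by simp
  qed simp
  then have "(\<lambda>m. sqrt ((L2_norm (leb U) (\<lambda>x. a m x - b m x))\<^sup>2
   + (sqrt (enn2real (gagliardo s U (\<lambda>x. a m x - b m x))))\<^sup>2)) \<longlonglongrightarrow> sqrt (0\<^sup>2 + 0\<^sup>2)" by (intro tendsto_intros L0)
  then show ?thesis using False by (simp add: Hs_norm_def)
 qed
qed

lemma Hs_diff:
 assumes "open U" "u \<in> Hs s U" "v \<in> Hs s U" shows "(\<lambda>x. u x - v x) \<in> Hs s U"
proof (cases "s = 1")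
 case True then show ?thesis using assms H1_diff by (auto simp: Hs_def)
next
 case False
 have L: "u \<in> Lebesgue2 (leb U)" "v \<in> Lebesgue2 (leb U)" using Hs_L2[OF assms(2)] Hs_L2[OF assms(3)] by (auto simp: L2_def)
 show ?thesis using False assms
   gagliardo_diff_norm(1)[OF Lebesgue2_measurable[OF L(1)] _ Lebesgue2_measurable[OF L(2)], of s] by (auto simp: Hs_def L2_def)
qed

section \<open>Surface measure on the facets of a polytope\<close>

definition slab_projection :: "real^'n => real^'n => real^'n => real^'n" where
 "slab_projection n a x = x - ((x - a) \<bullet> n) *\<^sub>R n"

text \<open>The measure inside \<open>hyperplane_measure\<close> before completion; Fubini is
  carried out for this Borel measure and the completion is added in
  \<open>surface_measure_eq\<close>.\<close>

definition slab_measure :: "real^'n => real^'n => (real^'n) measure" where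
 "slab_measure n a = distr (restrict_space lborel {x. 0 \<le> (x - a) \<bullet> n \<and> (x - a) \<bullet> n \<le> 1}) borel (slab_projection n a)"

lemma slab_projection_borel [measurable]: "slab_projection n a \<in> borel_measurable borel"
 unfolding slab_projection_def by measurable

lemma slab_borel [measurable]: "{x::real^'n. 0 \<le> (x - a) \<bullet> n \<and> (x - a) \<bullet> n \<le> 1} \<in> sets borel" by simp

lemma sets_slab_measure [measurable_cong, simp]: "sets (slab_measure n a) = sets borel" by (simp add: slab_measure_def)

lemma space_slab_measure [simp]: "space (slab_measure n a) = UNIV" by (simp add: slab_measure_def)

lemma slab_projection_shift:
 assumes "norm n = 1" shows "slab_projection n a (s *\<^sub>R n + x) = slab_projection n a x" "(s *\<^sub>R n + x - a) \<bullet> n = s + (x - a) \<bullet> n"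
proof -
 show 2: "(s *\<^sub>R n + x - a) \<bullet> n = s + (x - a) \<bullet> n" using assms by (simp add: norm_eq_1 inner_simps)
 show "slab_projection n a (s *\<^sub>R n + x) = slab_projection n a x" unfolding slab_projection_def 2 by (simp add: algebra_simps)
qed

lemma nn_integral_slab_measure:
 assumes [measurable]: "f \<in> borel_measurable borel" shows "(\<integral>\<^sup>+y. f y \<partial>slab_measure n a) =
  (\<integral>\<^sup>+x. f (slab_projection n a x) * indicator {0..1} ((x - a) \<bullet> n) \<partial>lborel)"
proof -
 have m: "slab_projection n a \<in> measurable (restrict_space lborel {x. 0 \<le> (x - a) \<bullet> n \<and> (x - a) \<bullet> n \<le> 1}) borel"
  by (rule measurable_restrict_space1) simp
 have "(\<integral>\<^sup>+y. f y \<partial>slab_measure n a) = (\<integral>\<^sup>+x. f (slab_projection n a x) * indicator {x. 0 \<le> (x - a) \<bullet> n \<and> (x - a) \<bullet> n \<le> 1} x \<partial>lborel)"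
  unfolding slab_measure_def by (subst nn_integral_distr[OF m], simp, subst nn_integral_restrict_space) auto
 also have "\<dots> = (\<integral>\<^sup>+x. f (slab_projection n a x) * indicator {0..1} ((x - a) \<bullet> n) \<partial>lborel)"
  by (intro nn_integral_cong) (auto simp: indicator_def)
 finally show ?thesis .
qed

text \<open>Insert \<open>1 = \<integral> indicator {0..1} (t - s) ds\<close> and exchange the integrals.\<close>

lemma nn_integral_slab_product:
 fixes g :: "real => real^'n => ennreal"
 assumes n: "norm n = 1" and [measurable]: "case_prod g \<in> borel_measurable (borel \<Otimes>\<^sub>M borel)"
 shows "(\<integral>\<^sup>+x. g ((x - a) \<bullet> n) (slab_projection n a x) \<partial>lborel) = (\<integral>\<^sup>+y. (\<integral>\<^sup>+s. g s y \<partial>lborel) \<partial>slab_measure n a)"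
proof -
 let ?t = "\<lambda>x. (x - a) \<bullet> n" and ?p = "slab_projection n a"
 have "(\<integral>\<^sup>+x. g (?t x) (?p x) \<partial>lborel) = (\<integral>\<^sup>+x. (\<integral>\<^sup>+s. g (?t x) (?p x) * indicator {0..1} (?t x - s) \<partial>lborel) \<partial>lborel)"
 proof (rule nn_integral_cong)
  fix x :: "real^'n"
  have "(\<integral>\<^sup>+s. indicator {0..1} (?t x - s) \<partial>lborel) = (\<integral>\<^sup>+s. indicator {?t x - 1..?t x} s \<partial>(lborel :: real measure))"
   by (intro nn_integral_cong) (auto simp: indicator_def)
  also have "\<dots> = 1" by simp
  finally have 1: "(\<integral>\<^sup>+s. indicator {0..1} (?t x - s) \<partial>lborel) = 1" .
  show "g (?t x) (?p x) = (\<integral>\<^sup>+s. g (?t x) (?p x) * indicator {0..1} (?t x - s) \<partial>lborel)"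
   by (subst nn_integral_cmult) (auto simp: 1)
 qed
 also have "\<dots> = (\<integral>\<^sup>+s. (\<integral>\<^sup>+x. g (?t x) (?p x) * indicator {0..1} (?t x - s) \<partial>lborel) \<partial>lborel)"
  by (rule lborel_pair.Fubini'[symmetric]) measurable
 also have "\<dots> = (\<integral>\<^sup>+s. (\<integral>\<^sup>+x. g (s + ?t x) (?p x) * indicator {0..1} (?t x) \<partial>lborel) \<partial>lborel)"
 proof (rule nn_integral_cong)
  fix s :: real
  have "(\<integral>\<^sup>+x. g (?t x) (?p x) * indicator {0..1} (?t x - s) \<partial>lborel)
    = ennreal (\<bar>1\<bar> ^ DIM(real^'n)) * (\<integral>\<^sup>+x. g (?t (s *\<^sub>R n + 1 *\<^sub>R x)) (?p (s *\<^sub>R n + 1 *\<^sub>R x)) * indicator {0..1} (?t (s *\<^sub>R n + 1 *\<^sub>R x) - s) \<partial>lborel)"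
  proof (rule nn_integral_lborel_affine)
   show "(\<lambda>x. g (?t x) (?p x) * indicator {0..1} (?t x - s)) \<in> borel_measurable borel" by simp
  qed simp
  then show "(\<integral>\<^sup>+x. g (?t x) (?p x) * indicator {0..1} (?t x - s) \<partial>lborel) = (\<integral>\<^sup>+x. g (s + ?t x) (?p x) * indicator {0..1} (?t x) \<partial>lborel)"
   by (simp add: slab_projection_shift[OF n])
 qed
 also have "\<dots> = (\<integral>\<^sup>+x. (\<integral>\<^sup>+s. g (s + ?t x) (?p x) * indicator {0..1} (?t x) \<partial>lborel) \<partial>lborel)"
  by (rule lborel_pair.Fubini') measurable
 also have "\<dots> = (\<integral>\<^sup>+x. (\<integral>\<^sup>+s. g s (?p x) \<partial>lborel) * indicator {0..1} (?t x) \<partial>lborel)"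
 proof (rule nn_integral_cong)
  fix x :: "real^'n"
  have "(\<integral>\<^sup>+s. g s (?p x) \<partial>lborel) = ennreal (\<bar>1\<bar> ^ DIM(real)) * (\<integral>\<^sup>+s. g (?t x + 1 *\<^sub>R s) (?p x) \<partial>lborel)"
  proof (rule nn_integral_lborel_affine)
   show "(\<lambda>s. g s (?p x)) \<in> borel_measurable borel" by simp
  qed simp
  then show "(\<integral>\<^sup>+s. g (s + ?t x) (?p x) * indicator {0..1} (?t x) \<partial>lborel)
    = (\<integral>\<^sup>+s. g s (?p x) \<partial>lborel) * indicator {0..1} (?t x)" by (subst nn_integral_multc) (auto simp: add.commute)
 qed
 also have "\<dots> = (\<integral>\<^sup>+y. (\<integral>\<^sup>+s. g s y \<partial>lborel) \<partial>slab_measure n a)" by (rule nn_integral_slab_measure[symmetric]) measurable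
 finally show ?thesis .
qed

text \<open>The vectors orthogonal to a hyperplane form a line. The lemma pins down normals that the
  definitions introduce by a choice.\<close>

lemma unit_normal_unique:
 fixes n n' :: "'a::euclidean_space"
 assumes F: "aff_dim F = int DIM('a) - 1" "F \<noteq> {}" and n: "norm n = 1" "norm n' = 1"
  and "\<And>x y. x \<in> F ==> y \<in> F ==> (x - y) \<bullet> n = 0" "\<And>x y. x \<in> F ==> y \<in> F ==> (x - y) \<bullet> n' = 0" shows "n' = n \<or> n' = - n"
proof -
 obtain a where a: "a \<in> F" using F by blast
 have "aff_dim F = int (DIM('a) - 1)" using F(1) by simp
 then obtain c d where cd: "c \<noteq> 0" "affine hull F = {x. c \<bullet> x = d}" unfolding aff_dim_eq_hyperplane by blast
 have sub: "affine hull F \<subseteq> {x. m \<bullet> x = m \<bullet> a}" if "\<And>x y. x \<in> F ==> y \<in> F ==> (x - y) \<bullet> m = 0" for m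
 proof (rule hull_minimal)
  show "affine {x. m \<bullet> x = m \<bullet> a}" by (rule affine_hyperplane)
  show "F \<subseteq> {x. m \<bullet> x = m \<bullet> a}"
  proof
  fix x assume "x \<in> F"
  then have "(x - a) \<bullet> m = 0" using that a by blast
  then show "x \<in> {x. m \<bullet> x = m \<bullet> a}" by (simp add: inner_diff_left inner_commute[of m])
  qed
 qed
 have par: "m = (m \<bullet> c / (c \<bullet> c)) *\<^sub>R c" if "affine hull F \<subseteq> {x. m \<bullet> x = m \<bullet> a}" for m
 proof -
  define v where "v = m - (m \<bullet> c / (c \<bullet> c)) *\<^sub>R c"
  have vc: "v \<bullet> c = 0" by (simp add: v_def inner_diff_left)
  have "a \<in> affine hull F" using a by (rule hull_inc)
  then have "a + v \<in> affine hull F" using vc cd(2) by (simp add: inner_add_right inner_commute)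
  then have "v \<bullet> v = 0" using that vc by (auto simp: inner_add_right v_def inner_diff_left inner_commute)
  then show ?thesis by (simp add: v_def)
 qed
 obtain k k' where k: "n = k *\<^sub>R c" "n' = k' *\<^sub>R c" using par[OF sub[OF assms(5)]] par[OF sub[OF assms(6)]] by blast
 have "\<bar>k\<bar> * norm c = \<bar>k'\<bar> * norm c" using n k by simp
 then show ?thesis using k by (auto simp: abs_if split: if_splits)
qed

locale full_polytope =
 fixes T :: "(real^'n) set"
 assumes polytope: "polytope T" and interior: "interior T \<noteq> {}"
begin

lemma convex: "convex T" and compact: "compact T" and polyhedron: "polyhedron T"
 using polytope by (auto simp: polytope_imp_convex polytope_imp_compact polytope_imp_polyhedron)

lemma facets_finite: "finite {F. F facet_of T}" by (rule finite_polytope_facets[OF polytope])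

lemma affine_hull: "affine hull T = UNIV" by (rule affine_hull_nonempty_interior[OF interior])

lemma aff_dim: "aff_dim T = int CARD('n)" using aff_dim_affine_hull[of T] affine_hull by simp

text \<open>An irredundant description by half-spaces, so that facets correspond exactly to bounding
  hyperplanes; full dimension removes the affine hull from the description.\<close>

lemma halfspaces:
 obtains H :: "(real^'n) set set" and a b where
  "T = \<Inter>H" "\<And>h. h \<in> H ==> a h \<noteq> 0" "\<And>h. h \<in> H ==> h = {x. a h \<bullet> x \<le> b h}"
  "\<And>F. F facet_of T \<longleftrightarrow> (\<exists>h. h \<in> H \<and> F = T \<inter> {x. a h \<bullet> x = b h})"
proof -
 obtain H where H: "finite H" "T = affine hull T \<inter> \<Inter>H"
  "\<forall>h\<in>H. \<exists>a b. a \<noteq> 0 \<and> h = {x. a \<bullet> x \<le> b}" "\<forall>F'. F' \<subset> H \<longrightarrow> T \<subset> affine hull T \<inter> \<Inter>F'"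
  using polyhedron unfolding polyhedron_Int_affine_minimal by blast
 obtain a where "\<forall>h\<in>H. \<exists>b. a h \<noteq> 0 \<and> h = {x. a h \<bullet> x \<le> b}" using bchoice[OF H(3)] by blast
 from bchoice[OF this] obtain b where ab: "\<forall>h\<in>H. a h \<noteq> 0 \<and> h = {x. a h \<bullet> x \<le> b h}" by blast
 show ?thesis
 proof (rule that)
  show "T = \<Inter>H" using H(2) affine_hull by simp
  show "F facet_of T \<longleftrightarrow> (\<exists>h. h \<in> H \<and> F = T \<inter> {x. a h \<bullet> x = b h})" for F
  proof (rule facet_of_polyhedron_explicit[OF H(1,2)])
   show "a h \<noteq> 0 \<and> h = {x. a h \<bullet> x \<le> b h}" if "h \<in> H" for h using ab that by (rule bspec)
   show "T \<subset> affine hull T \<inter> \<Inter>F'" if "F' \<subset> H" for F' by (rule H(4)[rule_format, OF that])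
  qed
  show "a h \<noteq> 0" "h = {x. a h \<bullet> x \<le> b h}" if "h \<in> H" for h using bspec[OF ab that] by (rule conjunct1, rule conjunct2)
 qed
qed

lemma facet_aff_dim: "F facet_of T ==> aff_dim F = int DIM(real^'n) - 1" using aff_dim by (simp add: facet_of_def)

lemma facet_nonempty: "F facet_of T ==> F \<noteq> {}" by (simp add: facet_of_def)

lemma facet_closed: "F facet_of T ==> closed F"
 using face_of_imp_closed[OF convex compact_imp_closed[OF compact]] facet_of_imp_face_of by blast

lemma facet_compact: "F facet_of T ==> compact F" using face_of_imp_compact[OF convex compact] facet_of_imp_face_of by blast

lemma supporting_facet:
 assumes "F facet_of T"
 obtains n c where "norm n = 1" "\<And>x. x \<in> T ==> x \<bullet> n \<le> c" "F = T \<inter> {x. x \<bullet> n = c}"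
proof -
 obtain H a b where H: "T = \<Inter>H" "\<And>h. h \<in> H ==> a h \<noteq> 0" "\<And>h. h \<in> H ==> h = {x. a h \<bullet> x \<le> b h}"
  "\<And>F. F facet_of T \<longleftrightarrow> (\<exists>h. h \<in> H \<and> F = T \<inter> {x. a h \<bullet> x = b h})" by (rule halfspaces) blast
 obtain h where h: "h \<in> H" "F = T \<inter> {x. a h \<bullet> x = b h}" using assms H(4) by blast
 have pos: "0 < norm (a h)" using H(2)[OF h(1)] by simp
 show ?thesis
 proof (rule that)
  show "norm ((1 / norm (a h)) *\<^sub>R a h) = 1" using pos by simp
  show "x \<bullet> ((1 / norm (a h)) *\<^sub>R a h) \<le> b h / norm (a h)" if "x \<in> T" for x
  proof -
   have "a h \<bullet> x \<le> b h" using that H(1) h(1) H(3)[OF h(1)] by auto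
   then show ?thesis by (simp add: inner_commute divide_right_mono)
  qed
  show "F = T \<inter> {x. x \<bullet> ((1 / norm (a h)) *\<^sub>R a h) = b h / norm (a h)}" using h(2) pos by (auto simp: inner_commute)
 qed
qed

text \<open>Justifies the definite description in \<open>outer_normal\<close>: the dimension of the
  facet fixes the direction, and the sign is fixed because the polytope is not contained in the
  hyperplane of the facet.\<close>

lemma outer_normal:
 assumes F: "F facet_of T" shows "norm (outer_normal T F) = 1" and "\<And>x y. x \<in> F ==> y \<in> T ==> (y - x) \<bullet> outer_normal T F \<le> 0"
  and "\<And>m. norm m = 1 ==> (\<And>x y. x \<in> F ==> y \<in> T ==> (y - x) \<bullet> m \<le> 0) ==> m = outer_normal T F"
  and "\<And>a. a \<in> F ==> F = T \<inter> {x. (x - a) \<bullet> outer_normal T F = 0}"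
proof -
 obtain n c where n: "norm n = 1" "\<And>x. x \<in> T ==> x \<bullet> n \<le> c" "F = T \<inter> {x. x \<bullet> n = c}" using supporting_facet[OF F] by blast
 have Fc: "x \<bullet> n = c" if "x \<in> F" for x using that n(3) by blast
 have uniq: "m = n" if m: "norm m = 1" "\<And>x y. x \<in> F ==> y \<in> T ==> (y - x) \<bullet> m \<le> 0" for m
 proof -
  note sub = facet_of_imp_subset[OF F]
  have "m = n \<or> m = - n"
  proof (rule unit_normal_unique[OF facet_aff_dim[OF F] facet_nonempty[OF F] n(1) m(1)])
   show "(x - y) \<bullet> n = 0" if "x \<in> F" "y \<in> F" for x y using Fc that by (simp add: inner_diff_left)
   show "(x - y) \<bullet> m = 0" if "x \<in> F" "y \<in> F" for x y
    using m(2)[OF that(1) subsetD[OF sub that(2)]] m(2)[OF that(2) subsetD[OF sub that(1)]] by (simp add: inner_diff_left)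
  qed
  \<comment> \<open>With the opposite sign the polytope would lie on both sides of the hyperplane,
    hence in \<open>F\<close>.\<close>
  moreover have False if "m = - n"
  proof -
   obtain a where a: "a \<in> F" using facet_nonempty[OF F] by blast
   have "T \<subseteq> F"
   proof
    fix y assume y: "y \<in> T"
    have "y \<bullet> n = c" using m(2)[OF a y] that n(2)[OF y] Fc[OF a] by (simp add: inner_diff_left)
    then show "y \<in> F" using y n(3) by blast
   qed
   then show False using sub F by simp
  qed
  ultimately show ?thesis by blast
 qed
 have sup: "(y - x) \<bullet> n \<le> 0" if "x \<in> F" "y \<in> T" for x y using n(2)[OF that(2)] Fc[OF that(1)] by (simp add: inner_diff_left)
 have eq: "outer_normal T F = n" unfolding outer_normal_def using n(1) sup uniq by (intro the_equality) blast+
 show "norm (outer_normal T F) = 1" using n(1) eq by simp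
 show "(y - x) \<bullet> outer_normal T F \<le> 0" if "x \<in> F" "y \<in> T" for x y using sup that eq by simp
 show "m = outer_normal T F" if "norm m = 1" "\<And>x y. x \<in> F ==> y \<in> T ==> (y - x) \<bullet> m \<le> 0" for m using uniq that eq by simp
 show "F = T \<inter> {x. (x - a) \<bullet> outer_normal T F = 0}" if "a \<in> F" for a using n(3) Fc[OF that] eq by (auto simp: inner_diff_left)
qed

text \<open>The same choice as in \<open>surface_measure\<close>, so that the two match without an
  argument about independence of the base point.\<close>

definition facet_point :: "(real^'n) set => real^'n" where
 "facet_point F = (SOME a. a \<in> F)"

text \<open>Oriented to be nonnegative on the polytope, so that membership and the interior can be
  read off from signs. It is affine, and its gradient is minus the outer normal.\<close>

definition facet_dist :: "(real^'n) set => real^'n => real" where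
 "facet_dist F x = - ((x - facet_point F) \<bullet> outer_normal T F)"

lemma facet_point: "F facet_of T ==> facet_point F \<in> F" unfolding facet_point_def using facet_nonempty some_in_eq by metis

lemma facet_dist_eq: "F facet_of T ==> a \<in> F ==> facet_dist F x = - ((x - a) \<bullet> outer_normal T F)"
proof -
 assume F: "F facet_of T" and "a \<in> F"
 then have "(a - facet_point F) \<bullet> outer_normal T F = 0" using outer_normal(4)[OF F facet_point[OF F]] by blast
 then show ?thesis by (simp add: facet_dist_def inner_diff_left)
qed

lemma facet_dist_nonneg: "F facet_of T ==> x \<in> T ==> 0 \<le> facet_dist F x"
 using outer_normal(2)[OF _ facet_point] by (simp add: facet_dist_def)

lemma facet_iff: "F facet_of T ==> x \<in> F \<longleftrightarrow> x \<in> T \<and> facet_dist F x = 0"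
 using outer_normal(4)[OF _ facet_point, of F] by (auto simp: facet_dist_def)

lemma mem_iff: "x \<in> T \<longleftrightarrow> (\<forall>F. F facet_of T \<longrightarrow> 0 \<le> facet_dist F x)"
proof
 assume r: "\<forall>F. F facet_of T \<longrightarrow> 0 \<le> facet_dist F x"
 obtain H a b where H: "T = \<Inter>H" "\<And>h. h \<in> H ==> a h \<noteq> 0" "\<And>h. h \<in> H ==> h = {x. a h \<bullet> x \<le> b h}"
  "\<And>F. F facet_of T \<longleftrightarrow> (\<exists>h. h \<in> H \<and> F = T \<inter> {x. a h \<bullet> x = b h})" by (rule halfspaces) blast
 show "x \<in> T"
 proof (subst H(1), rule InterI)
  fix h assume h: "h \<in> H"
  define F where "F = T \<inter> {x. a h \<bullet> x = b h}"
  have F: "F facet_of T" using H(4) h F_def by blast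
  have pos: "0 < norm (a h)" using H(2)[OF h] by simp
  have eq: "(1 / norm (a h)) *\<^sub>R a h = outer_normal T F"
  proof (rule outer_normal(3)[OF F])
   show "norm ((1 / norm (a h)) *\<^sub>R a h) = 1" using pos by simp
   fix u v assume "u \<in> F" "v \<in> T"
   then have "a h \<bullet> (v - u) \<le> 0" using H(1) H(3)[OF h] h by (auto simp: F_def inner_diff_right)
   then have "(a h \<bullet> (v - u)) / norm (a h) \<le> 0" using pos by (rule divide_nonpos_pos)
   then show "(v - u) \<bullet> ((1 / norm (a h)) *\<^sub>R a h) \<le> 0" by (simp add: inner_commute)
  qed
  have fp: "a h \<bullet> facet_point F = b h" using facet_point[OF F] by (simp add: F_def)
  have "0 \<le> - ((x - facet_point F) \<bullet> ((1 / norm (a h)) *\<^sub>R a h))" using r F eq by (simp add: facet_dist_def)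
  then have "((x - facet_point F) \<bullet> a h) / norm (a h) \<le> 0" by simp
  then have "(x - facet_point F) \<bullet> a h \<le> 0" by (simp only: divide_le_0_iff) auto
  then have "a h \<bullet> x \<le> b h" using fp by (simp add: inner_diff_right inner_commute)
  then show "x \<in> h" using H(3)[OF h] by blast
 qed
qed (simp add: facet_dist_nonneg)

lemma facet_dist_pos_interior:
 assumes F: "F facet_of T" and x: "x \<in> interior T" shows "0 < facet_dist F x"
proof (rule ccontr)
 assume "\<not> 0 < facet_dist F x"
 moreover have xt: "x \<in> T" using x interior_subset by blast
 ultimately have "x \<in> F" using facet_iff[OF F] facet_dist_nonneg[OF F xt] by simp
 moreover have "F \<noteq> T" using F by auto
 ultimately show False using face_of_disjoint_interior[OF facet_of_imp_face_of[OF F]] x by blast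
qed

lemma outer_normal_inj:
 assumes "F facet_of T" "F' facet_of T" "outer_normal T F = outer_normal T F'" shows "F = F'"
proof -
 have sub: "facet_point F \<in> T" "facet_point F' \<in> T" using assms facet_point facet_of_imp_subset by blast+
 have eq: "facet_dist F x = facet_dist F' x" for x
  using facet_dist_nonneg[OF assms(1) sub(2)] facet_dist_nonneg[OF assms(2) sub(1)] assms(3)
  by (simp add: facet_dist_def inner_diff_left)
 show ?thesis
 proof (rule set_eqI)
  show "x \<in> F \<longleftrightarrow> x \<in> F'" for x unfolding facet_iff[OF assms(1)] facet_iff[OF assms(2)] eq ..
 qed
qed

lemma facet_dist_affine: "facet_dist F (x + s *\<^sub>R v) = facet_dist F x - s * (v \<bullet> outer_normal T F)"
 by (simp add: facet_dist_def algebra_simps inner_simps)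

abbreviation facet_proj :: "(real^'n) set => real^'n => real^'n" where
 "facet_proj F \<equiv> slab_projection (outer_normal T F) (facet_point F)"

lemma facet_proj_eq: "facet_proj F x = x + facet_dist F x *\<^sub>R outer_normal T F" by (simp add: slab_projection_def facet_dist_def)

lemma facet_dist_proj: "F facet_of T ==> facet_dist F (facet_proj F x) = 0"
 using outer_normal(1)[of F] by (simp add: facet_proj_eq facet_dist_affine norm_eq_1)

lemma facet_proj_in_facet:
 assumes "F facet_of T" "\<And>F'. F' facet_of T ==> F' \<noteq> F ==> 0 \<le> facet_dist F' (facet_proj F x)" shows "facet_proj F x \<in> F"
 using assms facet_dist_proj[OF assms(1)] by (subst facet_iff[OF assms(1)], subst mem_iff) (metis order_refl)

text \<open>The expression is affine in x, so its zero set is a hyperplane unless the two normals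
  are parallel. In that case they are opposite, and the distance of the projection to
  \<open>F'\<close> is a positive constant.\<close>

lemma AE_facet_dist_proj:
 assumes F: "F facet_of T" and F': "F' facet_of T" and ne: "F' \<noteq> F" shows "AE x in lborel. facet_dist F' (facet_proj F x) \<noteq> 0"
proof -
 let ?n = "outer_normal T F" and ?n' = "outer_normal T F'"
 define v where "v = ?n' - (?n \<bullet> ?n') *\<^sub>R ?n"
 have eq: "facet_dist F' (facet_proj F x) = (facet_point F' \<bullet> ?n' - (facet_point F \<bullet> ?n) * (?n \<bullet> ?n')) - v \<bullet> x" for x
  by (simp add: facet_proj_eq facet_dist_def v_def algebra_simps inner_commute)
 show ?thesis
 proof (cases "v = 0")
  case False
  have "negligible {x. v \<bullet> x = facet_point F' \<bullet> ?n' - (facet_point F \<bullet> ?n) * (?n \<bullet> ?n')}"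
   using False by (intro negligible_hyperplane) simp
  then have "AE x in lebesgue. x \<notin> {x. v \<bullet> x = facet_point F' \<bullet> ?n' - (facet_point F \<bullet> ?n) * (?n \<bullet> ?n')}"
   by (intro AE_not_in) (simp add: negligible_iff_null_sets)
  then have "AE x in lborel. x \<notin> {x. v \<bullet> x = facet_point F' \<bullet> ?n' - (facet_point F \<bullet> ?n) * (?n \<bullet> ?n')}"
   by (simp add: AE_completion_iff)
  then show ?thesis by eventually_elim (simp add: eq)
 next
  case True
  obtain k where k: "?n' = k *\<^sub>R ?n" using True by (auto simp: v_def)
  have "\<bar>k\<bar> = 1" using arg_cong[OF k, of norm] outer_normal(1)[OF F] outer_normal(1)[OF F'] by simp
  then have "k = 1 \<or> k = - 1" by linarith
  then have n': "?n' = - ?n" using k outer_normal_inj[OF F F'] ne by auto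
  obtain z where z: "z \<in> interior T" using interior by blast
  have "0 < facet_dist F z" "0 < facet_dist F' z" using facet_dist_pos_interior[OF F z] facet_dist_pos_interior[OF F' z] by auto
  moreover have "facet_dist F' y = facet_dist F' z + (facet_dist F z - facet_dist F y)" for y
   by (simp add: facet_dist_def n' inner_simps)
  ultimately have "0 < facet_dist F' (facet_proj F x)" for x using facet_dist_proj[OF F, of x] by (metis add_pos_pos diff_zero)
  then show ?thesis by (intro AE_I2) (metis less_irrefl)
 qed
qed

text \<open>The sign of the normal chosen here is unknown. It is kept as in
  \<open>surface_measure\<close> and dealt with once, in
  \<open>nn_integral_facet_product\<close>.\<close>

definition facet_base :: "(real^'n) set => (real^'n) measure" where
 "facet_base F = slab_measure (SOME n. norm n = 1 \<and> (\<forall>x\<in>F. \<forall>y\<in>F. (x - y) \<bullet> n = 0)) (facet_point F)"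

lemma surface_measure_eq: "surf F = restrict_space (completion (facet_base F)) F"
 by (simp add: surface_measure_def hyperplane_measure_def facet_base_def slab_measure_def
   facet_point_def slab_projection_def[abs_def] Let_def)

lemma sets_facet_base [measurable_cong, simp]: "sets (facet_base F) = sets borel" by (simp add: facet_base_def)

lemma space_facet_base [simp]: "space (facet_base F) = UNIV" by (simp add: facet_base_def)

text \<open>Fubini in the normal direction. The chosen normal is the outer one up to sign, and the
  sign is immaterial because the inner integral runs over the whole line.\<close>

lemma nn_integral_facet_product:
 fixes g :: "real => real^'n => ennreal"
 assumes F: "F facet_of T" and [measurable]: "case_prod g \<in> borel_measurable (borel \<Otimes>\<^sub>M borel)"
 shows "(\<integral>\<^sup>+x. g (facet_dist F x) (facet_proj F x) \<partial>lborel) = (\<integral>\<^sup>+y. (\<integral>\<^sup>+s. g s y \<partial>lborel) \<partial>facet_base F)"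
proof -
 define m where "m = (SOME n::real^'n. norm n = 1 \<and> (\<forall>x\<in>F. \<forall>y\<in>F. (x - y) \<bullet> n = 0))"
 let ?n = "outer_normal T F"
 have perp: "(x - y) \<bullet> ?n = 0" if "x \<in> F" "y \<in> F" for x y
  using outer_normal(2)[OF F that(1) subsetD[OF facet_of_imp_subset[OF F] that(2)]]
   outer_normal(2)[OF F that(2) subsetD[OF facet_of_imp_subset[OF F] that(1)]] by (simp add: inner_diff_left)
 have m: "norm m = 1 \<and> (\<forall>x\<in>F. \<forall>y\<in>F. (x - y) \<bullet> m = 0)"
  unfolding m_def by (rule someI[of _ ?n]) (use outer_normal(1)[OF F] perp in blast)
 have "m = ?n \<or> m = - ?n"
  by (rule unit_normal_unique[OF facet_aff_dim[OF F] facet_nonempty[OF F]]) (use outer_normal(1)[OF F] perp m in blast)+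
 then show ?thesis
 proof
  assume mn: "m = - ?n"
  have proj: "slab_projection m (facet_point F) = facet_proj F" by (rule ext) (simp add: slab_projection_def mn)
  have dist: "(x - facet_point F) \<bullet> m = facet_dist F x" for x by (simp add: facet_dist_def mn)
  show ?thesis using nn_integral_slab_product[OF conjunct1[OF m] assms(2), of "facet_point F"]
   by (simp add: facet_base_def m_def[symmetric] proj dist)
 next
  assume mn: "m = ?n"
  have dist: "(x - facet_point F) \<bullet> m = - facet_dist F x" for x by (simp add: facet_dist_def mn)
  have m2: "case_prod (\<lambda>s. g (- s)) \<in> borel_measurable (borel \<Otimes>\<^sub>M borel)" by simp
  have flip: "(\<integral>\<^sup>+s. g (- s) y \<partial>lborel) = (\<integral>\<^sup>+s. g s y \<partial>lborel)" for y
   using nn_integral_lborel_affine[of "\<lambda>s. g s y" "-1" 0] by simp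
  show ?thesis using nn_integral_slab_product[OF conjunct1[OF m] m2, of "facet_point F"]
   by (simp add: facet_base_def m_def[symmetric] dist flip) (simp add: mn)
 qed
qed

text \<open>A cylinder of height \<open>R\<close> over the part of the facet plane in the ball fits
  into the ball of twice the radius; dividing by \<open>R\<close> leaves the power
  \<open>CARD('n) - 1\<close>. This rate enters the exponent in
  \<open>cone_avg_step\<close>.\<close>

lemma facet_base_cball:
 assumes F: "F facet_of T" and R: "0 < R"
 shows "emeasure (facet_base F) (cball z R) \<le> ennreal (unit_ball_vol (real CARD('n)) * 2 ^ CARD('n) * R ^ (CARD('n) - 1))"
proof -
 let ?V = "unit_ball_vol (real CARD('n))"
 let ?g = "\<lambda>s y. indicator {0..R} (s::real) * indicator (cball z R) (y::real^'n) :: ennreal"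
 have [measurable]: "cball z R \<in> sets borel" by simp
 have "ennreal R * emeasure (facet_base F) (cball z R) = (\<integral>\<^sup>+y. ennreal R * indicator (cball z R) y \<partial>facet_base F)"
  by (simp add: nn_integral_cmult)
 also have "\<dots> = (\<integral>\<^sup>+y. (\<integral>\<^sup>+s. ?g s y \<partial>lborel) \<partial>facet_base F)" using R by (intro nn_integral_cong) (simp add: nn_integral_multc)
 also have "\<dots> = (\<integral>\<^sup>+x. ?g (facet_dist F x) (facet_proj F x) \<partial>lborel)"
  by (rule nn_integral_facet_product[OF F, symmetric]) measurable
 also have "\<dots> \<le> (\<integral>\<^sup>+x. indicator (cball z (2 * R)) x \<partial>lborel)"
 proof (rule nn_integral_mono)
  fix x
  show "?g (facet_dist F x) (facet_proj F x) \<le> indicator (cball z (2 * R)) x"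
  proof (cases "0 \<le> facet_dist F x \<and> facet_dist F x \<le> R \<and> dist z (facet_proj F x) \<le> R")
   case True
   show ?thesis using True outer_normal(1)[OF F] True dist_triangle[of z x "facet_proj F x"] by (simp add: facet_proj_eq dist_norm)
  qed (auto simp: indicator_def)
 qed
 also have "\<dots> = ennreal (?V * (2 * R) ^ CARD('n))" using R by (simp add: emeasure_cball)
 also have "\<dots> = ennreal R * ennreal (?V * 2 ^ CARD('n) * R ^ (CARD('n) - 1))"
 proof -
  have "R ^ CARD('n) = R * R ^ (CARD('n) - 1)" by (simp add: power_eq_if)
  then show ?thesis using R by (simp add: ennreal_mult[symmetric])
 qed
 finally show ?thesis using R by (simp add: ennreal_mult_le_mult_iff)
qed

lemma facet_base_bounded_finite: "F facet_of T ==> bounded B ==> emeasure (facet_base F) B < \<infinity>"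
proof -
 assume F: "F facet_of T" and "bounded B"
 then obtain R where R: "0 < R" "B \<subseteq> cball 0 R" using bounded_subset_ballD[of B 0] ball_subset_cball by (metis order_trans)
 have "emeasure (facet_base F) B \<le> emeasure (facet_base F) (cball 0 R)" by (rule emeasure_mono[OF R(2)]) simp
 also have "\<dots> < \<infinity>" using facet_base_cball[OF F R(1), of 0] by (simp add: le_less_trans)
 finally show ?thesis .
qed

lemma facet_borel: "F facet_of T ==> F \<in> sets borel" using facet_closed by simp

lemma facet_in_completion: "F facet_of T ==> F \<inter> space (completion (facet_base F)) \<in> sets (completion (facet_base F))"
 using facet_borel by (auto intro!: sets_completionI_sets)

lemma space_surface_measure: "space (surf F) = F" for F :: "(real^'n) set" by (simp add: surface_measure_eq space_restrict_space)

lemma nn_integral_surface: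
 assumes "F facet_of T" shows "(\<integral>\<^sup>+x. f x \<partial>surf F) = (\<integral>\<^sup>+x. f x * indicator F x \<partial>facet_base F)" unfolding surface_measure_eq
 by (simp add: nn_integral_restrict_space[OF facet_in_completion[OF assms]] nn_integral_completion)

lemma surface_borel: "f \<in> borel_measurable borel ==> f \<in> borel_measurable (surf F)"
 for F :: "(real^'n) set" unfolding surface_measure_eq by (intro measurable_restrict_space1 measurable_completion) simp

lemma surface_finite: "F facet_of T ==> finite_measure (surf F)"
proof
 assume F: "F facet_of T"
 have "emeasure (surf F) (space (surf F)) = (\<integral>\<^sup>+x. 1 \<partial>surf F)" by simp
 also have "\<dots> = (\<integral>\<^sup>+x. 1 * indicator F x \<partial>facet_base F)" by (rule nn_integral_surface[OF F])
 also have "\<dots> = emeasure (facet_base F) F" using facet_borel[OF F] by simp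
 also have "\<dots> < \<infinity>" by (rule facet_base_bounded_finite[OF F compact_imp_bounded[OF facet_compact[OF F]]])
 finally show "emeasure (surf F) (space (surf F)) \<noteq> \<infinity>" by simp
qed

lemma continuous_surface_L2:
 assumes "continuous_on UNIV Y" and F: "F facet_of T" shows "Y \<in> Lebesgue2 (surf F)"
proof -
 have "compact (Y ` F)" using facet_compact[OF F] by (intro compact_continuous_image continuous_on_subset[OF assms(1)]) auto
 then obtain B where B: "\<And>y. y \<in> Y ` F ==> norm y \<le> B" by (meson bounded_iff compact_imp_bounded)
 show ?thesis
  by (rule Lebesgue2_bounded[OF surface_finite[OF F] surface_borel[OF borel_measurable_continuous_onI[OF assms(1)]], of B])
   (use B in \<open>auto simp: space_surface_measure\<close>)
qed

text \<open>Points of \<open>F\<close> in the plane of another facet are negligible: the product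
  formula turns their surface measure into the volume of a set that
  \<open>AE_facet_dist_proj\<close> shows to be null.\<close>

lemma AE_surface_facet_dist:
 assumes F: "F facet_of T" and F': "F' facet_of T" and ne: "F' \<noteq> F" shows "AE x in surf F. 0 < facet_dist F' x"
proof -
 have [measurable]: "facet_dist F' \<in> borel_measurable borel" unfolding facet_dist_def by measurable
 let ?g = "\<lambda>s y. indicator {0..1} (s::real) * indicator {y. facet_dist F' y = 0} y :: ennreal"
 have "(\<integral>\<^sup>+y. indicator {y. facet_dist F' y = 0} y \<partial>facet_base F) = (\<integral>\<^sup>+y. (\<integral>\<^sup>+s. ?g s y \<partial>lborel) \<partial>facet_base F)"
  by (intro nn_integral_cong) (simp add: nn_integral_multc)
 also have "\<dots> = (\<integral>\<^sup>+x. ?g (facet_dist F x) (facet_proj F x) \<partial>lborel)"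
  by (rule nn_integral_facet_product[OF F, symmetric]) measurable
 also have "\<dots> = (\<integral>\<^sup>+x. 0 \<partial>(lborel :: (real^'n) measure))"
  by (rule nn_integral_cong_AE) (use AE_facet_dist_proj[OF F F' ne] in \<open>eventually_elim, simp\<close>)
 finally have z: "(\<integral>\<^sup>+y. indicator {y. facet_dist F' y = 0} y \<partial>facet_base F) = 0" by simp
 have m: "(\<lambda>y. indicator {y. facet_dist F' y = 0} y :: ennreal) \<in> borel_measurable (facet_base F)" by simp
 have "AE y in facet_base F. indicator {y. facet_dist F' y = 0} y = (0::ennreal)" using nn_integral_0_iff_AE[OF m] z by simp
 then have "AE y in completion (facet_base F). indicator {y. facet_dist F' y = 0} y = (0::ennreal)" by (rule AE_completion)
 then show ?thesis unfolding surface_measure_eq AE_restrict_space_iff[OF facet_in_completion[OF F]]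
 proof eventually_elim
  case (elim y)
  show ?case
  proof
   assume "y \<in> F"
   then have "0 \<le> facet_dist F' y" using facet_dist_nonneg[OF F'] facet_of_imp_subset[OF F] by blast
   moreover have "facet_dist F' y \<noteq> 0" using elim by auto
   ultimately show "0 < facet_dist F' y" by simp
  qed
 qed
qed

end

section \<open>The divergence theorem on a polytope\<close>

lemma nn_integral_flat_exp_deriv: "(\<integral>\<^sup>+s. ennreal (flat_exp_deriv s) \<partial>lborel) = 1"
proof -
 have m: "flat_exp_deriv \<in> borel_measurable borel" unfolding flat_exp_deriv_def[abs_def] by measurable
 have "(\<integral>\<^sup>+s. ennreal (flat_exp_deriv s) \<partial>lborel) = (\<integral>\<^sup>+s. ennreal (flat_exp_deriv s) * indicator {0..} s \<partial>lborel)"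
  by (intro nn_integral_cong) (auto simp: flat_exp_deriv_def)
 also have "\<dots> = ennreal (1 - flat_exp 0)" by (rule nn_integral_FTC_atLeast[OF m]) (auto intro: flat_exp_DERIV flat_exp_at_top)
 finally show ?thesis by simp
qed

lemma smooth_flat_exp_deriv: "smooth q ==> smooth (\<lambda>x. flat_exp_deriv (q x))" unfolding flat_exp_deriv_eq
 by (rule smooth_compose_family[of "\<lambda>k. exp_inv_poly (exp_inv_pow k)"]) (simp_all only: exp_inv_pow.simps(2) exp_inv_poly_deriv)

lemma flat_exp_deriv_borel [measurable]: "flat_exp_deriv \<in> borel_measurable borel"
 unfolding flat_exp_deriv_def[abs_def] by measurable

lemma flat_exp_borel [measurable]: "flat_exp \<in> borel_measurable borel" unfolding flat_exp_def[abs_def] by measurable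

lemma partial_prod:
 fixes g :: "'k => real^'n => real"
 assumes "finite S" "\<And>k. k \<in> S ==> smooth (g k)"
 shows "partial i (\<lambda>x. \<Prod>k\<in>S. g k x) x = (\<Sum>k\<in>S. partial i (g k) x * (\<Prod>l\<in>S - {k}. g l x))" using assms
proof (induction S rule: finite_induct)
 case (insert a S)
 have s: "smooth (g a)" "smooth (\<lambda>x. \<Prod>k\<in>S. g k x)" using insert by (auto intro: smooth_prod)
 have "partial i (\<lambda>x. \<Prod>k\<in>insert a S. g k x) x = partial i (\<lambda>x. g a x * (\<Prod>k\<in>S. g k x)) x" using insert(1,2) by simp
 also have "\<dots> = g a x * (\<Sum>k\<in>S. partial i (g k) x * (\<Prod>l\<in>S - {k}. g l x)) + partial i (g a) x * (\<Prod>k\<in>S. g k x)"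
  using insert by (simp add: partial_bilinear[OF bounded_bilinear_mult s])
 also have "g a x * (\<Sum>k\<in>S. partial i (g k) x * (\<Prod>l\<in>S - {k}. g l x)) = (\<Sum>k\<in>S. partial i (g k) x * (\<Prod>l\<in>insert a S - {k}. g l x))"
  unfolding sum_distrib_left
 proof (rule sum.cong)
  fix k assume k: "k \<in> S"
  then have "insert a S - {k} = insert a (S - {k})" using insert(2) by auto
  then show "g a x * (partial i (g k) x * (\<Prod>l\<in>S - {k}. g l x)) = partial i (g k) x * (\<Prod>l\<in>insert a S - {k}. g l x)"
   using insert(1,2) by simp
 qed simp
 finally show ?case using insert(1,2) by simp
qed simp

lemma negligible_AE_lborel: "negligible N ==> AE x in lborel. x \<notin> N"
proof -
 assume "negligible N"
 then have "AE x in lebesgue. x \<notin> N" by (intro AE_not_in) (simp add: negligible_iff_null_sets)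
 then show ?thesis by (simp add: AE_completion_iff)
qed

context full_polytope
begin

definition facets :: "(real^'n) set set" where "facets = {F. F facet_of T}"

lemma finite_facets [simp]: "finite facets" by (simp add: facets_def facets_finite)

lemma smooth_facet_dist: "smooth (facet_dist F)"
proof -
 have "smooth (\<lambda>x. - (x \<bullet> outer_normal T F) + facet_point F \<bullet> outer_normal T F)"
  by (intro smooth_add smooth_const smooth_bounded_linear bounded_linear_minus bounded_linear_inner_left)
 also have "(\<lambda>x. - (x \<bullet> outer_normal T F) + facet_point F \<bullet> outer_normal T F) = facet_dist F"
  by (auto simp: facet_dist_def inner_diff_left)
 finally show ?thesis .
qed

lemma partial_facet_dist: "partial i (facet_dist F) x = - (outer_normal T F $ i)"
proof -
 have "(facet_dist F has_derivative (\<lambda>h. - (h \<bullet> outer_normal T F))) (at x)"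
  unfolding facet_dist_def[abs_def] by (auto intro!: derivative_eq_intros)
 then show ?thesis by (simp add: partial_eq inner_axis' )
qed

lemma facet_dist_borel [measurable]: "facet_dist F \<in> borel_measurable borel" by (rule smooth_borel[OF smooth_facet_dist])

text \<open>The factor with \<open>flat_exp_deriv\<close> is a probability density in the distance
  to \<open>F\<close> that concentrates at 0, and the remaining product cuts the plane of
  \<open>F\<close> down to the facet. In the limit a volume integral becomes a surface
  integral.\<close>

lemma facet_limit:
 fixes Y :: "real^'n => real"
 assumes F: "F facet_of T" and Y: "continuous_on UNIV Y" "\<And>x. x \<in> T ==> 0 \<le> Y x"
 shows "(\<lambda>k. \<integral>\<^sup>+x. ennreal (Y x * (real (Suc k) * flat_exp_deriv (real (Suc k) * facet_dist F x)
    * (\<Prod>F'\<in>facets - {F}. flat_exp (real (Suc k) * facet_dist F' x)))) \<partial>lborel) \<longlonglongrightarrow> (\<integral>\<^sup>+x. ennreal (Y x) \<partial>surf F)"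
proof -
 let ?n = "outer_normal T F" and ?d = "facet_dist F" and ?p = "facet_proj F"
 note [measurable] = borel_measurable_continuous_onI[OF Y(1)]
 define e where "e k = 1 / real (Suc k)" for k
 have e: "0 < e k" for k by (simp add: e_def)
 have e0: "e \<longlonglongrightarrow> 0" unfolding e_def using LIMSEQ_inverse_real_of_nat by (simp add: inverse_eq_divide)
 define g where "g k s y = ennreal (Y (y - s *\<^sub>R ?n) * (real (Suc k) * flat_exp_deriv (real (Suc k) * s)
    * (\<Prod>F'\<in>facets - {F}. flat_exp (real (Suc k) * facet_dist F' (y - s *\<^sub>R ?n)))))" for k s y
 \<comment> \<open>This is \<open>g\<close> after the substitution s = \<open>e k * r\<close>, which
   replaces the concentrating density by a fixed one.\<close>
 define G where "G k r y = ennreal (Y (y - (e k * r) *\<^sub>R ?n) * (flat_exp_deriv r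
    * (\<Prod>F'\<in>facets - {F}. flat_exp (real (Suc k) * facet_dist F' (y - (e k * r) *\<^sub>R ?n)))))" for k r y
 have gm [measurable]: "case_prod (g k) \<in> borel_measurable (borel \<Otimes>\<^sub>M borel)" for k unfolding g_def[abs_def] by measurable
 have Gm [measurable]: "case_prod (G k) \<in> borel_measurable (borel \<Otimes>\<^sub>M borel)" for k unfolding G_def[abs_def] by measurable
 have scale: "(\<integral>\<^sup>+s. g k s y \<partial>lborel) = (\<integral>\<^sup>+r. G k r y \<partial>lborel)" for k y
 proof -
  have gy: "(\<lambda>s. g k s y) \<in> borel_measurable borel" unfolding g_def by measurable
  have "(\<integral>\<^sup>+s. g k s y \<partial>lborel) = ennreal (e k) * (\<integral>\<^sup>+r. g k (e k * r) y \<partial>lborel)"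
   using nn_integral_lborel_affine[OF gy, of "e k" 0] e[of k] by simp
  also have "\<dots> = (\<integral>\<^sup>+r. ennreal (e k) * g k (e k * r) y \<partial>lborel)"
   by (rule nn_integral_cmult[symmetric]) (unfold g_def, measurable)
  also have "\<dots> = (\<integral>\<^sup>+r. G k r y \<partial>lborel)"
  proof (rule nn_integral_cong)
   fix r
   have r: "real (Suc k) * (e k * r) = r" by (simp add: e_def)
   have key: "e k * (a * (real (Suc k) * b * c)) = a * (b * c)" for a b c by (simp add: e_def)
   show "ennreal (e k) * g k (e k * r) y = G k r y"
    unfolding g_def G_def r using e[of k] by (simp only: ennreal_mult'[symmetric] key)
  qed
  finally show ?thesis .
 qed
 have recon: "?p x - ?d x *\<^sub>R ?n = x" for x by (simp add: facet_proj_eq)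
 \<comment> \<open>The volume integral is split over the facet plane, rescaled along each normal
   line, and reassembled, so that dominated convergence can be used for Lebesgue measure.\<close>
 have eq: "(\<integral>\<^sup>+x. ennreal (Y x * (real (Suc k) * flat_exp_deriv (real (Suc k) * facet_dist F x)
    * (\<Prod>F'\<in>facets - {F}. flat_exp (real (Suc k) * facet_dist F' x)))) \<partial>lborel) = (\<integral>\<^sup>+x. G k (?d x) (?p x) \<partial>lborel)" for k
 proof -
  have "(\<integral>\<^sup>+x. ennreal (Y x * (real (Suc k) * flat_exp_deriv (real (Suc k) * facet_dist F x)
    * (\<Prod>F'\<in>facets - {F}. flat_exp (real (Suc k) * facet_dist F' x)))) \<partial>lborel)
   = (\<integral>\<^sup>+x. g k (?d x) (?p x) \<partial>lborel)" unfolding g_def recon ..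
  also have "\<dots> = (\<integral>\<^sup>+y. (\<integral>\<^sup>+s. g k s y \<partial>lborel) \<partial>facet_base F)" by (rule nn_integral_facet_product[OF F gm])
  also have "\<dots> = (\<integral>\<^sup>+y. (\<integral>\<^sup>+r. G k r y \<partial>lborel) \<partial>facet_base F)" unfolding scale ..
  also have "\<dots> = (\<integral>\<^sup>+x. G k (?d x) (?p x) \<partial>lborel)" by (rule nn_integral_facet_product[OF F Gm, symmetric])
  finally show ?thesis .
 qed
 obtain C0 where C0: "\<And>y. y \<in> Y ` T ==> norm y \<le> C0" using compact_continuous_image[OF continuous_on_subset[OF Y(1) subset_UNIV] compact] by (meson bounded_iff compact_imp_bounded)
 define C where "C = \<bar>C0\<bar>"
 have C: "0 \<le> C" "\<And>x. x \<in> T ==> Y x \<le> C" using C0 unfolding C_def by force+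
 have pc: "continuous_on UNIV ?p" unfolding slab_projection_def by (intro continuous_intros)
 obtain R where R: "\<And>y. y \<in> ?p ` T ==> norm y \<le> R" using compact_continuous_image[OF continuous_on_subset[OF pc subset_UNIV] compact] by (meson bounded_iff compact_imp_bounded)
 define W where "W s y = ennreal C * (ennreal (flat_exp_deriv s) * indicator (cball 0 R) y)" for s and y :: "real^'n"
 have [measurable]: "cball (0::real^'n) R \<in> sets borel" by simp
 have Wm [measurable]: "case_prod W \<in> borel_measurable (borel \<Otimes>\<^sub>M borel)" unfolding W_def[abs_def] by measurable
 \<comment> \<open>Where the integrand is nonzero its factors force the shifted point
   \<open>?q\<close> into the polytope. This bounds \<open>Y\<close> there and confines the
   projection to a compact set.\<close>
 have dom: "G k (?d x) (?p x) \<le> W (?d x) (?p x)" for k x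
 proof (cases "G k (?d x) (?p x) = 0")
  case False
  let ?q = "?p x - (e k * ?d x) *\<^sub>R ?n"
  have nz0: "b \<noteq> 0 \<and> c \<noteq> 0" if "ennreal (a * (b * c)) \<noteq> 0" for a b c :: real using that by auto
  have nz: "flat_exp_deriv (?d x) \<noteq> 0" "(\<Prod>F'\<in>facets - {F}. flat_exp (real (Suc k) * facet_dist F' ?q)) \<noteq> 0"
   using nz0[OF False[unfolded G_def]] by blast+
  have d: "0 < ?d x" using nz(1) by (simp add: flat_exp_deriv_def split: if_splits)
  have q: "?q \<in> T"
  proof (subst mem_iff, intro allI impI)
   fix F' assume F': "F' facet_of T"
   show "0 \<le> facet_dist F' ?q"
   proof (cases "F' = F")
    case True
    show ?thesis using facet_dist_affine[of F "?p x" "- (e k * ?d x)" ?n] facet_dist_proj[OF F, of x] outer_normal(1)[OF F] True d e[of k] by simp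
   next
    case False
    then have mem: "F' \<in> facets - {F}" using F' by (simp add: facets_def)
    have "flat_exp (real (Suc k) * facet_dist F' ?q) \<noteq> 0"
    proof
     assume "flat_exp (real (Suc k) * facet_dist F' ?q) = 0"
     then show False using mem nz(2) by auto
    qed
    then have "0 < real (Suc k) * facet_dist F' ?q" by (meson flat_exp_eq_0 not_less)
    then show ?thesis by (simp add: zero_less_mult_iff)
   qed
  qed
  have "?p ?q = ?p x" using facet_dist_affine[of F "?p x" "- (e k * ?d x)" ?n] facet_dist_proj[OF F, of x] outer_normal(1)[OF F]
   by (simp add: facet_proj_eq[of F ?q] norm_eq_1)
  then have px: "norm (?p x) \<le> R" using R[of "?p x"] q by (metis image_eqI)
  have pr: "(\<Prod>F'\<in>facets - {F}. flat_exp (real (Suc k) * facet_dist F' ?q)) \<le> 1" by (intro prod_le_1) (auto simp: flat_exp_le_1)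
  have "Y ?q * (flat_exp_deriv (?d x) * (\<Prod>F'\<in>facets - {F}. flat_exp (real (Suc k) * facet_dist F' ?q)))
    \<le> C * (flat_exp_deriv (?d x) * 1)" using C Y(2) q pr by (intro mult_mono mult_nonneg_nonneg prod_nonneg) auto
  then have "G k (?d x) (?p x) \<le> ennreal (C * (flat_exp_deriv (?d x) * 1))" unfolding G_def by (rule ennreal_leI)
  also have "\<dots> = W (?d x) (?p x)" using px C(1) by (simp add: W_def ennreal_mult)
  finally show ?thesis .
 qed simp
 have W_fin: "(\<integral>\<^sup>+x. W (?d x) (?p x) \<partial>lborel) < \<infinity>"
 proof -
  have "(\<integral>\<^sup>+x. W (?d x) (?p x) \<partial>lborel) = (\<integral>\<^sup>+y. (\<integral>\<^sup>+s. W s y \<partial>lborel) \<partial>facet_base F)"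
   by (rule nn_integral_facet_product[OF F Wm])
  also have "\<dots> = (\<integral>\<^sup>+y. ennreal C * indicator (cball 0 R) y \<partial>facet_base F)"
  proof (rule nn_integral_cong)
   fix y :: "real^'n"
   show "(\<integral>\<^sup>+s. W s y \<partial>lborel) = ennreal C * indicator (cball 0 R) y"
    unfolding W_def by (subst nn_integral_cmult, measurable) (simp add: nn_integral_multc nn_integral_flat_exp_deriv)
  qed
  also have "\<dots> = ennreal C * emeasure (facet_base F) (cball 0 R)" by (rule nn_integral_cmult_indicator) simp
  also have "\<dots> < \<infinity>" using facet_base_bounded_finite[OF F bounded_cball] by (simp add: ennreal_mult_less_top)
  finally show ?thesis .
 qed
 define L where "L s y = ennreal (Y y) * (ennreal (flat_exp_deriv s) * indicator F y)" for s y
 note [measurable] = facet_borel[OF F]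
 have Lm [measurable]: "case_prod L \<in> borel_measurable (borel \<Otimes>\<^sub>M borel)" unfolding L_def[abs_def] by measurable
 \<comment> \<open>For almost every x the projection has nonzero distance to all other facets. If
   all are positive, each factor tends to 1; if one is negative, its factor is eventually 0.\<close>
 have lim: "AE x in lborel. (\<lambda>k. G k (?d x) (?p x)) \<longlonglongrightarrow> L (?d x) (?p x)"
 proof -
  have "AE x in lborel. \<forall>F'\<in>facets - {F}. facet_dist F' (?p x) \<noteq> 0"
   by (intro AE_finite_allI) (auto simp: facets_def facets_finite intro!: AE_facet_dist_proj[OF F])
  then show ?thesis
  proof eventually_elim
   case (elim x)
   let ?y = "?p x" and ?r = "?d x"
   have lin: "real (Suc k) * facet_dist F' (?y - (e k * ?r) *\<^sub>R ?n)
     = real (Suc k) * facet_dist F' ?y + ?r * (?n \<bullet> outer_normal T F')" for k F'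
    using facet_dist_affine[of F' ?y "- (e k * ?r)" ?n] by (simp add: e_def field_simps)
   note top = filterlim_compose[OF filterlim_real_sequentially filterlim_Suc]
   show ?case
   proof (cases "\<forall>F'\<in>facets - {F}. 0 < facet_dist F' ?y")
    case True
    have yF: "?y \<in> F" by (rule facet_proj_in_facet[OF F]) (use True in \<open>simp add: facets_def less_imp_le\<close>)
    have f1: "(\<lambda>k. flat_exp (real (Suc k) * facet_dist F' (?y - (e k * ?r) *\<^sub>R ?n))) \<longlonglongrightarrow> 1"
     if "F' \<in> facets - {F}" for F' unfolding lin by (rule filterlim_compose[OF flat_exp_at_top], subst add.commute,
       rule filterlim_tendsto_add_at_top[OF tendsto_const], subst mult.commute,
       rule filterlim_tendsto_pos_mult_at_top[OF tendsto_const _ top]) (use True that in blast)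
    have f2: "(\<lambda>k. Y (?y - (e k * ?r) *\<^sub>R ?n)) \<longlonglongrightarrow> Y ?y"
    proof -
     have "(\<lambda>k. ?y - (e k * ?r) *\<^sub>R ?n) \<longlonglongrightarrow> ?y - (0 * ?r) *\<^sub>R ?n" by (intro tendsto_intros e0)
     then have "(\<lambda>k. Y (?y - (e k * ?r) *\<^sub>R ?n)) \<longlonglongrightarrow> Y (?y - (0 * ?r) *\<^sub>R ?n)"
      using Y(1) by (intro isCont_tendsto_compose[of _ Y]) (auto simp: continuous_on_eq_continuous_at)
     then show ?thesis by simp
    qed
    have "(\<lambda>k. G k ?r ?y) \<longlonglongrightarrow> ennreal (Y ?y * (flat_exp_deriv ?r * (\<Prod>F'\<in>facets - {F}. 1)))"
     unfolding G_def by (intro tendsto_ennrealI tendsto_mult tendsto_const f2 tendsto_prod f1)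
    moreover have "0 \<le> Y ?y" using Y(2) yF facet_of_imp_subset[OF F] by blast
    ultimately show ?thesis using yF by (simp add: L_def ennreal_mult)
   next
    case False
    then obtain F' where F': "F' \<in> facets - {F}" "facet_dist F' ?y < 0" using elim by (metis linorder_neqE_linordered_idom)
    have "filterlim (\<lambda>k. ?r * (?n \<bullet> outer_normal T F') + facet_dist F' ?y * real (Suc k)) at_bot sequentially"
     by (subst filterlim_tendsto_add_at_bot_iff[OF tendsto_const]) (rule filterlim_tendsto_neg_mult_at_bot[OF tendsto_const F'(2) top])
    then have "\<forall>\<^sub>F k in sequentially. ?r * (?n \<bullet> outer_normal T F') + facet_dist F' ?y * real (Suc k) \<le> 0"
     by (simp add: filterlim_at_bot)
    then have "\<forall>\<^sub>F k in sequentially. G k ?r ?y = 0"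
    proof eventually_elim
     case (elim k)
     then have "flat_exp (real (Suc k) * facet_dist F' (?y - (e k * ?r) *\<^sub>R ?n)) = 0"
      unfolding lin by (intro flat_exp_eq_0) (simp add: algebra_simps)
     then have "(\<Prod>F'\<in>facets - {F}. flat_exp (real (Suc k) * facet_dist F' (?y - (e k * ?r) *\<^sub>R ?n))) = 0"
      using F'(1) by (intro prod_zero) auto
     then show ?case by (simp only: G_def mult_zero_right ennreal_0)
    qed
    moreover have "?y \<notin> F" using facet_dist_nonneg[of F' ?y] F' facet_of_imp_subset[OF F] by (auto simp: facets_def)
    ultimately show ?thesis by (simp add: L_def tendsto_eventually)
   qed
  qed
 qed
 have "(\<lambda>k. \<integral>\<^sup>+x. G k (?d x) (?p x) \<partial>lborel) \<longlonglongrightarrow> (\<integral>\<^sup>+x. L (?d x) (?p x) \<partial>lborel)"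
 proof (rule nn_integral_dominated_convergence[OF _ _ _ _ W_fin lim])
  have comp: "(\<lambda>x. case_prod h (?d x, ?p x)) \<in> borel_measurable lborel"
   if "case_prod h \<in> borel_measurable (borel \<Otimes>\<^sub>M borel)" for h :: "real => real^'n => ennreal"
   by (rule measurable_compose[OF _ that]) measurable
  show "(\<lambda>x. G k (?d x) (?p x)) \<in> borel_measurable lborel" for k using comp[OF Gm] by simp
  show "(\<lambda>x. L (?d x) (?p x)) \<in> borel_measurable lborel" using comp[OF Lm] by simp
  show "(\<lambda>x. W (?d x) (?p x)) \<in> borel_measurable lborel" using comp[OF Wm] by simp
  show "AE x in lborel. G k (?d x) (?p x) \<le> W (?d x) (?p x)" for k by (rule AE_I2) (rule dom)
 qed
 also have "(\<integral>\<^sup>+x. L (?d x) (?p x) \<partial>lborel) = (\<integral>\<^sup>+y. (\<integral>\<^sup>+s. L s y \<partial>lborel) \<partial>facet_base F)"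
  by (rule nn_integral_facet_product[OF F Lm])
 also have "\<dots> = (\<integral>\<^sup>+y. ennreal (Y y) * indicator F y \<partial>facet_base F)"
 proof (rule nn_integral_cong)
  fix y :: "real^'n"
  show "(\<integral>\<^sup>+s. L s y \<partial>lborel) = ennreal (Y y) * indicator F y"
   unfolding L_def by (subst nn_integral_cmult, measurable) (simp add: nn_integral_multc nn_integral_flat_exp_deriv)
 qed
 also have "\<dots> = (\<integral>\<^sup>+x. ennreal (Y x) \<partial>surf F)" by (rule nn_integral_surface[OF F, symmetric])
 finally show ?thesis unfolding eq .
qed

lemma frontier_negligible: "negligible (frontier T)" by (rule negligible_convex_frontier[OF convex])

text \<open>\<open>E k\<close> is a smooth cut-off that vanishes outside the polytope and tends to 1
  in its interior. The derivative of \<open>Y * E k\<close> has integral 0, and the terms in which a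
  factor of \<open>E k\<close> is differentiated are those of \<open>facet_limit\<close>, whose
  \<open>nn_integral\<close> form is the reason for taking \<open>Y\<close> nonnegative.\<close>

lemma divergence_theorem_nonneg:
 assumes Y: "smooth Y" "\<And>x. x \<in> T ==> 0 \<le> Y x"
 shows "(LINT x|lborel. indicator T x * partial i Y x) = (\<Sum>F\<in>facets. outer_normal T F $ i * (LINT x|surf F. Y x))"
proof -
 define E where "E k x = (\<Prod>F\<in>facets. flat_exp (real (Suc k) * facet_dist F x))" for k x
 define T1 where "T1 k F x = Y x * (real (Suc k) * flat_exp_deriv (real (Suc k) * facet_dist F x)
    * (\<Prod>F'\<in>facets - {F}. flat_exp (real (Suc k) * facet_dist F' x)))" for k F x
 have sm: "smooth (\<lambda>x. real (Suc k) * facet_dist F x)" for k F by (intro smooth_mult smooth_const smooth_facet_dist)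
 have E_smooth: "smooth (E k)" for k unfolding E_def[abs_def] by (intro smooth_prod smooth_flat_exp sm)
 have zero: "flat_exp (real (Suc k) * facet_dist F x) = 0 \<and> flat_exp_deriv (real (Suc k) * facet_dist F x) = 0"
  if "facet_dist F x < 0" for k F x using that by (simp add: flat_exp_deriv_def mult_nonneg_nonpos)
 have out: "\<exists>F\<in>facets. facet_dist F x < 0" if "x \<notin> T" for x using that by (auto simp: mem_iff facets_def)
 have E_out: "E k x = 0" if x: "x \<notin> T" for k x
 proof -
  obtain F where F: "F \<in> facets" "facet_dist F x < 0" using out[OF x] by blast
  show ?thesis unfolding E_def by (rule prod_zero) (use F zero in auto)
 qed
 have T_out: "T1 k F x = 0" if x: "x \<notin> T" for k F x
 proof -
  obtain F' where F': "F' \<in> facets" "facet_dist F' x < 0" using out[OF x] by blast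
  show ?thesis
  proof (cases "F' = F")
   case True then show ?thesis using zero[OF F'(2), of k] by (simp add: T1_def)
  next
   case False
   have "(\<Prod>F'\<in>facets - {F}. flat_exp (real (Suc k) * facet_dist F' x)) = 0" by (rule prod_zero) (use False F' zero in auto)
   then show ?thesis by (simp only: T1_def mult_zero_right)
  qed
 qed
 have test: "(\<lambda>x. Y x * E k x) \<in> test_functions UNIV" for k
  by (rule test_functionsI[OF smooth_mult[OF Y(1) E_smooth] compact]) (auto simp: E_out)
 have T_test: "T1 k F \<in> test_functions UNIV" for k F
 proof (rule test_functionsI[OF _ compact])
  show "smooth (T1 k F)"
   unfolding T1_def[abs_def] by (intro smooth_mult smooth_const Y(1) smooth_flat_exp_deriv sm smooth_prod smooth_flat_exp)
 qed (auto simp: T_out)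
 have P_test: "(\<lambda>x. partial i Y x * E k x) \<in> test_functions UNIV" for k
  by (rule test_functionsI[OF smooth_mult[OF smooth_partial[OF Y(1)] E_smooth] compact]) (auto simp: E_out)
 have part: "partial i (\<lambda>x. Y x * E k x) x = partial i Y x * E k x - (\<Sum>F\<in>facets. outer_normal T F $ i * T1 k F x)" for k x
 proof -
  have pf: "partial i (\<lambda>x. flat_exp (real (Suc k) * facet_dist F x)) x
    = flat_exp_deriv (real (Suc k) * facet_dist F x) * (real (Suc k) * - (outer_normal T F $ i))" for F
   using partial_linear[OF bounded_linear_mult_right[of "real (Suc k)"] smooth_facet_dist, of i F x]
   by (simp add: partial_flat_exp[OF sm] partial_facet_dist del: of_nat_Suc)
  have "partial i (E k) x = (\<Sum>F\<in>facets. flat_exp_deriv (real (Suc k) * facet_dist F x) * (real (Suc k) * - (outer_normal T F $ i))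
    * (\<Prod>F'\<in>facets - {F}. flat_exp (real (Suc k) * facet_dist F' x)))"
   unfolding E_def[abs_def] by (subst partial_prod) (auto simp: pf simp del: of_nat_Suc intro: smooth_flat_exp sm)
  then have "Y x * partial i (E k) x = - (\<Sum>F\<in>facets. outer_normal T F $ i * T1 k F x)"
   by (simp add: T1_def sum_distrib_left sum_negf[symmetric] algebra_simps)
  then show ?thesis by (simp add: partial_bilinear[OF bounded_bilinear_mult Y(1) E_smooth])
 qed
 have id: "(LINT x|lborel. partial i Y x * E k x) = (\<Sum>F\<in>facets. outer_normal T F $ i * (LINT x|lborel. T1 k F x))" for k
 proof -
  have iT: "integrable lborel (\<lambda>x. \<Sum>F\<in>facets. outer_normal T F $ i * T1 k F x)"
   by (intro bochner_sum integrable_mult_right test_integrable[OF T_test])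
  have "0 = (LINT x|lborel. partial i Y x * E k x - (\<Sum>F\<in>facets. outer_normal T F $ i * T1 k F x))"
   using integral_partial_test[OF test[of k], of i] by (simp only: part)
  also have "\<dots> = (LINT x|lborel. partial i Y x * E k x) - (LINT x|lborel. (\<Sum>F\<in>facets. outer_normal T F $ i * T1 k F x))"
   by (rule Bochner_Integration.integral_diff[OF test_integrable[OF P_test] iT])
  also have "(LINT x|lborel. (\<Sum>F\<in>facets. outer_normal T F $ i * T1 k F x)) = (\<Sum>F\<in>facets. outer_normal T F $ i * (LINT x|lborel. T1 k F x))"
   by (subst bochner_int_sum) (auto intro: test_integrable[OF T_test])
  finally show ?thesis by simp
 qed
 have Tlim: "(\<lambda>k. LINT x|lborel. T1 k F x) \<longlonglongrightarrow> (LINT x|surf F. Y x)" if F: "F \<in> facets" for F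
 proof -
  have F': "F facet_of T" using F by (simp add: facets_def)
  have Tn: "0 \<le> T1 k F x" for k x
  proof (cases "x \<in> T")
   case True
   then show ?thesis unfolding T1_def using Y(2) by (intro mult_nonneg_nonneg prod_nonneg) simp_all
  qed (simp add: T_out)
  have sn: "0 \<le> Y x" if "x \<in> F" for x using Y(2) that facet_of_imp_subset[OF F'] by blast
  note isurf = integrable_of_Lebesgue2[OF surface_finite[OF F'] continuous_surface_L2[OF smooth_continuous[OF Y(1)] F']]
  have "(\<lambda>k. \<integral>\<^sup>+x. ennreal (T1 k F x) \<partial>lborel) \<longlonglongrightarrow> (\<integral>\<^sup>+x. ennreal (Y x) \<partial>surf F)"
   unfolding T1_def by (rule facet_limit[OF F' smooth_continuous[OF Y(1)] Y(2)])
  moreover have "(\<integral>\<^sup>+x. ennreal (T1 k F x) \<partial>lborel) = ennreal (LINT x|lborel. T1 k F x)" for k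
   by (rule nn_integral_eq_integral[OF test_integrable[OF T_test]]) (simp add: Tn)
  moreover have "(\<integral>\<^sup>+x. ennreal (Y x) \<partial>surf F) = ennreal (LINT x|surf F. Y x)"
   by (rule nn_integral_eq_integral[OF isurf]) (auto simp: space_surface_measure sn)
  moreover have "0 \<le> (LINT x|surf F. Y x)" by (rule integral_nonneg_AE) (auto simp: space_surface_measure sn)
  ultimately show ?thesis by (simp add: tendsto_ennreal_iff Tn)
 qed
 have lhs: "(\<lambda>k. LINT x|lborel. partial i Y x * E k x) \<longlonglongrightarrow> (LINT x|lborel. indicator T x * partial i Y x)"
 proof -
  have pc: "continuous_on UNIV (partial i Y)" by (intro smooth_continuous smooth_partial Y(1))
  note [measurable] = borel_measurable_continuous_onI[OF pc]
  have [measurable]: "T \<in> sets borel" using compact by (simp add: compact_imp_closed)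
  note [measurable] = smooth_borel[OF E_smooth]
  have int: "integrable lborel (\<lambda>x. indicator T x * norm (partial i Y x))"
  proof -
   have "integrable lebesgue (\<lambda>x. indicator T x *\<^sub>R norm (partial i Y x))" using integrable_norm[OF integrable_lebesgue_on_compact[OF pc compact]] compact_lebesgue[OF compact] by (simp add: integrable_lebesgue_on)
   then show ?thesis by (subst (asm) integrable_completion) auto
  qed
  have E1: "0 \<le> E k x" "E k x \<le> 1" for k x unfolding E_def by (auto intro!: prod_nonneg prod_le_1 flat_exp_le_1)
  show ?thesis
  proof (rule integral_dominated_convergence[OF _ _ int])
   show "AE x in lborel. norm (partial i Y x * E k x) \<le> indicator T x * norm (partial i Y x)" for k
   proof (rule AE_I2)
    fix x show "norm (partial i Y x * E k x) \<le> indicator T x * norm (partial i Y x)"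
     using E1[of k x] E_out[of x k] by (cases "x \<in> T") (auto simp: abs_mult intro: mult_right_le_one_le)
   qed
   show "AE x in lborel. (\<lambda>k. partial i Y x * E k x) \<longlonglongrightarrow> indicator T x * partial i Y x"
    using negligible_AE_lborel[OF frontier_negligible]
   proof eventually_elim
    case (elim x)
    show ?case
    proof (cases "x \<in> T")
     case True
     then have xi: "x \<in> interior T" using elim closure_subset[of T] by (auto simp: frontier_def)
     have "(\<lambda>k. E k x) \<longlonglongrightarrow> (\<Prod>F\<in>facets. 1)" unfolding E_def
     proof (intro tendsto_prod)
      fix F assume "F \<in> facets"
      then have d: "0 < facet_dist F x" using facet_dist_pos_interior xi by (simp add: facets_def)
      note top = filterlim_compose[OF filterlim_real_sequentially filterlim_Suc]
      show "(\<lambda>k. flat_exp (real (Suc k) * facet_dist F x)) \<longlonglongrightarrow> 1"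
       using filterlim_compose[OF flat_exp_at_top filterlim_tendsto_pos_mult_at_top[OF tendsto_const d top]]
       by (simp add: mult.commute)
     qed
     then have "(\<lambda>k. partial i Y x * E k x) \<longlonglongrightarrow> partial i Y x * (\<Prod>F\<in>facets. 1)" by (intro tendsto_intros)
     then show ?thesis using True by simp
    next
     case False
     then show ?thesis by (simp add: E_out)
    qed
   qed
  qed measurable
 qed
 have "(\<lambda>k. LINT x|lborel. partial i Y x * E k x) \<longlonglongrightarrow> (\<Sum>F\<in>facets. outer_normal T F $ i * (LINT x|surf F. Y x))"
  unfolding id by (intro tendsto_sum tendsto_mult tendsto_const Tlim)
 from LIMSEQ_unique[OF lhs this] show ?thesis .
qed

end

context full_polytope
begin

lemma open_interior: "open (interior T)" and convex_interior: "convex (interior T)"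
 and bounded_interior: "bounded (interior T)" and interior_borel [measurable]: "interior T \<in> sets borel"
 using convex convex_interior bounded_subset[OF compact_imp_bounded[OF compact] interior_subset] by auto

lemma AE_interior_iff: "AE x in lebesgue. x \<in> T \<longleftrightarrow> x \<in> interior T"
proof -
 have "AE x in lebesgue. x \<notin> frontier T" using frontier_negligible by (intro AE_not_in) (simp add: negligible_iff_null_sets)
 then show ?thesis by eventually_elim (use compact interior_subset[of T] in \<open>auto simp: frontier_def compact_imp_closed\<close>)
qed

text \<open>The frontier of a convex set is null. The forms integrate over closed elements while
  weak derivatives live on open ones. Nothing is assumed of \<open>f\<close>, so the nonmeasurable
  case, where both integrals are 0 by convention, is treated apart.\<close>

lemma LINT_interior:
 fixes f :: "real^'n => 'b::euclidean_space" shows "(LINT x|leb T. f x) = (LINT x|leb (interior T). f x)"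
proof -
 let ?a = "\<lambda>x. indicator T x *\<^sub>R f x" and ?b = "\<lambda>x. indicator (interior T) x *\<^sub>R f x"
 have ae: "AE x in lebesgue. ?a x = ?b x" using AE_interior_iff by eventually_elim (simp add: indicator_def)
 have ae': "AE x in lebesgue. ?b x = ?a x" using ae by eventually_elim (rule sym)
 have "integral\<^sup>L lebesgue ?a = integral\<^sup>L lebesgue ?b"
 proof (cases "?a \<in> borel_measurable lebesgue")
  case True
  then show ?thesis by (intro integral_cong_AE[OF _ _ ae] borel_measurable_AE[OF _ ae])
 next
  case False
  then have "\<not> integrable lebesgue ?a" "\<not> integrable lebesgue ?b" using borel_measurable_AE[OF _ ae'] borel_measurable_integrable by blast+
  then show ?thesis using not_integrable_integral_eq[of lebesgue ?a] not_integrable_integral_eq[of lebesgue ?b] by argo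
 qed
 then show ?thesis using compact_lebesgue[OF compact] by (simp add: integral_restrict_space)
qed

lemma continuous_surface_integrable:
 fixes Y :: "real^'n => 'b::euclidean_space"
 assumes "continuous_on UNIV Y" and F: "F \<in> facets" shows "integrable (surf F) Y"
 using F by (intro integrable_of_Lebesgue2 surface_finite continuous_surface_L2 assms(1)) (auto simp: facets_def)

text \<open>Adding a constant makes a real function nonnegative on the compact polytope; the
  constant drops out again because the nonnegative case, applied to it, shows that its boundary
  terms cancel. General values go by coordinates.\<close>

theorem divergence_theorem:
 fixes Y :: "real^'n => 'b::euclidean_space"
 assumes Y: "smooth Y"
 shows "(LINT x|leb (interior T). partial i Y x) = (\<Sum>F\<in>facets. outer_normal T F $ i *\<^sub>R (LINT x|surf F. Y x))"
proof -
 have leb: "(LINT x|lborel. indicator T x * f x) = (LINT x|leb (interior T). f x)"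
  if f: "f \<in> borel_measurable borel" for f :: "real^'n => real"
 proof -
  have [measurable]: "T \<in> sets borel" "f \<in> borel_measurable borel" using compact f by (auto simp: compact_imp_closed)
  have "(LINT x|lborel. indicator T x * f x) = (LINT x|lebesgue. indicator T x *\<^sub>R f x)" by (subst integral_completion) auto
  then show ?thesis by (simp add: LINT_interior[symmetric] integral_restrict_space)
 qed
 have real: "(LINT x|leb (interior T). partial i W x) = (\<Sum>F\<in>facets. outer_normal T F $ i * (LINT x|surf F. W x))"
  if W: "smooth W" for W :: "real^'n => real"
 proof -
  obtain B where B: "\<And>y. y \<in> W ` T ==> norm y \<le> B" using compact_continuous_image[OF continuous_on_subset[OF smooth_continuous[OF W] subset_UNIV] compact] by (meson bounded_iff compact_imp_bounded)
  define C where "C = \<bar>B\<bar>"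
  have C: "0 \<le> C" "0 \<le> W x + C" if "x \<in> T" for x using B[of "W x"] that unfolding C_def by auto
  have pb: "partial i f \<in> borel_measurable borel" if "smooth f" for f :: "real^'n => real"
   by (rule smooth_borel[OF smooth_partial[OF that]])
  have sC: "smooth (\<lambda>x. W x + C)" by (intro smooth_add smooth_const W)
  have c: "0 = (\<Sum>F\<in>facets. outer_normal T F $ i * (LINT x|surf F. C))"
   using divergence_theorem_nonneg[of "\<lambda>x. C" i] C(1) interior by (auto simp: smooth_const)
  have "(LINT x|leb (interior T). partial i W x) = (LINT x|lborel. indicator T x * partial i (\<lambda>x. W x + C) x)"
   by (subst leb[OF pb[OF sC]], rule arg_cong[where f = "integral\<^sup>L _"], rule ext) (simp add: partial_add[OF W smooth_const])
  also have "\<dots> = (\<Sum>F\<in>facets. outer_normal T F $ i * (LINT x|surf F. W x + C))" by (rule divergence_theorem_nonneg[OF sC C(2)])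
  also have "\<dots> = (\<Sum>F\<in>facets. outer_normal T F $ i * (LINT x|surf F. W x))
    + (\<Sum>F\<in>facets. outer_normal T F $ i * (LINT x|surf F. C))" unfolding sum.distrib[symmetric]
  proof (rule sum.cong)
   fix F assume F: "F \<in> facets"
   have "(LINT x|surf F. W x + C) = (LINT x|surf F. W x) + (LINT x|surf F. C)"
    by (intro Bochner_Integration.integral_add continuous_surface_integrable smooth_continuous W continuous_on_const F)
   then show "outer_normal T F $ i * (LINT x|surf F. W x + C)
    = outer_normal T F $ i * (LINT x|surf F. W x) + outer_normal T F $ i * (LINT x|surf F. C)" by (simp only: distrib_left)
  qed simp
  finally show ?thesis using c by linarith
 qed
 have pi: "integrable (leb (interior T)) (partial i Y)"
  using bounded_smooth_L2[OF smooth_continuous[OF smooth_partial[OF Y]] bounded_interior] bounded_interior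
  by (auto simp: L2_def intro!: integrable_of_Lebesgue2 finite_measure_lebesgue_on_bounded)
 show ?thesis
 proof (rule euclidean_eqI)
  fix b :: 'b
  note bl = bounded_linear_inner_left
  have si: "(LINT x|surf F. Y x) \<bullet> b = (LINT x|surf F. Y x \<bullet> b)" if "F \<in> facets" for F
   by (rule integral_inner_left[symmetric]) (intro impI continuous_surface_integrable smooth_continuous Y that)
  have "(LINT x|leb (interior T). partial i Y x) \<bullet> b = (LINT x|leb (interior T). partial i (\<lambda>x. Y x \<bullet> b) x)"
   unfolding partial_linear[OF bl Y] by (rule integral_inner_left[symmetric]) (rule pi)
  also have "\<dots> = (\<Sum>F\<in>facets. outer_normal T F $ i * (LINT x|surf F. Y x \<bullet> b))" by (rule real[OF smooth_linear[OF bl Y]])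
  finally show "(LINT x|leb (interior T). partial i Y x) \<bullet> b = (\<Sum>F\<in>facets. outer_normal T F $ i *\<^sub>R (LINT x|surf F. Y x)) \<bullet> b"
   by (simp add: inner_sum_left si)
 qed
qed

text \<open>One is added to have a positive number at once.\<close>

definition diam :: real where "diam = diameter T + 1"

lemma diam: "0 < diam" "x \<in> T ==> y \<in> T ==> dist x y \<le> diam"
 using diameter_bounded_bound[OF compact_imp_bounded[OF compact], of x y] diameter_ge_0[OF compact_imp_bounded[OF compact]]
 by (auto simp: diam_def)

end

section \<open>Cone averages and the trace inequality\<close>

context full_polytope
begin

definition vol :: real where "vol = measure lborel (interior T)"

lemma emeasure_interior: "emeasure lborel (interior T) = ennreal vol"
 using emeasure_bounded_finite[OF bounded_interior] by (simp add: vol_def emeasure_eq_ennreal_measure)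

lemma vol_pos: "0 < vol"
proof -
 have "vol \<noteq> 0"
 proof
  assume "vol = 0"
  then have "interior T \<in> null_sets lborel" using emeasure_interior by auto
  then have "interior T \<in> null_sets lebesgue" by (rule null_sets_completionI)
  then show False using open_not_negligible[OF open_interior interior] by (simp add: negligible_iff_null_sets)
 qed
 then show ?thesis by (simp add: vol_def zero_less_measure_iff)
qed

definition avg_weight :: "real^'n => real" where "avg_weight z = indicator (interior T) z / vol"

lemma avg_weight_borel [measurable]: "avg_weight \<in> borel_measurable borel" unfolding avg_weight_def by measurable

lemma avg_weight_nonneg: "0 \<le> avg_weight z" using vol_pos by (simp add: avg_weight_def)

lemma avg_weight_nn: "(\<integral>\<^sup>+z. ennreal (avg_weight z) \<partial>lborel) = 1"
proof -
 have "(\<integral>\<^sup>+z. ennreal (avg_weight z) \<partial>lborel) = (\<integral>\<^sup>+z. ennreal (1 / vol) * indicator (interior T) z \<partial>lborel)"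
  by (intro nn_integral_cong) (simp add: avg_weight_def indicator_def)
 then show ?thesis using vol_pos by (simp add: nn_integral_cmult_indicator emeasure_interior ennreal_mult[symmetric])
qed

text \<open>The mean value of \<open>Y\<close> over the copy of the polytope shrunk towards \<open>y\<close> by the factor \<open>t\<close>.\<close>

definition cone_avg :: "(real^'n => 'b::euclidean_space) => real => real^'n => 'b" where
 "cone_avg Y t y = (LINT z|lborel. avg_weight z *\<^sub>R Y ((1 - t) *\<^sub>R y + t *\<^sub>R z))"

lemma cone_avg_integrable:
 fixes f :: "real^'n => 'b::euclidean_space"
 assumes "continuous_on UNIV f" shows "integrable lborel (\<lambda>z. avg_weight z *\<^sub>R f z)"
proof -
 have "integrable lebesgue (\<lambda>x. indicator T x *\<^sub>R f x)" using integrable_lebesgue_on_compact[OF assms compact] integrable_lebesgue_on[OF compact_lebesgue[OF compact]] by blast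
 moreover have [measurable]: "f \<in> borel_measurable borel" "T \<in> sets borel"
  using borel_measurable_continuous_onI[OF assms] compact by (auto simp: compact_imp_closed)
 ultimately have "integrable lborel (\<lambda>x. indicator T x *\<^sub>R f x)" by (subst (asm) integrable_completion) auto
 then have "integrable lborel (\<lambda>x. indicator (interior T) x *\<^sub>R (indicator T x *\<^sub>R f x))"
  by (rule integrable_mult_indicator[rotated]) simp
 then have "integrable lborel (\<lambda>x. (1 / vol) *\<^sub>R (indicator (interior T) x *\<^sub>R (indicator T x *\<^sub>R f x)))"
  by (rule integrable_scaleR_right)
 also have "(\<lambda>x. (1 / vol) *\<^sub>R (indicator (interior T) x *\<^sub>R (indicator T x *\<^sub>R f x))) = (\<lambda>z. avg_weight z *\<^sub>R f z)"
  using interior_subset[of T] by (auto simp: avg_weight_def indicator_def fun_eq_iff)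
 finally show ?thesis .
qed

lemma cone_avg_diff_le:
 assumes Y: "continuous_on UNIV Y" shows "ennreal ((norm (cone_avg Y t y - c))\<^sup>2)
   \<le> (\<integral>\<^sup>+z. ennreal (avg_weight z) * ennreal ((norm (Y ((1 - t) *\<^sub>R y + t *\<^sub>R z) - c))\<^sup>2) \<partial>lborel)"
proof -
 note [measurable] = borel_measurable_continuous_onI[OF Y]
 have "continuous_on UNIV (\<lambda>z. Y ((1 - t) *\<^sub>R y + t *\<^sub>R z))"
  by (rule continuous_on_compose2[OF Y]) (auto intro!: continuous_intros)
 note i = cone_avg_integrable[OF this] cone_avg_integrable[OF continuous_on_const, of c]
 have w: "integrable lborel avg_weight" "(LINT z|lborel. avg_weight z) = 1"
  using cone_avg_integrable[OF continuous_on_const, of "1::real"] nn_integral_eq_integral[of lborel avg_weight] avg_weight_nn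
  by (auto simp: avg_weight_nonneg)
 have "cone_avg Y t y - c = (LINT z|lborel. avg_weight z *\<^sub>R (Y ((1 - t) *\<^sub>R y + t *\<^sub>R z) - c))"
  using i w by (simp add: scaleR_diff_right cone_avg_def)
 then show ?thesis by (simp only:) (rule Jensen_square, measurable, auto simp: avg_weight_nonneg avg_weight_nn)
qed

text \<open>The substitution contracts the polytope towards \<open>y\<close> by the factor
  \<open>t\<close>: convexity keeps the image inside, it lies within \<open>t * diam\<close> of
  \<open>y\<close>, and the Jacobian is \<open>t ^ CARD('n)\<close>.\<close>

lemma avg_weight_substitution:
 assumes [measurable]: "f \<in> borel_measurable borel" and y: "y \<in> T" and t: "0 < t" "t \<le> 1"
 shows "(\<integral>\<^sup>+z. ennreal (avg_weight z) * f ((1 - t) *\<^sub>R y + t *\<^sub>R z) \<partial>lborel)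
   \<le> ennreal (1 / (vol * t ^ CARD('n))) * (\<integral>\<^sup>+z. f z * indicator (interior T \<inter> cball y (t * diam)) z \<partial>lborel)"
proof -
 let ?I = "indicator (interior T \<inter> cball y (t * diam)) :: real^'n => ennreal"
 have [measurable]: "interior T \<inter> cball y (t * diam) \<in> sets borel" by (intro sets.Int interior_borel) simp
 have le: "ennreal (avg_weight z) * f ((1 - t) *\<^sub>R y + t *\<^sub>R z)
   \<le> ennreal (1 / vol) * (f ((1 - t) *\<^sub>R y + t *\<^sub>R z) * ?I ((1 - t) *\<^sub>R y + t *\<^sub>R z))" for z
 proof (cases "z \<in> interior T")
  case True
  have "(1 - t) *\<^sub>R y + t *\<^sub>R z = y - t *\<^sub>R (y - z)" by (simp add: algebra_simps)
  moreover note mem_interior_convex_shrink[OF convex True y t]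
  moreover have "dist y (y - t *\<^sub>R (y - z)) \<le> t * diam"
   using diam(2)[OF y] True interior_subset[of T] t by (auto simp: dist_norm)
  ultimately show ?thesis using True by (simp add: avg_weight_def)
 qed (simp add: avg_weight_def)
 have "(\<integral>\<^sup>+z. ennreal (avg_weight z) * f ((1 - t) *\<^sub>R y + t *\<^sub>R z) \<partial>lborel)
   \<le> ennreal (1 / vol) * (\<integral>\<^sup>+z. f ((1 - t) *\<^sub>R y + t *\<^sub>R z) * ?I ((1 - t) *\<^sub>R y + t *\<^sub>R z) \<partial>lborel)"
  by (subst nn_integral_cmult[symmetric]) (measurable, intro nn_integral_mono le)
 also have "(\<integral>\<^sup>+z. f ((1 - t) *\<^sub>R y + t *\<^sub>R z) * ?I ((1 - t) *\<^sub>R y + t *\<^sub>R z) \<partial>lborel)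
   = ennreal (1 / t ^ CARD('n)) * (\<integral>\<^sup>+z. f z * ?I z \<partial>lborel)"
  using t nn_integral_lborel_affine[of "\<lambda>z. f z * ?I z" t "(1 - t) *\<^sub>R y"]
  by (simp add: mult.assoc[symmetric] ennreal_mult[symmetric])
 also have "ennreal (1 / vol) * (ennreal (1 / t ^ CARD('n)) * (\<integral>\<^sup>+z. f z * ?I z \<partial>lborel))
   = ennreal (1 / (vol * t ^ CARD('n))) * (\<integral>\<^sup>+z. f z * ?I z \<partial>lborel)"
  using t vol_pos by (simp add: mult.assoc[symmetric] ennreal_mult[symmetric])
 finally show ?thesis .
qed

text \<open>Required for Fubini between the facet plane and the volume in
  \<open>cone_avg_step\<close>.\<close>

lemma sigma_finite_facet_base: "F \<in> facets ==> sigma_finite_measure (facet_base F)"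
proof
 assume F: "F \<in> facets"
 show "\<exists>A. countable A \<and> A \<subseteq> sets (facet_base F) \<and> \<Union>A = space (facet_base F) \<and> (\<forall>a\<in>A. emeasure (facet_base F) a \<noteq> \<infinity>)"
 proof (intro exI conjI ballI)
  show "countable (range (\<lambda>k::nat. cball (0::real^'n) (real k)))" by simp
  show "\<Union>(range (\<lambda>k::nat. cball (0::real^'n) (real k))) = space (facet_base F)" by (auto simp: real_arch_simple)
  fix a assume "a \<in> range (\<lambda>k::nat. cball (0::real^'n) (real k))"
  then show "emeasure (facet_base F) a \<noteq> \<infinity>" using facet_base_bounded_finite[of F a] F by (auto simp: facets_def)
 qed auto
qed

lemma cone_avg_borel:
 assumes "continuous_on UNIV Y" shows "cone_avg Y t \<in> borel_measurable borel"
proof -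
 note [measurable] = borel_measurable_continuous_onI[OF assms]
 show ?thesis unfolding cone_avg_def[abs_def] by (intro sigma_finite_measure.borel_measurable_lebesgue_integral sigma_finite_lborel) simp
qed

text \<open>Both averages use values within \<open>t * diam\<close> of y, so the squared difference
  is at most a double average of \<open>(norm (Y W - Y Z))\<^sup>2\<close>. Inserting the singular
  weight gains \<open>CARD('n) + 2 * s\<close> powers of t, the two densities cost
  \<open>2 * CARD('n)\<close>, and integrating y over the facet gains \<open>CARD('n) - 1\<close>;
  what remains is \<open>2 * s - 1\<close>.\<close>

lemma cone_avg_step:
 assumes F: "F \<in> facets" and s: "0 < s"
 obtains K where "0 \<le> K" "\<And>(Y :: real^'n => 'b::euclidean_space) t. continuous_on UNIV Y ==> 0 < t ==> t \<le> 1 ==>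
   nn2 (surf F) (\<lambda>y. cone_avg Y t y - cone_avg Y (t / 2) y :: 'b::euclidean_space)
   \<le> ennreal (K * t powr (2 * s - 1)) * gagliardo s (interior T) Y"
proof -
 let ?n = "CARD('n)" and ?U = "interior T"
 let ?V = "unit_ball_vol (real ?n) * 2 ^ ?n"
 \<comment> \<open>The factors are the normalisations of the averages at the scales \<open>t\<close>
   and \<open>t / 2\<close>, the surface bound of \<open>facet_base_cball\<close> at radius
   \<open>diam\<close>, and the bound of the singular weight, all with the powers of t
   removed.\<close>
 define K where "K = 1 / vol * (2 ^ ?n / vol) * (?V * diam ^ (?n - 1)) * ((2 * diam) powr (real ?n + 2 * s))"
 have F': "F facet_of T" using F by (simp add: facets_def)
 have "nn2 (surf F) (\<lambda>y. cone_avg Y t y - cone_avg Y (t / 2) y) \<le> ennreal (K * t powr (2 * s - 1)) * gagliardo s ?U Y"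
  if Y: "continuous_on UNIV Y" and t: "0 < t" "t \<le> 1" for Y :: "real^'n => 'b" and t
 proof -
  note [measurable] = borel_measurable_continuous_onI[OF Y]
  have [measurable]: "F \<in> sets borel" by (rule facet_borel[OF F'])
  define a where "a = 1 / (vol * t ^ ?n)"
  define b where "b = 1 / (vol * (t / 2) ^ ?n)"
  define g where "g p = (norm (gag_kernel s ?U Y p))\<^sup>2" for p
  have [measurable]: "gag_kernel s ?U Y \<in> borel_measurable borel" by measurable
  have gm: "g \<in> borel_measurable borel" unfolding g_def[abs_def] by measurable
  then have [measurable]: "g \<in> borel_measurable (borel \<Otimes>\<^sub>M borel)" by (simp add: borel_prod)
  define G where "G Z = (\<integral>\<^sup>+W. ennreal (g (Z, W)) \<partial>lborel)" for Z
  have [measurable]: "G \<in> borel_measurable borel" unfolding G_def[abs_def] by measurable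
  let ?e = "(2 * t * diam) powr (real ?n + 2 * s)"
  have ab: "0 \<le> a" "0 \<le> b" using vol_pos t by (auto simp: a_def b_def)
  have point: "ennreal ((norm (cone_avg Y t y - cone_avg Y (t / 2) y))\<^sup>2)
    \<le> ennreal (a * b * ?e) * (\<integral>\<^sup>+Z. G Z * indicator (cball y (t * diam)) Z \<partial>lborel)" if y: "y \<in> T" for y
  proof -
   let ?J = "\<lambda>t. indicator (?U \<inter> cball y (t * diam)) :: real^'n => ennreal"
   have [measurable]: "?U \<inter> cball y (r * diam) \<in> sets borel" "cball y (t * diam) \<in> sets borel" for r
    by (intro sets.Int interior_borel) simp_all
   have "ennreal ((norm (Y Z - cone_avg Y (t / 2) y))\<^sup>2)
     \<le> ennreal b * (\<integral>\<^sup>+W. ennreal ((norm (Y W - Y Z))\<^sup>2) * ?J (t / 2) W \<partial>lborel)" for Z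
    using order_trans[OF cone_avg_diff_le[OF Y, of "t / 2" y "Y Z"]
     avg_weight_substitution[of "\<lambda>W. ennreal ((norm (Y W - Y Z))\<^sup>2)" y "t / 2"]] y t by (simp add: norm_minus_commute b_def)
   then have inner: "(\<integral>\<^sup>+Z. ennreal ((norm (Y Z - cone_avg Y (t / 2) y))\<^sup>2) * ?J t Z \<partial>lborel)
    \<le> (\<integral>\<^sup>+Z. ennreal b * (\<integral>\<^sup>+W. ennreal ((norm (Y W - Y Z))\<^sup>2) * ?J (t / 2) W \<partial>lborel) * ?J t Z \<partial>lborel)"
    by (intro nn_integral_mono mult_right_mono) auto
   have "ennreal b * (\<integral>\<^sup>+W. ennreal ((norm (Y W - Y Z))\<^sup>2) * ?J (t / 2) W \<partial>lborel) * ?J t Z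
     \<le> ennreal (b * ?e) * (G Z * indicator (cball y (t * diam)) Z)" for Z
   proof (cases "Z \<in> ?U \<inter> cball y (t * diam)")
    case Z: True
    have "ennreal ((norm (Y W - Y Z))\<^sup>2) * ?J (t / 2) W \<le> ennreal ?e * ennreal (g (Z, W))" for W
    proof (cases "W \<in> ?U \<inter> cball y (t / 2 * diam)")
     case W: True
     have "(norm (Y W - Y Z))\<^sup>2 \<le> ?e * g (Z, W)"
     proof (cases "Z = W")
      case False
      have "dist y W \<le> t / 2 * diam" "dist y Z \<le> t * diam" "0 \<le> t * diam" using W Z t diam(1) by auto
      then have d: "norm (Z - W) \<le> 2 * t * diam" using dist_triangle3[of Z W y] by (simp add: dist_norm)
      have "norm (Z - W) powr (real ?n + 2 * s) \<le> ?e" using d s by (intro powr_mono2) auto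
      then have "(norm (Y W - Y Z))\<^sup>2 * 1 \<le> (norm (Y W - Y Z))\<^sup>2 * (?e / norm (Z - W) powr (real ?n + 2 * s))" using False by (intro mult_left_mono) auto
      then show ?thesis using Z W by (simp add: g_def gag_kernel_norm2 norm_minus_commute mult.commute)
     qed (simp add: g_def)
     then show ?thesis using W by (simp add: ennreal_mult[symmetric] g_def)
    qed simp
    then have "(\<integral>\<^sup>+W. ennreal ((norm (Y W - Y Z))\<^sup>2) * ?J (t / 2) W \<partial>lborel) \<le> (\<integral>\<^sup>+W. ennreal ?e * ennreal (g (Z, W)) \<partial>lborel)"
     by (rule nn_integral_mono)
    also have "\<dots> = ennreal ?e * G Z" unfolding G_def by (rule nn_integral_cmult) measurable
    finally have "ennreal b * (\<integral>\<^sup>+W. ennreal ((norm (Y W - Y Z))\<^sup>2) * ?J (t / 2) W \<partial>lborel) \<le> ennreal b * (ennreal ?e * G Z)"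
     by (rule mult_left_mono) simp
    then show ?thesis using Z ab by (simp add: ennreal_mult mult.assoc)
   qed simp
   then have "(\<integral>\<^sup>+Z. ennreal b * (\<integral>\<^sup>+W. ennreal ((norm (Y W - Y Z))\<^sup>2) * ?J (t / 2) W \<partial>lborel) * ?J t Z \<partial>lborel)
     \<le> (\<integral>\<^sup>+Z. ennreal (b * ?e) * (G Z * indicator (cball y (t * diam)) Z) \<partial>lborel)" by (rule nn_integral_mono)
   also have "\<dots> = ennreal (b * ?e) * (\<integral>\<^sup>+Z. G Z * indicator (cball y (t * diam)) Z \<partial>lborel)"
    by (rule nn_integral_cmult) measurable
   finally have X: "(\<integral>\<^sup>+Z. ennreal ((norm (Y Z - cone_avg Y (t / 2) y))\<^sup>2) * ?J t Z \<partial>lborel)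
     \<le> ennreal (b * ?e) * (\<integral>\<^sup>+Z. G Z * indicator (cball y (t * diam)) Z \<partial>lborel)" using inner by (rule order_trans[rotated])
   have "ennreal ((norm (cone_avg Y t y - cone_avg Y (t / 2) y))\<^sup>2)
     \<le> ennreal a * (\<integral>\<^sup>+Z. ennreal ((norm (Y Z - cone_avg Y (t / 2) y))\<^sup>2) * ?J t Z \<partial>lborel)"
    unfolding a_def using order_trans[OF cone_avg_diff_le[OF Y]
     avg_weight_substitution[of "\<lambda>Z. ennreal ((norm (Y Z - cone_avg Y (t / 2) y))\<^sup>2)" y t]] y t by simp
   also have "\<dots> \<le> ennreal a * (ennreal (b * ?e) * (\<integral>\<^sup>+Z. G Z * indicator (cball y (t * diam)) Z \<partial>lborel))"
    by (rule mult_left_mono[OF X]) simp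
   also have "\<dots> = ennreal (a * b * ?e) * (\<integral>\<^sup>+Z. G Z * indicator (cball y (t * diam)) Z \<partial>lborel)"
    using ab by (simp add: ennreal_mult mult.assoc)
   finally show ?thesis .
  qed
  \<comment> \<open>The centre of the ball varies too, so joint measurability of its indicator is
    derived from that of the distance.\<close>
  have Im: "(\<lambda>p. G (snd p) * indicator (cball (fst p) (t * diam)) (snd p)) \<in> borel_measurable (borel \<Otimes>\<^sub>M borel)"
  proof -
   have "(\<lambda>p. indicator {0..t * diam} (dist (fst p) (snd p :: real^'n)) :: ennreal) \<in> borel_measurable (borel \<Otimes>\<^sub>M borel)"
    by measurable
   also have "(\<lambda>p. indicator {0..t * diam} (dist (fst p) (snd p)) :: ennreal) = (\<lambda>p. indicator (cball (fst p) (t * diam)) (snd p :: real^'n))"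
    by (auto simp: indicator_def fun_eq_iff)
   finally have [measurable]: "(\<lambda>p. indicator (cball (fst p) (t * diam)) (snd p :: real^'n) :: ennreal) \<in> borel_measurable (borel \<Otimes>\<^sub>M borel)" .
   show ?thesis by measurable
  qed
  have "nn2 (surf F) (\<lambda>y. cone_avg Y t y - cone_avg Y (t / 2) y)
    = (\<integral>\<^sup>+y. ennreal ((norm (cone_avg Y t y - cone_avg Y (t / 2) y))\<^sup>2) * indicator F y \<partial>facet_base F)"
   by (rule nn_integral_surface[OF F'])
  also have "\<dots> \<le> (\<integral>\<^sup>+y. ennreal (a * b * ?e) * (\<integral>\<^sup>+Z. G Z * indicator (cball y (t * diam)) Z \<partial>lborel) \<partial>facet_base F)"
  proof (rule nn_integral_mono)
   fix y show "ennreal ((norm (cone_avg Y t y - cone_avg Y (t / 2) y))\<^sup>2) * indicator F y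
     \<le> ennreal (a * b * ?e) * (\<integral>\<^sup>+Z. G Z * indicator (cball y (t * diam)) Z \<partial>lborel)"
    using point[of y] facet_of_imp_subset[OF F'] by (auto simp: indicator_def)
  qed
  also have "\<dots> = ennreal (a * b * ?e) * (\<integral>\<^sup>+y. (\<integral>\<^sup>+Z. G Z * indicator (cball y (t * diam)) Z \<partial>lborel) \<partial>facet_base F)"
   by (rule nn_integral_cmult)
    (rule sigma_finite_measure.borel_measurable_nn_integral[OF sigma_finite_lborel], use Im in \<open>simp add: case_prod_beta' cong: measurable_cong_sets\<close>)
  also have "(\<integral>\<^sup>+y. (\<integral>\<^sup>+Z. G Z * indicator (cball y (t * diam)) Z \<partial>lborel) \<partial>facet_base F)
    = (\<integral>\<^sup>+Z. (\<integral>\<^sup>+y. G Z * indicator (cball y (t * diam)) Z \<partial>facet_base F) \<partial>lborel)"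
  proof -
   interpret pair_sigma_finite "facet_base F" lborel
    unfolding pair_sigma_finite_def using sigma_finite_facet_base[OF F] sigma_finite_lborel by blast
   show ?thesis by (rule Fubini'[symmetric]) (use Im in \<open>simp add: case_prod_beta' cong: measurable_cong_sets\<close>)
  qed
  \<comment> \<open>For fixed Z the facet points within \<open>t * diam\<close> of Z lie in a ball
    around Z, whose surface measure is of order \<open>t ^ (CARD('n) - 1)\<close>.\<close>
  also have "\<dots> \<le> (\<integral>\<^sup>+Z. ennreal (?V * (t * diam) ^ (?n - 1)) * G Z \<partial>lborel)"
  proof (rule nn_integral_mono)
   fix Z :: "real^'n"
   have [measurable]: "cball Z (t * diam) \<in> sets borel" by simp
   have "(\<integral>\<^sup>+y. G Z * indicator (cball y (t * diam)) Z \<partial>facet_base F) = (\<integral>\<^sup>+y. G Z * indicator (cball Z (t * diam)) y \<partial>facet_base F)"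
    by (intro nn_integral_cong) (auto simp: indicator_def dist_commute)
   also have "\<dots> = G Z * emeasure (facet_base F) (cball Z (t * diam))" by (rule nn_integral_cmult_indicator) simp
   also have "\<dots> \<le> G Z * ennreal (?V * (t * diam) ^ (?n - 1))"
    using t diam(1) by (intro mult_left_mono facet_base_cball[OF F']) auto
   finally show "(\<integral>\<^sup>+y. G Z * indicator (cball y (t * diam)) Z \<partial>facet_base F) \<le> ennreal (?V * (t * diam) ^ (?n - 1)) * G Z"
    by (simp add: mult.commute)
  qed
  also have "\<dots> = ennreal (?V * (t * diam) ^ (?n - 1)) * (\<integral>\<^sup>+Z. G Z \<partial>lborel)" by (rule nn_integral_cmult) measurable
  also have "(\<integral>\<^sup>+Z. G Z \<partial>lborel) = gagliardo s ?U Y"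
  proof -
   have "gagliardo s ?U Y = (\<integral>\<^sup>+p. ennreal (g p) \<partial>(lborel \<Otimes>\<^sub>M lborel))"
    by (subst gagliardo_kernel) (simp_all add: g_def lborel_prod)
   also have "\<dots> = (\<integral>\<^sup>+Z. G Z \<partial>lborel)" unfolding G_def by (rule lborel.nn_integral_fst[symmetric]) measurable
   finally show ?thesis by simp
  qed
  finally have fin: "nn2 (surf F) (\<lambda>y. cone_avg Y t y - cone_avg Y (t / 2) y)
    \<le> ennreal (a * b * ?e) * (ennreal (?V * (t * diam) ^ (?n - 1)) * gagliardo s ?U Y)" by (simp add: mult_left_mono)
  have V0: "0 \<le> ?V" by simp
  have "a * b * ?e * (?V * (t * diam) ^ (?n - 1)) = K * t powr (2 * s - 1)"
  proof -
   obtain N where N: "?n = Suc N" using zero_less_card_finite[where 'a='n] by (cases "?n") auto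
   have h1: "?e = (2 * diam) powr (real ?n + 2 * s) * t powr (real ?n + 2 * s)"
    using t diam(1) by (simp add: powr_mult[symmetric] mult_ac)
   have h2: "a * b * (t * diam) ^ (?n - 1) = 1 / vol * (2 ^ ?n / vol) * diam ^ (?n - 1) * (t ^ N / (t ^ Suc N * t ^ Suc N))"
    unfolding N using t vol_pos by (simp add: a_def b_def N power_mult_distrib power_divide mult_ac)
   have h3: "t ^ N / (t ^ Suc N * t ^ Suc N) * t powr (real ?n + 2 * s) = t powr (2 * s - 1)"
   proof -
    have "t powr (real ?n + 2 * s) = t ^ Suc N * t powr (2 * s)" unfolding N powr_add using t by (simp only: powr_realpow)
    moreover have "t powr (2 * s - 1) = t powr (2 * s) / t" using t by (simp add: powr_diff)
    ultimately show ?thesis using t by (simp add: field_simps)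
   qed
   have "a * b * ?e * (?V * (t * diam) ^ (?n - 1)) = (a * b * (t * diam) ^ (?n - 1)) * ?e * ?V" by (simp only: mult_ac)
   also have "\<dots> = 1 / vol * (2 ^ ?n / vol) * diam ^ (?n - 1) * ((2 * diam) powr (real ?n + 2 * s)) * ?V
     * (t ^ N / (t ^ Suc N * t ^ Suc N) * t powr (real ?n + 2 * s))" unfolding h1 h2 by (simp only: mult_ac)
   finally show ?thesis unfolding h3 K_def by (simp only: mult_ac)
  qed
  then show ?thesis using ab V0 t diam(1) fin by (simp add: mult.assoc[symmetric] ennreal_mult[symmetric])
 qed
 moreover have "0 \<le> K" using vol_pos diam(1) by (simp add: K_def)
 ultimately show ?thesis using that by blast
qed

lemma L2_norm_bounded:
 assumes S: "finite_measure S" and "u \<in> borel_measurable S" and b: "\<And>x. x \<in> space S ==> norm (u x) \<le> e" and e: "0 \<le> e"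
 shows "L2_norm S u \<le> e * sqrt (measure S (space S))"
proof (rule L2_norm_le_nn[OF assms(2)])
 have "nn2 S u \<le> (\<integral>\<^sup>+x. ennreal (e\<^sup>2) \<partial>S)" by (intro nn_integral_mono ennreal_leI power_mono b) auto
 also have "\<dots> = ennreal ((e * sqrt (measure S (space S)))\<^sup>2)"
  using finite_measure.emeasure_eq_measure[OF S] by (simp add: power_mult_distrib ennreal_mult)
 finally show "nn2 S u \<le> ennreal ((e * sqrt (measure S (space S)))\<^sup>2)" .
qed (use e in simp)

lemma cone_avg_close:
 assumes Y: "continuous_on UNIV Y" and y: "y \<in> T" and t: "0 < t" "t \<le> 1" and e: "0 \<le> e"
  and b: "\<And>z. z \<in> T ==> dist y z \<le> t * diam ==> norm (Y z - c) \<le> e" shows "norm (cone_avg Y t y - c) \<le> e"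
proof -
 have "ennreal ((norm (cone_avg Y t y - c))\<^sup>2)
   \<le> (\<integral>\<^sup>+z. ennreal (avg_weight z) * ennreal ((norm (Y ((1 - t) *\<^sub>R y + t *\<^sub>R z) - c))\<^sup>2) \<partial>lborel)"
  by (rule cone_avg_diff_le[OF Y])
 also have "\<dots> \<le> (\<integral>\<^sup>+z. ennreal (avg_weight z) * ennreal (e\<^sup>2) \<partial>lborel)"
 proof (rule nn_integral_mono)
  fix z
  show "ennreal (avg_weight z) * ennreal ((norm (Y ((1 - t) *\<^sub>R y + t *\<^sub>R z) - c))\<^sup>2) \<le> ennreal (avg_weight z) * ennreal (e\<^sup>2)"
  proof (cases "z \<in> interior T")
   case True
   then have z: "z \<in> T" using interior_subset by blast
   have "dist y ((1 - t) *\<^sub>R y + t *\<^sub>R z) = norm (t *\<^sub>R (y - z))" by (simp add: dist_norm algebra_simps)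
   then have "dist y ((1 - t) *\<^sub>R y + t *\<^sub>R z) \<le> t * diam" using diam(2)[OF y z] t by (simp add: dist_norm)
   moreover have "(1 - t) *\<^sub>R y + t *\<^sub>R z \<in> T" using t by (intro convexD[OF convex y z]) auto
   ultimately show ?thesis using b by (intro mult_left_mono ennreal_leI power_mono) auto
  qed (simp add: avg_weight_def)
 qed
 also have "\<dots> = ennreal (e\<^sup>2)" by (simp add: nn_integral_multc avg_weight_nn)
 finally show ?thesis using e by simp
qed

text \<open>At scale 1 the cone average is the mean over the polytope, bounded by the L2 norm; the
  steps between the scales \<open>1 / 2 ^ j\<close> are bounded by a geometric series times the
  seminorm; and the averages tend to \<open>Y\<close> on the facet.\<close>

lemma trace_inequality_fractional:
 assumes F: "F \<in> facets" and s: "1/2 < s" "s < 1"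
 obtains C where "0 \<le> C" "\<And>Y :: real^'n => 'b::euclidean_space. smooth Y ==> L2_norm (surf F) Y \<le> C * Hs_norm s (interior T) Y"
proof -
 let ?U = "interior T" and ?S = "surf F"
 have F': "F facet_of T" and Ft: "F \<subseteq> T" using F by (auto simp: facets_def dest: facet_of_imp_subset)
 note S = surface_finite[OF F']
 have s0: "0 < s" using s by simp
 obtain K where K: "0 \<le> K" "\<And>(Y :: real^'n => 'b) t. continuous_on UNIV Y ==> 0 < t ==> t \<le> 1 ==>
   nn2 ?S (\<lambda>y. cone_avg Y t y - cone_avg Y (t / 2) y) \<le> ennreal (K * t powr (2 * s - 1)) * gagliardo s ?U Y"
  by (rule cone_avg_step[OF F s0, where 'b='b]) (rule that)
 define A where "A = measure ?S (space ?S)"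
 \<comment> \<open>The square root of \<open>t powr (2 * s - 1)\<close> at
   \<open>t = 1 / 2 ^ j\<close> is \<open>q ^ j\<close>, and \<open>q < 1\<close> is the condition
   \<open>s > 1/2\<close>.\<close>
 define q where "q = (2::real) powr (1/2 - s)"
 have q: "0 < q" "q < 1" using s by (auto simp: q_def powr_less_one)
 define C where "C = sqrt (1 / vol) * sqrt A + sqrt K / (1 - q)"
 have C0: "0 \<le> sqrt (1 / vol) * sqrt A" "0 \<le> sqrt K / (1 - q)" using vol_pos K(1) q by (auto simp: A_def)
 have "L2_norm ?S Y \<le> C * Hs_norm s ?U Y" if sm: "smooth Y" for Y :: "real^'n => 'b"
 proof -
  note Y = smooth_continuous[OF sm]
  define a where "a j = cone_avg Y (1 / 2 ^ j)" for j
  define g where "g = sqrt (enn2real (gagliardo s ?U Y))"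
  have g: "0 \<le> g" "gagliardo s ?U Y = ennreal (g\<^sup>2)"
   using smooth_gagliardo_finite[OF sm open_interior convex_interior bounded_interior s] by (auto simp: g_def)
  have t: "0 < 1 / (2::real) ^ j" "1 / (2::real) ^ j \<le> 1" for j by simp_all
  obtain B where B: "\<And>x. x \<in> T ==> norm (Y x) \<le> B"
  proof -
   have "bounded (Y ` T)"
    by (rule compact_imp_bounded[OF compact_continuous_image[OF continuous_on_subset[OF Y subset_UNIV] compact]])
   then show ?thesis using that by (meson bounded_iff imageI)
  qed
  have am: "a j \<in> borel_measurable ?S" for j unfolding a_def by (rule surface_borel[OF cone_avg_borel[OF Y]])
  have aL: "a j \<in> Lebesgue2 ?S" for j
  proof (rule Lebesgue2_bounded[OF S am], rule AE_I2)
   fix y assume "y \<in> space ?S"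
   then have y: "y \<in> T" using Ft by (auto simp: space_surface_measure)
   have "norm (cone_avg Y (1 / 2 ^ j) y - 0) \<le> B"
    by (rule cone_avg_close[OF Y y t order_trans[OF norm_ge_zero B[OF y]]]) (simp add: B)
   then show "norm (a j y) \<le> B" by (simp add: a_def)
  qed
  note YL = continuous_surface_L2[OF Y F']
  have step: "L2_norm ?S (\<lambda>y. a (Suc j) y - a j y) \<le> sqrt K * g * q ^ j" for j
  proof (rule L2_norm_le_nn)
   have p: "K * (1 / 2 ^ j) powr (2 * s - 1) = (sqrt K * q ^ j)\<^sup>2"
   proof -
    have "(1 / 2 ^ j) powr (2 * s - 1) = 2 powr (- real j * (2 * s - 1))"
     by (simp add: powr_realpow[symmetric] powr_powr powr_minus_divide[symmetric])
    also have "- real j * (2 * s - 1) = (1/2 - s) * real j + (1/2 - s) * real j" by (simp add: algebra_simps)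
    also have "2 powr ((1/2 - s) * real j + (1/2 - s) * real j) = (q ^ j)\<^sup>2"
     unfolding powr_add powr_powr[symmetric] q_def[symmetric] using q(1) by (simp add: powr_realpow power2_eq_square)
    finally show ?thesis using K(1) by (simp add: power_mult_distrib)
   qed
   have "nn2 ?S (\<lambda>y. a (Suc j) y - a j y) \<le> ennreal (K * (1 / 2 ^ j) powr (2 * s - 1)) * ennreal (g\<^sup>2)"
    using K(2)[OF Y t] unfolding a_def g(2) by (simp add: norm_minus_commute mult.commute)
   also have "\<dots> = ennreal ((sqrt K * g * q ^ j)\<^sup>2)"
    unfolding p by (simp add: ennreal_mult[symmetric] power_mult_distrib mult_ac)
   finally show "nn2 ?S (\<lambda>y. a (Suc j) y - a j y) \<le> ennreal ((sqrt K * g * q ^ j)\<^sup>2)" .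
   show "(\<lambda>y. a (Suc j) y - a j y) \<in> borel_measurable ?S" using am by simp
   show "0 \<le> sqrt K * g * q ^ j" using K(1) g(1) q by simp
  qed
  have sums: "L2_norm ?S (a J) \<le> L2_norm ?S (a 0) + sqrt K * g * (\<Sum>j<J. q ^ j)" for J
  proof (induction J)
   case (Suc J)
   have "L2_norm ?S (a (Suc J)) \<le> L2_norm ?S (\<lambda>y. a (Suc J) y - a J y) + L2_norm ?S (a J)"
    by (rule L2_norm_le_add_diff[OF aL aL])
   then show ?case using step[of J] Suc by (simp add: distrib_left)
  qed simp
  have "L2_norm ?S (a 0) \<le> sqrt (1 / vol) * L2_norm (leb ?U) Y * sqrt A" unfolding A_def
  proof (rule L2_norm_bounded[OF S am])
   fix y
   have "ennreal ((norm (cone_avg Y 1 y - 0))\<^sup>2) \<le> (\<integral>\<^sup>+z. ennreal (avg_weight z) * ennreal ((norm (Y z))\<^sup>2) \<partial>lborel)"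
    using cone_avg_diff_le[OF Y, of 1 y 0] by simp
   also have "\<dots> = (\<integral>\<^sup>+z. ennreal (1 / vol) * (ennreal ((norm (Y z))\<^sup>2) * indicator ?U z) \<partial>lborel)"
    by (intro nn_integral_cong) (simp add: avg_weight_def indicator_def)
   also have "\<dots> = ennreal (1 / vol) * (\<integral>\<^sup>+z. ennreal ((norm (Y z))\<^sup>2) * indicator ?U z \<partial>lborel)"
    using smooth_borel[OF sm] by (intro nn_integral_cmult) simp
   also have "(\<integral>\<^sup>+z. ennreal ((norm (Y z))\<^sup>2) * indicator ?U z \<partial>lborel) = nn2 (leb ?U) Y"
    using smooth_borel[OF sm] by (intro nn_integral_lebesgue_on_borel[symmetric] interior_borel) simp
   also have "\<dots> = ennreal ((L2_norm (leb ?U) Y)\<^sup>2)"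
    using bounded_smooth_L2[OF Y bounded_interior] open_interior by (intro nn_integral_norm2) (auto simp: L2_def)
   also have "ennreal (1 / vol) * \<dots> = ennreal ((sqrt (1 / vol) * L2_norm (leb ?U) Y)\<^sup>2)"
    using vol_pos by (simp add: ennreal_mult[symmetric] power_mult_distrib)
   finally have "(norm (a 0 y))\<^sup>2 \<le> (sqrt (1 / vol) * L2_norm (leb ?U) Y)\<^sup>2" by (simp add: a_def)
   then show "norm (a 0 y) \<le> sqrt (1 / vol) * L2_norm (leb ?U) Y" by (rule power2_le_imp_le) (use vol_pos in simp)
  qed (use vol_pos in simp)
  also have "\<dots> \<le> sqrt (1 / vol) * sqrt A * Hs_norm s ?U Y"
   using mult_left_mono[OF Hs_norm_ge_L2[where s = s and U = ?U and u = Y] C0(1)] by (simp only: mult_ac)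
  finally have a0: "L2_norm ?S (a 0) \<le> sqrt (1 / vol) * sqrt A * Hs_norm s ?U Y" .
  have geo: "(\<Sum>j<J. q ^ j) \<le> 1 / (1 - q)" for J using q by (simp add: sum_gp_strict divide_right_mono)
  have aJ: "L2_norm ?S (a J) \<le> C * Hs_norm s ?U Y" for J
  proof -
   have "sqrt K * g * (\<Sum>j<J. q ^ j) \<le> sqrt K * g * (1 / (1 - q))" by (intro mult_left_mono geo) (use K(1) g(1) in auto)
   also have "\<dots> = sqrt K / (1 - q) * g" by simp
   also have "\<dots> \<le> sqrt K / (1 - q) * Hs_norm s ?U Y"
    using Hs_norm_ge_gagliardo[OF less_imp_neq[OF s(2)], of ?U Y] C0(2) unfolding g_def by (rule mult_left_mono)
   finally show ?thesis using sums[of J] a0 by (simp add: C_def distrib_right)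
  qed
  \<comment> \<open>Uniform continuity of \<open>Y\<close> suffices here: the rate depends on
    \<open>Y\<close>, but it does not enter the constant \<open>C\<close>.\<close>
  have lim: "(\<lambda>J. L2_norm ?S (\<lambda>y. Y y - a J y)) \<longlonglongrightarrow> 0"
  proof (rule LIMSEQ_I)
   fix r :: real assume r: "0 < r"
   define e where "e = r / (sqrt A + 1)"
   have A0: "0 \<le> sqrt A" by (simp add: A_def)
   have e: "0 < e" "e * sqrt A < r" using r A0 by (auto simp: e_def field_simps add_pos_nonneg)
   obtain d where d: "0 < d" "\<forall>x\<in>T. \<forall>x'\<in>T. dist x' x < d \<longrightarrow> dist (Y x') (Y x) < e" using compact_uniformly_continuous[OF continuous_on_subset[OF Y subset_UNIV] compact] e(1) unfolding uniformly_continuous_on_def by blast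
   obtain J0 where J0: "diam / d < 2 ^ J0" using real_arch_pow[of 2 "diam / d"] by auto
   have "L2_norm ?S (\<lambda>y. Y y - a J y) < r" if J: "J0 \<le> J" for J
   proof -
    have "(2::real) ^ J0 \<le> 2 ^ J" using J by simp
    then have "diam / d < 2 ^ J" using J0 by linarith
    then have small: "1 / 2 ^ J * diam < d" using d(1) by (simp add: field_simps)
    have "L2_norm ?S (\<lambda>y. Y y - a J y) \<le> e * sqrt A" unfolding A_def
    proof (rule L2_norm_bounded[OF S])
     show "(\<lambda>y. Y y - a J y) \<in> borel_measurable ?S" using am Lebesgue2_measurable[OF YL] by simp
     fix y assume "y \<in> space ?S"
     then have y: "y \<in> T" using Ft by (auto simp: space_surface_measure)
     have "norm (cone_avg Y (1 / 2 ^ J) y - Y y) \<le> e"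
     proof (rule cone_avg_close[OF Y y t])
      fix z assume z: "z \<in> T" "dist y z \<le> 1 / 2 ^ J * diam"
      then have "dist z y < d" using small by (simp add: dist_commute)
      then show "norm (Y z - Y y) \<le> e" using d(2) z(1) y by (simp add: dist_norm less_imp_le)
     qed (use e in simp)
     then show "norm (Y y - a J y) \<le> e" by (simp add: a_def norm_minus_commute)
    qed (use e in simp)
    then show ?thesis using e(2) by linarith
   qed
   then show "\<exists>J0. \<forall>J\<ge>J0. norm (L2_norm ?S (\<lambda>y. Y y - a J y) - 0) < r" by (auto simp: L2_norm_nonneg)
  qed
  have "(\<lambda>J. L2_norm ?S (\<lambda>y. Y y - a J y) + C * Hs_norm s ?U Y) \<longlonglongrightarrow> 0 + C * Hs_norm s ?U Y" by (intro tendsto_intros lim)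
  moreover have "L2_norm ?S Y \<le> L2_norm ?S (\<lambda>y. Y y - a J y) + C * Hs_norm s ?U Y" for J
   using L2_norm_le_add_diff[OF YL aL[of J]] aJ[of J] by linarith
  ultimately show ?thesis by (intro LIMSEQ_le_const[of "\<lambda>J. L2_norm ?S (\<lambda>y. Y y - a J y) + C * Hs_norm s ?U Y"]) auto
 qed
 moreover have "0 \<le> C" unfolding C_def using C0 by (rule add_nonneg_nonneg)
 ultimately show ?thesis using that by blast
qed

text \<open>At \<open>s = 1\<close> the norm has another form, so the fractional case is used at an
  intermediate order; 3/4 is an arbitrary number strictly between 1/2 and 1.\<close>

lemma trace_inequality:
 assumes F: "F \<in> facets" and s: "1/2 < s" "s \<le> 1"
 obtains C where "0 \<le> C" "\<And>Y :: real^'n => 'b::euclidean_space. smooth Y ==> L2_norm (surf F) Y \<le> C * Hs_norm s (interior T) Y"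
proof (cases "s = 1")
 case True
 obtain C where C: "0 \<le> C" "\<And>Y :: real^'n => 'b. smooth Y ==> L2_norm (surf F) Y \<le> C * Hs_norm (3/4) (interior T) Y"
  by (rule trace_inequality_fractional[OF F, of "3/4", where 'b='b]) (simp, simp, rule that)
 obtain K where K: "0 \<le> K" "\<And>Y :: real^'n => 'b. smooth Y ==> Hs_norm (3/4) (interior T) Y \<le> K * H1_norm (interior T) Y"
  by (rule Hs_norm_le_H1_norm[OF open_interior convex_interior bounded_interior, of "3/4", where 'b='b]) (simp, simp, rule that)
 have "L2_norm (surf F) Y \<le> (C * K) * Hs_norm s (interior T) Y" if "smooth Y" for Y :: "real^'n => 'b"
  using C(2)[OF that] mult_left_mono[OF K(2)[OF that] C(1)] True by (simp add: Hs_norm_def)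
 then show ?thesis using C(1) K(1) by (intro that[of "C * K"]) simp_all
next
 case False
 then show ?thesis using trace_inequality_fractional[OF F s(1), where 'b='b] s(2) that by (metis less_le)
qed

end

section \<open>Traces and integration by parts on an element\<close>

text \<open>One mollifying weight is fixed for each polytope, so that smoothings need not carry it
  as a parameter.\<close>

definition (in full_polytope) rho :: "real^'n => real" where
 "rho = (SOME Q. mollifier (interior T) Q)"

sublocale full_polytope \<subseteq> mollifier "interior T" rho
proof -
 obtain Q where "mollifier (interior T) Q" by (rule mollifier_exists[OF open_interior convex_interior bounded_interior interior])
 then show "mollifier (interior T) rho" unfolding rho_def by (rule someI[of "\<lambda>Q. mollifier (interior T) Q"])
qed

context full_polytope
begin

abbreviation smoothing :: "nat => (real^'n => 'b::euclidean_space) => real^'n => 'b" where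
 "smoothing \<equiv> moll (interior T) rho"

text \<open>In contrast to \<open>is_trace\<close> no Sobolev order is involved, and the
  approximation is the fixed smoothing, which is linear in \<open>u\<close>. Sums and linear images,
  as needed for the stress, are then easy to treat.\<close>

definition ltrace :: "(real^'n) set => (real^'n => 'b::euclidean_space) => (real^'n => 'b) => bool" where
 "ltrace F u g \<longleftrightarrow> g \<in> Lebesgue2 (surf F) \<and> L2_conv (surf F) (\<lambda>m. smoothing m u) g"

text \<open>Identities between smoothings are proved in the interior, where the kernel is a test
  function; continuity carries them to the facets.\<close>

lemma smooth_eq_extend:
 assumes "smooth f" "smooth g" "\<And>x. x \<in> interior T ==> f x = g x" "x \<in> T" shows "f x = g x"
proof -
 have cl: "closure (interior T) = T" using convex_closure_interior[OF convex interior] compact by (simp add: compact_imp_closed)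
 have c: "continuous_on (closure (interior T)) (\<lambda>x. f x - g x)"
  using continuous_on_subset[OF continuous_on_diff[OF assms(1,2)[THEN smooth_continuous]] subset_UNIV] .
 have "f x - g x = 0" by (rule continuous_constant_on_closure[OF c]) (use assms(3,4) cl in simp_all)
 then show ?thesis by simp
qed

lemma facet_surface:
 assumes "F \<in> facets" shows "F facet_of T" "F \<subseteq> T" "finite_measure (surf F)" "space (surf F) = F"
  "smooth f ==> f \<in> Lebesgue2 (surf F)" using assms surface_finite continuous_surface_L2[OF smooth_continuous, of f F]
 by (auto simp: facets_def space_surface_measure dest: facet_of_imp_subset)

lemma smoothing_surface: "u \<in> L2 (interior T) ==> F \<in> facets ==> smoothing m u \<in> Lebesgue2 (surf F)"
 by (intro facet_surface moll_smooth)

text \<open>The trace inequality is applied to the difference of the two approximations. This is why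
  a trace does not depend on the approximating sequence.\<close>

lemma Hs_norm_limit_traces:
 fixes a b :: "nat => real^'n => 'b::euclidean_space"
 assumes F: "F \<in> facets" and s: "1/2 < s" "s \<le> 1" and u: "u \<in> Hs s (interior T)"
  and a: "\<And>m. smooth (a m)" "(\<lambda>m. Hs_norm s (interior T) (\<lambda>x. a m x - u x)) \<longlonglongrightarrow> 0"
  and b: "\<And>m. smooth (b m)" "(\<lambda>m. Hs_norm s (interior T) (\<lambda>x. b m x - u x)) \<longlonglongrightarrow> 0"
 shows "(\<lambda>m. L2_norm (surf F) (\<lambda>x. a m x - b m x)) \<longlonglongrightarrow> 0"
proof -
 obtain C where C: "0 \<le> C" "\<And>Y :: real^'n => 'b. smooth Y ==>
  L2_norm (surf F) Y \<le> C * Hs_norm s (interior T) Y" using trace_inequality[OF F s, where 'b='b] by blast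
 have H: "(\<lambda>x. c x - u x) \<in> Hs s (interior T)" if "smooth c" for c by (rule Hs_diff[OF U(1) smooth_Hs[OF that U s] u])
 have "(\<lambda>m. C * Hs_norm s (interior T) (\<lambda>x. a m x - b m x)) \<longlonglongrightarrow> C * 0" using Hs_norm_diff_tendsto[OF U(1) H[OF a(1)] H[OF b(1)] a(2) b(2)] by (intro tendsto_mult tendsto_const) simp
 then show ?thesis by (intro tendsto_zero_le[OF L2_norm_nonneg C(2)[OF smooth_diff[OF a(1) b(1)]]]) simp
qed

text \<open>The order hidden in \<open>is_trace\<close> may differ from the \<open>s\<close> at
  hand. The smoothing converges in every admissible order to which \<open>u\<close> belongs, and so
  links the two without an embedding between the spaces.\<close>

lemma is_trace_limit:
 assumes F: "F \<in> facets" and g: "is_trace T F u g" shows "ltrace F u g"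
  and "[|u \<in> Hs s (interior T); 1/2 < s; s \<le> 1; \<And>m. smooth (b m); (\<lambda>m. Hs_norm s (interior T) (\<lambda>x. b m x - u x)) \<longlonglongrightarrow> 0|]
   ==> L2_conv (surf F) b g"
proof -
 obtain s' Y where g2: "g \<in> Lebesgue2 (surf F)" and s: "1/2 < s'" "s' \<le> 1" "u \<in> Hs s' (interior T)"
  and Y: "\<And>m. smooth (Y m)" "(\<lambda>m. Hs_norm s' (interior T) (\<lambda>x. Y m x - u x)) \<longlonglongrightarrow> 0"
   "L2_conv (surf F) Y g" using g unfolding is_trace_def by blast
 have tri: "L2_conv (surf F) a g"
  if "(\<lambda>m. L2_norm (surf F) (\<lambda>x. a m x - c m x)) \<longlonglongrightarrow> 0"
   "L2_conv (surf F) c g" "\<And>m. smooth (a m)" "\<And>m. smooth (c m)" for a c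
  using L2_norm_triangle_diff[OF facet_surface(5)[OF F that(3)] facet_surface(5)[OF F that(4)] g2] tendsto_add[OF that(1,2)]
  by (intro tendsto_zero_le[OF L2_norm_nonneg]) auto
 note sm = moll_smooth[OF Hs_L2[OF s(3)]]
 note l = tri[OF Hs_norm_limit_traces[OF F s sm moll_Hs_tendsto[OF s(3,1)] Y(1,2)] Y(3) sm Y(1)]
 then show "ltrace F u g" using g2 by (simp add: ltrace_def)
 show "L2_conv (surf F) b g"
  if "u \<in> Hs s (interior T)" "1/2 < s" "s \<le> 1" "\<And>m. smooth (b m)" "(\<lambda>m. Hs_norm s (interior T) (\<lambda>x. b m x - u x)) \<longlonglongrightarrow> 0"
  by (rule tri[OF Hs_norm_limit_traces[OF F that(2,3,1,4,5) sm moll_Hs_tendsto[OF that(1,2)]] l that(4) sm])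
qed

text \<open>Existence turns the choice in \<open>face_trace\<close> into a genuine trace: the
  smoothings form a Cauchy sequence on the facet by \<open>Hs_norm_limit_traces\<close>, and L2 is
  complete.\<close>

lemma face_trace_is_trace:
 assumes F: "F \<in> facets" and s: "1/2 < s" "s \<le> 1" and u: "u \<in> Hs s (interior T)" shows "is_trace T F u (face_trace T F u)"
proof -
 let ?N = "L2_norm (surf F)"
 note sm = moll_smooth[OF Hs_L2[OF u]] and lim = moll_Hs_tendsto[OF u s(1)]
 have "\<exists>N. \<forall>m\<ge>N. \<forall>k\<ge>N. ?N (\<lambda>x. smoothing m u x - smoothing k u x) < e" if e: "0 < e" for e
 proof (rule ccontr)
  assume "\<not> ?thesis"
  \<comment> \<open>A failing Cauchy condition yields two index sequences tending to infinity along
    which the smoothings stay \<open>e\<close> apart. Both reindexed sequences still approximate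
    \<open>u\<close>, against \<open>Hs_norm_limit_traces\<close>.\<close>
  then have "\<forall>N. \<exists>p. N \<le> fst p \<and> N \<le> snd p \<and> e \<le> ?N (\<lambda>x. smoothing (fst p) u x - smoothing (snd p) u x)" by (simp add: not_less)
  then obtain p where p: "\<And>N. N \<le> fst (p N)" "\<And>N. N \<le> snd (p N)"
   "\<And>N. e \<le> ?N (\<lambda>x. smoothing (fst (p N)) u x - smoothing (snd (p N)) u x)" by metis
  have top: "filterlim q at_top sequentially" if "\<And>N. N \<le> q N" for q :: "nat => nat"
   by (rule filterlim_at_top_mono[OF filterlim_ident]) (simp add: that)
  have "(\<lambda>N. ?N (\<lambda>x. smoothing (fst (p N)) u x - smoothing (snd (p N)) u x)) \<longlonglongrightarrow> 0"
   by (rule Hs_norm_limit_traces[OF F s u sm filterlim_compose[OF lim top] sm filterlim_compose[OF lim top]]) (rule p)+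
  then have "e \<le> 0" by (rule LIMSEQ_le_const) (use p(3) in blast)
  then show False using e by simp
 qed
 from L2_complete[OF facet_surface(3)[OF F] smoothing_surface[OF Hs_L2[OF u] F] this]
 obtain g where "g \<in> Lebesgue2 (surf F)" "(\<lambda>m. ?N (\<lambda>x. smoothing m u x - g x)) \<longlonglongrightarrow> 0" .
 then have "is_trace T F u g" unfolding is_trace_def by (intro conjI exI[of _ s] exI[of _ "\<lambda>m. smoothing m u"] allI s u sm lim)
 then show ?thesis unfolding face_trace_def by (rule someI[of "is_trace T F u"])
qed

lemma ltrace_linear:
 assumes F: "F \<in> facets" and u: "u \<in> L2 (interior T)" and h: "bounded_linear h" and g: "ltrace F u g"
 shows "ltrace F (\<lambda>x. h (u x)) (\<lambda>x. h (g x))"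
proof -
 have hu: "(\<lambda>x. h (u x)) \<in> L2 (interior T)" using Lebesgue2_bounded_linear[OF h] u by (auto simp: L2_def)
 have "L2_norm (surf F) (\<lambda>x. smoothing m (\<lambda>x. h (u x)) x - h (g x)) = L2_norm (surf F) (\<lambda>x. h (smoothing m u x) - h (g x))" for m
  unfolding L2_norm_def by (intro arg_cong[where f = sqrt] bochner_int_cong refl)
   (use smooth_eq_extend[OF moll_smooth[OF hu] smooth_linear[OF h moll_smooth[OF u]] moll_linear[OF u h]]
    facet_surface(2,4)[OF F] in auto)
 moreover have "L2_conv (surf F) (\<lambda>m x. h (smoothing m u x)) (\<lambda>x. h (g x))"
  using L2_norm_bounded_linear_tendsto[OF h smoothing_surface[OF u F]] g by (auto simp: ltrace_def)
 ultimately show ?thesis using g Lebesgue2_bounded_linear[OF h] by (auto simp: ltrace_def)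
qed

lemma ltrace_add:
 assumes F: "F \<in> facets" and u: "u \<in> L2 (interior T)" "ltrace F u g" and v: "v \<in> L2 (interior T)" "ltrace F v g'"
 shows "ltrace F (\<lambda>x. u x + v x) (\<lambda>x. g x + g' x)"
proof -
 let ?N = "L2_norm (surf F)"
 have uv: "(\<lambda>x. u x + v x) \<in> L2 (interior T)" using u v by (auto simp: L2_def)
 have add: "smoothing m (\<lambda>x. u x + v x) x = smoothing m u x + smoothing m v x" if "x \<in> T" for m x
 proof (rule smooth_eq_extend[OF moll_smooth[OF uv] smooth_add[OF moll_smooth[OF u(1)] moll_smooth[OF v(1)]] _ that])
  fix x assume x: "x \<in> interior T"
  show "smoothing m (\<lambda>x. u x + v x) x = smoothing m u x + smoothing m v x"
   using test_mult_integrable[OF U(1) locally_integrable_L2[OF u(1)] moll_kernel_test[OF x, of m]]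
    test_mult_integrable[OF U(1) locally_integrable_L2[OF v(1)] moll_kernel_test[OF x, of m]]
   unfolding moll_def by (simp add: scaleR_add_right)
 qed
 have le: "?N (\<lambda>x. smoothing m (\<lambda>x. u x + v x) x - (g x + g' x)) \<le> ?N (\<lambda>x. smoothing m u x - g x) + ?N (\<lambda>x. smoothing m v x - g' x)" for m
 proof -
  have "?N (\<lambda>x. smoothing m (\<lambda>x. u x + v x) x - (g x + g' x)) = ?N (\<lambda>x. (smoothing m u x - g x) + (smoothing m v x - g' x))"
   unfolding L2_norm_def
   by (intro arg_cong[where f = sqrt] bochner_int_cong refl) (use add facet_surface(2,4)[OF F] in \<open>auto simp: algebra_simps\<close>)
  then show ?thesis
   using L2_norm_triangle[OF Lebesgue2_diff[OF smoothing_surface[OF u(1) F]] Lebesgue2_diff[OF smoothing_surface[OF v(1) F]], of g g' m m] u v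
   by (simp add: ltrace_def)
 qed
 have "(\<lambda>m. ?N (\<lambda>x. smoothing m u x - g x) + ?N (\<lambda>x. smoothing m v x - g' x)) \<longlonglongrightarrow> 0 + 0"
  using u v unfolding ltrace_def by (intro tendsto_add) blast+
 then have "(\<lambda>m. ?N (\<lambda>x. smoothing m (\<lambda>x. u x + v x) x - (g x + g' x))) \<longlonglongrightarrow> 0"
  by (intro tendsto_zero_le[OF L2_norm_nonneg le]) simp
 then show ?thesis using u v unfolding ltrace_def by (intro conjI) blast+
qed

lemma Hs_norm_zero: "Hs_norm 1 (interior T) (\<lambda>x. 0 :: 'b::euclidean_space) = 0"
proof -
 note z = is_weak_partial_zero
 have "L2_norm (leb (interior T)) (weak_partial (interior T) i (\<lambda>x. 0 :: 'b)) = 0" for i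
  by (rule L2_norm_AE_zero[OF weak_partial_AE[OF U(1) z]])
   (use locally_integrable_measurable[OF U(1)] is_weak_partial_weak_partial[OF z] in \<open>auto simp: is_weak_partial_def\<close>)
 then show ?thesis by (simp add: Hs_norm_def H1_norm_def L2_norm_def)
qed

lemma ltrace_smooth:
 assumes F: "F \<in> facets" and Y: "smooth Y" shows "ltrace F Y Y"
proof -
 have "is_trace T F Y Y" unfolding is_trace_def
  by (intro conjI exI[of _ 1] exI[of _ "\<lambda>m. Y"] facet_surface(5)[OF F Y] smooth_Hs[OF Y U] allI Y)
   (simp_all add: Hs_norm_zero L2_norm_def)
 then show ?thesis by (rule is_trace_limit(1)[OF F])
qed

text \<open>The divergence theorem is applied to products of the smoothings of \<open>W j\<close>
  and \<open>V\<close>. Of the derivatives of the smoothed \<open>W j\<close> only the sum over j is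
  identified, by \<open>moll_div\<close>, as a smoothing of \<open>D\<close>. Volume terms then
  converge in L2 of the element, boundary terms by the definition of \<open>ltrace\<close>.\<close>

theorem elementwise_ibp:
 fixes W :: "'n => real^'n => 'b::euclidean_space" and V :: "real^'n => 'c::euclidean_space"
  and h :: "'b => 'c => 'd::euclidean_space"
 assumes h: "bounded_bilinear h" and W: "\<And>j. W j \<in> L2 (interior T)" "weak_div (interior T) W D" and D: "D \<in> L2 (interior T)"
  and V: "V \<in> H1 (interior T)" and tr: "\<And>F j. F \<in> facets ==> ltrace F (W j) (w F j)" "\<And>F. F \<in> facets ==> ltrace F V (v F)"
 shows "(LINT x|leb (interior T). h (D x) (V x))
   + (\<Sum>j\<in>UNIV. LINT x|leb (interior T). h (W j x) (weak_partial (interior T) j V x))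
  = (\<Sum>F\<in>facets. LINT x|surf F. h (\<Sum>j\<in>UNIV. outer_normal T F $ j *\<^sub>R w F j x) (v F x))"
proof -
 interpret h: bounded_bilinear h by fact
 let ?M = "leb (interior T)" and ?d = "\<lambda>j. weak_partial (interior T) j V"
 note V2 = H1_L2[OF V] and d2 = H1_weak_partial_L2[OF U(1) V]
 note L = W(1)[unfolded L2_def] D[unfolded L2_def] V2[unfolded L2_def] d2[unfolded L2_def]
 define G where "G m j x = h (smoothing m (W j) x) (smoothing m V x)" for m j x
 have sm: "smooth (G m j)" for m j unfolding G_def[abs_def] by (intro smooth_bilinear[OF h] moll_smooth W(1) V2)
 \<comment> \<open>The factor stems from differentiating a contracted argument, as in
   \<open>moll_div\<close>.\<close>
 let ?s = "\<lambda>m u x. (1 - moll_eps m) *\<^sub>R smoothing m u x"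
 let ?I = "\<lambda>m. (LINT x|?M. h (?s m D x) (smoothing m V x)) + (\<Sum>j\<in>UNIV. LINT x|?M. h (smoothing m (W j) x) (?s m (?d j) x))"
 have sL: "?s m u \<in> Lebesgue2 ?M" "smoothing m u \<in> Lebesgue2 ?M" if "u \<in> L2 (interior T)" for m and u :: "real^'n => 'e::euclidean_space"
  using moll_L2[OF that, of m] unfolding L2_def by (rule Lebesgue2_scaleR, assumption)
 have I: "?I m = (\<Sum>F\<in>facets. \<Sum>j\<in>UNIV. outer_normal T F $ j *\<^sub>R (LINT x|surf F. G m j x))" for m
 proof -
  have pi: "integrable ?M (partial j (G m j))" for j
   using bounded_smooth_L2[OF smooth_continuous[OF smooth_partial[OF sm]] U(3)] U(1,3)
   by (auto simp: L2_def intro!: integrable_of_Lebesgue2 finite_measure_lebesgue_on_bounded)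
  have "?I m = (LINT x|?M. h (?s m D x) (smoothing m V x) + (\<Sum>j\<in>UNIV. h (smoothing m (W j) x) (?s m (?d j) x)))"
   using L2_pairing_integrable[OF h sL(1)[OF D] sL(2)[OF V2], of m m] L2_pairing_integrable[OF h sL(2)[OF W(1)] sL(1)[OF d2], of m _ m]
   by (subst Bochner_Integration.integral_add) auto
  also have "\<dots> = (LINT x|?M. (\<Sum>j\<in>UNIV. partial j (G m j) x))"
  proof (rule bochner_int_cong)
   fix x assume "x \<in> space ?M"
   then have x: "x \<in> interior T" by simp
   have "partial j (G m j) x = h (smoothing m (W j) x) (?s m (?d j) x) + h (partial j (smoothing m (W j)) x) (smoothing m V x)" for j
    unfolding G_def[abs_def] partial_bilinear[OF h moll_smooth[OF W(1)] moll_smooth[OF V2]]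
     moll_partial[OF H1_weak_partial[OF V] V2 x] ..
   then show "h (?s m D x) (smoothing m V x) + (\<Sum>j\<in>UNIV. h (smoothing m (W j) x) (?s m (?d j) x)) = (\<Sum>j\<in>UNIV. partial j (G m j) x)"
    by (simp add: sum.distrib h.sum_left[symmetric] moll_div[OF W(2,1) x])
  qed simp
  also have "\<dots> = (\<Sum>j\<in>UNIV. LINT x|?M. partial j (G m j) x)" by (rule bochner_int_sum) (rule pi)
  finally show ?thesis by (simp add: divergence_theorem[OF sm] sum.swap[of _ facets])
 qed
 have "?I \<longlonglongrightarrow> (LINT x|?M. h (D x) (V x)) + (\<Sum>j\<in>UNIV. LINT x|?M. h (W j x) (?d j x))"
  by (intro tendsto_add tendsto_sum L2_pairing_tendsto[OF h] L sL scaled_moll_L2_tendsto moll_L2_tendsto D V2 W(1) d2)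
 moreover have "?I \<longlonglongrightarrow> (\<Sum>F\<in>facets. \<Sum>j\<in>UNIV. outer_normal T F $ j *\<^sub>R (LINT x|surf F. h (w F j x) (v F x)))"
  unfolding I G_def using tr
  by (intro tendsto_sum tendsto_scaleR L2_pairing_tendsto[OF h] smoothing_surface W(1) V2) (auto simp: ltrace_def)
 moreover have "(\<Sum>j\<in>UNIV. outer_normal T F $ j *\<^sub>R (LINT x|surf F. h (w F j x) (v F x)))
   = (LINT x|surf F. h (\<Sum>j\<in>UNIV. outer_normal T F $ j *\<^sub>R w F j x) (v F x))" if F: "F \<in> facets" for F
  using tr[OF F] by (simp add: h.sum_left h.scaleR_left) (subst bochner_int_sum,
   auto simp: ltrace_def intro!: L2_pairing_integrable[OF h])
 ultimately show ?thesis using LIMSEQ_unique by fastforce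
qed

end

section \<open>The faces of a mesh\<close>

context full_polytope
begin

text \<open>A relative interior point of \<open>F\<close> lying in \<open>F'\<close> would force all
  of \<open>F\<close> into the face \<open>F'\<close>, which is impossible for different facets,
  their dimensions being equal.\<close>

lemma rel_interior_facet_pos:
 assumes F: "F facet_of T" "F' facet_of T" "F' \<noteq> F" and x: "x \<in> rel_interior F" shows "0 < facet_dist F' x"
proof (rule ccontr)
 have xF: "x \<in> F" and xt: "x \<in> T" using rel_interior_subset[of F] x facet_of_imp_subset[OF F(1)] by auto
 assume "\<not> 0 < facet_dist F' x"
 then have sub: "F \<subseteq> F'" using facet_iff[OF F(2)] facet_dist_nonneg[OF F(2) xt] xt subset_of_face_of[OF facet_of_imp_face_of[OF F(2)] facet_of_imp_subset[OF F(1)]] x by auto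
 then show False using face_of_subset[OF facet_of_imp_face_of[OF F(1)] _ facet_of_imp_subset[OF F(2)]] face_of_aff_dim_lt[OF face_of_imp_convex[OF facet_of_imp_face_of[OF F(2)]]] F(3) facet_aff_dim F by fastforce
qed

lemma rel_interior_facet:
 assumes F: "F facet_of T" shows "rel_interior F \<noteq> {}" "F \<subseteq> closure (rel_interior F)"
 using rel_interior_eq_empty[of F] convex_closure_rel_interior[of F] face_of_imp_convex[OF facet_of_imp_face_of[OF F]]
  facet_nonempty[OF F] closure_subset[of F] by auto

lemma open_facet_dist: "finite A ==> open {y. \<forall>F\<in>A. 0 < facet_dist F y}"
proof (induction A rule: finite_induct)
 case (insert F A)
 have "open {y. 0 < facet_dist F y}" by (intro open_Collect_less continuous_on_const smooth_continuous[OF smooth_facet_dist])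
 then show ?case using insert by (auto simp: Collect_conj_eq)
qed simp

lemma interior_iff: "x \<in> interior T \<longleftrightarrow> (\<forall>F\<in>facets. 0 < facet_dist F x)"
proof
 assume "\<forall>F\<in>facets. 0 < facet_dist F x"
 moreover have "{y. \<forall>F\<in>facets. 0 < facet_dist F y} \<subseteq> interior T"
  by (intro interior_maximal open_facet_dist finite_facets) (auto simp: mem_iff facets_def less_imp_le)
 ultimately show "x \<in> interior T" by blast
qed (auto simp: facets_def facet_dist_pos_interior)

text \<open>The distance to \<open>F\<close> grows linearly with the step, and the distances to the
  other facets start positive and stay so for small steps.\<close>

lemma inward_interior:
 assumes F: "F facet_of T" and x: "x \<in> rel_interior F" shows "\<forall>\<^sub>F s in at_right 0. x - s *\<^sub>R outer_normal T F \<in> interior T"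
proof -
 let ?n = "outer_normal T F"
 have "\<forall>\<^sub>F s in at_right 0. 0 < facet_dist F' (x - s *\<^sub>R ?n)" if F': "F' \<in> facets" for F'
 proof (cases "F' = F")
  case True
  have "facet_dist F' (x - s *\<^sub>R ?n) = s" for s using x rel_interior_subset[of F] facet_iff[OF F, of x] True facet_dist_affine[of F x "- s" ?n] outer_normal(1)[OF F] by (auto simp: norm_eq_1)
  then show ?thesis by (simp add: eventually_at_right_less)
 next
  case False
  have "((\<lambda>s. facet_dist F' (x - s *\<^sub>R ?n)) \<longlongrightarrow> facet_dist F' (x - 0 *\<^sub>R ?n)) (at_right 0)"
   unfolding facet_dist_def by (intro tendsto_intros)
  then show ?thesis
   using rel_interior_facet_pos[OF F _ False x] F' by (auto simp: facets_def dest!: order_tendstoD(1)[where a = 0])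
 qed
 then show ?thesis unfolding interior_iff by (intro eventually_ball_finite finite_facets) blast
qed

end

locale mesh =
 fixes D :: "(real^'n) set" and \<T> :: "(real^'n) set set"
 assumes domain: "polyhedral_domain D" and partition: "simplicial_partition D \<T>"
begin

lemma open_domain: "open D" and bounded_domain: "bounded D" and interior_closure: "interior (closure D) = D"
 using domain by (auto simp: polyhedral_domain_def)

lemma finite_mesh: "finite \<T>" and face_Int: "T \<in> \<T> ==> T' \<in> \<T> ==> T \<inter> T' face_of T" and Union_mesh: "\<Union>\<T> = closure D"
 using partition by (auto simp: simplicial_partition_def triangulation_def)

lemma element: "T \<in> \<T> ==> full_polytope T"
proof
 assume "T \<in> \<T>"
 then have s: "int CARD('n) simplex T" using partition by (simp add: simplicial_partition_def)
 show "polytope T" by (rule simplex_imp_polytope[OF s])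
 have "aff_dim T = int DIM(real^'n)" using aff_dim_simplex[OF s] by simp
 moreover from this have "T \<noteq> {}" by auto
 ultimately show "interior T \<noteq> {}"
  using interior_rel_interior[of T] rel_interior_eq_empty[of T] polytope_imp_convex[OF \<open>polytope T\<close>] by simp
qed

lemma interior_element: "T \<in> \<T> ==> interior T \<subseteq> D" using interior_mono[of T "closure D"] Union_mesh interior_closure by auto

text \<open>The intersection is a face of both elements. A proper face of one misses the interior of
  that element; if it is all of one element, it is a proper face of the other.\<close>

lemma disjoint_interiors:
 assumes "T \<in> \<T>" "T' \<in> \<T>" "T \<noteq> T'" shows "interior T \<inter> interior T' = {}"
proof (cases "T \<inter> T' = T")
 case True
 then have "T \<inter> interior T' = {}"
  using face_of_disjoint_interior[of T T'] face_Int[OF assms(2,1)] assms(3) by (simp add: Int_commute)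
 then show ?thesis using interior_subset by blast
next
 case False
 then show ?thesis
  using face_of_disjoint_interior[OF face_Int[OF assms(1,2)]] interior_subset[of T] interior_subset[of T'] by blast
qed

text \<open>\<open>T \<inter> T'\<close> is a face of \<open>T\<close> that contains a facet and is
  not all of \<open>T\<close>, so the dimensions leave no room between the facet and the
  intersection.\<close>

lemma shared_facet:
 assumes T: "T \<in> \<T>" "T' \<in> \<T>" "T \<noteq> T'" and F: "F facet_of T" "F \<subseteq> T'" shows "F = T \<inter> T'" "F facet_of T'"
proof -
 interpret P: full_polytope T by (rule element[OF T(1)])
 interpret Q: full_polytope T' by (rule element[OF T(2)])
 have sub: "F \<subseteq> T \<inter> T'" using F facet_of_imp_subset by blast
 have "T \<inter> T' \<noteq> T"
 proof
  assume "T \<inter> T' = T"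
  then have "interior T \<subseteq> interior T'" by (intro interior_mono) blast
  then show False using disjoint_interiors[OF T] P.interior by blast
 qed
 then have lt: "aff_dim (T \<inter> T') < aff_dim T" by (rule face_of_aff_dim_lt[OF P.convex face_Int[OF T(1,2)]])
 show eq: "F = T \<inter> T'"
 proof (rule ccontr)
  assume "F \<noteq> T \<inter> T'"
  then show False using face_of_aff_dim_lt[OF convex_Int[OF P.convex Q.convex]] face_of_subset[OF facet_of_imp_face_of[OF F(1)] sub] lt P.facet_aff_dim[OF F(1)] P.aff_dim by fastforce
 qed
 then show "F facet_of T'"
  using face_Int[OF T(2,1)] P.facet_aff_dim[OF F(1)] P.facet_nonempty[OF F(1)] Q.aff_dim by (simp add: facet_of_def Int_commute)
qed

text \<open>The normals agree up to sign. If they were equal, a small inward step from a relative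
  interior point of the facet would enter both interiors.\<close>

lemma opposite_normals:
 assumes T: "T \<in> \<T>" "T' \<in> \<T>" "T \<noteq> T'" and F: "F facet_of T" "F facet_of T'" shows "outer_normal T' F = - outer_normal T F"
proof -
 interpret P: full_polytope T by (rule element[OF T(1)])
 interpret Q: full_polytope T' by (rule element[OF T(2)])
 have perp: "(x - y) \<bullet> outer_normal T F = 0" "(x - y) \<bullet> outer_normal T' F = 0" if "x \<in> F" "y \<in> F" for x y
  using P.outer_normal(4)[OF F(1) that(2)] Q.outer_normal(4)[OF F(2) that(2)] that(1) by auto
 note unit_normal_unique[OF P.facet_aff_dim[OF F(1)] P.facet_nonempty[OF F(1)] P.outer_normal(1)[OF F(1)] Q.outer_normal(1)[OF F(2)] perp]
 moreover have "outer_normal T' F \<noteq> outer_normal T F"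
 proof
  assume eq: "outer_normal T' F = outer_normal T F"
  obtain x where x: "x \<in> rel_interior F" using P.rel_interior_facet(1)[OF F(1)] by blast
  have "\<exists>s. x - s *\<^sub>R outer_normal T F \<in> interior T \<and> x - s *\<^sub>R outer_normal T F \<in> interior T'"
   by (rule eventually_happens'[OF _ eventually_conj[OF P.inward_interior[OF F(1) x] Q.inward_interior[OF F(2) x, unfolded eq]]]) simp
  then show False using disjoint_interiors[OF T] by blast
 qed
 ultimately show ?thesis by blast
qed

text \<open>A third element would have a normal opposite to each of two normals that are themselves
  opposite.\<close>

lemma two_elements:
 assumes "T \<in> \<T>" "T' \<in> \<T>" "T \<noteq> T'" "F facet_of T" "F facet_of T'" shows "{Z \<in> \<T>. F facet_of Z} = {T, T'}"
proof -
 have "Z = T \<or> Z = T'" if Z: "Z \<in> \<T>" "F facet_of Z" for Z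
 proof (rule ccontr)
  assume "\<not> ?thesis"
  then have "T \<noteq> Z" "T' \<noteq> Z" by auto
  then have "outer_normal Z F = - outer_normal T F" "outer_normal Z F = - outer_normal T' F"
   by (simp_all add: opposite_normals Z assms)
  then have "outer_normal T F = 0" using opposite_normals[OF assms] by (simp add: vec_eq_iff)
  then show False using full_polytope.outer_normal(1)[OF element[OF assms(1)] assms(4)] by simp
 qed
 then show ?thesis using assms by blast
qed

text \<open>If a relative interior point of \<open>F\<close> lay in the domain, the points just
  beyond \<open>F\<close> would belong to the other elements, which are finitely many closed sets.
  The point itself would then lie in one of them, and with it the whole facet, contrary to
  uniqueness.\<close>

lemma frontier_facet:
 assumes T: "T \<in> \<T>" "F facet_of T" and only: "\<And>T'. T' \<in> \<T> ==> F facet_of T' ==> T' = T" shows "F \<subseteq> frontier D"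
proof -
 interpret P: full_polytope T by (rule element[OF T(1)])
 let ?n = "outer_normal T F"
 have "rel_interior F \<inter> D = {}"
 proof (rule ccontr)
  assume "\<not> ?thesis"
  then obtain x where x: "x \<in> rel_interior F" "x \<in> D" by blast
  have xF: "x \<in> F" using x rel_interior_subset by blast
  have lim: "((\<lambda>s. x + s *\<^sub>R ?n) \<longlongrightarrow> x) (at_right 0)" by (rule tendsto_eq_intros | simp)+
  have ev: "\<forall>\<^sub>F s in at_right (0::real). x + s *\<^sub>R ?n \<in> \<Union>(\<T> - {T})"
   using topological_tendstoD[OF lim open_domain x(2)] eventually_at_right_less[of 0]
  proof eventually_elim
   case (elim s)
   have "P.facet_dist F (x + s *\<^sub>R ?n) < 0"
    using P.facet_dist_affine[of F x s ?n] P.facet_iff[OF T(2), of x] xF P.outer_normal(1)[OF T(2)] elim by (simp add: norm_eq_1)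
   then have "x + s *\<^sub>R ?n \<notin> T" using P.facet_dist_nonneg[OF T(2)] by (meson not_less)
   moreover have "x + s *\<^sub>R ?n \<in> \<Union>\<T>" using elim closure_subset Union_mesh by blast
   ultimately show ?case by blast
  qed
  have cl: "closed (\<Union>(\<T> - {T}))"
   using finite_mesh element full_polytope.compact by (intro closed_Union) (auto intro: compact_imp_closed)
  have "x \<in> \<Union>(\<T> - {T})" by (rule Lim_in_closed_set[OF cl ev _ lim]) simp
  then obtain T' where T': "T' \<in> \<T>" "T' \<noteq> T" "x \<in> T'" by blast
  show False using subset_of_face_of[OF face_Int[OF T(1) T'(1)] facet_of_imp_subset[OF T(2)]] x xF facet_of_imp_subset[OF T(2)] shared_facet(2)[OF T(1) T'(1) T'(2)[symmetric] T(2)] only T' by auto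
 qed
 then have "F \<inter> D = {}" using open_Int_closure_eq_empty[OF open_domain] P.rel_interior_facet(2)[OF T(2)] by blast
 moreover have "F \<subseteq> closure D" using facet_of_imp_subset[OF T(2)] T(1) Union_mesh by blast
 ultimately show ?thesis using open_domain by (auto simp: frontier_def interior_open)
qed

text \<open>The signed distances to the common facet are opposite, so at each point one of them is
  nonnegative. In the second part the strict inequalities describe an open set inside the closure of
  the domain, hence inside the domain, which has no slits.\<close>

lemma two_sided:
 assumes T: "T \<in> \<T>" "T' \<in> \<T>" "T \<noteq> T'" and F: "F facet_of T" "F facet_of T'"
 shows "[|\<And>F'. F' facet_of T ==> F' \<noteq> F ==> 0 \<le> full_polytope.facet_dist T F' y;
   \<And>F'. F' facet_of T' ==> F' \<noteq> F ==> 0 \<le> full_polytope.facet_dist T' F' y|] ==> y \<in> T \<union> T'"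
  and "[|\<And>F'. F' facet_of T ==> F' \<noteq> F ==> 0 < full_polytope.facet_dist T F' y;
   \<And>F'. F' facet_of T' ==> F' \<noteq> F ==> 0 < full_polytope.facet_dist T' F' y|] ==> y \<in> D"
proof -
 interpret P: full_polytope T by (rule element[OF T(1)])
 interpret Q: full_polytope T' by (rule element[OF T(2)])
 have opp: "Q.facet_dist F y = - P.facet_dist F y" for y
  using P.facet_dist_eq[OF F(1) P.facet_point[OF F(1)], of y] Q.facet_dist_eq[OF F(2) P.facet_point[OF F(1)], of y] opposite_normals[OF T F]
  by simp
 show un: "y \<in> T \<union> T'"
  if "\<And>F'. F' facet_of T ==> F' \<noteq> F ==> 0 \<le> P.facet_dist F' y" "\<And>F'. F' facet_of T' ==> F' \<noteq> F ==> 0 \<le> Q.facet_dist F' y" for y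
 proof (cases "0 \<le> P.facet_dist F y")
  case True
  then have "y \<in> T" using that(1) by (subst P.mem_iff) metis
  then show ?thesis ..
 next
  case False
  then have "0 \<le> Q.facet_dist F y" by (simp add: opp)
  then have "y \<in> T'" using that(2) by (subst Q.mem_iff) metis
  then show ?thesis ..
 qed
 assume y: "\<And>F'. F' facet_of T ==> F' \<noteq> F ==> 0 < P.facet_dist F' y" "\<And>F'. F' facet_of T' ==> F' \<noteq> F ==> 0 < Q.facet_dist F' y"
 let ?N = "{y. \<forall>F'\<in>P.facets - {F}. 0 < P.facet_dist F' y} \<inter> {y. \<forall>F'\<in>Q.facets - {F}. 0 < Q.facet_dist F' y}"
 have "?N \<subseteq> T \<union> T'" by (intro subsetI un) (auto simp: P.facets_def Q.facets_def less_imp_le)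
 then have "?N \<subseteq> closure D" using T Union_mesh by blast
 then have "?N \<subseteq> interior (closure D)" by (intro interior_maximal open_Int P.open_facet_dist Q.open_facet_dist) simp_all
 then show "y \<in> D" using y by (auto simp: interior_closure P.facets_def Q.facets_def)
qed

lemma interior_face:
 assumes "F \<in> interior_faces \<T>"
 shows "elem_plus \<T> F \<in> \<T>" "F facet_of elem_plus \<T> F" "elem_minus \<T> F \<in> \<T>" "F facet_of elem_minus \<T> F"
  "elem_plus \<T> F \<noteq> elem_minus \<T> F" "{Z \<in> \<T>. F facet_of Z} = {elem_plus \<T> F, elem_minus \<T> F}"
proof -
 obtain T T' where T: "T \<in> \<T>" "T' \<in> \<T>" "T \<noteq> T'" "F facet_of T" "F facet_of T'" using assms by (auto simp: interior_faces_def)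
 have p: "elem_plus \<T> F \<in> \<T> \<and> F facet_of elem_plus \<T> F" unfolding elem_plus_def by (rule someI[of _ T]) (use T in blast)
 have "\<exists>Z. Z \<in> \<T> \<and> F facet_of Z \<and> Z \<noteq> elem_plus \<T> F" using T by metis
 then have m: "elem_minus \<T> F \<in> \<T> \<and> F facet_of elem_minus \<T> F \<and> elem_minus \<T> F \<noteq> elem_plus \<T> F"
  unfolding elem_minus_def by (rule someI_ex)
 show "elem_plus \<T> F \<in> \<T>" "F facet_of elem_plus \<T> F" "elem_minus \<T> F \<in> \<T>" "F facet_of elem_minus \<T> F"
  "elem_plus \<T> F \<noteq> elem_minus \<T> F" using p m by auto
 show "{Z \<in> \<T>. F facet_of Z} = {elem_plus \<T> F, elem_minus \<T> F}" by (rule two_elements) (use p m in auto)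
qed

text \<open>If two elements shared a boundary face, its relative interior would lie in the domain by
  \<open>two_sided\<close>, but an open set misses its frontier.\<close>

lemma boundary_face:
 assumes "F \<in> boundary_faces D \<T>"
 shows "elem_plus \<T> F \<in> \<T>" "F facet_of elem_plus \<T> F" "{Z \<in> \<T>. F facet_of Z} = {elem_plus \<T> F}" "F \<notin> interior_faces \<T>"
proof -
 have ex: "\<exists>Z. Z \<in> \<T> \<and> F facet_of Z" and fr: "F \<subseteq> frontier D" using assms by (auto simp: boundary_faces_def)
 have p: "elem_plus \<T> F \<in> \<T> \<and> F facet_of elem_plus \<T> F" unfolding elem_plus_def by (rule someI_ex[OF ex])
 have "Z = T" if Z: "Z \<in> \<T>" "T \<in> \<T>" "F facet_of Z" "F facet_of T" for Z T
 proof (rule ccontr)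
  assume ne: "Z \<noteq> T"
  interpret P: full_polytope Z by (rule element[OF Z(1)])
  interpret Q: full_polytope T by (rule element[OF Z(2)])
  obtain x where x: "x \<in> rel_interior F" using P.rel_interior_facet(1)[OF Z(3)] by blast
  have "x \<in> D"
   using P.rel_interior_facet_pos[OF Z(3) _ _ x] Q.rel_interior_facet_pos[OF Z(4) _ _ x] by (intro two_sided(2)[OF Z(1,2) ne Z(3,4)])
  moreover have "x \<in> frontier D" using x fr rel_interior_subset by blast
  ultimately show False using open_domain by (simp add: frontier_def interior_open)
 qed
 then show "{Z \<in> \<T>. F facet_of Z} = {elem_plus \<T> F}" "F \<notin> interior_faces \<T>" using p unfolding interior_faces_def by blast+
 show "elem_plus \<T> F \<in> \<T>" "F facet_of elem_plus \<T> F" using p by auto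
qed

text \<open>Faces are defined as shared facets and as facets on the frontier;
  \<open>frontier_facet\<close> ensures that no facet escapes both descriptions.\<close>

lemma all_faces_eq: "all_faces D \<T> = (\<Union>T\<in>\<T>. full_polytope.facets T)"
proof
 show "all_faces D \<T> \<subseteq> (\<Union>T\<in>\<T>. full_polytope.facets T)"
  using full_polytope.facets_def[OF element] by (auto simp: all_faces_def interior_faces_def boundary_faces_def)
 show "(\<Union>T\<in>\<T>. full_polytope.facets T) \<subseteq> all_faces D \<T>"
 proof
  fix F assume "F \<in> (\<Union>T\<in>\<T>. full_polytope.facets T)"
  then obtain T where T: "T \<in> \<T>" "F facet_of T" using full_polytope.facets_def[OF element] by auto
  show "F \<in> all_faces D \<T>"
  proof (cases "\<forall>T'\<in>\<T>. F facet_of T' \<longrightarrow> T' = T")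
   case True
   then show ?thesis using frontier_facet[OF T] T by (auto simp: all_faces_def boundary_faces_def)
  next
   case False
   then obtain T' where T': "T' \<in> \<T>" "F facet_of T'" "T \<noteq> T'" by blast
   show ?thesis using shared_facet(1)[OF T(1) T'(1,3) T(2) facet_of_imp_subset[OF T'(2)]] T T' unfolding all_faces_def interior_faces_def by blast
  qed
 qed
qed

lemma finite_all_faces: "finite (all_faces D \<T>)"
 unfolding all_faces_eq using finite_mesh full_polytope.finite_facets[OF element] by (intro finite_UN_I)

lemma sum_all_faces: shows "sum h (all_faces D \<T>) = sum h (interior_faces \<T>) + sum h (boundary_faces D \<T>)"
 using finite_all_faces boundary_face(4) unfolding all_faces_def by (intro sum.union_disjoint) auto

text \<open>After exchanging the sums, each interior face is visited from exactly two elements and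
  each boundary face from one. This turns element identities into face terms.\<close>

lemma sum_element_faces: shows "(\<Sum>T\<in>\<T>. \<Sum>F\<in>full_polytope.facets T. h T F)
  = (\<Sum>F\<in>interior_faces \<T>. h (elem_plus \<T> F) F + h (elem_minus \<T> F) F) + (\<Sum>F\<in>boundary_faces D \<T>. h (elem_plus \<T> F) F)"
proof -
 have "(\<Sum>T\<in>\<T>. \<Sum>F\<in>full_polytope.facets T. h T F) = (\<Sum>T\<in>\<T>. \<Sum>F | F \<in> all_faces D \<T> \<and> F facet_of T. h T F)"
  using all_faces_eq full_polytope.facets_def[OF element] by (intro sum.cong refl) auto
 also have "\<dots> = (\<Sum>F\<in>all_faces D \<T>. \<Sum>T | T \<in> \<T> \<and> F facet_of T. h T F)"
  by (rule sum.swap_restrict[OF finite_mesh finite_all_faces])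
 also have "\<dots> = (\<Sum>F\<in>interior_faces \<T>. h (elem_plus \<T> F) F + h (elem_minus \<T> F) F) + (\<Sum>F\<in>boundary_faces D \<T>. h (elem_plus \<T> F) F)"
  unfolding sum_all_faces by (intro arg_cong2[where f = "(+)"] refl) (simp_all add: interior_face boundary_face)
 finally show ?thesis .
qed

text \<open>The interiors are disjoint and cover the domain up to the frontiers of the elements,
  which are null.\<close>

lemma sum_integral_elements:
 fixes f :: "real^'n => 'b::euclidean_space"
 assumes f: "integrable (leb D) f" shows "(\<Sum>T\<in>\<T>. LINT x|leb (interior T). f x) = (LINT x|leb D. f x)"
proof -
 let ?f = "\<lambda>x. indicator D x *\<^sub>R f x"
 have fi: "integrable lebesgue ?f" using f open_domain by (subst integrable_lebesgue_on[symmetric]) auto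
 have eq: "indicator (interior T) x *\<^sub>R ?f x = indicator (interior T) x *\<^sub>R f x" if "T \<in> \<T>" for T x
  using interior_element[OF that] by (auto simp: indicator_def)
 have i: "integrable lebesgue (\<lambda>x. indicator (interior T) x *\<^sub>R ?f x)" for T by (rule integrable_mult_indicator[OF _ fi]) simp
 have "(\<Sum>T\<in>\<T>. LINT x|leb (interior T). f x) = (\<Sum>T\<in>\<T>. LINT x|lebesgue. indicator (interior T) x *\<^sub>R ?f x)"
  by (intro sum.cong refl) (simp only: eq, simp add: integral_restrict_space)
 also have "\<dots> = (LINT x|lebesgue. (\<Sum>T\<in>\<T>. indicator (interior T) x *\<^sub>R ?f x))" by (rule bochner_int_sum[symmetric]) (rule i)
 also have "\<dots> = (LINT x|lebesgue. ?f x)"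
 proof (rule integral_cong_AE)
  have "AE x in lebesgue. \<forall>T\<in>\<T>. x \<in> T \<longleftrightarrow> x \<in> interior T"
   using finite_mesh full_polytope.AE_interior_iff[OF element] by (intro AE_finite_allI) auto
  then show "AE x in lebesgue. (\<Sum>T\<in>\<T>. indicator (interior T) x *\<^sub>R ?f x) = ?f x"
  proof eventually_elim
   case (elim x)
   show ?case
   proof (cases "x \<in> D")
    case True
    then obtain Z where "Z \<in> \<T>" "x \<in> Z" using closure_subset[of D] Union_mesh by auto
    then have Z: "Z \<in> \<T>" "x \<in> interior Z" using elim by simp_all
    have "indicator (interior T) x *\<^sub>R ?f x = (if Z = T then ?f x else 0)" if "T \<in> \<T>" for T
     using disjoint_interiors[OF Z(1) that] Z(2) by (auto simp: indicator_def)
    then show ?thesis using Z(1) finite_mesh by simp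
   qed simp
  qed
  show "(\<lambda>x. \<Sum>T\<in>\<T>. indicator (interior T) x *\<^sub>R ?f x) \<in> borel_measurable lebesgue"
   using i by (intro borel_measurable_sum borel_measurable_integrable)
  show "?f \<in> borel_measurable lebesgue" by (rule borel_measurable_integrable[OF fi])
 qed
 also have "\<dots> = (LINT x|leb D. f x)" using open_domain by (simp add: integral_restrict_space)
 finally show ?thesis .
qed

end

section \<open>Operations on Sobolev functions\<close>

text \<open>The Gagliardo kernel commutes with linear maps, so the fractional case is the L2
  statement for kernels.\<close>

lemma Hs_linear:
 assumes U: "open U" and h: "bounded_linear h" and u: "u \<in> Hs s U" shows "(\<lambda>x. h (u x)) \<in> Hs s U"
proof (cases "s = 1")
 case True
 then show ?thesis using H1_linear[OF U h] u by (simp add: Hs_def)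
next
 case False
 interpret h: bounded_linear h by fact
 have U': "U \<in> sets borel" using U by simp
 have u2: "u \<in> Lebesgue2 (leb U)" and g: "gagliardo s U u < \<infinity>" using u False by (auto simp: Hs_def L2_def)
 obtain w where w: "w \<in> borel_measurable borel" "AE x in leb U. u x = w x"
  using measurable_borel_representative[OF Lebesgue2_measurable[OF u2] U'] by blast
 have hw: "(\<lambda>x. h (w x)) \<in> borel_measurable borel"
  by (rule measurable_compose[OF w(1)]) (simp add: borel_measurable_continuous_onI h linear_continuous_on)
 have "gagliardo s U w < \<infinity>" using g gagliardo_cong_AE[OF w(2)] by simp
 then have "(\<lambda>q. h (gag_kernel s U w q)) \<in> Lebesgue2 lborel"
  by (rule Lebesgue2_bounded_linear[OF h gag_kernel_Lebesgue2[OF w(1) U']])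
 moreover have "(\<lambda>q. h (gag_kernel s U w q)) = gag_kernel s U (\<lambda>x. h (w x))"
  by (rule ext) (simp add: gag_kernel_def h.scaleR h.diff)
 ultimately have "gagliardo s U (\<lambda>x. h (w x)) < \<infinity>" unfolding gagliardo_kernel[OF hw U'] by (simp add: nn_integral_norm2)
 moreover have ae: "AE x in leb U. h (u x) = h (w x)" using w(2) by eventually_elim simp
 ultimately show ?thesis
  using False Lebesgue2_bounded_linear[OF h u2] gagliardo_cong_AE[OF ae, of s] by (simp add: Hs_def L2_def)
qed

lemma Hs_sum:
 assumes U: "open U" and "finite I" "I \<noteq> {}" "\<And>i. i \<in> I ==> u i \<in> Hs s U" shows "(\<lambda>x. \<Sum>i\<in>I. u i x) \<in> Hs s U" using assms(2-4)
proof (induction I rule: finite_ne_induct)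
 case (insert i I)
 have "(\<lambda>x. u i x - - (\<Sum>i\<in>I. u i x)) \<in> Hs s U"
  using insert by (intro Hs_diff[OF U] Hs_linear[OF U bounded_linear_minus[OF bounded_linear_ident]]) auto
 then show ?case using insert by simp
qed simp

lemma Hs_subset:
 assumes U: "open U" "open V" "V \<subseteq> U" and u: "u \<in> Hs s U" shows "u \<in> Hs s V"
proof (cases "s = 1")
 case True
 then show ?thesis using H1_subset[OF U] u by (simp add: Hs_def)
next
 case False
 have mono: "(\<integral>\<^sup>+x. f x \<partial>leb V) \<le> (\<integral>\<^sup>+x. f x \<partial>leb U)" for f
  using U by (simp add: nn_integral_restrict_space) (intro nn_integral_mono mult_left_mono, auto simp:)
 have "gagliardo s V u \<le> gagliardo s U u" unfolding gagliardo_def by (rule order_trans[OF mono]) (intro nn_integral_mono mono)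
 then show ?thesis using u False L2_restrict[OF _ U(3)] U by (auto simp: Hs_def intro: le_less_trans)
qed

lemma Hs_cong_AE:
 assumes U: "open U" and u: "u \<in> Hs s U" and v: "v \<in> borel_measurable (leb U)" "AE x in leb U. u x = v x" shows "v \<in> Hs s U"
proof -
 have v2: "v \<in> L2 U" using Lebesgue2_cong_AE[OF _ v] Hs_L2[OF u] by (simp add: L2_def)
 show ?thesis
 proof (cases "s = 1")
  case True
  then have H: "u \<in> H1 U" using u by (simp add: Hs_def)
  note g = H1_weak_partial[OF H] H1_weak_partial_L2[OF U H]
  have "v \<in> H1 U"
   by (rule H1I[OF v2 g(2)]) (rule is_weak_partial_cong_AE[OF U g(1) v Lebesgue2_measurable[OF g(2)[unfolded L2_def]] AE_I2[OF refl]])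
  then show ?thesis using True by (simp add: Hs_def)
 next
  case False
  then show ?thesis using u v2 gagliardo_cong_AE[OF v(2)] by (auto simp: Hs_def)
 qed
qed

lemma H1_add_AE:
 assumes "open U" "bounded U" "u \<in> H1 U" "smooth p" "w \<in> borel_measurable (leb U)" "AE x in leb U. w x = p x"
 shows "(\<lambda>x. u x + w x) \<in> H1 U"
proof -
 have "p \<in> Hs 1 U" using smooth_H1 assms by (simp add: Hs_def)
 then have "w \<in> Hs 1 U" by (rule Hs_cong_AE[OF assms(1) _ assms(5)]) (use assms(6) in eventually_elim, simp)
 then show ?thesis using H1_add assms by (simp add: Hs_def)
qed

lemma smooth_polynomial:
 fixes p :: "real^'n => 'b::euclidean_space"
 assumes "is_polynomial k p" shows "smooth p"
proof -
 obtain c where c: "p = (\<lambda>x. \<Sum>A | (\<Sum>i\<in>UNIV. A i) \<le> k. (\<Prod>i\<in>UNIV. (x $ i) ^ A i) *\<^sub>R c A)"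
  using assms by (auto simp: is_polynomial_def)
 have "smooth (\<lambda>x::real^'n. (x $ i) ^ m)" for i :: 'n and m
  using smooth_prod[of "{..<m}" "\<lambda>_ x. x $ i"] by (simp add: smooth_component)
 then show ?thesis unfolding c by (intro smooth_sum smooth_scaleR smooth_prod smooth_const)
qed

lemma grad_column: "(\<chi> i. grad U u x $ i $ j) = weak_partial U j u x" by (simp add: grad_def)

lemma bounded_linear_column: "bounded_linear (\<lambda>A::complex^'n^'m. (\<chi> i. A $ i $ j))"
 unfolding linear_conv_bounded_linear[symmetric] by (rule linearI) (simp_all add: vec_eq_iff)

text \<open>A matrix field is the sum of its columns, put back in place by the linear maps
  \<open>B j\<close>; this reduces tensors to vectors.\<close>

lemma Hs_columns:
 fixes A :: "real^'n => complex^'n^'m"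
 assumes U: "open U" and A: "\<And>j. (\<lambda>x. (\<chi> i. A x $ i $ j)) \<in> Hs s U" shows "A \<in> Hs s U"
proof -
 define B where "B j w = (\<chi> i k. if k = j then w $ i else 0)" for j :: 'n and w :: "complex^'m"
 have "bounded_linear (B j)" for j
  unfolding linear_conv_bounded_linear[symmetric] B_def by (rule linearI) (auto simp: vec_eq_iff)
 then have "(\<lambda>x. B j (\<chi> i. A x $ i $ j)) \<in> Hs s U" for j by (rule Hs_linear[OF U _ A])
 then have "(\<lambda>x. \<Sum>j\<in>UNIV. B j (\<chi> i. A x $ i $ j)) \<in> Hs s U" by (rule Hs_sum[OF U finite_class.finite_UNIV UNIV_not_empty])
 also have "(\<lambda>x. \<Sum>j\<in>UNIV. B j (\<chi> i. A x $ i $ j)) = A" by (simp add: fun_eq_iff vec_eq_iff B_def cong:)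
 finally show ?thesis .
qed

text \<open>\<open>H1_plus\<close> speaks of the representatives chosen on \<open>U\<close>, the
  discrete forms of those chosen on an element; invariance of \<open>Hs\<close> under a.e. changes
  reconciles them.\<close>

lemma grad_Hs:
 assumes U: "open U" "open V" "V \<subseteq> U" and u: "u \<in> H1_plus r U" shows "grad V u \<in> Hs r V"
proof (rule Hs_columns[OF U(2)])
 have H: "u \<in> H1 U" and w: "weak_partial U j u \<in> Hs r U" for j using u by (auto simp: H1_plus_def)
 show "(\<lambda>x. (\<chi> i. grad V u x $ i $ j)) \<in> Hs r V" for j unfolding grad_column
 proof (rule Hs_cong_AE[OF U(2) Hs_subset[OF U w[of j]]])
  show "weak_partial V j u \<in> borel_measurable (leb V)"
   by (rule Lebesgue2_measurable[OF H1_weak_partial_L2[OF U(2) H1_subset[OF U H], unfolded L2_def]])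
  show "AE x in leb V. weak_partial U j u x = weak_partial V j u x"
   using weak_partial_subset_AE[OF U H1_weak_partial[OF H, of j]] by eventually_elim simp
 qed
qed

lemma weak_div_cong_AE:
 assumes U: "open U" and u: "weak_div U u D" and v: "\<And>j. v j \<in> borel_measurable (leb U)" "\<And>j. AE x in leb U. u j x = v j x"
  and E: "E \<in> borel_measurable (leb U)" "AE x in leb U. D x = E x" shows "weak_div U v E"
proof -
 have l: "locally_integrable U (u j)" "locally_integrable U (v j)" "locally_integrable U D" "locally_integrable U E" for j
  using u locally_integrable_cong_AE[OF _ v(1) _ v(2)] locally_integrable_cong_AE[OF _ E(1) _ E(2)] U by (auto simp: weak_div_def)
 then show ?thesis using u unfolding weak_div_def
  by (simp add: LINT_test_cong_AE[OF U l(1,2) v(2) test_functions_partial] LINT_test_cong_AE[OF U l(3,4) E(2)])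
qed

text \<open>Weak derivatives are defined with real test functions. Here the roles are reversed, a
  real function being paired with vector-valued tests, and coordinates reduce this to the
  definition.\<close>

lemma weak_partial_vector_test:
 fixes A :: "real^'n => 'b::euclidean_space"
 assumes U: "open U" "bounded U" and b: "is_weak_partial U i b g" "b \<in> L2 U" "g \<in> L2 U" and A: "A \<in> test_functions U"
 shows "(LINT x|leb U. b x *\<^sub>R partial i A x) = - (LINT x|leb U. (g x :: real) *\<^sub>R A x)"
proof (rule euclidean_eqI)
 fix c :: 'b
 have L: "A \<in> Lebesgue2 (leb U)" "partial i A \<in> Lebesgue2 (leb U)"
  using bounded_smooth_L2[OF smooth_continuous[OF test_smooth] U(2)] A test_functions_partial[OF A] U(1) by (auto simp: L2_def)
 note i = L2_pairing_integrable[OF bounded_bilinear_scaleR b(2)[unfolded L2_def] L(2)]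
  L2_pairing_integrable[OF bounded_bilinear_scaleR b(3)[unfolded L2_def] L(1)]
 have bl: "bounded_linear (\<lambda>y. y \<bullet> c)" by (rule bounded_linear_inner_left)
 show "(LINT x|leb U. b x *\<^sub>R partial i A x) \<bullet> c = - (LINT x|leb U. g x *\<^sub>R A x) \<bullet> c" using b(1) test_functions_linear[OF bl A] i by (auto simp: is_weak_partial_def partial_linear[OF bl test_smooth[OF A]] integral_inner_left[symmetric] mult.commute)
qed

lemma ess_bounded_mult_L2:
 assumes "ess_bounded U b" "u \<in> L2 U" shows "(\<lambda>x. b x *\<^sub>R u x) \<in> L2 U"
proof -
 obtain C where C: "AE x in leb U. norm (b x) \<le> C" and m: "b \<in> borel_measurable (leb U)"
  using assms(1) by (auto simp: ess_bounded_def)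
 have "AE x in leb U. norm (b x *\<^sub>R u x) \<le> C * norm (u x)" using C by eventually_elim (simp add: mult_right_mono)
 then show ?thesis unfolding L2_def by (rule Lebesgue2_dominated[OF assms(2)[unfolded L2_def], rotated])
   (intro borel_measurable_scaleR m Lebesgue2_measurable[OF assms(2)[unfolded L2_def]])
qed

lemma H1_limit:
 assumes U: "open U" "bounded U" and u: "u \<in> H1 U" and Y: "\<And>m. smooth (Y m)" "(\<lambda>m. H1_norm U (\<lambda>x. Y m x - u x)) \<longlonglongrightarrow> 0"
 shows "L2_conv (leb U) Y u" and "L2_conv (leb U) (\<lambda>m. partial i (Y m)) (weak_partial U i u)"
proof -
 show "L2_conv (leb U) Y u" by (rule tendsto_zero_le[OF L2_norm_nonneg H1_norm_ge(1) Y(2)])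
 have "L2_norm (leb U) (\<lambda>x. partial i (Y m) x - weak_partial U i u x) = L2_norm (leb U) (weak_partial U i (\<lambda>x. Y m x - u x))" for m
 proof (rule L2_norm_cong_AE)
  note sH = smooth_H1[OF Y(1) U(2,1)]
  have w: "is_weak_partial U i (\<lambda>x. Y m x - u x) (\<lambda>x. partial i (Y m) x - weak_partial U i u x)"
   by (rule is_weak_partial_diff[OF U(1) smooth_is_weak_partial[OF Y(1) U(1)] H1_weak_partial[OF u]])
  show "(\<lambda>x. partial i (Y m) x - weak_partial U i u x) \<in> borel_measurable (leb U)"
   using locally_integrable_measurable[OF U(1)] w[unfolded is_weak_partial_def] by blast
  show "weak_partial U i (\<lambda>x. Y m x - u x) \<in> borel_measurable (leb U)"
   using H1_weak_partial_L2[OF U(1) H1_diff[OF U(1) sH u], of i] by (simp add: L2_def Lebesgue2_measurable)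
  show "AE x in leb U. partial i (Y m) x - weak_partial U i u x = weak_partial U i (\<lambda>x. Y m x - u x) x"
   using weak_partial_AE[OF U(1) w] by eventually_elim simp
 qed
 then show "L2_conv (leb U) (\<lambda>m. partial i (Y m)) (weak_partial U i u)"
  using tendsto_zero_le[OF L2_norm_nonneg H1_norm_ge(2) Y(2)] by simp
qed

text \<open>A test function times the smooth \<open>Y m\<close> is again a test function, so the
  weak derivative of \<open>b\<close> applies to it, and the limit in m gives the rule for
  \<open>u\<close>. The sequence is a hypothesis because it comes from mollification on convex
  elements but from the definition of \<open>H1_0\<close> on the whole domain.\<close>

lemma weak_product_rule:
 fixes u :: "real^'n => 'b::euclidean_space" and b :: "real^'n => real"
 assumes U: "open U" "bounded U" and u: "u \<in> H1 U" and Y: "\<And>m. smooth (Y m)" "(\<lambda>m. H1_norm U (\<lambda>x. Y m x - u x)) \<longlonglongrightarrow> 0"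
  and b: "ess_bounded U b" "ess_bounded U g" "is_weak_partial U i b g"
 shows "is_weak_partial U i (\<lambda>x. b x *\<^sub>R u x) (\<lambda>x. b x *\<^sub>R weak_partial U i u x + g x *\<^sub>R u x)"
proof -
 let ?M = "leb U" and ?w = "weak_partial U i u"
 have Us: "U \<in> sets lebesgue" using U(1) by simp
 have b2: "b \<in> L2 U" "g \<in> L2 U"
  using b(1,2)[THEN ess_bounded_mult_L2, OF bounded_smooth_L2[OF continuous_on_const U(2) Us, of "1::real"]] by simp_all
 note u2 = H1_L2[OF u] and w2 = H1_weak_partial_L2[OF U(1) u]
 note bu = ess_bounded_mult_L2[OF b(1) u2] ess_bounded_mult_L2[OF b(1) w2] ess_bounded_mult_L2[OF b(2) u2]
 have "(LINT x|?M. partial i W x *\<^sub>R (b x *\<^sub>R u x)) = - (LINT x|?M. W x *\<^sub>R (b x *\<^sub>R ?w x + g x *\<^sub>R u x))"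
  if W: "W \<in> test_functions U" for W :: "real^'n => real"
 proof -
  note Ws = test_smooth[OF W] and pW = test_functions_partial[OF W]
  have c: "(\<lambda>x. E x *\<^sub>R a x) \<in> Lebesgue2 ?M" if E: "E \<in> test_functions U" and a: "a \<in> L2 U" for E a :: "real^'n => real"
  proof -
   obtain B where "\<And>x. norm (E x) \<le> B" using test_bounded[OF E] by blast
   moreover have "E \<in> borel_measurable ?M" using test_borel[OF E] by (simp add: measurable_completion measurable_restrict_space1)
   ultimately have "ess_bounded U E" by (auto simp: ess_bounded_def)
   then show ?thesis using ess_bounded_mult_L2[OF _ a] by (simp add: L2_def)
  qed
  have L: "Y m \<in> Lebesgue2 ?M" "partial i (Y m) \<in> Lebesgue2 ?M" for m
   using bounded_smooth_L2[OF smooth_continuous U(2) Us] Y(1) smooth_partial by (auto simp: L2_def)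
  note L2s = u2[unfolded L2_def] w2[unfolded L2_def]
  have const: "L2_conv ?M (\<lambda>m. a) a" for a :: "real^'n => real" by (simp add: L2_norm_def)
  have lim: "(\<lambda>m. LINT x|?M. a x *\<^sub>R Y m x) \<longlonglongrightarrow> (LINT x|?M. a x *\<^sub>R u x)"
    "(\<lambda>m. LINT x|?M. a x *\<^sub>R partial i (Y m) x) \<longlonglongrightarrow> (LINT x|?M. a x *\<^sub>R ?w x)" if "a \<in> Lebesgue2 ?M" for a :: "real^'n => real"
   by (rule L2_pairing_tendsto[OF bounded_bilinear_scaleR that _ that _ const]; intro L2s L H1_limit[OF U u Y])+
  note int = L2_pairing_integrable[OF bounded_bilinear_scaleR]
  have eq: "(LINT x|?M. (partial i W x *\<^sub>R b x) *\<^sub>R Y m x) + (LINT x|?M. (W x *\<^sub>R b x) *\<^sub>R partial i (Y m) x)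
    = - (LINT x|?M. (W x *\<^sub>R g x) *\<^sub>R Y m x)" for m
  proof -
   have "(LINT x|?M. b x *\<^sub>R partial i (\<lambda>x. W x *\<^sub>R Y m x) x) = - (LINT x|?M. g x *\<^sub>R (W x *\<^sub>R Y m x))"
    by (rule weak_partial_vector_test[OF U b(3) b2 test_functions_bilinear[OF bounded_bilinear_scaleR W Y(1)]])
   moreover have "b x *\<^sub>R partial i (\<lambda>x. W x *\<^sub>R Y m x) x = (partial i W x *\<^sub>R b x) *\<^sub>R Y m x + (W x *\<^sub>R b x) *\<^sub>R partial i (Y m) x" for x
    by (simp add: partial_bilinear[OF bounded_bilinear_scaleR Ws Y(1)] algebra_simps)
   ultimately show ?thesis using int[OF c[OF pW b2(1)] L(1)] int[OF c[OF W b2(1)] L(2)] by (simp add: mult.commute)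
  qed
  have "(\<lambda>m. (LINT x|?M. (partial i W x *\<^sub>R b x) *\<^sub>R Y m x) + (LINT x|?M. (W x *\<^sub>R b x) *\<^sub>R partial i (Y m) x))
    \<longlonglongrightarrow> (LINT x|?M. (partial i W x *\<^sub>R b x) *\<^sub>R u x) + (LINT x|?M. (W x *\<^sub>R b x) *\<^sub>R ?w x)" by (intro tendsto_add lim c pW W b2)
  moreover have "(\<lambda>m. (LINT x|?M. (partial i W x *\<^sub>R b x) *\<^sub>R Y m x) + (LINT x|?M. (W x *\<^sub>R b x) *\<^sub>R partial i (Y m) x))
    \<longlonglongrightarrow> - (LINT x|?M. (W x *\<^sub>R g x) *\<^sub>R u x)" unfolding eq by (intro tendsto_minus lim c W b2)
  ultimately have lim_eq: "(LINT x|?M. (partial i W x *\<^sub>R b x) *\<^sub>R u x) + (LINT x|?M. (W x *\<^sub>R b x) *\<^sub>R ?w x) = - (LINT x|?M. (W x *\<^sub>R g x) *\<^sub>R u x)"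
   by (rule LIMSEQ_unique)
  have "(LINT x|?M. (W x *\<^sub>R b x) *\<^sub>R ?w x) + (LINT x|?M. (W x *\<^sub>R g x) *\<^sub>R u x) = (LINT x|?M. W x *\<^sub>R (b x *\<^sub>R ?w x + g x *\<^sub>R u x))"
   using int[OF c[OF W b2(1)] L2s(2)] int[OF c[OF W b2(2)] L2s(1)] by (simp add: scaleR_add_right)
  then show ?thesis using lim_eq by (simp add: eq_neg_iff_add_eq_0 add.assoc)
 qed
 moreover have "locally_integrable U (\<lambda>x. b x *\<^sub>R ?w x + g x *\<^sub>R u x)" "locally_integrable U (\<lambda>x. b x *\<^sub>R u x)"
  by (intro locally_integrable_add locally_integrable_L2 bu Us)+
 ultimately show ?thesis by (simp add: is_weak_partial_def)
qed

section \<open>The adjoint problem\<close>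

text \<open>Bilinearity is meant over the reals, which tolerates conjugation, so that the general
  pairing lemmas serve sesquilinear forms.\<close>

lemma bounded_bilinear_vdot_cnj: "bounded_bilinear (\<lambda>(a::complex^'n) b. vdot b (vcnj a))"
 and bounded_bilinear_vdot_cnj': "bounded_bilinear (\<lambda>(a::complex^'n) b. vdot a (vcnj b))"
 and bounded_bilinear_tdot_cnj: "bounded_bilinear (\<lambda>(A::complex^'n^'n) B. of_real c * tdot A (tcnj B))"
 and bounded_bilinear_mult_cnj: "bounded_bilinear (\<lambda>(a::complex) b. cnj a * b)"
 and bounded_bilinear_mult_vec: "bounded_bilinear (\<lambda>(A::complex^'n^'n) (x::complex^'n). A *v x)"
 unfolding bilinear_conv_bounded_bilinear[symmetric] bilinear_def
 by (auto intro!: linearI simp: vdot_def vcnj_def tdot_def tcnj_def matrix_vector_mult_def vec_eq_iff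
   sum.distrib sum_distrib_left scaleR_sum_right algebra_simps)

lemma bounded_linear_axis: "bounded_linear (\<lambda>a::complex. axis i a :: complex^'n)"
 unfolding linear_conv_bounded_linear[symmetric] by (rule linearI) (auto simp: axis_def vec_eq_iff)

lemma vdot_axis: "vdot (axis i a) w = a * w $ i"
proof -
 have "vdot (axis i a) w = (\<Sum>k\<in>UNIV. if k = i then a * w $ k else 0)" unfolding vdot_def by (rule sum.cong) (auto simp: axis_def)
 then show ?thesis by simp
qed

text \<open>Column j of the stress, the pressure entering through the identity matrix. Columns are
  used because the divergence sums partial derivatives over j.\<close>

definition stress :: "real => (real^'n) set => (real^'n => complex^'n) => (real^'n => complex) => 'n => real^'n => complex^'n" where
 "stress \<mu> U u p j x = \<mu> *\<^sub>R weak_partial U j u x - axis j (p x)"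

text \<open>The identity matrix in the stress picks out the divergence of \<open>w\<close>; one
  pairing thus yields the viscous and the pressure term of the forms.\<close>

lemma vdot_stress:
 "(\<Sum>j\<in>UNIV. vdot (weak_partial U j w x) (vcnj (stress \<mu> U u p j x)))
  = of_real \<mu> * tdot (grad U w x) (tcnj (grad U u x)) - cnj (p x) * divergence U w x"
proof -
 have ax: "vdot a (vcnj (axis j c)) = cnj c * a $ j" for a :: "complex^'n" and j c
  unfolding vdot_def vcnj_def axis_def by (simp add: if_distrib[of cnj] if_distrib[of "(*) _"] cong: if_cong)
 have diff: "vdot a (vcnj (b - c)) = vdot a (vcnj b) - vdot a (vcnj c)" for a b c :: "complex^'n"
  by (simp add: vdot_def vcnj_def sum_subtractf algebra_simps)
 have "(\<Sum>j\<in>UNIV. vdot (weak_partial U j w x) (vcnj (\<mu> *\<^sub>R weak_partial U j u x))) = of_real \<mu> * tdot (grad U w x) (tcnj (grad U u x))"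
  unfolding vdot_def tdot_def vcnj_def tcnj_def grad_def
  by (subst (2) sum.swap) (simp add: sum_distrib_left scaleR_conv_of_real[where 'a=complex] mult_ac)
 then show ?thesis by (simp add: stress_def diff sum_subtractf ax divergence_def sum_distrib_left)
qed

locale adjoint_problem = mesh +
 fixes \<mu> r :: real and \<beta> :: "real^'n => real^'n" and f u :: "real^'n => complex^'n" and p :: "real^'n => complex"
 assumes \<beta>: "\<beta> \<in> W1_infinity D" "divergence_free D \<beta>" and f: "f \<in> L2 D" and adjoint: "adjoint_solution D \<mu> \<beta> f u p"
  and r: "1/2 < r" "r \<le> 1" and u_plus: "u \<in> H1_plus r D" and p_Hs: "p \<in> Hs r D"
begin

lemma ess_bounded_beta: "ess_bounded D (\<lambda>x. \<beta> x $ j)" and beta_partial: "\<exists>g. ess_bounded D g \<and> is_weak_partial D i (\<lambda>x. \<beta> x $ j) g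
   \<and> (AE x in leb D. g x = weak_partial D i \<beta> x $ j)"
proof -
 have comp: "ess_bounded D (\<lambda>x. g x $ j)" if g: "ess_bounded D g" for g :: "real^'n => real^'n"
 proof -
  obtain C where m: "g \<in> borel_measurable (leb D)" and C: "AE x in leb D. norm (g x) \<le> C"
   using g by (auto simp: ess_bounded_def)
  have "AE x in leb D. norm (g x $ j) \<le> C" using C by eventually_elim (rule order_trans[OF Finite_Cartesian_Product.norm_nth_le])
  then show ?thesis using measurable_compose[OF m, of "\<lambda>y. y $ j" borel] by (auto simp: ess_bounded_def)
 qed
 show "ess_bounded D (\<lambda>x. \<beta> x $ j)" using \<beta>(1) by (intro comp) (simp add: W1_infinity_def)
 obtain g where g: "ess_bounded D g" "is_weak_partial D i \<beta> g" using \<beta>(1) by (auto simp: W1_infinity_def)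
 show "\<exists>g. ess_bounded D g \<and> is_weak_partial D i (\<lambda>x. \<beta> x $ j) g \<and> (AE x in leb D. g x = weak_partial D i \<beta> x $ j)" using weak_partial_AE[OF open_domain g(2)] comp[OF g(1)] is_weak_partial_linear[OF open_domain bounded_linear_vec_nth g(2)] by auto
qed

text \<open>In the product rule the terms with derivatives of \<open>\<beta>\<close> add up to its
  divergence times \<open>v\<close>, which vanishes. Convection is thereby a weak divergence and can
  be integrated by parts like the stress.\<close>

lemma convection:
 fixes v :: "real^'n => complex^'n"
 assumes U: "open U" "U \<subseteq> D" and v: "v \<in> H1 U" and Y: "\<And>m. smooth (Y m)" "(\<lambda>m. H1_norm U (\<lambda>x. Y m x - v x)) \<longlonglongrightarrow> 0"
 shows "(\<lambda>x. \<beta> x $ j *\<^sub>R v x) \<in> H1 U" and "convect U \<beta> v \<in> L2 U" and "weak_div U (\<lambda>j x. \<beta> x $ j *\<^sub>R v x) (convect U \<beta> v)"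
proof -
 have U': "U \<in> sets lebesgue" "D \<in> sets lebesgue" "bounded U" using U open_domain bounded_domain bounded_subset by auto
 note v2 = H1_L2[OF v] and w2 = H1_weak_partial_L2[OF U(1) v]
 define g where "g i j = (SOME g. ess_bounded D g \<and> is_weak_partial D i (\<lambda>x. \<beta> x $ j) g
   \<and> (AE x in leb D. g x = weak_partial D i \<beta> x $ j))" for i j
 have g: "ess_bounded D (g i j)" "is_weak_partial D i (\<lambda>x. \<beta> x $ j) (g i j)"
  "AE x in leb D. g i j x = weak_partial D i \<beta> x $ j" for i j using someI_ex[OF beta_partial[of i j]] unfolding g_def by blast+
 have eb: "ess_bounded U b" if "ess_bounded D b" for b :: "real^'n => real"
  using that lebesgue_on_subset_measurable[OF _ U(2)] AE_lebesgue_on_subset[OF _ U(2) U'(2,1)] unfolding ess_bounded_def by blast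
 note prod = weak_product_rule[OF U(1) U'(3) v Y eb[OF ess_bounded_beta] eb[OF g(1)] is_weak_partial_subset[OF open_domain U g(2)]]
 have L: "(\<lambda>x. \<beta> x $ j *\<^sub>R v x) \<in> L2 U" "(\<lambda>x. \<beta> x $ j *\<^sub>R weak_partial U i v x) \<in> L2 U" "(\<lambda>x. g i j x *\<^sub>R v x) \<in> L2 U" for i j
  by (intro ess_bounded_mult_L2 eb ess_bounded_beta g v2 w2)+
 show bv: "(\<lambda>x. \<beta> x $ j *\<^sub>R v x) \<in> H1 U" for j by (rule H1I[OF L(1) _ prod]) (use L(2,3) in \<open>auto simp: L2_def\<close>)
 show c2: "convect U \<beta> v \<in> L2 U"
  using Lebesgue2_sum[of UNIV "\<lambda>j x. \<beta> x $ j *\<^sub>R weak_partial U j v x"] L(2) by (simp add: L2_def convect_def[abs_def])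
 show "weak_div U (\<lambda>j x. \<beta> x $ j *\<^sub>R v x) (convect U \<beta> v)"
 proof (rule weak_div_cong_AE[OF U(1) weak_div_of_partials[OF prod U(1)]])
  have "AE x in leb D. \<forall>i. g i i x = weak_partial D i \<beta> x $ i" using g(3) by (simp add: AE_all_countable)
  then have "AE x in leb D. (\<Sum>i\<in>UNIV. g i i x) = 0"
   using \<beta>(2) unfolding divergence_free_def by eventually_elim (simp add: divergence_def)
  then have "AE x in leb U. (\<Sum>i\<in>UNIV. g i i x) = 0" by (rule AE_lebesgue_on_subset[OF _ U(2) U'(2,1)])
  then show "AE x in leb U. (\<Sum>j\<in>UNIV. \<beta> x $ j *\<^sub>R weak_partial U j v x + g j j x *\<^sub>R v x) = convect U \<beta> v x"
   by eventually_elim (simp add: sum.distrib scaleR_sum_left[symmetric] convect_def)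
 qed (use L(1) c2 in \<open>auto simp: L2_def Lebesgue2_measurable\<close>)
qed

lemma u_H1: "u \<in> H1 D" and u_H1_0: "u \<in> H1_0 D" and p_L2: "p \<in> L2 D"
 using u_plus Hs_L2[OF p_Hs] adjoint by (simp_all add: H1_plus_def adjoint_solution_def)

text \<open>The domain need not be convex, so the smooth approximations are the test functions from
  the definition of \<open>H1_0\<close> instead of mollifications.\<close>

lemma convect_u: "convect D \<beta> u \<in> L2 D" "weak_div D (\<lambda>j x. \<beta> x $ j *\<^sub>R u x) (convect D \<beta> u)"
proof -
 obtain Y where Y: "\<And>m. Y m \<in> test_functions D" "(\<lambda>m. H1_norm D (\<lambda>x. Y m x - u x)) \<longlonglongrightarrow> 0" using u_H1_0 unfolding H1_0_def by blast
 show "convect D \<beta> u \<in> L2 D" "weak_div D (\<lambda>j x. \<beta> x $ j *\<^sub>R u x) (convect D \<beta> u)"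
  using convection(2,3)[OF open_domain subset_refl u_H1 test_smooth[OF Y(1)] Y(2)] by auto
qed

lemma stress_L2:
 assumes "open U" "U \<subseteq> D" shows "stress \<mu> U u p j \<in> L2 U"
proof -
 have "u \<in> H1 U" "p \<in> L2 U" using H1_subset[OF open_domain assms u_H1] L2_restrict[OF p_L2 assms(2)] assms(1) open_domain by auto
 then show ?thesis using H1_weak_partial_L2[OF assms(1)] unfolding L2_def stress_def[abs_def] by (intro Lebesgue2_diff Lebesgue2_scaleR Lebesgue2_bounded_linear[OF bounded_linear_axis])
qed

lemma stress_split:
 assumes U: "open U" "U \<subseteq> D" and v: "v \<in> H1 U"
 shows "(\<Sum>j\<in>UNIV. LINT x|leb U. vdot (weak_partial U j v x) (vcnj (stress \<mu> U u p j x)))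
  = (LINT x|leb U. of_real \<mu> * tdot (grad U v x) (tcnj (grad U u x))) - (LINT x|leb U. cnj (p x) * divergence U v x)"
proof -
 let ?M = "leb U"
 note w2 = H1_weak_partial_L2[OF U(1) v, unfolded L2_def] and s2 = stress_L2[OF U, unfolded L2_def]
 note si = L2_pairing_integrable[OF bounded_bilinear_vdot_cnj s2 w2]
 have "p \<in> Lebesgue2 ?M" using L2_restrict[OF p_L2 U(2)] U(1) open_domain by (simp add: L2_def)
 moreover have "divergence U v \<in> Lebesgue2 ?M"
  unfolding divergence_def[abs_def] by (intro Lebesgue2_sum Lebesgue2_bounded_linear[OF bounded_linear_vec_nth w2])
 ultimately have d: "integrable ?M (\<lambda>x. cnj (p x) * divergence U v x)" by (rule L2_pairing_integrable[OF bounded_bilinear_mult_cnj])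
 have "(LINT x|?M. of_real \<mu> * tdot (grad U v x) (tcnj (grad U u x)))
   = (LINT x|?M. (\<Sum>j\<in>UNIV. vdot (weak_partial U j v x) (vcnj (stress \<mu> U u p j x))) + cnj (p x) * divergence U v x)"
  by (simp add: vdot_stress)
 also have "\<dots> = (\<Sum>j\<in>UNIV. LINT x|?M. vdot (weak_partial U j v x) (vcnj (stress \<mu> U u p j x))) + (LINT x|?M. cnj (p x) * divergence U v x)"
  using d si by simp
 finally show ?thesis by simp
qed

text \<open>The adjoint equation is taken at pressure 0 and a smooth velocity and rewritten with the
  stress, the classical derivatives replacing the chosen weak ones.\<close>

lemma adjoint_test:
 assumes A: "A \<in> test_functions D" shows "(\<Sum>j\<in>UNIV. LINT x|leb D. vdot (partial j A x) (vcnj (stress \<mu> D u p j x)))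
  + (\<Sum>j\<in>UNIV. LINT x|leb D. vdot (partial j A x) (vcnj (\<beta> x $ j *\<^sub>R u x))) = L2_inner D A f"
proof -
 let ?M = "leb D"
 note H0 = test_functions_H1_0[OF A open_domain bounded_domain]
 then have H: "A \<in> H1 D" by (simp add: H1_0_def)
 have z: "(\<lambda>x. 0) \<in> L2_zero_mean D" by (simp add: L2_zero_mean_def L2_def)
 note w2 = H1_weak_partial_L2[OF open_domain H, unfolded L2_def]
 note wp = weak_partial_AE[OF open_domain smooth_is_weak_partial[OF test_smooth[OF A] open_domain]]
 have p2: "partial j A \<in> Lebesgue2 ?M" for j
  using bounded_smooth_L2[OF smooth_continuous[OF smooth_partial[OF test_smooth[OF A]]] bounded_domain] open_domain by (simp add: L2_def)
 have u2: "\<And>j. (\<lambda>x. \<beta> x $ j *\<^sub>R u x) \<in> Lebesgue2 ?M"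
  using ess_bounded_mult_L2[OF ess_bounded_beta H1_L2[OF u_H1]] by (simp add: L2_def)
 note s2 = stress_L2[OF open_domain subset_refl, unfolded L2_def]
 note pair = L2_pairing_integrable[OF bounded_bilinear_vdot_cnj]
 have cong: "(LINT x|?M. vdot (weak_partial D j A x) (vcnj (a x))) = (LINT x|?M. vdot (partial j A x) (vcnj (a x)))"
  if a: "a \<in> Lebesgue2 ?M" for a j
  by (rule integral_cong_AE[OF borel_measurable_integrable[OF pair[OF a w2]] borel_measurable_integrable[OF pair[OF a p2]]])
   (use wp[of j] in eventually_elim, simp)
 have conv: "L2_inner D (convect D \<beta> A) u = (\<Sum>j\<in>UNIV. LINT x|?M. vdot (weak_partial D j A x) (vcnj (\<beta> x $ j *\<^sub>R u x)))"
 proof -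
  have "vdot (convect D \<beta> A x) (vcnj (u x)) = (\<Sum>j\<in>UNIV. vdot (weak_partial D j A x) (vcnj (\<beta> x $ j *\<^sub>R u x)))" for x
   unfolding convect_def vdot_def vcnj_def by (subst sum.swap) (simp add: sum_distrib_left mult_ac)
  then show ?thesis unfolding L2_inner_def by (simp add: pair[OF u2 w2])
 qed
 have "form_AB D \<mu> \<beta> (A, \<lambda>x. 0) (u, p) = L2_inner D A f" using adjoint H0 z unfolding adjoint_solution_def by blast
 moreover have "cnj (LINT x|?M. p x * cnj (divergence D A x)) = (LINT x|?M. cnj (p x) * divergence D A x)"
  using Bochner_Integration.integral_cnj[of ?M "\<lambda>x. p x * cnj (divergence D A x)"] by simp
 ultimately show ?thesis
  using stress_split[OF open_domain subset_refl H] by (simp add: form_AB_def form_A_def form_B_def conv cong[OF s2] cong[OF u2] diff_add_eq)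
qed

text \<open>Tests of the form \<open>Y\<close> times a unit vector extract one component of the
  equation, conjugated because the solution stands in the conjugated slot. The convective term
  carries the derivative of the test function and is moved onto \<open>u\<close> by
  \<open>convect_u\<close>.\<close>

lemma weak_div_stress: "weak_div D (stress \<mu> D u p) (\<lambda>x. - (f x + convect D \<beta> u x))"
proof -
 let ?M = "leb D"
 have Os: "D \<in> sets lebesgue" using open_domain by simp
 note s2 = stress_L2[OF open_domain subset_refl] and c2 = convect_u(1)
 note u2 = ess_bounded_mult_L2[OF ess_bounded_beta H1_L2[OF u_H1]]
 have "(\<Sum>j\<in>UNIV. LINT x|?M. partial j Y x *\<^sub>R stress \<mu> D u p j x) = (LINT x|?M. Y x *\<^sub>R (f x + convect D \<beta> u x))"
  if Y: "Y \<in> test_functions D" for Y :: "real^'n => real"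
 proof -
  note int = test_mult_integrable[OF open_domain locally_integrable_L2[OF _ Os]]
  note pY = test_functions_partial[OF Y]
  have comp: "(LINT x|?M. vdot (axis i (of_real (W x))) (vcnj (a x))) = cnj ((LINT x|?M. W x *\<^sub>R a x) $ i)"
   if W: "W \<in> test_functions D" and a: "a \<in> L2 D" for W :: "real^'n => real" and a and i :: 'n
  proof -
   have "bounded_linear (\<lambda>y::complex^'n. cnj (y $ i))"
    by (rule bounded_linear_compose[OF bounded_linear_cnj bounded_linear_vec_nth])
   from integral_bounded_linear[OF this int[OF a W]] show ?thesis
    by (simp add: vdot_axis vcnj_def scaleR_conv_of_real[where 'a=complex])
  qed
  have "(\<Sum>j\<in>UNIV. LINT x|?M. partial j Y x *\<^sub>R stress \<mu> D u p j x)
    + (\<Sum>j\<in>UNIV. LINT x|?M. partial j Y x *\<^sub>R (\<beta> x $ j *\<^sub>R u x)) = (LINT x|?M. Y x *\<^sub>R f x)" (is "?A + ?B = ?C")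
  proof (rule vec_eq_iff[THEN iffD2], rule allI)
   fix i
   define h where "h a = (axis i (of_real a) :: complex^'n)" for a :: real
   have h: "bounded_linear h"
    unfolding h_def[abs_def] by (rule bounded_linear_compose[OF bounded_linear_axis bounded_linear_of_real])
   note hc = comp[where i = i, folded h_def]
   have "cnj ((?A + ?B) $ i) = cnj (?C $ i)"
    using adjoint_test[OF test_functions_linear[OF h Y]] unfolding L2_inner_def partial_linear[OF h test_smooth[OF Y]]
    by (simp add: hc[OF pY s2] hc[OF pY u2] hc[OF Y f] del:)
   then show "(?A + ?B) $ i = ?C $ i" by (simp only: complex_cnj_cancel_iff)
  qed
  moreover have "?B = - (LINT x|?M. Y x *\<^sub>R convect D \<beta> u x)" using convect_u(2) Y by (simp only: weak_div_def)
  ultimately show ?thesis using int[OF f Y] int[OF c2 Y] by (simp add: algebra_simps)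
 qed
 moreover have "locally_integrable D (\<lambda>x. - (f x + convect D \<beta> u x))"
  using f c2 by (intro locally_integrable_L2[OF _ Os]) (auto simp: L2_def)
 ultimately show ?thesis using locally_integrable_L2[OF s2 Os] by (simp add: weak_div_def del: minus_add_distrib)
qed

end

section \<open>Integration by parts for the discrete functions on one element\<close>

locale dg_problem = adjoint_problem +
 fixes k :: nat and v :: "real^'n => complex^'n"
 assumes v: "v \<in> dg_sum_space D \<T> k"
begin

text \<open>Assembled from the separate traces of gradient and pressure, since these occur in the
  discrete forms; \<open>ltrace_stress\<close> shows that it is the trace of the stress.\<close>

definition stress_trace :: "(real^'n) set => (real^'n) set => 'n => real^'n => complex^'n" where
 "stress_trace T F j x = \<mu> *\<^sub>R (\<chi> i. face_trace T F (grad (interior T) u) x $ i $ j) - axis j (face_trace T F p x)"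

definition normal_stress :: "(real^'n) set => (real^'n) set => real^'n => complex^'n" where
 "normal_stress T F x = (\<Sum>j\<in>UNIV. outer_normal T F $ j *\<^sub>R stress_trace T F j x)"

text \<open>The convective face terms take the trace of this product as a whole, not a product of
  traces.\<close>

definition vb :: "real^'n => complex^'n^'n" where
 "vb x = tensor (v x) (cvec (\<beta> x))"

lemma normal_stress_eq:
 "normal_stress T F x = \<mu> *\<^sub>R (face_trace T F (grad (interior T) u) x *v cvec (outer_normal T F))
   - (\<chi> i. face_trace T F p x * cvec (outer_normal T F) $ i)" unfolding normal_stress_def stress_trace_def
 by (simp add: vec_eq_iff matrix_vector_mult_def cvec_def axis_def scaleR_diff_right sum_subtractf scaleR_sum_right
   scaleR_conv_of_real[where 'a=complex] mult_ac if_distrib[of "(*) _"] sum_distrib_left cong: if_cong)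

lemma vb_column: "(\<chi> i. vb x $ i $ j) = \<beta> x $ j *\<^sub>R v x"
 by (simp add: vb_def tensor_def cvec_def vec_eq_iff scaleR_conv_of_real[where 'a=complex])

context
 fixes T assumes T: "T \<in> \<T>"
begin

interpretation P: full_polytope T by (rule element[OF T])

lemma U: "open (interior T)" "interior T \<subseteq> D" "interior T \<in> sets lebesgue" using interior_element[OF T] by auto

text \<open>On one element a member of the sum space is an H1 function plus, up to a null set, a
  polynomial.\<close>

lemma v_H1: "v \<in> H1 (interior T)"
proof -
 obtain v0 w where vw: "v = (\<lambda>x. v0 x + w x)" "v0 \<in> H1_0 D" "w \<in> dg_space D \<T> k" using v unfolding dg_sum_space_def by blast
 obtain q where q: "is_polynomial k q" "AE x in leb T. w x = q x" using vw(3) T unfolding dg_space_def by blast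
 have "v0 \<in> H1 (interior T)" using H1_subset[OF open_domain U(1,2), of v0] vw(2) by (simp add: H1_0_def)
 moreover have "w \<in> borel_measurable (leb (interior T))"
  using vw(3) lebesgue_on_subset_measurable[OF Lebesgue2_measurable U(2), of w] by (simp add: dg_space_def L2_def)
 ultimately show ?thesis unfolding vw(1) by (rule H1_add_AE[OF U(1) P.bounded_interior _ smooth_polynomial[OF q(1)]])
   (rule AE_lebesgue_on_subset[OF q(2) interior_subset compact_lebesgue[OF P.compact] U(3)])
qed

lemma u_H1_element: "u \<in> H1 (interior T)" and p_Hs_element: "p \<in> Hs r (interior T)"
 and grad_u_element: "grad (interior T) u \<in> Hs r (interior T)"
 using H1_subset[OF open_domain U(1,2) u_H1] Hs_subset[OF open_domain U(1,2) p_Hs] grad_Hs[OF open_domain U(1,2) u_plus] by auto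

text \<open>Elements are convex, so mollification supplies the smooth approximations that
  \<open>convection\<close> asks for.\<close>

lemmas convection_v = convection[OF U(1,2) v_H1 P.moll_smooth[OF H1_L2[OF v_H1]] P.moll_H1_tendsto[OF v_H1]]
lemmas convection_u = convection[OF U(1,2) u_H1_element P.moll_smooth[OF H1_L2[OF u_H1_element]] P.moll_H1_tendsto[OF u_H1_element]]

lemma vb_H1: "vb \<in> Hs 1 (interior T)" by (rule Hs_columns[OF U(1)]) (use convection_v(1) in \<open>simp add: vb_column Hs_def\<close>)

lemma weak_partial_u: "AE x in leb (interior T). \<forall>j. weak_partial (interior T) j u x = weak_partial D j u x"
 using weak_partial_subset_AE[OF open_domain U(1,2) H1_weak_partial[OF u_H1]] by (simp add: AE_all_countable)

lemma source_L2: "(\<lambda>x. - (f x + convect (interior T) \<beta> u x)) \<in> L2 (interior T)"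
 using L2_restrict[OF f U(2)] U(3) open_domain convection_u(2) unfolding L2_def by (intro Lebesgue2_uminus Lebesgue2_add) auto

lemma weak_div_stress_element:
 "weak_div (interior T) (stress \<mu> (interior T) u p) (\<lambda>x. - (f x + convect (interior T) \<beta> u x))"
proof (rule weak_div_cong_AE[OF U(1) weak_div_subset[OF open_domain U(1,2) weak_div_stress]])
 note s2 = stress_L2[OF U(1,2), unfolded L2_def]
 show "AE x in leb (interior T). stress \<mu> D u p j x = stress \<mu> (interior T) u p j x" for j
  using weak_partial_u by eventually_elim (simp add: stress_def)
 show "AE x in leb (interior T). - (f x + convect D \<beta> u x) = - (f x + convect (interior T) \<beta> u x)"
  using weak_partial_u by eventually_elim (simp add: convect_def)
 show "stress \<mu> (interior T) u p j \<in> borel_measurable (leb (interior T))" for j by (rule Lebesgue2_measurable[OF s2])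
 show "(\<lambda>x. - (f x + convect (interior T) \<beta> u x)) \<in> borel_measurable (leb (interior T))"
  by (rule Lebesgue2_measurable[OF source_L2[unfolded L2_def]])
qed

context
 fixes F assumes F: "F \<in> P.facets"
begin

lemma face_traces:
 "P.ltrace F v (face_trace T F v)" "P.ltrace F u (face_trace T F u)" "P.ltrace F p (face_trace T F p)"
 "P.ltrace F vb (face_trace T F vb)" "P.ltrace F (grad (interior T) u) (face_trace T F (grad (interior T) u))"
proof -
 have H: "w \<in> Hs 1 (interior T) \<longleftrightarrow> w \<in> H1 (interior T)" for w :: "real^'n => complex^'n" by (simp add: Hs_def)
 note tr = P.is_trace_limit(1)[OF F P.face_trace_is_trace[OF F]]
 show "P.ltrace F v (face_trace T F v)" "P.ltrace F u (face_trace T F u)" by (rule tr[of 1], use v_H1 u_H1_element H in auto)+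
 show "P.ltrace F vb (face_trace T F vb)" by (rule tr[OF _ _ vb_H1]) auto
 show "P.ltrace F p (face_trace T F p)" by (rule tr[OF r p_Hs_element])
 show "P.ltrace F (grad (interior T) u) (face_trace T F (grad (interior T) u))" by (rule tr[OF r grad_u_element])
qed

lemmas face_traces_L2 = face_traces[unfolded P.ltrace_def, THEN conjunct1]

lemma ltrace_stress: "P.ltrace F (stress \<mu> (interior T) u p j) (stress_trace T F j)"
proof -
 have b: "bounded_linear (\<lambda>A::complex^'n^'n. \<mu> *\<^sub>R (\<chi> i. A $ i $ j))" "bounded_linear (\<lambda>a. - axis j a :: complex^'n)"
  by (rule bounded_linear_compose[OF bounded_linear_scaleR_right bounded_linear_column], rule bounded_linear_minus[OF bounded_linear_axis])
 have L: "grad (interior T) u \<in> L2 (interior T)" "p \<in> L2 (interior T)" using Hs_L2 grad_u_element p_Hs_element by blast+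
 have L': "(\<lambda>x. \<mu> *\<^sub>R (\<chi> i. grad (interior T) u x $ i $ j)) \<in> L2 (interior T)" "(\<lambda>x. - axis j (p x) :: complex^'n) \<in> L2 (interior T)"
  using Lebesgue2_bounded_linear[OF b(1)] Lebesgue2_bounded_linear[OF b(2)] L unfolding L2_def by blast+
 show ?thesis
  using P.ltrace_add[OF F L'(1) P.ltrace_linear[OF F L(1) b(1) face_traces(5)] L'(2) P.ltrace_linear[OF F L(2) b(2) face_traces(3)]]
  by (simp add: stress_def[abs_def] stress_trace_def[abs_def] grad_column)
qed

lemma ltrace_vb_column: "P.ltrace F (\<lambda>x. \<beta> x $ j *\<^sub>R v x) (\<lambda>x. \<chi> i. face_trace T F vb x $ i $ j)"
 using P.ltrace_linear[OF F Hs_L2[OF vb_H1] bounded_linear_column face_traces(4), of j] by (simp add: vb_column)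

lemma normal_stress_L2: "normal_stress T F \<in> Lebesgue2 (surf F)" unfolding normal_stress_def[abs_def]
 by (intro Lebesgue2_sum Lebesgue2_scaleR) (use ltrace_stress in \<open>simp add: P.ltrace_def\<close>)

end

text \<open>Two integrations by parts: the stress against \<open>v\<close>, and the products
  \<open>\<beta>_j v\<close> against \<open>u\<close>. The second one cancels the term with
  \<open>(\<beta> \<cdot> \<nabla>)u\<close> that the divergence of the stress brings in, so that
  only \<open>f\<close> and face terms remain.\<close>

lemma element_identity:
 "(LINT x|leb T. of_real \<mu> * tdot (grad (interior T) v x) (tcnj (grad (interior T) u x)))
  + (LINT x|leb T. vdot (convect (interior T) \<beta> v x) (vcnj (u x))) - (LINT x|leb T. cnj (p x) * divergence (interior T) v x)
  = (LINT x|leb (interior T). vdot (v x) (vcnj (f x)))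
  + (\<Sum>F\<in>P.facets. (LINT x|surf F. vdot (face_trace T F v x) (vcnj (normal_stress T F x)))
   + (LINT x|surf F. vdot (face_trace T F vb x *v cvec (outer_normal T F)) (vcnj (face_trace T F u x))))"
proof -
 let ?M = "leb (interior T)" and ?c = "convect (interior T) \<beta> u" and ?w = "\<lambda>j. weak_partial (interior T) j u"
 have f2: "f \<in> Lebesgue2 ?M" and c2: "?c \<in> Lebesgue2 ?M"
  using L2_restrict[OF f U(2)] U(3) open_domain convection_u(2) by (auto simp: L2_def)
 note v2 = H1_L2[OF v_H1, unfolded L2_def] and bv2 = H1_L2[OF convection_v(1), unfolded L2_def]
  and w2 = H1_weak_partial_L2[OF U(1) u_H1_element, unfolded L2_def]
 \<comment> \<open>The integrals are replaced by letters: \<open>D\<close> and \<open>S\<close> are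
   the volume terms of the stress identity, \<open>Cu\<close> and \<open>B\<close> those of the
   convective one, and the term that cancels is \<open>Cv\<close>.\<close>
 have alg: "T1 + Cu - Q = F + (S' + C')" if "D + S = S'" "Cu + B = C'" "B = Cv" "D = - F - Cv" "S = T1 - Q"
  for T1 Cu Q F S' C' D S B Cv :: complex using that by auto
 have e1: "(LINT x|?M. vdot (v x) (vcnj (- (f x + ?c x))))
   + (\<Sum>j\<in>UNIV. LINT x|?M. vdot (weak_partial (interior T) j v x) (vcnj (stress \<mu> (interior T) u p j x)))
  = (\<Sum>F\<in>P.facets. LINT x|surf F. vdot (face_trace T F v x) (vcnj (normal_stress T F x)))" unfolding normal_stress_def
  by (rule P.elementwise_ibp[OF bounded_bilinear_vdot_cnj stress_L2[OF U(1,2)] weak_div_stress_element source_L2 v_H1]) (rule ltrace_stress face_traces, assumption)+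
 have e2: "(LINT x|?M. vdot (convect (interior T) \<beta> v x) (vcnj (u x))) + (\<Sum>j\<in>UNIV. LINT x|?M. vdot (\<beta> x $ j *\<^sub>R v x) (vcnj (?w j x)))
  = (\<Sum>F\<in>P.facets. LINT x|surf F. vdot (\<Sum>j\<in>UNIV. outer_normal T F $ j *\<^sub>R (\<chi> i. face_trace T F vb x $ i $ j)) (vcnj (face_trace T F u x)))"
  by (rule P.elementwise_ibp[OF bounded_bilinear_vdot_cnj' H1_L2[OF convection_v(1)] convection_v(3,2) u_H1_element]) (rule ltrace_vb_column face_traces, assumption)+
 have col: "(\<Sum>j\<in>UNIV. outer_normal T F $ j *\<^sub>R (\<chi> i. A $ i $ j)) = A *v cvec (outer_normal T F)" for F and A :: "complex^'n^'n"
  by (simp add: vec_eq_iff matrix_vector_mult_def cvec_def scaleR_conv_of_real[where 'a=complex] mult.commute)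
 have e3: "(\<Sum>j\<in>UNIV. LINT x|?M. vdot (\<beta> x $ j *\<^sub>R v x) (vcnj (?w j x))) = (LINT x|?M. vdot (v x) (vcnj (?c x)))"
 proof -
  have "(\<Sum>j\<in>UNIV. vdot (\<beta> x $ j *\<^sub>R v x) (vcnj (?w j x))) = vdot (v x) (vcnj (?c x))" for x
   unfolding vdot_def vcnj_def convect_def by (subst sum.swap) (simp add: sum_distrib_left)
  then show ?thesis using bochner_int_sum[of UNIV ?M "\<lambda>j x. vdot (\<beta> x $ j *\<^sub>R v x) (vcnj (?w j x))"]
    L2_pairing_integrable[OF bounded_bilinear_vdot_cnj' bv2 w2] by simp
 qed
 have e4: "(LINT x|?M. vdot (v x) (vcnj (- (f x + ?c x)))) = - (LINT x|?M. vdot (v x) (vcnj (f x))) - (LINT x|?M. vdot (v x) (vcnj (?c x)))"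
 proof -
  show ?thesis using L2_pairing_integrable[OF bounded_bilinear_vdot_cnj' v2 f2] L2_pairing_integrable[OF bounded_bilinear_vdot_cnj' v2 c2] by (simp add: vdot_def vcnj_def sum_subtractf sum_negf algebra_simps)
 qed
 show ?thesis unfolding P.LINT_interior sum.distrib by (rule alg[OF e1 e2[unfolded col] e3 e4 stress_split[OF U(1,2) v_H1]])
qed

end

end

lemma integral_add_sum:
 assumes "integrable M a" "\<And>j. integrable M (b j)"
 shows "(LINT x|M. a x + (\<Sum>j\<in>I. b j x)) = (LINT x|M. a x) + (\<Sum>j\<in>I. LINT x|M. b j x)" using assms by (simp add: bochner_int_sum)

lemma L2_norm_subset:
 assumes "u \<in> L2 U" "V \<subseteq> U" "U \<in> sets lebesgue" "V \<in> sets lebesgue" shows "L2_norm (leb V) u \<le> L2_norm (leb U) u"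
proof -
 have "u \<in> Lebesgue2 (leb V)" using L2_restrict[OF assms] by (simp add: L2_def)
 moreover have "nn2 (leb V) u \<le> ennreal ((L2_norm (leb U) u)\<^sup>2)"
  unfolding nn_integral_norm2[OF assms(1)[unfolded L2_def], symmetric]
  using assms by (simp add: nn_integral_restrict_space) (intro nn_integral_mono mult_left_mono, auto simp:)
 ultimately show ?thesis by (intro L2_norm_le_nn Lebesgue2_measurable) simp_all
qed

lemma H1_norm_subset:
 assumes U: "open U" "open V" "V \<subseteq> U" and u: "u \<in> H1 U" shows "H1_norm V u \<le> H1_norm U u"
proof -
 have s: "U \<in> sets lebesgue" "V \<in> sets lebesgue" using U by auto
 have "L2_norm (leb V) (weak_partial V i u) \<le> L2_norm (leb U) (weak_partial U i u)" for i
 proof -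
  have "L2_norm (leb V) (weak_partial V i u) = L2_norm (leb V) (weak_partial U i u)"
   using H1_weak_partial_L2[OF U(2) H1_subset[OF U u]] L2_restrict[OF H1_weak_partial_L2[OF U(1) u] U(3) s]
   by (intro L2_norm_cong_AE weak_partial_subset_AE[OF U H1_weak_partial[OF u]]) (auto simp: L2_def Lebesgue2_measurable)
  then show ?thesis using L2_norm_subset[OF H1_weak_partial_L2[OF U(1) u] U(3) s] by simp
 qed
 then show ?thesis
  unfolding H1_norm_def by (intro real_sqrt_le_mono add_mono sum_mono power_mono L2_norm_subset[OF H1_L2[OF u] U(3) s]) simp_all
qed

lemma (in full_polytope) ltrace_sum:
 assumes F: "F \<in> facets" and W: "\<And>j. W j \<in> L2 (interior T)" "\<And>j. ltrace F (W j) (w j)" and I: "finite I"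
 shows "ltrace F (\<lambda>x. \<Sum>j\<in>I. c j *\<^sub>R W j x) (\<lambda>x. \<Sum>j\<in>I. c j *\<^sub>R w j x)" using I
proof (induction I rule: finite_induct)
 case (insert i I)
 have L: "(\<lambda>x. c j *\<^sub>R W j x) \<in> Lebesgue2 (leb (interior T))" for j using W(1) by (auto simp: L2_def)
 show ?case using ltrace_add[OF F _ ltrace_linear[OF F W(1) bounded_linear_scaleR_right W(2)] _ insert.IH, of "c i" i]
   L Lebesgue2_sum[of I "\<lambda>j x. c j *\<^sub>R W j x", OF L] insert(1,2) by (simp add: L2_def)
qed (simp add: ltrace_smooth[OF F])

section \<open>Continuity of the velocity and of the normal stress across faces\<close>

context dg_problem
begin

text \<open>One sequence of test functions on the whole domain converges to the traces of
  \<open>u\<close> on every facet and from every side. Traces from two sides therefore agree, and on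
  the boundary, where test functions vanish, they are 0.\<close>

lemma u_trace_limit:
 obtains Y :: "nat => real^'n => complex^'n" where "\<And>m. Y m \<in> test_functions D"
  "\<And>T F. T \<in> \<T> ==> F \<in> full_polytope.facets T ==> L2_conv (surf F) Y (face_trace T F u)"
proof -
 obtain Y where Y: "\<And>m. Y m \<in> test_functions D" "(\<lambda>m. H1_norm D (\<lambda>x. Y m x - u x)) \<longlonglongrightarrow> 0" using u_H1_0 unfolding H1_0_def by blast
 have "L2_conv (surf F) Y (face_trace T F u)"
  if T: "T \<in> \<T>" and F: "F \<in> full_polytope.facets T" for T F
 proof -
  interpret P: full_polytope T by (rule element[OF T])
  have u1: "u \<in> Hs 1 (interior T)" using u_H1_element[OF T] by (simp add: Hs_def)
  note le = H1_norm_subset[OF open_domain U(1,2)[OF T] H1_diff[OF open_domain smooth_H1[OF test_smooth[OF Y(1)] bounded_domain open_domain] u_H1]]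
  have "(\<lambda>m. H1_norm (interior T) (\<lambda>x. Y m x - u x)) \<longlonglongrightarrow> 0"
   by (rule tendsto_zero_le[OF _ le Y(2)]) (simp add: H1_norm_def sum_nonneg)
  then have "(\<lambda>m. Hs_norm 1 (interior T) (\<lambda>x. Y m x - u x)) \<longlonglongrightarrow> 0" by (simp add: Hs_norm_def)
  then show ?thesis by (intro P.is_trace_limit(2)[OF F P.face_trace_is_trace[OF F _ _ u1] u1] test_smooth[OF Y(1)]) simp_all
 qed
 then show ?thesis using that Y(1) by blast
qed

lemma u_trace_interior:
 assumes F: "F \<in> interior_faces \<T>" shows "AE x in surf F. face_trace (elem_plus \<T> F) F u x = face_trace (elem_minus \<T> F) F u x"
proof -
 note e = interior_face[OF F]
 obtain Y where Y: "\<And>m. Y m \<in> test_functions D"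
  "\<And>T F. T \<in> \<T> ==> F \<in> full_polytope.facets T ==> L2_conv (surf F) Y (face_trace T F u)" using u_trace_limit by blast
 have FP: "F \<in> full_polytope.facets (elem_plus \<T> F)" "F \<in> full_polytope.facets (elem_minus \<T> F)"
  using e full_polytope.facets_def[OF element] by auto
 note YL = full_polytope.facet_surface(5)[OF element[OF e(1)] FP(1) test_smooth[OF Y(1)]]
 show ?thesis
  by (rule L2_limit_unique[OF YL YL face_traces_L2(2)[OF e(1) FP(1)] face_traces_L2(2)[OF e(3) FP(2)] Y(2)[OF e(1) FP(1)] Y(2)[OF e(3) FP(2)]])
   (simp add: L2_norm_def)
qed

lemma u_trace_boundary:
 assumes F: "F \<in> boundary_faces D \<T>" shows "AE x in surf F. face_trace (elem_plus \<T> F) F u x = 0"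
proof -
 note e = boundary_face[OF F]
 obtain Y where Y: "\<And>m. Y m \<in> test_functions D"
  "\<And>T F. T \<in> \<T> ==> F \<in> full_polytope.facets T ==> L2_conv (surf F) Y (face_trace T F u)" using u_trace_limit by blast
 have FP: "F \<in> full_polytope.facets (elem_plus \<T> F)" using e full_polytope.facets_def[OF element] by auto
 have "L2_norm (surf F) (\<lambda>x. Y m x - face_trace (elem_plus \<T> F) F u x) = L2_norm (surf F) (face_trace (elem_plus \<T> F) F u)" for m
 proof -
  have "Y m x = 0" if "x \<in> F" for x
   using F that open_domain by (intro test_outside[OF Y(1)]) (auto simp: boundary_faces_def frontier_def interior_open)
  then show ?thesis unfolding L2_norm_def by (intro arg_cong[where f = sqrt] bochner_int_cong refl)
    (simp add: full_polytope.facet_surface(4)[OF element[OF e(1)] FP])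
 qed
 then have "L2_norm (surf F) (face_trace (elem_plus \<T> F) F u) = 0" using Y(2)[OF e(1) FP] by (simp add: LIMSEQ_const_iff)
 then show ?thesis by (rule AE_zero_of_L2_norm[OF face_traces_L2(2)[OF e(1) FP]])
qed

text \<open>
 Continuity of the normal stress: test the weak divergence with smooth functions supported in the two
 adjacent elements and away from their other facets, and let these approximate the jump itself.
\<close>

lemma normal_stress_test:
 assumes F: "F \<in> interior_faces \<T>" and T: "T = elem_plus \<T> F" and T': "T' = elem_minus \<T> F" and W: "W \<in> test_functions D"
  and supp: "\<And>x. x \<notin> T \<union> T' ==> W x = 0"
  and facets: "\<And>Z F' x. Z \<in> {T, T'} ==> F' facet_of Z ==> F' \<noteq> F ==> x \<in> F' ==> W x = (0::real)"
 shows "(LINT x|surf F. W x *\<^sub>R (normal_stress T F x + normal_stress T' F x)) = 0"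
proof -
 note e = interior_face[OF F, folded T T']
 let ?G = "\<lambda>x. W x *\<^sub>R (- (f x + convect D \<beta> u x)) + (\<Sum>j\<in>UNIV. partial j W x *\<^sub>R stress \<mu> D u p j x)"
 note bb = bounded_bilinear.flip[OF bounded_bilinear_scaleR]
 have li: "locally_integrable D (\<lambda>x. - (f x + convect D \<beta> u x))" "locally_integrable D (stress \<mu> D u p j)" for j
  using weak_div_stress by (auto simp: weak_div_def)
 note int = test_mult_integrable[OF open_domain li(1) W] test_mult_integrable[OF open_domain li(2) test_functions_partial[OF W]]
 have Gi: "integrable (leb D) ?G" by (intro bochner_add bochner_sum int)
 have "(LINT x|leb D. ?G x) = (LINT x|leb D. W x *\<^sub>R (- (f x + convect D \<beta> u x)))
   + (\<Sum>j\<in>UNIV. LINT x|leb D. partial j W x *\<^sub>R stress \<mu> D u p j x)" by (rule integral_add_sum[OF int])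
 also have "\<dots> = 0" using weak_div_stress W by (simp add: weak_div_def del:)
 finally have "0 = (\<Sum>Z\<in>\<T>. LINT x|leb (interior Z). ?G x)" by (simp only: sum_integral_elements[OF Gi])
 also have "\<dots> = (\<Sum>Z\<in>{T, T'}. LINT x|leb (interior Z). ?G x)"
 proof (rule sum.mono_neutral_right[OF finite_mesh])
  show "{T, T'} \<subseteq> \<T>" using e by blast
  show "\<forall>Z\<in>\<T> - {T, T'}. (LINT x|leb (interior Z). ?G x) = 0"
  proof
   fix Z assume Z: "Z \<in> \<T> - {T, T'}"
   \<comment> \<open>The weight vanishes outside the two closed elements, so the open element must
     be disjoint from the closed ones; each of these is the closure of its interior.\<close>
   have "interior Z \<inter> Q = {}" if "Q \<in> \<T>" "Z \<noteq> Q" for Q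
   proof -
    have "closure (interior Q) = Q"
     using element[OF that(1)] by (metis convex_closure_interior full_polytope.convex full_polytope.interior full_polytope.compact compact_imp_closed closure_closed)
    moreover have "interior Z \<inter> interior Q = {}" using disjoint_interiors[of Z Q] Z that by blast
    ultimately show ?thesis using open_Int_closure_eq_empty[of "interior Z" "interior Q"] by simp
   qed
   then have z: "W x = 0" if "x \<in> interior Z" for x using Z e that by (intro supp) blast
   then have "?G x = 0" if "x \<in> interior Z" for x using partial_outside[of "interior Z" x W] that by simp
   then show "(LINT x|leb (interior Z). ?G x) = 0" by (intro integral_eq_zero_AE AE_I2) simp
  qed
 qed
 also have "\<dots> = (\<Sum>Z\<in>{T, T'}. LINT x|surf F. W x *\<^sub>R normal_stress Z F x)"
 proof (rule sum.cong)
  fix Z assume Z: "Z \<in> {T, T'}"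
  have ZT1: "Z \<in> \<T>" and FZ: "F facet_of Z" using Z e by auto
  interpret P: full_polytope Z by (rule element[OF ZT1])
  have FZ': "F \<in> P.facets" using FZ by (simp add: P.facets_def)
  let ?M = "leb (interior Z)"
  note U = U[OF ZT1] and s = test_smooth[OF W]
  note WH = smooth_H1[OF s P.bounded_interior U(1)]
  have "AE x in ?M. \<forall>j. weak_partial (interior Z) j W x = partial j W x"
   using weak_partial_AE[OF U(1) smooth_is_weak_partial[OF s U(1)]] by (simp add: AE_all_countable)
  with weak_partial_u[OF ZT1] have ae: "AE x in ?M. ?G x = W x *\<^sub>R (- (f x + convect (interior Z) \<beta> u x))
    + (\<Sum>j\<in>UNIV. weak_partial (interior Z) j W x *\<^sub>R stress \<mu> (interior Z) u p j x)"
   by eventually_elim (simp add: stress_def convect_def)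
  note pi = L2_pairing_integrable[OF bb source_L2[OF ZT1, unfolded L2_def] H1_L2[OF WH, unfolded L2_def]]
   L2_pairing_integrable[OF bb stress_L2[OF U(1,2), unfolded L2_def] H1_weak_partial_L2[OF U(1) WH, unfolded L2_def]]
  have "(LINT x|?M. ?G x) = (LINT x|?M. W x *\<^sub>R (- (f x + convect (interior Z) \<beta> u x)) +
    (\<Sum>j\<in>UNIV. weak_partial (interior Z) j W x *\<^sub>R stress \<mu> (interior Z) u p j x))"
   by (rule integral_cong_AE[OF lebesgue_on_subset_measurable[OF borel_measurable_integrable[OF Gi] U(2)] _ ae])
    (intro borel_measurable_integrable bochner_add bochner_sum pi)
  also have "\<dots> = (LINT x|?M. W x *\<^sub>R (- (f x + convect (interior Z) \<beta> u x)))
    + (\<Sum>j\<in>UNIV. LINT x|?M. weak_partial (interior Z) j W x *\<^sub>R stress \<mu> (interior Z) u p j x)"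
   by (rule integral_add_sum[OF pi])
  also have "\<dots> = (\<Sum>F'\<in>P.facets. LINT x|surf F'. W x *\<^sub>R normal_stress Z F' x)" unfolding normal_stress_def
   by (rule P.elementwise_ibp[OF bb stress_L2[OF U(1,2)] weak_div_stress_element[OF ZT1] source_L2[OF ZT1] WH])
    (rule ltrace_stress[OF ZT1] P.ltrace_smooth s, assumption?)+
  also have "\<dots> = (\<Sum>F'\<in>P.facets. if F' = F then LINT x|surf F. W x *\<^sub>R normal_stress Z F x else 0)"
  proof (intro sum.cong refl)
   fix F' assume F': "F' \<in> P.facets"
   show "(LINT x|surf F'. W x *\<^sub>R normal_stress Z F' x) = (if F' = F then LINT x|surf F. W x *\<^sub>R normal_stress Z F x else 0)"
   proof (cases "F' = F")
    case False
    have "W x = 0" if "x \<in> F'" for x by (rule facets[OF Z P.facet_surface(1)[OF F'] False that])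
    then have "(LINT x|surf F'. W x *\<^sub>R normal_stress Z F' x) = 0"
     by (intro integral_eq_zero_AE AE_I2) (simp add: P.facet_surface(4)[OF F'])
    then show ?thesis using False by simp
   qed simp
  qed
  finally show "(LINT x|?M. ?G x) = (LINT x|surf F. W x *\<^sub>R normal_stress Z F x)" using FZ' by simp
 qed simp
 also have "\<dots> = (LINT x|surf F. W x *\<^sub>R (normal_stress T F x + normal_stress T' F x))"
 proof -
  have FP: "F \<in> full_polytope.facets T" "F \<in> full_polytope.facets T'" using e full_polytope.facets_def[OF element] by auto
  note i = L2_pairing_integrable[OF bb normal_stress_L2 full_polytope.facet_surface(5)[OF element[OF e(1)] FP(1) test_smooth[OF W]]]
  show ?thesis using i[OF e(1) FP(1)] i[OF e(3) FP(2)] e(5) by (simp add: scaleR_add_right)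
 qed
 finally show ?thesis by simp
qed

lemma normal_stress_jump:
 assumes F: "F \<in> interior_faces \<T>"
 shows "AE x in surf F. normal_stress (elem_minus \<T> F) F x = - normal_stress (elem_plus \<T> F) F x"
proof -
 define T where "T = elem_plus \<T> F"
 define T' where "T' = elem_minus \<T> F"
 note e = interior_face[OF F, folded T_def T'_def]
 interpret P: full_polytope T by (rule element[OF e(1)])
 interpret Q: full_polytope T' by (rule element[OF e(3)])
 let ?S = "surf F"
 have FP: "F \<in> P.facets" "F \<in> Q.facets" using e by (auto simp: P.facets_def Q.facets_def)
 define J where "J x = normal_stress T F x + normal_stress T' F x" for x
 have J2: "J \<in> Lebesgue2 ?S" unfolding J_def[abs_def] by (intro Lebesgue2_add normal_stress_L2 e FP)
 \<comment> \<open>The jump is only an L2 function on the face. Smoothings of the stresses of both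
   sides, added up, are smooth functions that converge to it there.\<close>
 obtain G :: "nat => real^'n => complex^'n" where G: "\<And>m. smooth (G m)" "L2_conv ?S G J"
 proof -
  let ?N = "\<lambda>Z x. \<Sum>j\<in>UNIV. outer_normal Z F $ j *\<^sub>R stress \<mu> (interior Z) u p j x"
  have N2: "?N Z \<in> L2 (interior Z)" if "Z \<in> \<T>" for Z
   using stress_L2[OF U(1,2)[OF that]] unfolding L2_def by (intro Lebesgue2_sum Lebesgue2_scaleR)
  have tr: "P.ltrace F (?N T) (normal_stress T F)" "Q.ltrace F (?N T') (normal_stress T' F)"
   unfolding normal_stress_def[abs_def]
   by (rule P.ltrace_sum[OF FP(1) stress_L2[OF U(1,2)[OF e(1)]] ltrace_stress[OF e(1) FP(1)]] Q.ltrace_sum[OF FP(2) stress_L2[OF U(1,2)[OF e(3)]] ltrace_stress[OF e(3) FP(2)]], simp)+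
  let ?a = "\<lambda>m. P.smoothing m (?N T)" and ?b = "\<lambda>m. Q.smoothing m (?N T')"
  have sm: "smooth (?a m)" "smooth (?b m)" for m by (intro P.moll_smooth Q.moll_smooth N2 e)+
  have le: "L2_norm ?S (\<lambda>x. (?a m x + ?b m x) - J x) \<le> L2_norm ?S (\<lambda>x. ?a m x - normal_stress T F x) + L2_norm ?S (\<lambda>x. ?b m x - normal_stress T' F x)" for m
   using L2_norm_triangle[OF Lebesgue2_diff[OF P.facet_surface(5)[OF FP(1) sm(1)[of m]] normal_stress_L2[OF e(1) FP(1)]]
     Lebesgue2_diff[OF P.facet_surface(5)[OF FP(1) sm(2)[of m]] normal_stress_L2[OF e(3) FP(2)]]]
   by (simp add: J_def algebra_simps)
  have "(\<lambda>m. L2_norm ?S (\<lambda>x. ?a m x - normal_stress T F x) + L2_norm ?S (\<lambda>x. ?b m x - normal_stress T' F x)) \<longlonglongrightarrow> 0 + 0"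
   using tr unfolding P.ltrace_def Q.ltrace_def by (intro tendsto_add) blast+
  then have "L2_conv ?S (\<lambda>m x. (?a m x + ?b m x)) J" by (intro tendsto_zero_le[OF L2_norm_nonneg le]) simp
  with smooth_add[OF sm] show ?thesis by (rule that)
 qed
 let ?A = "P.facets - {F}" and ?B = "Q.facets - {F}"
 \<comment> \<open>A smooth weight, positive exactly where the distance to every other facet of the
   two elements exceeds \<open>C\<close>. It thus vanishes near the other facets, while the distance
   to \<open>F\<close> is left free.\<close>
 define E where "E C x = (\<Prod>F'\<in>?A. flat_exp (P.facet_dist F' x - C)) * (\<Prod>F'\<in>?B. flat_exp (Q.facet_dist F' x - C))" for C x
 have Es: "smooth (E C)" for C unfolding E_def[abs_def]
  by (intro smooth_mult smooth_prod smooth_flat_exp smooth_diff smooth_const P.smooth_facet_dist Q.smooth_facet_dist)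
 have zero: "AE x in ?S. E C x *\<^sub>R J x = 0" if C: "0 < C" for C
 proof -
  \<comment> \<open>A compact set outside which the weight vanishes: it is bounded because it lies
    in the two elements, and contained in the domain by \<open>two_sided\<close>.\<close>
  let ?K = "(\<Inter>F'\<in>?A. {x. C \<le> P.facet_dist F' x}) \<inter> (\<Inter>F'\<in>?B. {x. C \<le> Q.facet_dist F' x})"
  have KP: "0 < P.facet_dist F' x" if "x \<in> ?K" "F' facet_of T" "F' \<noteq> F" for x F'
   by (rule less_le_trans[OF C]) (use that in \<open>simp add: P.facets_def\<close>)
  have KQ: "0 < Q.facet_dist F' x" if "x \<in> ?K" "F' facet_of T'" "F' \<noteq> F" for x F'
   by (rule less_le_trans[OF C]) (use that in \<open>simp add: Q.facets_def\<close>)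
  have KU: "?K \<subseteq> T \<union> T'"
   by (rule subsetI, rule two_sided(1)[OF e(1,3,5,2,4)]) (rule less_imp_le[OF KP] less_imp_le[OF KQ], assumption+)+
  have KD: "?K \<subseteq> D" by (rule subsetI, rule two_sided(2)[OF e(1,3,5,2,4)]) (rule KP KQ, assumption+)+
  have "closed ?K"
   by (intro closed_Int closed_INT ballI closed_Collect_le continuous_on_const smooth_continuous P.smooth_facet_dist Q.smooth_facet_dist)
  moreover have "bounded ?K" using P.compact Q.compact by (intro bounded_subset[OF _ KU]) (simp add: compact_imp_bounded)
  ultimately have Kc: "compact ?K" by (simp add: compact_eq_bounded_closed)
  have E0: "E C x = 0" if nK: "x \<notin> ?K" for x
  proof -
   obtain F' where "F' \<in> ?A \<and> P.facet_dist F' x - C \<le> 0 \<or> F' \<in> ?B \<and> Q.facet_dist F' x - C \<le> 0"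
    using nK by (auto simp: not_le dest: less_imp_le)
   then have "(\<Prod>F'\<in>?A. flat_exp (P.facet_dist F' x - C)) = 0 \<or> (\<Prod>F'\<in>?B. flat_exp (Q.facet_dist F' x - C)) = 0"
   proof
    assume "F' \<in> ?A \<and> P.facet_dist F' x - C \<le> 0"
    then show ?thesis by (intro disjI1 prod_zero finite_Diff P.finite_facets bexI[of _ F'] flat_exp_eq_0) blast+
   next
    assume "F' \<in> ?B \<and> Q.facet_dist F' x - C \<le> 0"
    then show ?thesis by (intro disjI2 prod_zero finite_Diff Q.finite_facets bexI[of _ F'] flat_exp_eq_0) blast+
   qed
   then show ?thesis unfolding E_def by (rule disjE) simp_all
  qed
  have A: "(LINT x|?S. (Y x * E C x) *\<^sub>R J x) = 0" if Y: "smooth Y" for Y unfolding J_def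
  proof (rule normal_stress_test[OF F T_def T'_def])
   show "(\<lambda>x. Y x * E C x) \<in> test_functions D" by (rule test_functionsI[OF smooth_mult[OF Y Es] Kc KD]) (simp add: E0)
   show "Y x * E C x = 0" if "x \<notin> T \<union> T'" for x by (subst E0) (use KU that in \<open>blast, simp\<close>)
   show "Y x * E C x = 0" if Z: "Z \<in> {T, T'}" "F' facet_of Z" "F' \<noteq> F" "x \<in> F'" for Z F' x
   proof -
    have "x \<notin> ?K"
    proof
     assume K: "x \<in> ?K"
     show False
     proof (cases "Z = T")
      case True
      then show False using KP[OF K _ Z(3)] P.facet_iff[of F' x] Z(2,4) by simp
     next
      case False
      then show False using KQ[OF K _ Z(3)] Q.facet_iff[of F' x] Z by simp
     qed
    qed
    then show ?thesis by (simp add: E0)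
   qed
  qed
  have E1: "0 \<le> E C x" "E C x \<le> 1" for x
   unfolding E_def by (auto intro!: mult_nonneg_nonneg mult_le_one prod_nonneg prod_le_1 flat_exp_le_1)
  have EJ: "(\<lambda>x. E C x *\<^sub>R J x) \<in> Lebesgue2 ?S"
  proof (rule Lebesgue2_dominated[OF J2, of _ 1])
   show "(\<lambda>x. E C x *\<^sub>R J x) \<in> borel_measurable ?S"
    using Lebesgue2_measurable[OF P.facet_surface(5)[OF FP(1) Es]] Lebesgue2_measurable[OF J2] by (rule borel_measurable_scaleR)
   show "AE x in ?S. norm (E C x *\<^sub>R J x) \<le> 1 * norm (J x)" using E1 by (intro AE_I2) (simp add: mult_left_le_one_le)
  qed
  \<comment> \<open>The scalar tests given by the coordinates of \<open>G m\<close> are combined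
    over the basis into an inner product with the weighted jump.\<close>
  have "(LINT x|?S. G m x \<bullet> (E C x *\<^sub>R J x)) = 0" for m
  proof -
   note s = smooth_linear[OF bounded_linear_inner_left G(1)]
   note i = L2_pairing_integrable[OF bounded_bilinear_scaleR P.facet_surface(5)[OF FP(1) smooth_mult[OF s Es]] J2]
   have "(LINT x|?S. G m x \<bullet> (E C x *\<^sub>R J x)) = (LINT x|?S. (\<Sum>b\<in>Basis. (((G m x \<bullet> b) * E C x) *\<^sub>R J x) \<bullet> b))"
    by (subst euclidean_inner) (simp add: mult_ac)
   also have "\<dots> = (\<Sum>b\<in>Basis. (LINT x|?S. ((G m x \<bullet> b) * E C x) *\<^sub>R J x) \<bullet> b)" by (rule trans[OF bochner_int_sum])
     (rule integrable_inner_left, rule i, rule sum.cong, rule refl, rule integral_inner_left, rule i)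
   finally show ?thesis by (simp add: A[OF s])
  qed
  moreover have "(\<lambda>m. LINT x|?S. G m x \<bullet> (E C x *\<^sub>R J x)) \<longlonglongrightarrow> (LINT x|?S. J x \<bullet> (E C x *\<^sub>R J x))"
   by (rule L2_pairing_tendsto[OF bounded_bilinear_inner J2 EJ P.facet_surface(5)[OF FP(1) G(1)] EJ G(2)]) (simp add: L2_norm_def)
  ultimately have z: "(LINT x|?S. J x \<bullet> (E C x *\<^sub>R J x)) = 0" by (simp add: LIMSEQ_const_iff)
  have "AE x in ?S. J x \<bullet> (E C x *\<^sub>R J x) = 0"
   using z integral_nonneg_eq_0_iff_AE[OF L2_pairing_integrable[OF bounded_bilinear_inner J2 EJ]] E1(1) by simp
  then show ?thesis by auto
 qed
 \<comment> \<open>The thresholds \<open>C = 1 / real (Suc m)\<close> exhaust the face up to its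
   intersections with other facets, which surface measure does not see.\<close>
 have "AE x in ?S. \<forall>m::nat. E (1 / real (Suc m)) x *\<^sub>R J x = 0" unfolding AE_all_countable by (intro allI zero) simp
 moreover have "AE x in ?S. \<forall>F'\<in>?A. 0 < P.facet_dist F' x"
  using P.AE_surface_facet_dist e(2) by (intro AE_finite_allI finite_Diff P.finite_facets) (auto simp: P.facets_def)
 moreover have "AE x in ?S. \<forall>F'\<in>?B. 0 < Q.facet_dist F' x"
  using Q.AE_surface_facet_dist e(4) by (intro AE_finite_allI finite_Diff Q.finite_facets) (auto simp: Q.facets_def)
 ultimately show ?thesis
 proof eventually_elim
  case (elim x)
  have ev: "\<forall>\<^sub>F m in sequentially. 1 / real (Suc m) < d" if "0 < d" for d :: real
   using order_tendstoD(2)[OF LIMSEQ_inverse_real_of_nat that] by (simp add: inverse_eq_divide)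
  have "\<forall>\<^sub>F m in sequentially. (\<forall>F'\<in>?A. 1 / real (Suc m) < P.facet_dist F' x) \<and> (\<forall>F'\<in>?B. 1 / real (Suc m) < Q.facet_dist F' x)"
   using elim ev by (intro eventually_conj eventually_ball_finite) simp_all
  then obtain m where m: "\<forall>F'\<in>?A. 1 / real (Suc m) < P.facet_dist F' x" "\<forall>F'\<in>?B. 1 / real (Suc m) < Q.facet_dist F' x"
   by (auto dest: eventually_happens)
  have "0 < E (1 / real (Suc m)) x" unfolding E_def using m by (intro mult_pos_pos prod_pos) (simp_all add: del:)
  moreover have "E (1 / real (Suc m)) x *\<^sub>R J x = 0" using elim by blast
  ultimately have "J x = 0" by (metis less_irrefl scaleR_eq_0_iff)
  then show ?case by (simp add: J_def T_def T'_def eq_neg_iff_add_eq_0 add.commute)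
 qed
qed

end

section \<open>Face terms and the consistency identity\<close>

lemma bounded_linear_tensor: "bounded_linear (\<lambda>a. tensor a w)" and bounded_linear_vdot: "bounded_linear (\<lambda>a. vdot a w)"
 and bounded_linear_mult_vec: "bounded_linear (\<lambda>A::complex^'n^'n. A *v w)" unfolding linear_conv_bounded_linear[symmetric]
 by (rule linearI; simp add: tensor_def vdot_def matrix_vector_mult_def vec_eq_iff sum.distrib scaleR_sum_right algebra_simps)+

lemma cvec_minus: "cvec (- n) = - cvec n" by (simp add: cvec_def vec_eq_iff)

lemma tensor_minus: "tensor a (- w) = - tensor a w" and vdot_minus: "vdot a (- w) = - vdot a w"
 by (simp_all add: tensor_def vdot_def vec_eq_iff sum_negf)

lemma product_zero [simp]: "tensor 0 w = 0" "vdot 0 w = 0" "vdot w (vcnj 0) = 0" "tdot 0 T = 0" "tdot S (tcnj 0) = 0" "tdot S 0 = 0"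
 by (simp_all add: tensor_def vdot_def tdot_def tcnj_def vcnj_def vec_eq_iff)

text \<open>The contribution of a one-sided gradient \<open>G\<close> and pressure \<open>q\<close>
  paired with a value \<open>a\<close> on a face of normal \<open>N\<close>. By
  \<open>face_pairing_stress\<close> it depends on \<open>G\<close> and \<open>q\<close> only
  through the normal stress.\<close>

definition face_pairing :: "real => complex^'n => complex^'n^'n => complex => complex^'n => complex" where
 "face_pairing \<mu> N G q a = of_real \<mu> * tdot (tcnj G) (tensor a N) - cnj q * vdot a N"

lemma face_pairing_stress:
 "face_pairing \<mu> (cvec n) G q a = vdot a (vcnj (\<mu> *\<^sub>R (G *v cvec n) - (\<chi> i. q * cvec n $ i)))" unfolding face_pairing_def
 by (simp add: vdot_def tdot_def vcnj_def tcnj_def tensor_def matrix_vector_mult_def cvec_def scaleR_conv_of_real[where 'a=complex]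
   sum_distrib_left sum_distrib_right sum_subtractf algebra_simps)

text \<open>Mean times jump expands into four products of one-sided quantities; the minus signs come
  from the opposite normal that multiplies \<open>b\<close>.\<close>

lemma face_pairing_mean:
 "of_real \<mu> * tdot (tcnj ((1/2) *\<^sub>R (G + G'))) (tensor a N + tensor b (- N)) - cnj ((1/2) *\<^sub>R (q + q')) * (vdot a N + vdot b (- N))
  = (face_pairing \<mu> N G q a + face_pairing \<mu> N G' q' a - face_pairing \<mu> N G q b - face_pairing \<mu> N G' q' b) / 2"
proof -
 have t: "tdot (tcnj ((1/2) *\<^sub>R (G + G'))) (tensor a N - tensor b N)
   = (tdot (tcnj G) (tensor a N) + tdot (tcnj G') (tensor a N) - tdot (tcnj G) (tensor b N) - tdot (tcnj G') (tensor b N)) / 2"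
  by (simp add: tdot_def tcnj_def sum.distrib sum_subtractf sum_divide_distrib scaleR_conv_of_real[where 'a=complex] algebra_simps diff_divide_distrib add_divide_distrib)
 show ?thesis
  unfolding tensor_minus vdot_minus add_uminus_conv_diff t face_pairing_def by (simp add: scaleR_conv_of_real[where 'a=complex] field_simps)
qed

context dg_problem
begin

text \<open>The contribution of a single facet to the right side of
  \<open>element_identity\<close>.\<close>

definition flux :: "(real^'n) set => (real^'n) set => complex" where
 "flux T F = (LINT x|surf F. vdot (face_trace T F v x) (vcnj (normal_stress T F x)))
   + (LINT x|surf F. vdot (face_trace T F vb x *v cvec (outer_normal T F)) (vcnj (face_trace T F u x)))"

definition stress_term :: "(real^'n) set => complex" where
 "stress_term F = (LINT x|surf F. of_real \<mu> * tdot (tcnj (mean \<T> F (\<lambda>T. grad (interior T) u) x)) (jump_full \<T> F (\<lambda>T. v) x))"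

definition pressure_term :: "(real^'n) set => complex" where
 "pressure_term F = (LINT x|surf F. mean \<T> F (\<lambda>T. p) x * cnj (jump_vec \<T> F (\<lambda>T. v) x))"

definition convection_term :: "(real^'n) set => complex" where
 "convection_term F = (LINT x|surf F. vdot (jump_tensor \<T> F (\<lambda>T. vb) x) (vcnj (mean \<T> F (\<lambda>T. u) x)))"

text \<open>The two terms are joined under one integral because only their combination, the normal
  stress, is continuous across a face.\<close>

lemma stress_pressure_term:
 assumes "mean \<T> F (\<lambda>T. grad (interior T) u) \<in> Lebesgue2 (surf F)" "mean \<T> F (\<lambda>T. p) \<in> Lebesgue2 (surf F)"
  "jump_full \<T> F (\<lambda>T. v) \<in> Lebesgue2 (surf F)" "jump_vec \<T> F (\<lambda>T. v) \<in> Lebesgue2 (surf F)"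
  and g: "g = (\<lambda>x. of_real \<mu> * tdot (tcnj (mean \<T> F (\<lambda>T. grad (interior T) u) x)) (jump_full \<T> F (\<lambda>T. v) x)
   - cnj (mean \<T> F (\<lambda>T. p) x) * jump_vec \<T> F (\<lambda>T. v) x)"
 shows "stress_term F - cnj (pressure_term F) = (LINT x|surf F. g x)" and "integrable (surf F) g"
proof -
 have i: "integrable (surf F) (\<lambda>x. of_real \<mu> * tdot (tcnj (mean \<T> F (\<lambda>T. grad (interior T) u) x)) (jump_full \<T> F (\<lambda>T. v) x))" using L2_pairing_integrable[OF bounded_bilinear_tdot_cnj[of \<mu>] assms(3,1)] by (simp add: tdot_def mult.commute)
 note j = L2_pairing_integrable[OF bounded_bilinear_mult_cnj assms(2,4)]
 show "stress_term F - cnj (pressure_term F) = (LINT x|surf F. g x)" using Bochner_Integration.integral_cnj[of "surf F" "\<lambda>x. mean \<T> F (\<lambda>T. p) x * cnj (jump_vec \<T> F (\<lambda>T. v) x)"] i j by (simp add: pressure_term_def stress_term_def g)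
 show "integrable (surf F) g" unfolding g by (rule Bochner_Integration.integrable_diff[OF i j])
qed

text \<open>Continuity of the normal stress makes the pairings with the two one-sided stresses
  coincide, so the four products of \<open>face_pairing_mean\<close> collapse to one for each side.
  In the convective term the mean of \<open>u\<close> equals either of its traces almost
  everywhere.\<close>

lemma flux_interior:
 assumes F: "F \<in> interior_faces \<T>"
 shows "flux (elem_plus \<T> F) F + flux (elem_minus \<T> F) F = stress_term F - cnj (pressure_term F) + convection_term F"
  and "AE x in surf F. jump_full \<T> F (\<lambda>T. u) x = 0 \<and> jump_vec \<T> F (\<lambda>T. u) x = 0"
proof -
 define T T' where T: "T = elem_plus \<T> F" and T': "T' = elem_minus \<T> F"
 define n where "n = outer_normal T F"
 note e = interior_face[OF F, folded T T']
 let ?S = "surf F"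
 have FP: "F \<in> full_polytope.facets T" "F \<in> full_polytope.facets T'" using e full_polytope.facets_def[OF element] by auto
 note L = face_traces_L2[OF e(1) FP(1)] and L' = face_traces_L2[OF e(3) FP(2)]
  and ns = normal_stress_L2[OF e(1) FP(1)] and ns' = normal_stress_L2[OF e(3) FP(2)]
 have n': "outer_normal T' F = - n" using opposite_normals[OF e(1,3,5,2,4)] by (simp add: n_def)
 have mean: "mean \<T> F Y = (\<lambda>x. (1/2) *\<^sub>R (face_trace T F (Y T) x + face_trace T' F (Y T') x))" for Y :: "(real^'n) set => real^'n => 'b::euclidean_space"
  using F by (simp add: mean_def T T' fun_eq_iff)
 have jump: "jump_wrt pr \<T> F Y = (\<lambda>x. pr (face_trace T F (Y T) x) (cvec n) + pr (face_trace T' F (Y T') x) (- cvec n))"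
  for Y :: "(real^'n) set => real^'n => 'b::euclidean_space" and pr :: "'b => complex^'n => 'c::ab_group_add"
  using F by (simp add: jump_wrt_def Let_def T T' n_def normal_plus_def cvec_minus fun_eq_iff)
 note u = u_trace_interior[OF F, folded T T']
 show "AE x in ?S. jump_full \<T> F (\<lambda>T. u) x = 0 \<and> jump_vec \<T> F (\<lambda>T. u) x = 0"
  using u by eventually_elim (simp add: jump tensor_minus vdot_minus)
 have "integrable ?S (\<lambda>x. vdot (face_trace Z F vb x *v w) (vcnj (face_trace Z' F u x)))" if "Z \<in> {T, T'}" "Z' \<in> {T, T'}" for Z Z' w
  by (rule L2_pairing_integrable[OF bounded_bilinear_vdot_cnj' Lebesgue2_bounded_linear[OF bounded_linear_mult_vec]]) (use that L L' in auto)
 note ci = this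
 have c: "convection_term F = (LINT x|?S. vdot (face_trace T F vb x *v cvec n) (vcnj (face_trace T F u x)))
   + (LINT x|?S. vdot (face_trace T' F vb x *v cvec (- n)) (vcnj (face_trace T' F u x)))"
 proof -
  have "convection_term F = (LINT x|?S. vdot (face_trace T F vb x *v cvec n) (vcnj (face_trace T F u x))
    + vdot (face_trace T' F vb x *v cvec (- n)) (vcnj (face_trace T' F u x)))" unfolding convection_term_def
  proof (rule integral_cong_AE)
   show "(\<lambda>x. vdot (jump_tensor \<T> F (\<lambda>T. vb) x) (vcnj (mean \<T> F (\<lambda>T. u) x))) \<in> borel_measurable ?S" unfolding jump mean
    by (intro borel_measurable_integrable L2_pairing_integrable[OF bounded_bilinear_vdot_cnj'] Lebesgue2_add Lebesgue2_scaleR Lebesgue2_bounded_linear[OF bounded_linear_mult_vec] L L')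
   show "AE x in ?S. vdot (jump_tensor \<T> F (\<lambda>T. vb) x) (vcnj (mean \<T> F (\<lambda>T. u) x)) = vdot (face_trace T F vb x *v cvec n) (vcnj (face_trace T F u x))
    + vdot (face_trace T' F vb x *v cvec (- n)) (vcnj (face_trace T' F u x))" using u
   proof eventually_elim
    case (elim x)
    show ?case using elim by (simp add: jump mean cvec_minus vdot_def sum.distrib algebra_simps)
   qed
  qed (intro borel_measurable_integrable bochner_add ci, simp_all)
  then show ?thesis using ci by simp
 qed
 have a: "stress_term F - cnj (pressure_term F) = (LINT x|?S. vdot (face_trace T F v x) (vcnj (normal_stress T F x)))
   + (LINT x|?S. vdot (face_trace T' F v x) (vcnj (normal_stress T' F x)))"
 proof -
  note i = L2_pairing_integrable[OF bounded_bilinear_vdot_cnj' L(1) ns] L2_pairing_integrable[OF bounded_bilinear_vdot_cnj' L'(1) ns']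
  note sp = stress_pressure_term[of F, unfolded mean jump, OF Lebesgue2_scaleR[OF Lebesgue2_add[OF L(5) L'(5)]] Lebesgue2_scaleR[OF Lebesgue2_add[OF L(3) L'(3)]]
    Lebesgue2_add[OF Lebesgue2_bounded_linear[OF bounded_linear_tensor L(1)] Lebesgue2_bounded_linear[OF bounded_linear_tensor L'(1)]]
    Lebesgue2_add[OF Lebesgue2_bounded_linear[OF bounded_linear_vdot L(1)] Lebesgue2_bounded_linear[OF bounded_linear_vdot L'(1)]] refl]
  have "stress_term F - cnj (pressure_term F)
    = (LINT x|?S. vdot (face_trace T F v x) (vcnj (normal_stress T F x)) + vdot (face_trace T' F v x) (vcnj (normal_stress T' F x)))"
   unfolding sp(1)
  proof (rule integral_cong_AE[OF borel_measurable_integrable[OF sp(2)] borel_measurable_integrable[OF bochner_add[OF i]]])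
   show "AE x in ?S. of_real \<mu> * tdot (tcnj ((1/2) *\<^sub>R (face_trace T F (grad (interior T) u) x + face_trace T' F (grad (interior T') u) x)))
     (tensor (face_trace T F v x) (cvec n) + tensor (face_trace T' F v x) (- cvec n))
     - cnj ((1/2) *\<^sub>R (face_trace T F p x + face_trace T' F p x)) * (vdot (face_trace T F v x) (cvec n) + vdot (face_trace T' F v x) (- cvec n))
    = vdot (face_trace T F v x) (vcnj (normal_stress T F x)) + vdot (face_trace T' F v x) (vcnj (normal_stress T' F x))"
    using normal_stress_jump[OF F, folded T T']
   proof eventually_elim
    case (elim x)
    have "face_pairing \<mu> (cvec n) (face_trace T F (grad (interior T) u) x) (face_trace T F p x) a = vdot a (vcnj (normal_stress T F x))" for a
     by (simp add: face_pairing_stress normal_stress_eq n_def)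
    moreover have "face_pairing \<mu> (cvec n) (face_trace T' F (grad (interior T') u) x) (face_trace T' F p x) a = vdot a (vcnj (normal_stress T F x))" for a
    proof -
     have "normal_stress T F x = \<mu> *\<^sub>R (face_trace T' F (grad (interior T') u) x *v cvec n) - (\<chi> i. face_trace T' F p x * cvec n $ i)"
      using elim unfolding normal_stress_eq[of T'] n' cvec_minus
      by (simp add: matrix_vector_mult_def vec_eq_iff sum_negf algebra_simps)
     then show ?thesis by (simp add: face_pairing_stress)
    qed
    moreover have "vdot b (vcnj (- s)) = - vdot b (vcnj s)" for b s :: "complex^'n" by (simp add: vdot_def vcnj_def sum_negf)
    ultimately show ?case unfolding face_pairing_mean elim by simp
   qed
  qed
  then show ?thesis using i by simp
 qed
 show "flux (elem_plus \<T> F) F + flux (elem_minus \<T> F) F = stress_term F - cnj (pressure_term F) + convection_term F"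
  unfolding a c by (simp add: flux_def T[symmetric] T'[symmetric] n' n_def[symmetric])
qed

text \<open>The trace of \<open>u\<close> vanishes, which leaves no convective contribution, and on
  a boundary face means and jumps reduce to one-sided values.\<close>

lemma flux_boundary:
 assumes F: "F \<in> boundary_faces D \<T>" shows "flux (elem_plus \<T> F) F = stress_term F - cnj (pressure_term F)"
  and "AE x in surf F. jump_full \<T> F (\<lambda>T. u) x = 0 \<and> jump_vec \<T> F (\<lambda>T. u) x = 0"
proof -
 define T where T: "T = elem_plus \<T> F"
 note e = boundary_face[OF F, folded T] and u = u_trace_boundary[OF F, folded T]
 let ?S = "surf F" and ?N = "cvec (outer_normal T F)"
 have FP: "F \<in> full_polytope.facets T" using e full_polytope.facets_def[OF element] by auto
 note L = face_traces_L2[OF e(1) FP]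
 have mean: "mean \<T> F Y = face_trace T F (Y T)" for Y :: "(real^'n) set => real^'n => 'b::euclidean_space"
  using e(4) by (simp add: mean_def T fun_eq_iff)
 have jump: "jump_wrt pr \<T> F Y = (\<lambda>x. pr (face_trace T F (Y T) x) ?N)" if "\<And>w. pr 0 w = 0"
  for Y :: "(real^'n) set => real^'n => 'b::euclidean_space" and pr :: "'b => complex^'n => 'c::ab_group_add"
  using e(4) that by (simp add: jump_wrt_def T normal_plus_def fun_eq_iff)
 show "AE x in ?S. jump_full \<T> F (\<lambda>T. u) x = 0 \<and> jump_vec \<T> F (\<lambda>T. u) x = 0" using u by eventually_elim (simp add: jump)
 note sp = stress_pressure_term(1)[of F, unfolded mean jump[of tensor, OF product_zero(1)] jump[of vdot, OF product_zero(2)], OF L(5,3)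
   Lebesgue2_bounded_linear[OF bounded_linear_tensor L(1)] Lebesgue2_bounded_linear[OF bounded_linear_vdot L(1)] refl]
 have "(LINT x|?S. vdot (face_trace T F vb x *v ?N) (vcnj (face_trace T F u x))) = 0"
  by (rule integral_eq_zero_AE) (use u in eventually_elim, simp)
 then show "flux (elem_plus \<T> F) F = stress_term F - cnj (pressure_term F)"
  unfolding sp by (simp add: flux_def T[symmetric] normal_stress_eq face_pairing_stress[symmetric] face_pairing_def)
qed

lemma v_L2: "v \<in> L2 D"
proof -
 obtain v0 w where "v = (\<lambda>x. v0 x + w x)" "v0 \<in> H1_0 D" "w \<in> dg_space D \<T> k" using v unfolding dg_sum_space_def by blast
 then show ?thesis using H1_L2[of v0 D] by (auto simp: H1_0_def dg_space_def L2_def)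
qed

lemma sum_identity:
 "(\<Sum>T\<in>\<T>. LINT x|leb T. of_real \<mu> * tdot (grad (interior T) v x) (tcnj (grad (interior T) u x)))
  + (\<Sum>T\<in>\<T>. LINT x|leb T. vdot (convect (interior T) \<beta> v x) (vcnj (u x)))
  - (\<Sum>T\<in>\<T>. LINT x|leb T. cnj (p x) * divergence (interior T) v x)
  = L2_inner D v f + (\<Sum>F\<in>all_faces D \<T>. stress_term F) - (\<Sum>F\<in>all_faces D \<T>. cnj (pressure_term F))
  + (\<Sum>F\<in>interior_faces \<T>. convection_term F)"
proof -
 have "(\<Sum>T\<in>\<T>. LINT x|leb (interior T). vdot (v x) (vcnj (f x))) = L2_inner D v f" unfolding L2_inner_def
  by (rule sum_integral_elements[OF L2_pairing_integrable[OF bounded_bilinear_vdot_cnj' v_L2[unfolded L2_def] f[unfolded L2_def]]])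
 moreover have "(\<Sum>T\<in>\<T>. \<Sum>F\<in>full_polytope.facets T. flux T F) = (\<Sum>F\<in>all_faces D \<T>. stress_term F)
   - (\<Sum>F\<in>all_faces D \<T>. cnj (pressure_term F)) + (\<Sum>F\<in>interior_faces \<T>. convection_term F)"
  unfolding sum_element_faces sum_all_faces by (simp add: flux_interior(1) flux_boundary(1) sum.distrib sum_subtractf del:)
 ultimately show ?thesis unfolding sum.distrib[symmetric] sum_subtractf[symmetric]
  by (subst sum.cong[OF refl element_identity]) (simp_all add: sum.distrib flux_def[symmetric] sum_subtractf del: cnj_sum)
qed

text \<open>The adjoint equation with zero velocity and pressure \<open>q\<close> annihilates the
  volume term, and the face terms vanish with the jumps of \<open>u\<close>.\<close>

lemma form_B_h_u:
 assumes q: "q \<in> L2_zero_mean D" shows "form_B_h D \<T> u q = 0"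
proof -
 have q2: "q \<in> Lebesgue2 (leb D)" using q by (simp add: L2_zero_mean_def L2_def)
 have div: "divergence D u \<in> Lebesgue2 (leb D)" unfolding divergence_def[abs_def]
  by (intro Lebesgue2_sum Lebesgue2_bounded_linear[OF bounded_linear_vec_nth H1_weak_partial_L2[OF open_domain u_H1, unfolded L2_def]])
 have bb: "bounded_bilinear (\<lambda>(a::complex) b. b * cnj a)" using bounded_bilinear_mult_cnj by (simp only: mult.commute)
 note qi = L2_pairing_integrable[OF bb div q2]
 note z = test_functions_H1_0[OF test_functions_zero open_domain bounded_domain]
 have "(\<Sum>T\<in>\<T>. LINT x|leb T. q x * cnj (divergence (interior T) u x)) = (\<Sum>T\<in>\<T>. LINT x|leb (interior T). q x * cnj (divergence D u x))"
 proof (rule sum.cong)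
  fix T assume T: "T \<in> \<T>"
  have ae: "AE x in leb (interior T). divergence (interior T) u x = divergence D u x"
   using weak_partial_u[OF T] by eventually_elim (simp add: divergence_def)
  have d: "divergence (interior T) u \<in> Lebesgue2 (leb (interior T))" unfolding divergence_def[abs_def]
   by (intro Lebesgue2_sum Lebesgue2_bounded_linear[OF bounded_linear_vec_nth H1_weak_partial_L2[OF U(1)[OF T] u_H1_element[OF T], unfolded L2_def]])
  have q3: "q \<in> Lebesgue2 (leb (interior T))"
   using L2_restrict[OF _ U(2)[OF T] _ U(3)[OF T], of q] q2 open_domain by (simp add: L2_def)
  show "(LINT x|leb T. q x * cnj (divergence (interior T) u x)) = (LINT x|leb (interior T). q x * cnj (divergence D u x))"
   unfolding full_polytope.LINT_interior[OF element[OF T]]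
   by (rule integral_cong_AE[OF borel_measurable_integrable[OF L2_pairing_integrable[OF bb d q3]]
     lebesgue_on_subset_measurable[OF borel_measurable_integrable[OF qi] U(2)[OF T]]]) (use ae in eventually_elim, simp)
 qed simp
 also have "\<dots> = (LINT x|leb D. q x * cnj (divergence D u x))" by (rule sum_integral_elements[OF qi])
 also have "\<dots> = 0"
 proof -
  have "form_AB D \<mu> \<beta> (\<lambda>x. 0, q) (u, p) = L2_inner D (\<lambda>x. 0) f" using adjoint z q unfolding adjoint_solution_def by blast
  \<comment> \<open>The weak derivatives of the zero function are chosen representatives, hence zero
    only almost everywhere.\<close>
  moreover have w0: "AE x in leb D. \<forall>j. weak_partial D j (\<lambda>x. 0 :: complex^'n) x = 0"
   unfolding AE_all_countable by (intro allI weak_partial_AE[OF open_domain is_weak_partial_zero])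
  have "(LINT x|leb D. tdot (grad D (\<lambda>x. 0) x) (tcnj (grad D u x))) = 0"
   "L2_inner D (convect D \<beta> (\<lambda>x. 0)) u = 0" "(LINT x|leb D. p x * cnj (divergence D (\<lambda>x. 0) x)) = 0" unfolding L2_inner_def
   by (rule integral_eq_zero_AE, use w0 in eventually_elim, simp add: tdot_def grad_def convect_def divergence_def)+
  ultimately show ?thesis by (simp add: form_AB_def form_A_def form_B_def L2_inner_def)
 qed
 moreover have "(LINT x|surf F. mean \<T> F (\<lambda>T. q) x * cnj (jump_vec \<T> F (\<lambda>T. u) x)) = 0" if "F \<in> all_faces D \<T>" for F
  using that flux_interior(2)[of F] flux_boundary(2)[of F] unfolding all_faces_def by (intro integral_eq_zero_AE) auto
 ultimately show ?thesis by (simp add: form_B_h_def)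
qed

text \<open>Jumps and boundary traces of \<open>u\<close> vanish almost everywhere, which removes
  the term with the mean gradient of \<open>v\<close>, the penalty and the boundary convection. This
  holds whether or not the gradient of \<open>v\<close> has a trace, because the other factor is
  0.\<close>

lemma form_A_h_u:
 "form_A_h D \<T> \<mu> \<beta> \<gamma> \<theta> v u = (\<Sum>T\<in>\<T>. LINT x|leb T. of_real \<mu> * tdot (grad (interior T) v x) (tcnj (grad (interior T) u x)))
  + (\<Sum>T\<in>\<T>. LINT x|leb T. vdot (convect (interior T) \<beta> v x) (vcnj (u x)))
  + of_real \<theta> * (\<Sum>F\<in>all_faces D \<T>. stress_term F) - (\<Sum>F\<in>interior_faces \<T>. convection_term F)"
proof -
 have j: "AE x in surf F. jump_full \<T> F (\<lambda>T. u) x = 0" if "F \<in> all_faces D \<T>" for F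
  using that flux_interior(2)[of F] flux_boundary(2)[of F] unfolding all_faces_def by auto
 have z: "(LINT x|surf F. tdot (A x) (tcnj (jump_full \<T> F (\<lambda>T. u) x))) = 0" if "F \<in> all_faces D \<T>" for F A
  by (rule integral_eq_zero_AE) (use j[OF that] in eventually_elim, simp)
 have b: "(LINT x|surf F. vdot (face_trace (elem_plus \<T> F) F vb x *v cvec (normal_plus \<T> F)) (vcnj (face_trace (elem_plus \<T> F) F u x))) = 0"
  if "F \<in> boundary_faces D \<T>" for F by (rule integral_eq_zero_AE) (use u_trace_boundary[OF that] in eventually_elim, simp)
 have vb: "(\<lambda>x. tensor (v x) (cvec (\<beta> x))) = vb" by (simp add: vb_def fun_eq_iff)
 show ?thesis unfolding form_A_h_def vb by (simp add: z b stress_term_def convection_term_def)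
qed

text \<open>The form contains the stress terms with factor \<open>\<theta>\<close>; after
  subtracting \<open>1 + \<theta>\<close> times them the factor is -1, and the summed integration by
  parts supplies the same terms with factor 1.\<close>

theorem consistency:
 assumes q: "q \<in> L2_zero_mean D"
 shows "form_AB_h D \<T> \<mu> \<beta> \<gamma> \<theta> (v, q) (u, p) - of_real (1 + \<theta>) * (\<Sum>F\<in>all_faces D \<T>. stress_term F) = L2_inner D v f"
proof -
 have "(LINT x|leb T. cnj (p x) * divergence (interior T) v x) = cnj (LINT x|leb T. p x * cnj (divergence (interior T) v x))" for T
  using Bochner_Integration.integral_cnj[of "leb T" "\<lambda>x. p x * cnj (divergence (interior T) v x)"] by simp
 then have B: "cnj (form_B_h D \<T> v p) = - (\<Sum>T\<in>\<T>. LINT x|leb T. cnj (p x) * divergence (interior T) v x) + (\<Sum>F\<in>all_faces D \<T>. cnj (pressure_term F))"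
  unfolding form_B_h_def pressure_term_def[symmetric] by simp
 \<comment> \<open>\<open>b\<close> stands for the pressure form with volume part \<open>d\<close>
   and face part \<open>g\<close>, \<open>s\<close> for the stress terms, and \<open>e\<close> for
   the convective face terms, which cancel.\<close>
 have alg: "(a + c + t * s - e) + 0 + b - (1 + t) * s = l" if "b = - d + g" "a + c - d = l + s - g + e" for a b c d e g l s t :: complex
 proof -
  show ?thesis using that(2) by (simp add: that(1) algebra_simps)
 qed
 show ?thesis
  unfolding form_AB_h_def prod.case form_A_h_u form_B_h_u[OF q] of_real_add of_real_1 by (rule alg[OF B sum_identity])
qed

end

theorem lemma2p4:
  fixes \<Omega> :: "(real^'n) set" and \<M> :: "(real^'n) set set set" and \<T> :: "(real^'n) set set"
    and \<mu> \<gamma> \<theta> :: real and \<beta> :: "real^'n \<Rightarrow> real^'n" and k :: nat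
    and f us vh :: "real^'n \<Rightarrow> complex^'n" and ps qh :: "real^'n \<Rightarrow> complex"
  assumes "CARD('n) \<in> {2, 3}"
    and "polyhedral_domain \<Omega>"
    and "0 < \<mu>"
    and "\<beta> \<in> W1_infinity \<Omega>" and "divergence_free \<Omega> \<beta>"
    and "regularity_assumption \<Omega> \<mu> \<beta>"
    and "regular_family \<Omega> \<M>" and "\<T> \<in> \<M>"
    and "1 \<le> k" and "0 < \<gamma>" and "\<theta> \<in> {-1, 0, 1}"
    and "f \<in> L2 \<Omega>"
    and "adjoint_solution \<Omega> \<mu> \<beta> f us ps"
    and "vh \<in> dg_sum_space \<Omega> \<T> k" and "qh \<in> L2_zero_mean \<Omega>"
  shows "form_AB_h \<Omega> \<T> \<mu> \<beta> \<gamma> \<theta> (vh, qh) (us, ps)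
      - of_real (1 + \<theta>) * (\<Sum>F\<in>all_faces \<Omega> \<T>. face_integral F (\<lambda>x.
          of_real \<mu> * tdot (tcnj (mean \<T> F (\<lambda>\<tau>. grad (interior \<tau>) us) x))
            (jump_full \<T> F (\<lambda>\<tau>. vh) x)))
      = L2_inner \<Omega> vh f"
proof -
  \<comment> \<open>The regularity assumption is applied to the adjoint solution; it is the source
    of the exponent above 1/2 on which all traces of gradient and pressure rest.\<close>
  obtain r where r: "1/2 < r" "r \<le> 1" "us \<in> H1_plus r \<Omega>" "ps \<in> Hs r \<Omega>"
    using assms(6,12,13) unfolding regularity_assumption_def by blast
  have "simplicial_partition \<Omega> \<T>" using assms(7,8) by (simp add: regular_family_def)
  then interpret dg_problem \<Omega> \<T> \<mu> r \<beta> f us ps k vh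
    by unfold_locales (use assms r in blast)+
  show ?thesis using consistency[OF assms(15)] by (simp add: stress_term_def)
qed


end
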